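(* Let $k$ be a field of characteristic different from $2$ and $E/k$ an elliptic curve with a projectively normal embedding in $\mathbb{P}^3$ such that $\mathcal{O}_E(1)\cong\mathcal{L}(4(O))$. If $E(k)[2]\cong(\mathbb{Z}/2\mathbb{Z})^2$, then there exists $(a,b)\in k^2$ such that $E$ is linearly isomorphic to the Jacobi model $J_{(a,b)}$.
   Context: For $a,b\in k$ and $c=-a-b$, $J_{(a,b)}\subset\mathbb{P}^3$ is the curve $aX_0^2+X_1^2=X_2^2$, $bX_0^2+X_2^2=X_3^2$, $cX_0^2+X_3^2=X_1^2$ (taken with parameters for which it is nonsingular), with identity $(0:1:1:1)$. Linearly isomorphic means there is a projective linear transformation of $\mathbb{P}^3$ restricting to an isomorphism of elliptic curves $E\to J_{(a,b)}$. Projectively normal: $k[X_0,\dots,X_3]_n\to\Gamma(E,\mathcal{O}_E(n))$ surjective for all $n$; $O$ is the identity of $E$. *)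

theory Defs
  imports
    "HOL-Analysis.Cartesian_Space"
    "HOL-Library.Poly_Mapping"
    "HOL-Library.Numeral_Type"
    "HOL-Computational_Algebra.Fraction_Field"
    "HOL-Algebra.Algebraic_Closure_Type"
    "HOL-Algebra.Elementary_Groups"
begin

section \<open>Polynomials in four variables\<close>

text \<open>
  The variables are \<open>X\<^sub>0, X\<^sub>1, X\<^sub>2, X\<^sub>3\<close>, indexed by the four-element type \<open>4\<close> whose elements
  are \<open>0, 1, 2, 3\<close>.
\<close>

type_synonym 'a poly4 = "(4 \<Rightarrow>\<^sub>0 nat) \<Rightarrow>\<^sub>0 'a"

definition Const4 :: "'a::zero \<Rightarrow> 'a poly4" where
  "Const4 c = Poly_Mapping.single 0 c"

definition Var4 :: "4 \<Rightarrow> 'a::zero_neq_one poly4" where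
  "Var4 i = Poly_Mapping.single (Poly_Mapping.single i 1) 1"

definition mdegree :: "(4 \<Rightarrow>\<^sub>0 nat) \<Rightarrow> nat" where
  "mdegree m = (\<Sum>i\<in>UNIV. Poly_Mapping.lookup m i)"

definition is_form :: "nat \<Rightarrow> 'a::zero poly4 \<Rightarrow> bool" where
  "is_form d F \<longleftrightarrow> (\<forall>m\<in>Poly_Mapping.keys F. mdegree m = d)"

definition hom_component :: "nat \<Rightarrow> 'a::comm_monoid_add poly4 \<Rightarrow> 'a poly4" where
  "hom_component d F =
     (\<Sum>m | m \<in> Poly_Mapping.keys F \<and> mdegree m = d. Poly_Mapping.single m (Poly_Mapping.lookup F m))"

definition eval4 :: "'a::field poly4 \<Rightarrow> 'a alg_closure ^ 4 \<Rightarrow> 'a alg_closure" where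
  "eval4 F v = (\<Sum>m\<in>Poly_Mapping.keys F. to_ac (Poly_Mapping.lookup F m) * (\<Prod>i\<in>UNIV. v $ i ^ Poly_Mapping.lookup m i))"

definition pderiv4 :: "4 \<Rightarrow> 'a::comm_semiring_1 poly4 \<Rightarrow> 'a poly4" where
  "pderiv4 i F = (\<Sum>m\<in>Poly_Mapping.keys F.
     Poly_Mapping.single (m - Poly_Mapping.single i 1) (of_nat (Poly_Mapping.lookup m i) * Poly_Mapping.lookup F m))"

definition gradient4 :: "'a::field poly4 \<Rightarrow> 'a alg_closure ^ 4 \<Rightarrow> 'a alg_closure ^ 4" where
  "gradient4 F v = (\<chi> i. eval4 (pderiv4 i F) v)"

text \<open>The composite of \<open>F\<close> with the linear map \<open>v \<mapsto> M v\<close>.\<close>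

definition lin_subst :: "'a::comm_ring_1 ^ 4 ^ 4 \<Rightarrow> 'a poly4 \<Rightarrow> 'a poly4" where
  "lin_subst M F = (\<Sum>m\<in>Poly_Mapping.keys F.
     Const4 (Poly_Mapping.lookup F m) * (\<Prod>i\<in>UNIV. (\<Sum>j\<in>UNIV. Const4 (M $ i $ j) * Var4 j) ^ Poly_Mapping.lookup m i))"

definition scale4 :: "'a::comm_semiring_1 \<Rightarrow> 'a poly4 \<Rightarrow> 'a poly4" where
  "scale4 c F = Const4 c * F"

interpretation poly4_vs: vector_space "scale4 :: 'a::field \<Rightarrow> 'a poly4 \<Rightarrow> 'a poly4"
  by unfold_locales
    (simp_all add: scale4_def Const4_def algebra_simps single_add mult_single flip: mult.assoc)

abbreviation poly4_ring :: "'a::comm_ring_1 poly4 ring" where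
  "poly4_ring \<equiv> ring_of_type_algebra"


section \<open>Projective space and its closed subschemes\<close>

definition proj_rel :: "'a::field ^ 4 \<Rightarrow> 'a ^ 4 \<Rightarrow> bool" where
  "proj_rel v w \<longleftrightarrow> v \<noteq> 0 \<and> w \<noteq> 0 \<and> (\<exists>c. c \<noteq> 0 \<and> w = c *s v)"

lemma part_equivp_proj_rel: "part_equivp proj_rel"
proof (rule part_equivpI)
  have "(1 :: 'a::field ^ 4) \<noteq> 0" by (simp add: vec_eq_iff)
  then have "proj_rel (1 :: 'a ^ 4) 1"
    unfolding proj_rel_def by (metis vec.scale_one zero_neq_one)
  then show "\<exists>v :: 'a ^ 4. proj_rel v v" by blast
  show "symp (proj_rel :: 'a ^ 4 \<Rightarrow> 'a ^ 4 \<Rightarrow> bool)"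
  proof (rule sympI)
    fix v w :: "'a ^ 4"
    assume "proj_rel v w"
    then obtain c where c: "v \<noteq> 0" "w \<noteq> 0" "c \<noteq> 0" "w = c *s v"
      unfolding proj_rel_def by blast
    then have "v = inverse c *s w" by simp
    with c show "proj_rel w v"
      unfolding proj_rel_def by (metis nonzero_imp_inverse_nonzero)
  qed
  show "transp (proj_rel :: 'a ^ 4 \<Rightarrow> 'a ^ 4 \<Rightarrow> bool)"
  proof (rule transpI)
    fix u v w :: "'a ^ 4"
    assume "proj_rel u v" "proj_rel v w"
    then obtain c d where "u \<noteq> 0" "w \<noteq> 0" "c \<noteq> 0" "d \<noteq> 0" "w = (d * c) *s u"
      unfolding proj_rel_def by (auto simp: vec.scale_scale)
    then show "proj_rel u w"
      unfolding proj_rel_def by (metis mult_eq_0_iff)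
  qed
qed

quotient_type (overloaded) 'a pspace3 = "'a::field ^ 4" / partial: proj_rel
  by (rule part_equivp_proj_rel)

definition proj_point :: "'a::field ^ 4 \<Rightarrow> 'a pspace3" where
  "proj_point = abs_pspace3"

definition coords :: "'a::field pspace3 \<Rightarrow> 'a ^ 4" where
  "coords = rep_pspace3"

definition to_ac_point :: "'a::field pspace3 \<Rightarrow> 'a alg_closure pspace3" where
  "to_ac_point P = proj_point (\<chi> i. to_ac (coords P $ i))"

definition vanishes_at :: "'a::field poly4 \<Rightarrow> 'a alg_closure pspace3 \<Rightarrow> bool" where
  "vanishes_at F P \<longleftrightarrow> eval4 F (coords P) = 0"

text \<open>
  A closed subscheme of projective 3-space over the field \<open>'a\<close> is given by its saturated
  homogeneous ideal.  Its closed points are the orbits of its geometric points under the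
  automorphism group of the algebraic closure, and its open subsets are handled as the
  corresponding sets of geometric points.
\<close>

definition homogeneous_ideal :: "'a::field poly4 set \<Rightarrow> bool" where
  "homogeneous_ideal I \<longleftrightarrow> ideal I poly4_ring \<and> (\<forall>F\<in>I. \<forall>d. hom_component d F \<in> I)"

definition saturation :: "'a::field poly4 set \<Rightarrow> 'a poly4 set" where
  "saturation I = {F. \<exists>n. \<forall>i. Var4 i ^ n * F \<in> I}"

definition geom_points :: "'a::field poly4 set \<Rightarrow> 'a alg_closure pspace3 set" where
  "geom_points I = {P. \<forall>F\<in>I. vanishes_at F P}"

definition rational_points :: "'a::field poly4 set \<Rightarrow> 'a pspace3 set" where
  "rational_points I = {P. to_ac_point P \<in> geom_points I}"

definition zariski_open :: "'a::field poly4 set \<Rightarrow> 'a alg_closure pspace3 set \<Rightarrow> bool" where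
  "zariski_open I U \<longleftrightarrow> (\<exists>A. (\<forall>F\<in>A. \<exists>d. is_form d F) \<and>
     U = {P \<in> geom_points I. \<exists>F\<in>A. \<not> vanishes_at F P})"

definition base_change :: "'a::field poly4 set \<Rightarrow> 'a alg_closure poly4 set" where
  "base_change I = Idl\<^bsub>poly4_ring\<^esub> (Poly_Mapping.map to_ac ` I)"

definition geom_integral :: "'a::field poly4 set \<Rightarrow> bool" where
  "geom_integral I \<longleftrightarrow> primeideal I poly4_ring \<and> primeideal (base_change I) poly4_ring"

text \<open>Jacobian criterion for smoothness of a curve: the rank is the codimension \<open>3 - 1 = 2\<close>.\<close>

definition nonsingular_curve :: "'a::field poly4 set \<Rightarrow> bool" where
  "nonsingular_curve I \<longleftrightarrow>
     (\<forall>P\<in>geom_points I. vec.dim {gradient4 F (coords P) | F. F \<in> I} = 2)"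

text \<open>\<open>hilbert_function I n\<close> is the dimension of the degree \<open>n\<close> part of \<open>k[X]/I\<close>.\<close>

definition hilbert_function :: "'a::field poly4 set \<Rightarrow> nat \<Rightarrow> nat" where
  "hilbert_function I n =
     poly4_vs.dim {F :: 'a poly4. is_form n F} - poly4_vs.dim {F \<in> I. is_form n F}"

definition is_hilbert_polynomial :: "'a::field poly4 set \<Rightarrow> rat poly \<Rightarrow> bool" where
  "is_hilbert_polynomial I p \<longleftrightarrow>
     (\<forall>\<^sub>F n in sequentially. of_nat (hilbert_function I n) = poly p (of_nat n))"

text \<open>
  The dimension is the degree of the Hilbert polynomial \<open>p\<close>; for a curve the arithmetic genus,
  which for a smooth geometrically integral curve is the genus, is \<open>1 - p(0)\<close>.
\<close>

definition is_curve_of_genus :: "'a::field poly4 set \<Rightarrow> nat \<Rightarrow> bool" where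
  "is_curve_of_genus I g \<longleftrightarrow> (\<exists>p. is_hilbert_polynomial I p \<and>
     Polynomial.degree p = 1 \<and> 1 - poly p 0 = of_nat g)"

definition elliptic_curve :: "'a::field poly4 set \<Rightarrow> 'a pspace3 \<Rightarrow> bool" where
  "elliptic_curve I p0 \<longleftrightarrow>
     homogeneous_ideal I \<and> geom_integral I \<and> is_curve_of_genus I 1 \<and> nonsingular_curve I \<and>
     p0 \<in> rational_points I"


section \<open>Rational functions, divisors and invertible sheaves\<close>

text \<open>
  Let \<open>I\<close> be the homogeneous prime ideal of an integral subscheme \<open>E\<close>.  Elements of the function
  field of \<open>E\<close>, and more generally rational sections of \<open>\<O>\<^sub>E(n)\<close>, are represented by fractions
  \<open>F/G\<close> of forms with \<open>deg F - deg G = n\<close> and \<open>G \<notin> I\<close>; two fractions represent the same section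
  iff their difference has a numerator in \<open>I\<close> (relation \<open>sect_eq\<close>).
\<close>

definition rat_sections :: "'a::field poly4 set \<Rightarrow> int \<Rightarrow> 'a poly4 fract set" where
  "rat_sections I n = {Fract F G | F G d e.
     is_form e F \<and> is_form d G \<and> G \<notin> I \<and> int e = int d + n}"

definition sect_eq ::
    "'a::field poly4 set \<Rightarrow> 'a poly4 fract \<Rightarrow> 'a poly4 fract \<Rightarrow> bool" where
  "sect_eq I s t \<longleftrightarrow> (\<exists>F G. F \<in> I \<and> G \<notin> I \<and> s - t = Fract F G)"

definition stalk ::
    "'a::field poly4 set \<Rightarrow> int \<Rightarrow> 'a alg_closure pspace3 \<Rightarrow> 'a poly4 fract set" where
  "stalk I n P = {s \<in> rat_sections I n. \<exists>F G d e.
     is_form e F \<and> is_form d G \<and> int e = int d + n \<and> \<not> vanishes_at G P \<and>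
     sect_eq I s (Fract F G)}"

definition max_ideal ::
    "'a::field poly4 set \<Rightarrow> 'a alg_closure pspace3 \<Rightarrow> 'a poly4 fract set" where
  "max_ideal I P = {s \<in> rat_sections I 0. \<exists>F G d.
     is_form d F \<and> is_form d G \<and> \<not> vanishes_at G P \<and> vanishes_at F P \<and>
     sect_eq I s (Fract F G)}"

definition uniformizer ::
    "'a::field poly4 set \<Rightarrow> 'a alg_closure pspace3 \<Rightarrow> 'a poly4 fract \<Rightarrow> bool" where
  "uniformizer I P t \<longleftrightarrow> t \<in> max_ideal I P \<and>
     (\<forall>f\<in>max_ideal I P. \<exists>g\<in>stalk I 0 P. sect_eq I f (g * t))"

definition ord_at ::
    "'a::field poly4 set \<Rightarrow> 'a alg_closure pspace3 \<Rightarrow> 'a poly4 fract \<Rightarrow> int" where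
  "ord_at I P f = (THE n. \<exists>t u. uniformizer I P t \<and> u \<in> stalk I 0 P - max_ideal I P \<and>
     sect_eq I f (u * t powi n))"

text \<open>
  Divisors are integer-valued functions on the geometric points; only divisors supported at
  rational points and divisors of rational functions over the ground field occur.
\<close>

definition point_divisor :: "'a::field pspace3 \<Rightarrow> 'a alg_closure pspace3 \<Rightarrow> int" where
  "point_divisor Q = (\<lambda>P. if P = to_ac_point Q then 1 else 0)"

definition lin_equiv :: "'a::field poly4 set \<Rightarrow>
    ('a alg_closure pspace3 \<Rightarrow> int) \<Rightarrow> ('a alg_closure pspace3 \<Rightarrow> int) \<Rightarrow> bool" where
  "lin_equiv I D D' \<longleftrightarrow> (\<exists>f\<in>rat_sections I 0. \<not> sect_eq I f 0 \<and>
     (\<forall>P\<in>geom_points I. D P - D' P = ord_at I P f))"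

text \<open>\<open>\<O>\<^sub>E(n)\<close> and \<open>\<L>(D)\<close>, as subsheaves of the constant sheaf of rational sections; this is
  meant for nonempty open sets \<open>U\<close> only (over the empty set the sheaf has only the zero section).\<close>

definition twisting_sheaf ::
    "'a::field poly4 set \<Rightarrow> int \<Rightarrow> 'a alg_closure pspace3 set \<Rightarrow> 'a poly4 fract set" where
  "twisting_sheaf I n U = {s \<in> rat_sections I n. \<forall>P\<in>U. s \<in> stalk I n P}"

definition divisor_sheaf :: "'a::field poly4 set \<Rightarrow> ('a alg_closure pspace3 \<Rightarrow> int) \<Rightarrow>
    'a alg_closure pspace3 set \<Rightarrow> 'a poly4 fract set" where
  "divisor_sheaf I D U = {f \<in> rat_sections I 0.
     sect_eq I f 0 \<or> (\<forall>P\<in>U. ord_at I P f \<ge> - D P)}"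

text \<open>
  Isomorphism of sheaves of \<open>\<O>\<^sub>E\<close>-modules.  Restriction maps are inclusions, since sections are
  represented by rational sections.  The second conjunct says that \<open>\<phi> U\<close> is well defined
  and injective modulo \<open>sect_eq\<close>.
\<close>

definition sheaf_isomorphic :: "'a::field poly4 set \<Rightarrow>
    ('a alg_closure pspace3 set \<Rightarrow> 'a poly4 fract set) \<Rightarrow>
    ('a alg_closure pspace3 set \<Rightarrow> 'a poly4 fract set) \<Rightarrow> bool" where
  "sheaf_isomorphic I M N \<longleftrightarrow>
     (\<exists>\<phi> :: 'a alg_closure pspace3 set \<Rightarrow> 'a poly4 fract \<Rightarrow> 'a poly4 fract.
       \<forall>U. zariski_open I U \<and> U \<noteq> {} \<longrightarrow>
         \<phi> U ` M U \<subseteq> N U \<and>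
         (\<forall>s\<in>M U. \<forall>t\<in>M U. sect_eq I (\<phi> U s) (\<phi> U t) \<longleftrightarrow> sect_eq I s t) \<and>
         (\<forall>f\<in>N U. \<exists>s\<in>M U. sect_eq I (\<phi> U s) f) \<and>
         (\<forall>s\<in>M U. \<forall>t\<in>M U. sect_eq I (\<phi> U (s + t)) (\<phi> U s + \<phi> U t)) \<and>
         (\<forall>h\<in>twisting_sheaf I 0 U. \<forall>s\<in>M U. sect_eq I (\<phi> U (h * s)) (h * \<phi> U s)) \<and>
         (\<forall>V. zariski_open I V \<and> V \<noteq> {} \<and> V \<subseteq> U \<longrightarrow>
            (\<forall>s\<in>M U. sect_eq I (\<phi> V s) (\<phi> U s))))"

definition projectively_normal :: "'a::field poly4 set \<Rightarrow> bool" where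
  "projectively_normal I \<longleftrightarrow> (\<forall>n. \<forall>s\<in>twisting_sheaf I (int n) (geom_points I).
     \<exists>F. is_form n F \<and> sect_eq I s (Fract F 1))"


section \<open>The group of rational points\<close>

text \<open>\<open>P + Q\<close> is the point \<open>R\<close> for which the divisors \<open>(P) + (Q)\<close> and \<open>(R) + (p0)\<close> are
  linearly equivalent.\<close>

definition ec_add :: "'a::field poly4 set \<Rightarrow> 'a pspace3 \<Rightarrow>
    'a pspace3 \<Rightarrow> 'a pspace3 \<Rightarrow> 'a pspace3" where
  "ec_add I p0 P Q = (THE R. R \<in> rational_points I \<and>
     lin_equiv I (\<lambda>x. point_divisor P x + point_divisor Q x)
                 (\<lambda>x. point_divisor R x + point_divisor p0 x))"

definition ec_group :: "'a::field poly4 set \<Rightarrow> 'a pspace3 \<Rightarrow> 'a pspace3 monoid" where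
  "ec_group I p0 = \<lparr>carrier = rational_points I, monoid.mult = ec_add I p0, one = p0\<rparr>"

definition ec_torsion :: "'a::field poly4 set \<Rightarrow> 'a pspace3 \<Rightarrow> nat \<Rightarrow> 'a pspace3 monoid" where
  "ec_torsion I p0 n =
     (ec_group I p0)\<lparr>carrier := {P \<in> rational_points I. P [^]\<^bsub>ec_group I p0\<^esub> n = p0}\<rparr>"


section \<open>Linear isomorphism and the Jacobi model\<close>

text \<open>
  The transformation \<open>x \<mapsto> M x\<close> carries the closed subscheme with saturated ideal \<open>I\<close> onto the one
  with saturated ideal \<open>J\<close>, and the point \<open>p0\<close> to \<open>p0'\<close>.
\<close>

definition linearly_isomorphic ::
    "'a::field poly4 set \<Rightarrow> 'a pspace3 \<Rightarrow> 'a poly4 set \<Rightarrow> 'a pspace3 \<Rightarrow> bool" where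
  "linearly_isomorphic I p0 J p0' \<longleftrightarrow> (\<exists>M :: 'a ^ 4 ^ 4. invertible M \<and>
     J = {F. lin_subst M F \<in> I} \<and> proj_point (M *v coords p0) = p0')"

definition jacobi_model :: "'a::field \<Rightarrow> 'a \<Rightarrow> 'a poly4 set" where
  "jacobi_model a b = (let c = - a - b in saturation (Idl\<^bsub>poly4_ring\<^esub>
     {Const4 a * Var4 0 ^ 2 + Var4 1 ^ 2 - Var4 2 ^ 2,
      Const4 b * Var4 0 ^ 2 + Var4 2 ^ 2 - Var4 3 ^ 2,
      Const4 c * Var4 0 ^ 2 + Var4 3 ^ 2 - Var4 1 ^ 2}))"

definition jacobi_identity :: "'a::field pspace3" where
  "jacobi_identity = proj_point (\<chi> i. if i = 0 then 0 else 1)"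

end

(*
  Let E be the curve with ideal I and O its point p0. At every point the Jacobian criterion gives a
  uniformizer, and linear growth of the Hilbert function bounds orders of vanishing. Expanding in a
  uniformizer at O therefore embeds the function field of E in the field of Laurent series over k, with the
  order at O as valuation.

  The isomorphism of O_E(1) with L(4(O)) is division by a linear form L vanishing only at O. By
  projective normality the functions of pole order at most n * ord_O(L) at O and regular elsewhere are the F/L^n
  with F a form of degree n. Since the Hilbert polynomial has constant term 0, the semigroup of their pole
  orders has exactly one gap, which is 1. Functions x and y with poles of order 2 and 3 then satisfy a
  Weierstrass equation y^2 = f(x), and (1 : x : y : x^2) are linear coordinates on projective 3-space.

  If T = (p, q) is a rational point with q nonzero, then the tangent line at T gives a rational point R different
  from O with 2(T) ~ (R) + (O). So the three nontrivial 2-torsion points have q = 0 and f has three distinct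
  roots e1, e2, e3 in k. The linear change of coordinates X_0 = 2y,
  X_i = (x - e_i)^2 - (e_i - e_j)(e_i - e_k) carries E to the Jacobi model with a = e1 - e2, b = e2 - e3.
*)
theory Submission
  imports Defs "HOL-Computational_Algebra.Formal_Laurent_Series"
begin

section \<open>Ring homomorphisms and evaluation of polynomials\<close>

text \<open>Rational sections are fractions of polynomials that are equal only up to
  \<open>sect_eq\<close>, and the residue field at a geometric point may be a proper extension of k.
  Because O is rational, expansion at O has coefficients in k and turns \<open>sect_eq\<close> into
  equality inside one field (\<open>nu\<close>); the local rings at all points are compared in that
  field. Riemann-Roch is replaced by counting: the pole orders up to a multiple of ord_O(L) are as
  many as the independent forms of the corresponding degree, so the Hilbert function determines
  them. The final coordinates come from the duplication formula. On y^2 = (x - e1)(x - e2)(x - e3)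
  one has x(2P) - e_i = ((x - e_i)^2 - (e_i - e_j)(e_i - e_k))^2 / (2y)^2. Thus (X_i/X_0)^2 = x(2P)
  - e_i, and the differences (X_i/X_0)^2 - (X_j/X_0)^2 = e_j - e_i are the equations of the Jacobi
  model. The plane X_0 = 0 cuts out the four points of order dividing 2, and their sum is linearly
  equivalent to 4(O).\<close>

definition rhom :: "('a::comm_ring_1 \<Rightarrow> 'b::comm_ring_1) \<Rightarrow> bool" where
  "rhom h \<longleftrightarrow> h 1 = 1 \<and> (\<forall>a b. h (a + b) = h a + h b) \<and> (\<forall>a b. h (a * b) = h a * h b)"

lemma rhom_1: "rhom h \<Longrightarrow> h 1 = 1"
  and rhom_add: "rhom h \<Longrightarrow> h (a + b) = h a + h b"
  and rhom_mult: "rhom h \<Longrightarrow> h (a * b) = h a * h b"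
  by (simp_all add: rhom_def)

lemma rhom_0: "rhom h \<Longrightarrow> h 0 = 0"
  using rhom_add[of h 0 0] by simp

lemma rhom_uminus: "rhom h \<Longrightarrow> h (- a) = - h a"
  using rhom_add[of h a "- a"] rhom_0[of h] by (simp add: minus_unique)

lemma rhom_diff: "rhom h \<Longrightarrow> h (a - b) = h a - h b"
  using rhom_add[of h a "- b"] rhom_uminus[of h b] by simp

lemma rhom_power: "rhom h \<Longrightarrow> h (a ^ n) = h a ^ n"
  by (induction n) (simp_all add: rhom_1 rhom_mult)

lemma rhom_sum: "rhom h \<Longrightarrow> h (sum f A) = (\<Sum>x\<in>A. h (f x))"
  by (induction A rule: infinite_finite_induct) (simp_all add: rhom_0 rhom_add)

lemma rhom_prod: "rhom h \<Longrightarrow> h (prod f A) = (\<Prod>x\<in>A. h (f x))"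
  by (induction A rule: infinite_finite_induct) (simp_all add: rhom_1 rhom_mult)

lemma rhom_of_nat: "rhom h \<Longrightarrow> h (of_nat n) = of_nat n"
  by (induction n) (simp_all add: rhom_0 rhom_1 rhom_add)

lemma rhom_numeral: "rhom h \<Longrightarrow> h (numeral n) = numeral n"
  using rhom_of_nat[of h "numeral n"] by simp

lemmas rhom_simps = rhom_0 rhom_1 rhom_add rhom_mult rhom_uminus rhom_diff rhom_power rhom_sum
  rhom_prod rhom_of_nat rhom_numeral

lemma rhom_to_ac: "rhom to_ac"
  by (simp add: rhom_def)

lemma rhom_comp: "rhom g \<Longrightarrow> rhom h \<Longrightarrow> rhom (\<lambda>x. h (g x))"
  by (simp add: rhom_def)

lemma Const4_0 [simp]: "Const4 0 = 0"
  and Const4_1 [simp]: "Const4 1 = 1"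
  by (simp_all add: Const4_def)

lemma rhom_Const4: "rhom Const4"
  by (simp add: rhom_def Const4_def single_add mult_single)

lemmas Const4_add = rhom_add[OF rhom_Const4]
  and Const4_mult = rhom_mult[OF rhom_Const4]
  and Const4_diff = rhom_diff[OF rhom_Const4]
  and Const4_uminus = rhom_uminus[OF rhom_Const4]

lemma Var4_power: "Var4 i ^ n = Poly_Mapping.single (Poly_Mapping.single i n) (1::'a::comm_ring_1)"
  by (induction n) (simp_all add: Var4_def mult_single flip: single_add)

lemma single_plus_prod:
  "finite A \<Longrightarrow> (\<Prod>i\<in>A. Poly_Mapping.single (f i) (1::'a::comm_ring_1)) = Poly_Mapping.single (\<Sum>i\<in>A. f i) 1"
  by (induction A rule: finite_induct) (simp_all add: mult_single)

lemma exponent_expand: "(\<Sum>i\<in>UNIV. Poly_Mapping.single i (Poly_Mapping.lookup m i)) = (m :: 4 \<Rightarrow>\<^sub>0 nat)"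
  by (rule poly_mapping_eqI) (simp add: lookup_sum lookup_single when_def)

lemma single_poly4:
  "Poly_Mapping.single m (c::'a::comm_ring_1) = Const4 c * (\<Prod>i\<in>UNIV. Var4 i ^ Poly_Mapping.lookup m i)"
  by (simp add: Var4_power single_plus_prod exponent_expand Const4_def mult_single)

lemma poly4_expand: "F = (\<Sum>m\<in>Poly_Mapping.keys F. Poly_Mapping.single m (Poly_Mapping.lookup F m))"
  by (rule poly_mapping_eqI)
    (simp add: lookup_sum lookup_single when_def in_keys_iff)

lemma poly4_induct [case_names const var add mult]:
  fixes F :: "'a::comm_ring_1 poly4"
  assumes const: "\<And>c. P (Const4 c)" and var: "\<And>i. P (Var4 i)"
    and add: "\<And>F G. P F \<Longrightarrow> P G \<Longrightarrow> P (F + G)"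
    and mult: "\<And>F G. P F \<Longrightarrow> P G \<Longrightarrow> P (F * G)"
  shows "P F"
proof -
  have 1: "P 1" and 0: "P 0" using const[of 1] const[of 0] by simp_all
  have pow: "P (Var4 i ^ n)" for i n by (induction n) (simp_all add: 1 var mult)
  have prod: "P (\<Prod>i\<in>A. Var4 i ^ f i)" for A f
    by (induction A rule: infinite_finite_induct) (simp_all add: 1 pow mult)
  have sum: "(\<And>x. x \<in> A \<Longrightarrow> P (g x)) \<Longrightarrow> P (sum g A)" for A :: "(4 \<Rightarrow>\<^sub>0 nat) set" and g
    by (induction A rule: infinite_finite_induct) (simp_all add: 0 add)
  show ?thesis
    by (subst poly4_expand) (auto intro!: sum simp: single_poly4 const prod mult)
qed

text \<open>\<open>eval4\<close>, \<open>lin_subst\<close>, dehomogenisation and evaluation in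
  Laurent series are all instances of this map; \<open>rhom_ext\<close> reduces identities between
  them to constants and variables.\<close>

definition peval :: "('a::comm_ring_1 \<Rightarrow> 'b::comm_ring_1) \<Rightarrow> (4 \<Rightarrow> 'b) \<Rightarrow> 'a poly4 \<Rightarrow> 'b" where
  "peval h v F = (\<Sum>m\<in>Poly_Mapping.keys F. h (Poly_Mapping.lookup F m) * (\<Prod>i\<in>UNIV. v i ^ Poly_Mapping.lookup m i))"

lemma peval_superset:
  assumes "rhom h" "finite A" "Poly_Mapping.keys F \<subseteq> A"
  shows "peval h v F = (\<Sum>m\<in>A. h (Poly_Mapping.lookup F m) * (\<Prod>i\<in>UNIV. v i ^ Poly_Mapping.lookup m i))"
  unfolding peval_def using assms
  by (intro sum.mono_neutral_left) (auto simp: in_keys_iff rhom_0)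

lemma peval_add: assumes "rhom h" shows "peval h v (F + G) = peval h v F + peval h v G"
proof -
  let ?A = "Poly_Mapping.keys F \<union> Poly_Mapping.keys G"
  have "peval h v H = (\<Sum>m\<in>?A. h (Poly_Mapping.lookup H m) * (\<Prod>i\<in>UNIV. v i ^ Poly_Mapping.lookup m i))"
    if "Poly_Mapping.keys H \<subseteq> ?A" for H
    using that assms by (intro peval_superset) auto
  from this[of F] this[of G] this[of "F + G"] show ?thesis
    using assms by (simp add: keys_add lookup_add rhom_add algebra_simps sum.distrib)
qed

lemma peval_0: "peval h v 0 = 0" by (simp add: peval_def)

lemma peval_sum: "rhom h \<Longrightarrow> peval h v (sum f A) = (\<Sum>x\<in>A. peval h v (f x))"
  by (induction A rule: infinite_finite_induct) (simp_all add: peval_0 peval_add)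

lemma peval_single:
  "rhom h \<Longrightarrow> peval h v (Poly_Mapping.single m c) = h c * (\<Prod>i\<in>UNIV. v i ^ Poly_Mapping.lookup m i)"
  by (cases "c = 0") (simp_all add: peval_def rhom_0)

lemma rhom_peval: assumes h: "rhom h" shows "rhom (peval h v)"
  unfolding rhom_def
proof (intro conjI allI)
  show "peval h v 1 = 1" by (simp add: peval_def rhom_1[OF h])
  show "peval h v (F + G) = peval h v F + peval h v G" for F G by (rule peval_add[OF h])
  fix F G :: "'a poly4"
  let ?s = "\<lambda>F m. Poly_Mapping.single m (Poly_Mapping.lookup F m)"
  have "peval h v (F * G)
      = peval h v ((\<Sum>m\<in>Poly_Mapping.keys F. ?s F m) * (\<Sum>n\<in>Poly_Mapping.keys G. ?s G n))"
    using poly4_expand[of F] poly4_expand[of G] by simp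
  also have "\<dots> = (\<Sum>m\<in>Poly_Mapping.keys F. \<Sum>n\<in>Poly_Mapping.keys G. peval h v (?s F m * ?s G n))"
    by (simp add: sum_product peval_sum[OF h])
  also have "\<dots> = (\<Sum>m\<in>Poly_Mapping.keys F. \<Sum>n\<in>Poly_Mapping.keys G. peval h v (?s F m) * peval h v (?s G n))"
    by (intro sum.cong refl)
      (simp add: mult_single peval_single[OF h] rhom_mult[OF h] lookup_add power_add prod.distrib algebra_simps)
  also have "\<dots> = peval h v (\<Sum>m\<in>Poly_Mapping.keys F. ?s F m) * peval h v (\<Sum>n\<in>Poly_Mapping.keys G. ?s G n)"
    by (simp add: sum_product peval_sum[OF h])
  finally show "peval h v (F * G) = peval h v F * peval h v G"
    using poly4_expand[of F] poly4_expand[of G] by simp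
qed

lemma peval_Const4: "rhom h \<Longrightarrow> peval h v (Const4 c) = h c"
  by (simp add: Const4_def peval_single)

lemma peval_Var4: "rhom h \<Longrightarrow> peval h v (Var4 i) = v i"
  by (simp add: Var4_def peval_single rhom_1 lookup_single when_def if_distrib[of "\<lambda>n. _ ^ n"] cong: if_cong)

lemma rhom_ext:
  fixes g h :: "'a::comm_ring_1 poly4 \<Rightarrow> 'b::comm_ring_1"
  assumes "rhom g" "rhom h" "\<And>c. g (Const4 c) = h (Const4 c)" "\<And>i. g (Var4 i) = h (Var4 i)"
  shows "g F = h F"
  by (induction F rule: poly4_induct) (simp_all add: assms rhom_add[OF assms(1)] rhom_add[OF assms(2)]
    rhom_mult[OF assms(1)] rhom_mult[OF assms(2)])

lemma rhom_eq_peval: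
  assumes "rhom g" "rhom h" "\<And>c. g (Const4 c) = h c"
  shows "g F = peval h (\<lambda>i. g (Var4 i)) F"
  by (rule rhom_ext) (simp_all add: assms rhom_peval peval_Const4 peval_Var4)

lemma peval_comp:
  assumes "rhom h" "rhom g"
  shows "g (peval h v F) = peval (\<lambda>c. g (h c)) (\<lambda>i. g (v i)) F"
  by (rule rhom_ext[of "\<lambda>F. g (peval h v F)"])
    (simp_all add: assms rhom_comp rhom_peval peval_Const4 peval_Var4)

lemma peval_Const4_Var4: "peval Const4 Var4 F = (F :: 'a::comm_ring_1 poly4)"
proof -
  have "rhom (\<lambda>F. F :: 'a poly4)" by (simp add: rhom_def)
  from rhom_ext[OF rhom_peval[OF rhom_Const4] this]
  show ?thesis by (simp add: rhom_Const4 peval_Const4 peval_Var4)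
qed

lemma eval4_eq: "eval4 F v = peval to_ac (\<lambda>i. v $ i) F"
  by (simp add: eval4_def peval_def)

lemma lin_subst_eq: "lin_subst M = peval Const4 (\<lambda>i. \<Sum>j\<in>UNIV. Const4 (M $ i $ j) * Var4 j)"
  by (rule ext) (simp add: lin_subst_def peval_def)

lemma rhom_eval4: "rhom (\<lambda>F. eval4 F v)"
  by (simp add: eval4_eq rhom_peval[OF rhom_to_ac])

lemma rhom_lin_subst: "rhom (lin_subst M)"
  by (simp add: lin_subst_eq rhom_peval[OF rhom_Const4])

section \<open>Forms\<close>

lemma mdegree_add: "mdegree (m + n) = mdegree m + mdegree n"
  by (simp add: mdegree_def lookup_add sum.distrib)

lemma mdegree_single: "mdegree (Poly_Mapping.single i n) = n"
  by (simp add: mdegree_def lookup_single when_def)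

lemma is_form_0 [simp]: "is_form d 0"
  by (simp add: is_form_def)

lemma is_form_Const4 [simp]: "is_form 0 (Const4 c)"
  by (simp add: is_form_def Const4_def mdegree_def)

lemma is_form_1 [simp]: "is_form 0 1"
  by (simp add: is_form_def mdegree_def)

lemma is_form_Var4 [simp]: "is_form (Suc 0) (Var4 i)"
  by (simp add: is_form_def Var4_def mdegree_single)

lemma is_form_add: "is_form d F \<Longrightarrow> is_form d G \<Longrightarrow> is_form d (F + G)"
  using keys_add[of F G] by (auto simp: is_form_def)

lemma is_form_uminus: "is_form d (F :: 'a::comm_ring_1 poly4) \<Longrightarrow> is_form d (- F)"
  by (simp add: is_form_def in_keys_iff)

lemma is_form_diff: "is_form d (F :: 'a::comm_ring_1 poly4) \<Longrightarrow> is_form d G \<Longrightarrow> is_form d (F - G)"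
  using is_form_add[of d F "- G"] is_form_uminus by auto

lemma is_form_sum: "(\<And>x. x \<in> A \<Longrightarrow> is_form d (f x)) \<Longrightarrow> is_form d (sum f A)"
  by (induction A rule: infinite_finite_induct) (simp_all add: is_form_add)

lemma is_form_mult:
  fixes F G :: "'a::comm_ring_1 poly4"
  shows "is_form d F \<Longrightarrow> is_form e G \<Longrightarrow> n = d + e \<Longrightarrow> is_form n (F * G)"
  using keys_mult[of F G] by (fastforce simp: is_form_def mdegree_add)

lemma is_form_Const4_mult: "is_form d (F :: 'a::comm_ring_1 poly4) \<Longrightarrow> is_form d (Const4 c * F)"
  by (rule is_form_mult[of 0]) simp_all

lemma is_form_power: "is_form d (F :: 'a::comm_ring_1 poly4) \<Longrightarrow> n = d * k \<Longrightarrow> is_form n (F ^ k)"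
  by (induction k arbitrary: n) (auto intro!: is_form_mult)

lemma is_form_Var4_power: "is_form n (Var4 i ^ n :: 'a::comm_ring_1 poly4)"
  by (rule is_form_power[of "Suc 0"]) simp_all

lemma is_form_single: "mdegree m = d \<Longrightarrow> is_form d (Poly_Mapping.single m c)"
  by (simp add: is_form_def)

lemma lookup_hom_component:
  "Poly_Mapping.lookup (hom_component d F) m = (if mdegree m = d then Poly_Mapping.lookup F m else 0)"
  unfolding hom_component_def lookup_sum lookup_single when_def
  by (simp add: in_keys_iff sum.delta)

lemma is_form_hom_component: "is_form d (hom_component d F)"
  by (auto simp: is_form_def in_keys_iff lookup_hom_component split: if_splits)

lemma hom_component_form: "is_form d F \<Longrightarrow> hom_component e F = (if e = d then F else 0)"
  by (rule poly_mapping_eqI) (auto simp: lookup_hom_component is_form_def in_keys_iff)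

lemma hom_component_expand: "F = (\<Sum>d\<in>mdegree ` Poly_Mapping.keys F. hom_component d F)"
  by (rule poly_mapping_eqI) (auto simp: lookup_sum lookup_hom_component in_keys_iff)

lemma peval_scale_form:
  assumes "is_form d F"
  shows "peval h (\<lambda>i. c * v i) F = c ^ d * peval h v F"
proof -
  have "(\<Prod>i\<in>UNIV. (c * v i) ^ Poly_Mapping.lookup m i) = c ^ d * (\<Prod>i\<in>UNIV. v i ^ Poly_Mapping.lookup m i)"
    if "m \<in> Poly_Mapping.keys F" for m
  proof -
    have "d = sum (Poly_Mapping.lookup m) UNIV" using assms that by (auto simp: is_form_def mdegree_def)
    then show ?thesis by (simp add: power_mult_distrib prod.distrib power_sum)
  qed
  then show ?thesis by (simp add: peval_def sum_distrib_left algebra_simps)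
qed

section \<open>Derivatives\<close>

lemma pderiv4_superset:
  assumes "finite A" "Poly_Mapping.keys F \<subseteq> A"
  shows "pderiv4 i F = (\<Sum>m\<in>A.
     Poly_Mapping.single (m - Poly_Mapping.single i 1) (of_nat (Poly_Mapping.lookup m i) * Poly_Mapping.lookup F m))"
  unfolding pderiv4_def using assms
  by (intro sum.mono_neutral_left) (auto simp: in_keys_iff)

lemma pderiv4_add: "pderiv4 i (F + G) = pderiv4 i F + pderiv4 i G"
proof -
  let ?A = "Poly_Mapping.keys F \<union> Poly_Mapping.keys G"
  have "pderiv4 i H = (\<Sum>m\<in>?A. Poly_Mapping.single (m - Poly_Mapping.single i 1)
      (of_nat (Poly_Mapping.lookup m i) * Poly_Mapping.lookup H m))"
    if "Poly_Mapping.keys H \<subseteq> ?A" for H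
    using that by (intro pderiv4_superset) auto
  from this[of F] this[of G] this[of "F + G"] show ?thesis
    by (simp add: keys_add lookup_add single_add algebra_simps sum.distrib)
qed

lemma pderiv4_single: "pderiv4 i (Poly_Mapping.single m c)
    = Poly_Mapping.single (m - Poly_Mapping.single i 1) (of_nat (Poly_Mapping.lookup m i) * c)"
  by (simp add: pderiv4_def)

lemma pderiv4_0: "pderiv4 i 0 = 0" by (simp add: pderiv4_def)

lemma pderiv4_sum: "pderiv4 i (sum f A) = (\<Sum>x\<in>A. pderiv4 i (f x))"
  by (induction A rule: infinite_finite_induct) (simp_all add: pderiv4_0 pderiv4_add)

lemma exponent_diff_add:
  fixes m n :: "4 \<Rightarrow>\<^sub>0 nat"
  shows "Poly_Mapping.lookup m i \<noteq> 0 \<Longrightarrow>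
    m - Poly_Mapping.single i (Suc 0) + n = m + n - Poly_Mapping.single i (Suc 0)"
  by (rule poly_mapping_eqI) (auto simp: lookup_add lookup_minus lookup_single when_def)

lemma pderiv4_mult_single:
  fixes c d :: "'a::comm_ring_1"
  shows "pderiv4 i (Poly_Mapping.single m c * Poly_Mapping.single n d)
    = pderiv4 i (Poly_Mapping.single m c) * Poly_Mapping.single n d
      + Poly_Mapping.single m c * pderiv4 i (Poly_Mapping.single n d)"
proof -
  have "Poly_Mapping.single (m - Poly_Mapping.single i 1) (of_nat (Poly_Mapping.lookup m i) * c) * Poly_Mapping.single n d
     = Poly_Mapping.single (m + n - Poly_Mapping.single i 1) (of_nat (Poly_Mapping.lookup m i) * c * d)"
    by (cases "Poly_Mapping.lookup m i = 0") (simp_all add: mult_single exponent_diff_add)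
  moreover have "Poly_Mapping.single m c * Poly_Mapping.single (n - Poly_Mapping.single i 1) (of_nat (Poly_Mapping.lookup n i) * d)
     = Poly_Mapping.single (m + n - Poly_Mapping.single i 1) (of_nat (Poly_Mapping.lookup n i) * c * d)"
    using exponent_diff_add[of n i m]
    by (cases "Poly_Mapping.lookup n i = 0") (simp_all add: mult_single add.commute mult.left_commute mult.assoc)
  ultimately show ?thesis
    by (simp add: mult_single pderiv4_single lookup_add algebra_simps flip: single_add)
qed

lemma pderiv4_mult:
  fixes F G :: "'a::comm_ring_1 poly4"
  shows "pderiv4 i (F * G) = pderiv4 i F * G + F * pderiv4 i G"
proof -
  let ?s = "\<lambda>F m. Poly_Mapping.single m (Poly_Mapping.lookup F m)"
  let ?F = "\<Sum>m\<in>Poly_Mapping.keys F. ?s F m" and ?G = "\<Sum>n\<in>Poly_Mapping.keys G. ?s G n"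
  have "pderiv4 i (?F * ?G) = pderiv4 i ?F * ?G + ?F * pderiv4 i ?G"
    by (simp only: sum_product pderiv4_sum pderiv4_mult_single sum.distrib)
  then show ?thesis using poly4_expand[of F] poly4_expand[of G] by simp
qed

lemma pderiv4_Var4: "pderiv4 i (Var4 j :: 'a::comm_ring_1 poly4) = (if i = j then 1 else 0)"
  by (auto simp: Var4_def pderiv4_single lookup_single when_def)

lemma pderiv4_Const4: "pderiv4 i (Const4 c) = 0"
  by (simp add: Const4_def pderiv4_single)

lemma is_form_pderiv4: "is_form (Suc d) F \<Longrightarrow> is_form d (pderiv4 i F)"
  unfolding pderiv4_def
proof (rule is_form_sum)
  fix m assume F: "is_form (Suc d) F" and m: "m \<in> Poly_Mapping.keys F"
  show "is_form d (Poly_Mapping.single (m - Poly_Mapping.single i 1) (of_nat (Poly_Mapping.lookup m i) * Poly_Mapping.lookup F m))"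
  proof (cases "Poly_Mapping.lookup m i = 0")
    case False
    then have "m = (m - Poly_Mapping.single i 1) + Poly_Mapping.single i 1"
      by (intro poly_mapping_eqI) (auto simp: lookup_add lookup_minus lookup_single when_def)
    then have "mdegree m = mdegree (m - Poly_Mapping.single i 1) + 1"
      by (metis mdegree_add mdegree_single)
    with F m show ?thesis by (intro is_form_single) (auto simp: is_form_def)
  qed simp
qed

lemma pderiv4_form_0: "is_form 0 (F :: 'a::comm_ring_1 poly4) \<Longrightarrow> pderiv4 i F = 0"
  unfolding pderiv4_def by (intro sum.neutral) (auto simp: is_form_def mdegree_def)

lemma euler_single:
  "(\<Sum>i\<in>UNIV. Var4 i * pderiv4 i (Poly_Mapping.single m (c::'a::comm_ring_1))) = of_nat (mdegree m) * Poly_Mapping.single m c"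
proof -
  have "Var4 i * pderiv4 i (Poly_Mapping.single m c) = of_nat (Poly_Mapping.lookup m i) * Poly_Mapping.single m c" for i
  proof (cases "Poly_Mapping.lookup m i = 0")
    case False
    then have "Poly_Mapping.single i 1 + (m - Poly_Mapping.single i 1) = m"
      by (intro poly_mapping_eqI) (auto simp: lookup_add lookup_minus lookup_single when_def)
    then show ?thesis by (simp add: Var4_def pderiv4_single mult_single flip: single_of_nat)
  qed (simp add: pderiv4_single)
  then show ?thesis by (simp add: mdegree_def sum_distrib_right)
qed

text \<open>At a zero of \<open>F\<close> this makes the gradient orthogonal to the point, so the
  derivative along the chart variable is determined by the other three.\<close>

lemma euler:
  assumes "is_form d (F :: 'a::comm_ring_1 poly4)"
  shows "(\<Sum>i\<in>UNIV. Var4 i * pderiv4 i F) = of_nat d * F"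
proof -
  let ?s = "\<lambda>m. Poly_Mapping.single m (Poly_Mapping.lookup F m)"
  let ?K = "Poly_Mapping.keys F"
  have "(\<Sum>i\<in>UNIV. Var4 i * pderiv4 i (\<Sum>m\<in>?K. ?s m)) = (\<Sum>m\<in>?K. \<Sum>i\<in>UNIV. Var4 i * pderiv4 i (?s m))"
    by (simp only: pderiv4_sum sum_distrib_left) (rule sum.swap)
  also have "\<dots> = (\<Sum>m\<in>?K. of_nat d * ?s m)"
    using assms by (intro sum.cong refl) (simp only: euler_single is_form_def)
  also have "\<dots> = of_nat d * (\<Sum>m\<in>?K. ?s m)" by (simp only: sum_distrib_left)
  finally show ?thesis using poly4_expand[of F] by simp
qed

section \<open>Kernels of evaluation homomorphisms\<close>

definition hx :: "('r::comm_ring_1 \<Rightarrow> 's::comm_ring_1) \<Rightarrow> 's \<Rightarrow> 'r poly \<Rightarrow> 's" where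
  "hx h x p = poly (map_poly h p) x"

lemma hx_0: "hx h x 0 = 0"
  by (simp add: hx_def)

lemma hx_pCons: "rhom h \<Longrightarrow> hx h x (pCons a p) = h a + x * hx h x p"
  by (cases "a = 0 \<and> p = 0") (auto simp: hx_def map_poly_pCons rhom_0)

lemma hx_const: "rhom h \<Longrightarrow> hx h x [:a:] = h a"
  by (simp add: hx_pCons hx_0)

lemma rhom_hx:
  assumes h: "rhom h"
  shows "rhom (hx h x)"
proof -
  have add: "hx h x (p + q) = hx h x p + hx h x q" for p q
  proof -
    have "map_poly h (p + q) = map_poly h p + map_poly h q"
      by (rule poly_eqI) (simp add: coeff_map_poly rhom_0[OF h] rhom_add[OF h])
    then show ?thesis by (simp add: hx_def)
  qed
  have smult: "hx h x (smult a q) = h a * hx h x q" for a q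
    by (induction q) (simp_all add: hx_0 hx_pCons[OF h] rhom_mult[OF h] algebra_simps)
  have "hx h x (p * q) = hx h x p * hx h x q" for p q
    by (induction p) (simp_all add: hx_0 hx_pCons[OF h] add smult rhom_0[OF h] algebra_simps)
  moreover have "hx h x 1 = 1" by (simp add: one_pCons hx_const[OF h] rhom_1[OF h])
  ultimately show ?thesis using add by (simp add: rhom_def)
qed

lemma hx_comp:
  "rhom h \<Longrightarrow> rhom g \<Longrightarrow> g (hx h x p) = hx (\<lambda>a. g (h a)) (g x) p"
  by (induction p)
    (simp_all add: hx_0 hx_pCons rhom_comp rhom_0 rhom_add rhom_mult)

lemma hx_monom: "rhom h \<Longrightarrow> hx h x (monom c n) = h c * x ^ n"
  by (induction n) (simp_all add: monom_0 monom_Suc hx_const hx_pCons hx_0 rhom_0)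

text \<open>The minimal polynomial of \<open>x\<close> over the ground field: an annihilating
  polynomial is made monic, and one of least degree is chosen.\<close>

lemma alg_closure_monic:
  fixes x :: "'a::field alg_closure"
  obtains p :: "'a poly" where "lead_coeff p = 1" "hx to_ac x p = 0"
    "\<And>q. lead_coeff q = 1 \<Longrightarrow> hx to_ac x q = 0 \<Longrightarrow> Polynomial.degree p \<le> Polynomial.degree q"
proof -
  obtain p :: "'a poly" where p: "p \<noteq> 0" "poly (map_poly to_ac p) x = 0"
    by (rule alg_closure_algebraic)
  define q where "q = [:inverse (lead_coeff p):] * p"
  have "lead_coeff q = 1" using p by (simp add: q_def lead_coeff_mult)
  moreover have "hx to_ac x q = 0"
    using p rhom_mult[OF rhom_hx[OF rhom_to_ac], of x "[:inverse (lead_coeff p):]" p] by (simp add: q_def hx_def)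
  ultimately have "\<exists>q. lead_coeff q = 1 \<and> hx to_ac x q = 0" by blast
  from exists_least_iff[THEN iffD1, of "\<lambda>n. \<exists>q. lead_coeff q = 1 \<and> hx to_ac x q = 0 \<and> Polynomial.degree q = n"] this
  obtain q where "lead_coeff q = 1" "hx to_ac x q = 0"
    "\<And>m. m < Polynomial.degree q \<Longrightarrow> \<not> (\<exists>q. lead_coeff q = 1 \<and> hx to_ac x q = 0 \<and> Polynomial.degree q = m)"
    by auto
  then show thesis by (intro that) (auto simp: not_less[symmetric])
qed

text \<open>Cancelling powers of the nonzero element \<open>h a\<close> gives an algebraic relation
  with nonzero constant term; solving it for that term writes the inverse of \<open>h a\<close> as a
  polynomial in \<open>h a\<close>, hence as an element of the image.\<close>

lemma alg_closure_image_field: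
  fixes h :: "'r::comm_ring_1 \<Rightarrow> 'a::field alg_closure"
  assumes h: "rhom h" and c: "rhom c" and hc: "\<And>a. h (c a) = to_ac a" and nz: "h a \<noteq> 0"
  shows "\<exists>b. h (b * a) = 1"
proof -
  obtain p :: "'a poly" where p: "p \<noteq> 0" "poly (map_poly to_ac p) (h a) = 0"
    by (rule alg_closure_algebraic)
  have "\<exists>p0 p'. p0 \<noteq> 0 \<and> hx to_ac (h a) (pCons p0 p') = 0"
    using p(1) p(2)[folded hx_def]
  proof (induction p)
    case (pCons x p)
    show ?case
    proof (cases "x = 0")
      case True
      then have "p \<noteq> 0" "hx to_ac (h a) p = 0"
        using pCons.prems nz pCons.hyps by (auto simp: hx_pCons[OF rhom_to_ac])
      then show ?thesis using pCons.IH by blast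
    next
      case False
      then show ?thesis using pCons.prems by blast
    qed
  qed simp
  then obtain x p' where x: "x \<noteq> 0" and e: "to_ac x + h a * hx to_ac (h a) p' = 0"
    by (auto simp: hx_pCons[OF rhom_to_ac])
  have hp: "h (hx c a p') = hx to_ac (h a) p'"
    using hx_comp[OF c h, of a p'] by (simp add: hc)
  have "h (c (- inverse x) * hx c a p' * a) = 1"
    using x e by (simp add: rhom_mult[OF h] hc hp rhom_uminus[OF rhom_to_ac] mult.commute[of "h a"]
        add_eq_0_iff minus_equation_iff[of "_ * _"] flip: mult.assoc) (simp add: mult.assoc)
  then show ?thesis by blast
qed

text \<open>If the image of \<open>h\<close> is a field and its kernel has \<open>n\<close> generators, then lifting a minimal
  polynomial of \<open>x\<close> gives \<open>n + 1\<close> generators of the kernel of the extension of \<open>h\<close> by \<open>X \<mapsto> x\<close>.\<close>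

lemma kernel_generators_poly:
  fixes h :: "'r::comm_ring_1 \<Rightarrow> 'f::field"
  assumes h: "rhom h" and inv: "\<And>a. h a \<noteq> 0 \<Longrightarrow> \<exists>b. h (b * a) = 1"
    and g: "\<And>i. i < n \<Longrightarrow> h (g i) = 0" and gen: "\<And>a. h a = 0 \<Longrightarrow> \<exists>u. a = (\<Sum>i<n. u i * g i)"
    and alg: "\<exists>p. lead_coeff p = 1 \<and> hx h x p = 0"
  shows "\<exists>g'. (\<forall>i<Suc n. hx h x (g' i) = 0) \<and>
    (\<forall>p. hx h x p = 0 \<longrightarrow> (\<exists>u. p = (\<Sum>i<Suc n. u i * g' i)))"
proof -
  from exists_least_iff[THEN iffD1, of "\<lambda>n. \<exists>q. lead_coeff q = 1 \<and> hx h x q = 0 \<and> Polynomial.degree q = n"] alg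
  obtain f where f: "lead_coeff f = 1" "hx h x f = 0"
    and least: "\<And>m q. m < Polynomial.degree f \<Longrightarrow> \<not> (lead_coeff q = 1 \<and> hx h x q = 0 \<and> Polynomial.degree q = m)"
    by blast
  note H = rhom_hx[OF h, of x]
  \<comment> \<open>Otherwise \<open>r\<close>, truncated above the highest coefficient not killed
    by \<open>h\<close> and rescaled by an inverse of that coefficient, would be a monic annihilator
    of degree smaller than \<open>f\<close>.\<close>
  have low: "h (coeff r i) = 0"
    if r: "hx h x r = 0" and deg: "r = 0 \<or> Polynomial.degree r < Polynomial.degree f" for r i
  proof (rule ccontr)
    assume nz: "h (coeff r i) \<noteq> 0"
    define e where "e = Polynomial.degree (map_poly h r)"
    have nz': "map_poly h r \<noteq> 0" using nz by (auto simp: poly_eq_iff coeff_map_poly rhom_0[OF h])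
    then have "h (coeff r e) \<noteq> 0" using leading_coeff_0_iff[of "map_poly h r"]
      by (simp add: e_def coeff_map_poly rhom_0[OF h])
    then obtain b where b: "h (b * coeff r e) = 1" using inv by blast
    have "e \<le> Polynomial.degree r" by (simp add: e_def map_poly_degree_leq)
    then have e: "e < Polynomial.degree f" using deg nz by (auto simp: rhom_0[OF h])
    define s where "s = (\<Sum>i<e. monom (b * coeff r i) i)"
    have cs: "coeff s j = (if j < e then b * coeff r j else 0)" for j
      by (auto simp: s_def coeff_sum)
    define p where "p = monom 1 e + s"
    have cp: "coeff p j = (if j = e then 1 else if j < e then b * coeff r j else 0)" for j
      by (simp add: p_def cs)
    have dp: "Polynomial.degree p = e"
      by (rule antisym[OF degree_le le_degree]) (auto simp: cp)
    have "map_poly h p = smult (h b) (map_poly h r)"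
    proof (rule poly_eqI)
      fix j
      have "j > e \<Longrightarrow> h (coeff r j) = 0"
        using coeff_eq_0[of "map_poly h r" j] by (simp add: e_def coeff_map_poly rhom_0[OF h])
      then show "coeff (map_poly h p) j = coeff (smult (h b) (map_poly h r)) j"
        using b by (auto simp: coeff_map_poly rhom_0[OF h] rhom_1[OF h] cp rhom_mult[OF h] not_less le_less)
    qed
    then have "hx h x p = 0" using r by (simp add: hx_def)
    moreover have "lead_coeff p = 1" using dp cp by simp
    ultimately show False using least[OF e] dp by blast
  qed
  define g' where "g' i = (if i < n then [:g i:] else f)" for i
  have ker: "\<exists>u. p = (\<Sum>i<Suc n. u i * g' i)" if p: "hx h x p = 0" for p
  proof -
    have "f \<noteq> 0" using f by auto
    obtain q r where qr: "pseudo_divmod p f = (q, r)" by force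
    \<comment> \<open>As \<open>f\<close> is monic, pseudo-division is division with remainder over
      the ring itself.\<close>
    from pseudo_divmod[OF \<open>f \<noteq> 0\<close> qr] f(1)
    have pq: "p = f * q + r" and dr: "r = 0 \<or> Polynomial.degree r < Polynomial.degree f" by auto
    have "hx h x r = 0" using p pq by (simp add: rhom_add[OF H] rhom_mult[OF H] f(2))
    from low[OF this dr] gen have "\<forall>j. \<exists>u. coeff r j = (\<Sum>i<n. u i * g i)" by blast
    then obtain u where u: "\<And>j. coeff r j = (\<Sum>i<n. u j i * g i)" by metis
    define v where "v i = (\<Sum>j\<le>Polynomial.degree r. monom (u j i) j)" for i
    have "r = (\<Sum>j\<le>Polynomial.degree r. monom (coeff r j) j)" by (simp add: poly_as_sum_of_monoms)
    also have "\<dots> = (\<Sum>j\<le>Polynomial.degree r. \<Sum>i<n. monom (u j i) j * [:g i:])"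
      by (intro sum.cong refl poly_eqI) (auto simp: u coeff_sum mult.commute)
    also have "\<dots> = (\<Sum>i<n. v i * [:g i:])"
      by (subst sum.swap) (simp only: v_def sum_distrib_right)
    finally have "r = (\<Sum>i<n. v i * g' i)" by (simp add: g'_def)
    then have "p = (\<Sum>i<Suc n. (if i < n then v i else q) * g' i)"
      using pq by (simp add: g'_def mult.commute)
    then show ?thesis by (rule exI[of _ "\<lambda>i. if i < n then v i else q"])
  qed
  have "\<forall>i<Suc n. hx h x (g' i) = 0"
    using f g by (auto simp: g'_def hx_const[OF h])
  with ker show ?thesis by blast
qed

lemma indices4:
  fixes i :: 4
  obtains j1 j2 j3 where "UNIV = {i, j1, j2, j3}"
proof -
  have "card (UNIV - {i}) = 3" by simp
  then obtain j1 j2 j3 where "UNIV - {i} = {j1, j2, j3}" 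
    using card_3_iff[of "UNIV - {i}"] by blast
  then show thesis by (intro that[of j1 j2 j3]) blast
qed

text \<open>The three variables other than \<open>X_i\<close> are adjoined to the ground field one
  at a time, each adding one generator, and \<open>X_i\<close> is absorbed by
  \<open>Var4 i - 1\<close>. The number three matters: two equations of the curve will eliminate all
  but one of these generators.\<close>

lemma kernel_generators_poly4:
  fixes w :: "4 \<Rightarrow> 'a::field alg_closure" and i :: 4
  assumes w: "w i = 1"
  obtains g :: "nat \<Rightarrow> 'a poly4" where
    "\<And>b. b < 3 \<Longrightarrow> peval to_ac w (g b) = 0"
    "\<And>F. peval to_ac w F = 0 \<Longrightarrow> \<exists>f0 f. F = f0 * (Var4 i - 1) + (\<Sum>b<3. f b * g b)"
proof -
  obtain j1 j2 j3 where U: "UNIV = {i, j1, j2, j3}" by (rule indices4)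
  let ?k = "peval to_ac w"
  note k = rhom_peval[OF rhom_to_ac, of w]
  define r1 where "r1 = hx Const4 (Var4 j1 :: 'a poly4)"
  define r2 where "r2 = hx r1 (Var4 j2 :: 'a poly4)"
  define r3 where "r3 = hx r2 (Var4 j3 :: 'a poly4)"
  have r1: "rhom r1" unfolding r1_def by (rule rhom_hx[OF rhom_Const4])
  have r2: "rhom r2" unfolding r2_def by (rule rhom_hx[OF r1])
  have r3: "rhom r3" unfolding r3_def by (rule rhom_hx[OF r2])
  have k1: "?k (r1 p) = hx to_ac (w j1) p" for p
    unfolding r1_def by (subst hx_comp[OF rhom_Const4 k]) (simp add: peval_Const4[OF rhom_to_ac] peval_Var4[OF rhom_to_ac])
  have k2: "?k (r2 p) = hx (\<lambda>p. ?k (r1 p)) (w j2) p" for p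
    unfolding r2_def by (subst hx_comp[OF r1 k]) (simp add: peval_Var4[OF rhom_to_ac])
  have k3: "?k (r3 p) = hx (\<lambda>p. ?k (r2 p)) (w j3) p" for p
    unfolding r3_def by (subst hx_comp[OF r2 k]) (simp add: peval_Var4[OF rhom_to_ac])
  have kr: "rhom (\<lambda>p. ?k (r1 p))" "rhom (\<lambda>p. ?k (r2 p))"
    by (rule rhom_comp[OF r1 k], rule rhom_comp[OF r2 k])
  have c1: "rhom (\<lambda>a::'a. [:a:])" by (simp add: rhom_def one_pCons)
  have c2: "rhom (\<lambda>a::'a. [:[:a:]:])" by (simp add: rhom_def one_pCons)
  have rc: "r1 [:a:] = Const4 a" "r2 [:p:] = r1 p" "r3 [:q:] = r2 q" for a p q
    by (simp_all add: r1_def r2_def r3_def hx_const rhom_Const4 r1[unfolded r1_def] r2[unfolded r2_def r1_def])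
  have kc: "?k (Const4 a) = to_ac a" for a by (rule peval_Const4[OF rhom_to_ac])
  \<comment> \<open>The minimal polynomial over the ground field, lifted coefficientwise along the
    constants \<open>c\<close>, stays monic.\<close>
  have alg: "\<exists>p. lead_coeff p = 1 \<and> hx h x p = 0"
    if h: "rhom (h :: 'r::comm_ring_1 \<Rightarrow> 'a alg_closure)" and c: "rhom c" and hc: "\<And>a::'a. h (c a) = to_ac a" for h c x
  proof -
    obtain p :: "'a poly" where p: "lead_coeff p = 1" "hx to_ac x p = 0" by (rule alg_closure_monic)
    have cc: "coeff (map_poly c p) n = c (coeff p n)" for n by (simp add: coeff_map_poly rhom_0[OF c])
    have "Polynomial.degree (map_poly c p) = Polynomial.degree p"
      using p(1) by (intro antisym map_poly_degree_leq le_degree) (simp add: cc rhom_1[OF c])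
    then have "lead_coeff (map_poly c p) = 1" using p(1) by (simp add: cc rhom_1[OF c])
    moreover have "map_poly h (map_poly c p) = map_poly to_ac p"
      by (rule poly_eqI) (simp add: coeff_map_poly rhom_0[OF c] rhom_0[OF h] hc)
    ultimately show ?thesis using p(2) by (intro exI[of _ "map_poly c p"]) (simp add: hx_def)
  qed
  have inv0: "\<exists>b. to_ac (b * a) = 1" if "to_ac a \<noteq> 0" for a :: 'a
    using that by (intro exI[of _ "inverse a"]) (simp flip: to_ac_mult)
  obtain g1 where g1: "\<forall>i<Suc 0. hx to_ac (w j1) (g1 i) = 0"
    "\<forall>p. hx to_ac (w j1) p = 0 \<longrightarrow> (\<exists>u. p = (\<Sum>i<Suc 0. u i * g1 i))"
    using kernel_generators_poly[OF rhom_to_ac inv0, of 0 "\<lambda>_. 0" "w j1"] alg[OF rhom_to_ac, of "\<lambda>a. a" "w j1"]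
    by (auto simp: rhom_def)
  obtain g2 where g2: "\<forall>i<Suc (Suc 0). ?k (r2 (g2 i)) = 0"
    "\<forall>p. ?k (r2 p) = 0 \<longrightarrow> (\<exists>u. p = (\<Sum>i<Suc (Suc 0). u i * g2 i))"
    using kernel_generators_poly[OF kr(1), of "Suc 0" g1 "w j2"] g1 alg[OF kr(1) c1, of "w j2"]
      alg_closure_image_field[OF kr(1) c1] unfolding k2 by (auto simp: k1 rc kc)
  obtain g3 where g3: "\<forall>i<Suc (Suc (Suc 0)). ?k (r3 (g3 i)) = 0"
    "\<forall>p. ?k (r3 p) = 0 \<longrightarrow> (\<exists>u. p = (\<Sum>i<Suc (Suc (Suc 0)). u i * g3 i))"
    using kernel_generators_poly[OF kr(2), of "Suc (Suc 0)" g2 "w j3"] g2 alg[OF kr(2) c2, of "w j3"]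
      alg_closure_image_field[OF kr(2) c2] unfolding k3 by (auto simp: rc kc)
  \<comment> \<open>\<open>r3\<close> reaches all polynomials in the other three variables, and
    modulo \<open>X_i - 1\<close> there are no others.\<close>
  have surj: "\<exists>p. (Var4 i - 1) dvd F - r3 p" for F :: "'a poly4"
  proof (induction F rule: poly4_induct)
    case (const c)
    have "r3 [:[:[:c:]:]:] = Const4 c" by (simp add: rc)
    then show ?case by (intro exI[of _ "[:[:[:c:]:]:]"]) simp
  next
    case (var j)
    have v: "hx h x [:0, 1:] = x" if "rhom h" for h :: "'r::comm_ring_1 \<Rightarrow> 's::comm_ring_1" and x
      using that by (simp add: hx_pCons hx_0 rhom_0 rhom_1)
    have "j = i \<or> j = j1 \<or> j = j2 \<or> j = j3" using U by blast
    moreover have "r3 1 = 1" by (rule rhom_1[OF r3])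
    moreover have "r3 [:[:[:0, 1:]:]:] = Var4 j1" unfolding rc by (simp add: r1_def v rhom_Const4)
    moreover have "r3 [:[:0, 1:]:] = Var4 j2" unfolding rc by (simp add: r2_def v r1)
    moreover have "r3 [:0, 1:] = Var4 j3" by (simp add: r3_def v r2)
    ultimately show ?case by (metis cancel_comm_monoid_add_class.diff_cancel dvd_0_right dvd_refl)
  next
    case (add F G)
    then obtain p q where "(Var4 i - 1) dvd F - r3 p" "(Var4 i - 1) dvd G - r3 q" by blast
    then have "(Var4 i - 1) dvd (F - r3 p) + (G - r3 q)" by (rule dvd_add)
    then show ?case by (intro exI[of _ "p + q"]) (simp add: rhom_add[OF r3] algebra_simps)
  next
    case (mult F G)
    then obtain p q where "(Var4 i - 1) dvd F - r3 p" "(Var4 i - 1) dvd G - r3 q" by blast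
    then have "(Var4 i - 1) dvd (F - r3 p) * G + r3 p * (G - r3 q)" by (intro dvd_add dvd_mult dvd_mult2)
    then show ?case by (intro exI[of _ "p * q"]) (simp add: rhom_mult[OF r3] algebra_simps)
  qed
  show thesis
  proof (rule that[of "\<lambda>b. r3 (g3 b)"])
    show "?k (r3 (g3 b)) = 0" if "b < 3" for b using g3(1) that by (simp add: eval_nat_numeral)
    fix F assume F: "?k F = 0"
    obtain p H where p: "F - r3 p = (Var4 i - 1) * H" using surj[of F] by (auto simp: dvd_def)
    have "?k (F - r3 p) = 0"
      unfolding p by (simp add: rhom_mult[OF k] rhom_diff[OF k] rhom_1[OF k] peval_Var4[OF rhom_to_ac] w)
    then have "?k (r3 p) = 0" using F by (simp add: rhom_diff[OF k])
    then obtain u where "p = (\<Sum>i<3. u i * g3 i)" using g3(2) by (auto simp: eval_nat_numeral)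
    then have "r3 p = (\<Sum>b<3. r3 (u b) * r3 (g3 b))" by (simp add: rhom_sum[OF r3] rhom_mult[OF r3])
    then have "F = H * (Var4 i - 1) + (\<Sum>b<3. r3 (u b) * r3 (g3 b))" using p by (simp add: algebra_simps)
    then show "\<exists>f0 f. F = f0 * (Var4 i - 1) + (\<Sum>b<3. f b * r3 (g3 b))"
      by (intro exI[of _ H] exI[of _ "\<lambda>b. r3 (u b)"])
  qed
qed

section \<open>The local rings of a smooth projective curve\<close>

lemma proj_rel_coords: "proj_rel (coords P) (coords P)"
  unfolding coords_def by (rule Quotient_rep_reflp[OF Quotient_pspace3])

lemma coords_nonzero: "coords P \<noteq> 0"
  using proj_rel_coords[of P] by (simp add: proj_rel_def)

lemma proj_point_coords: "proj_point (coords P) = P"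
  unfolding coords_def proj_point_def by (rule Quotient_abs_rep[OF Quotient_pspace3])

lemma coords_proj_point: "v \<noteq> 0 \<Longrightarrow> \<exists>c. c \<noteq> 0 \<and> coords (proj_point v) = c *s v"
proof -
  assume v: "v \<noteq> 0"
  then have "proj_rel v v" unfolding proj_rel_def by (metis vec.scale_one zero_neq_one)
  then have "proj_rel (coords (proj_point v)) v"
    unfolding coords_def proj_point_def by (rule Quotient_rep_abs[OF Quotient_pspace3])
  then obtain c where c: "c \<noteq> 0" "v = c *s coords (proj_point v)" unfolding proj_rel_def by blast
  have "inverse c *s v = inverse c *s (c *s coords (proj_point v))" using c(2) by (rule arg_cong)
  then have "coords (proj_point v) = inverse c *s v"
    using c(1) by (simp only: vec.scale_scale left_inverse[OF c(1)] vec.scale_one)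
  moreover have "inverse c \<noteq> 0" using c(1) by simp
  ultimately show ?thesis by blast
qed

lemma proj_point_eqI: "v \<noteq> 0 \<Longrightarrow> c \<noteq> 0 \<Longrightarrow> proj_point (c *s v) = proj_point v"
  unfolding proj_point_def
  by (rule Quotient_rel_abs[OF Quotient_pspace3]) (auto simp: proj_rel_def intro!: exI[of _ "inverse c"])

lemma coords_nz_index: obtains i where "coords P $ i \<noteq> 0"
  using coords_nonzero[of P] by (auto simp: vec_eq_iff)

definition nvec :: "'a::field pspace3 \<Rightarrow> 4 \<Rightarrow> 4 \<Rightarrow> 'a" where
  "nvec P i = (\<lambda>j. coords P $ j / coords P $ i)"

lemma nvec_self: "coords P $ i \<noteq> 0 \<Longrightarrow> nvec P i i = 1"
  by (simp add: nvec_def)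

lemma eval4_coords_form:
  assumes "is_form d F" "coords P $ i \<noteq> 0"
  shows "eval4 F (coords P) = (coords P $ i) ^ d * peval to_ac (nvec P i) F"
proof -
  have "(\<lambda>j. coords P $ j) = (\<lambda>j. coords P $ i * nvec P i j)"
    using assms(2) by (simp add: nvec_def)
  from arg_cong[OF this, of "\<lambda>v. peval to_ac v F"] show ?thesis
    unfolding eval4_eq peval_scale_form[OF assms(1)] .
qed

lemma vanishes_at_iff:
  assumes "is_form d F" "coords P $ i \<noteq> 0"
  shows "vanishes_at F P \<longleftrightarrow> peval to_ac (nvec P i) F = 0"
  using eval4_coords_form[OF assms] assms(2) by (simp add: vanishes_at_def)

text \<open>Powers of \<open>X_i\<close> are 1 modulo \<open>X_i - 1\<close>, so the summands of a
  polynomial can be padded to a common degree.\<close>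

lemma homogenize:
  fixes F :: "'a::comm_ring_1 poly4"
  shows "\<exists>N G. is_form N G \<and> (Var4 i - 1) dvd G - F"
proof (induction F rule: poly4_induct)
  case (const c)
  show ?case by (intro exI[of _ 0] exI[of _ "Const4 c"]) simp
next
  case (var j)
  show ?case by (intro exI[of _ "Suc 0"] exI[of _ "Var4 j"]) simp
next
  case (add F1 F2)
  then obtain M G1 N G2 where G: "is_form M G1" "(Var4 i - 1) dvd G1 - F1" "is_form N G2" "(Var4 i - 1) dvd G2 - F2"
    by blast
  have d: "(Var4 i - 1 :: 'a poly4) dvd Var4 i ^ n - 1" for n
  proof (induction n)
    case (Suc n)
    have "Var4 i ^ Suc n - 1 = Var4 i * (Var4 i ^ n - 1) + (Var4 i - 1 :: 'a poly4)" by (simp add: algebra_simps)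
    then show ?case using Suc by (metis dvd_add dvd_mult dvd_refl)
  qed simp
  have "is_form (M + N) (Var4 i ^ N * G1 + Var4 i ^ M * G2)"
    using G by (intro is_form_add is_form_mult[OF is_form_Var4_power]) auto
  moreover have e: "Var4 i ^ N * G1 + Var4 i ^ M * G2 - (F1 + F2)
    = (Var4 i ^ N - 1) * G1 + (G1 - F1) + (Var4 i ^ M - 1) * G2 + (G2 - F2)" by (simp add: algebra_simps)
  have "(Var4 i - 1) dvd Var4 i ^ N * G1 + Var4 i ^ M * G2 - (F1 + F2)"
    unfolding e by (intro dvd_add dvd_mult2 d G)
  ultimately show ?case by blast
next
  case (mult F1 F2)
  then obtain M G1 N G2 where G: "is_form M G1" "(Var4 i - 1) dvd G1 - F1" "is_form N G2" "(Var4 i - 1) dvd G2 - F2"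
    by blast
  have "is_form (M + N) (G1 * G2)" using G by (intro is_form_mult) auto
  moreover have "G1 * G2 - F1 * F2 = (G1 - F1) * G2 + F1 * (G2 - F2)" by (simp add: algebra_simps)
  then have "(Var4 i - 1) dvd G1 * G2 - F1 * F2" using G by (simp add: dvd_add)
  ultimately show ?case by blast
qed

lemma gradient4_add: "gradient4 (F + G) v = gradient4 F v + gradient4 G v"
  by (simp add: gradient4_def vec_eq_iff pderiv4_add rhom_add[OF rhom_eval4])

lemma gradient4_0: "gradient4 0 v = 0"
  by (simp add: gradient4_def vec_eq_iff pderiv4_0 rhom_0[OF rhom_eval4])

lemma gradient4_sum: "gradient4 (sum f A) v = (\<Sum>x\<in>A. gradient4 (f x) v)"
  by (induction A rule: infinite_finite_induct) (simp_all add: gradient4_0 gradient4_add)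

text \<open>If all minors vanish, the coefficients \<open>s c\<close> and \<open>- r c\<close> give
  a relation between the rows for each column \<open>c\<close>. The hypothesis then makes both rows
  zero, and the coefficients 1 and 0 contradict it.\<close>

lemma exists_nonzero_minor:
  fixes r s :: "nat \<Rightarrow> 'a::field"
  assumes "\<And>x y. (\<And>b. b < 3 \<Longrightarrow> x * r b + y * s b = 0) \<Longrightarrow> x = 0 \<and> y = 0"
  shows "\<exists>b<3. \<exists>c<3. r b * s c - r c * s b \<noteq> 0"
proof (rule ccontr)
  assume "\<not> ?thesis"
  then have m: "r b * s c - r c * s b = 0" if "b < 3" "c < 3" for b c using that by blast
  have "s c = 0 \<and> - r c = 0" if c: "c < 3" for c
    using assms[of "s c" "- r c"] m[OF _ c] by (simp add: mult.commute)
  then show False using assms[of 1 0] by simp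
qed

locale smooth_curve =
  fixes I :: "'a::field poly4 set"
  assumes hom_I: "homogeneous_ideal I" and int_I: "geom_integral I" and genus_I: "is_curve_of_genus I 1"
    and smooth_I: "nonsingular_curve I"
begin

lemma ideal_I: "ideal I poly4_ring"
  using hom_I by (simp add: homogeneous_ideal_def)

lemma I_add: "F \<in> I \<Longrightarrow> G \<in> I \<Longrightarrow> F + G \<in> I"
  using additive_subgroup.a_closed[OF ideal.axioms(1)[OF ideal_I]] by (simp add: ring_of_type_algebra_def)

lemma I_0: "0 \<in> I"
  using additive_subgroup.zero_closed[OF ideal.axioms(1)[OF ideal_I]] by (simp add: ring_of_type_algebra_def)

lemma I_mult: "F \<in> I \<Longrightarrow> G * F \<in> I"
  using ideal.I_l_closed[OF ideal_I, of F G] by (simp add: ring_of_type_algebra_def)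

lemma I_mult2: "F \<in> I \<Longrightarrow> F * G \<in> I"
  using I_mult[of F G] by (simp add: mult.commute)

lemma I_uminus: "F \<in> I \<Longrightarrow> - F \<in> I"
  using I_mult[of F "- 1"] by simp

lemma I_sum: "(\<And>x. x \<in> A \<Longrightarrow> f x \<in> I) \<Longrightarrow> sum f A \<in> I"
  by (induction A rule: infinite_finite_induct) (simp_all add: I_0 I_add)

lemma I_prime: "F * G \<in> I \<Longrightarrow> F \<in> I \<or> G \<in> I"
  using primeideal.I_prime[of I poly4_ring F G] int_I
  by (simp add: geom_integral_def ring_of_type_algebra_def)

lemma I_1: "1 \<notin> I"
proof
  assume "1 \<in> I"
  then have "I = UNIV" using I_mult[of 1] by auto
  moreover have "carrier poly4_ring \<noteq> I"
    using primeideal.I_notcarr[of I poly4_ring] int_I by (simp add: geom_integral_def)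
  ultimately show False by (simp add: ring_of_type_algebra_def)
qed

lemma I_power: "F ^ n \<in> I \<Longrightarrow> F \<in> I"
  by (induction n) (auto simp: I_1 dest: I_prime)

lemma I_hom: "F \<in> I \<Longrightarrow> hom_component d F \<in> I"
  using hom_I by (simp add: homogeneous_ideal_def)

lemma vanish_I: "P \<in> geom_points I \<Longrightarrow> F \<in> I \<Longrightarrow> eval4 F (coords P) = 0"
  by (simp add: geom_points_def vanishes_at_def)

lemma nvec_I:
  assumes P: "P \<in> geom_points I" "coords P $ i \<noteq> 0" and F: "F \<in> I"
  shows "peval to_ac (nvec P i) F = 0"
proof -
  have "peval to_ac (nvec P i) (hom_component d F) = 0" for d
    using vanish_I[OF P(1) I_hom[OF F]] eval4_coords_form[OF is_form_hom_component P(2)] P(2) by simp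
  then have "peval to_ac (nvec P i) (\<Sum>d\<in>mdegree ` Poly_Mapping.keys F. hom_component d F) = 0"
    by (simp add: rhom_sum[OF rhom_peval[OF rhom_to_ac]])
  then show ?thesis using hom_component_expand[of F] by simp
qed

lemma Var4_notin_I: "P \<in> geom_points I \<Longrightarrow> coords P $ i \<noteq> 0 \<Longrightarrow> Var4 i \<notin> I"
  using nvec_I[of P i "Var4 i"] nvec_self[of P i] by (auto simp: peval_Var4[OF rhom_to_ac])

text \<open>The ideal of the affine chart \<open>X\<^sub>i = 1\<close>.\<close>

definition J :: "4 \<Rightarrow> 'a poly4 set" where
  "J i = {F. \<exists>G\<in>I. (Var4 i - 1) dvd F - G}"

lemma J_I: "F \<in> I \<Longrightarrow> F \<in> J i"
  by (auto simp: J_def intro!: bexI[of _ F])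

lemma J_dvd: "(Var4 i - 1) dvd F \<Longrightarrow> F \<in> J i"
  by (auto simp: J_def intro!: bexI[of _ 0] I_0)

lemma J_add: "F \<in> J i \<Longrightarrow> G \<in> J i \<Longrightarrow> F + G \<in> J i"
proof -
  assume "F \<in> J i" "G \<in> J i"
  then obtain A B where A: "A \<in> I" "(Var4 i - 1) dvd F - A" "B \<in> I" "(Var4 i - 1) dvd G - B" by (auto simp: J_def)
  from dvd_add[OF A(2,4)] have "(Var4 i - 1) dvd F + G - (A + B)" by (simp add: algebra_simps)
  then show ?thesis using A by (auto simp: J_def intro!: bexI[of _ "A + B"] I_add)
qed

lemma J_mult: "F \<in> J i \<Longrightarrow> G * F \<in> J i"
proof -
  assume "F \<in> J i"
  then obtain A where A: "A \<in> I" "(Var4 i - 1) dvd F - A" by (auto simp: J_def)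
  from dvd_mult[OF A(2), of G] have "(Var4 i - 1) dvd G * F - G * A" by (simp add: algebra_simps)
  then show ?thesis using A by (auto simp: J_def intro!: bexI[of _ "G * A"] I_mult)
qed

lemma J_diff: "F \<in> J i \<Longrightarrow> G \<in> J i \<Longrightarrow> F - G \<in> J i"
  using J_add[of F i "- 1 * G"] J_mult[of G i "- 1"] by simp

lemma J_cong: "F - G \<in> J i \<Longrightarrow> F \<in> J i \<longleftrightarrow> G \<in> J i"
  using J_add[of "F - G" i G] J_diff[of F i "F - G"] by auto

text \<open>The substitution of \<open>X_j / X_i\<close> for \<open>X_j\<close>. When the image of
  \<open>X_i\<close> is 1 it kills \<open>Var4 i - 1\<close>, and so compares the chart ideal
  \<open>J i\<close> with \<open>I\<close>.\<close>

definition dehom :: "4 \<Rightarrow> 'a poly4 \<Rightarrow> 'a poly4 fract" where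
  "dehom i = peval (\<lambda>c. Fract (Const4 c) 1) (\<lambda>j. Fract 1 (Var4 i) * Fract (Var4 j) 1)"

lemma rhom_Fract: "rhom (\<lambda>F::'a poly4. Fract F 1)"
  by (simp add: rhom_def One_fract_def)

lemma Fract_peval: "peval (\<lambda>c. Fract (Const4 c) 1) (\<lambda>j. Fract (Var4 j) 1) F = Fract (F :: 'a poly4) 1"
  using peval_comp[OF rhom_Const4 rhom_Fract, of Var4 F] by (simp add: peval_Const4_Var4)

lemma rhom_dehom: "rhom (dehom i)"
  unfolding dehom_def by (rule rhom_peval[OF rhom_comp[OF rhom_Const4 rhom_Fract]])

lemma Fract_power: "Fract a b ^ n = Fract (a ^ n) (b ^ n :: 'a poly4)"
  by (induction n) (simp_all add: One_fract_def)

lemma dehom_form: "is_form d F \<Longrightarrow> dehom i F = Fract F (Var4 i ^ d)"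
  unfolding dehom_def by (simp only: peval_scale_form Fract_peval Fract_power) simp

lemma Var4_nonzero: "Var4 i \<noteq> (0 :: 'a poly4)"
proof -
  have "Poly_Mapping.lookup (Var4 i :: 'a poly4) (Poly_Mapping.single i 1) = 1" by (simp add: Var4_def)
  then show ?thesis by auto
qed

lemma dehom_I: "F \<in> I \<Longrightarrow> \<exists>G\<in>I. \<exists>n. dehom i F = Fract G (Var4 i ^ n)"
proof -
  assume F: "F \<in> I"
  have "\<exists>G\<in>I. \<exists>n. (\<Sum>d\<in>D. dehom i (hom_component d F)) = Fract G (Var4 i ^ n)" if "finite D" for D
    using that
  proof (induction D rule: finite_induct)
    case empty
    show ?case by (intro bexI[of _ 0] exI[of _ 0]) (simp_all add: Zero_fract_def I_0)
  next
    case (insert d D)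
    then obtain G n where G: "G \<in> I" "(\<Sum>d\<in>D. dehom i (hom_component d F)) = Fract G (Var4 i ^ n)" by blast
    have "(\<Sum>d\<in>insert d D. dehom i (hom_component d F))
        = Fract (hom_component d F * Var4 i ^ n + G * Var4 i ^ d) (Var4 i ^ (d + n))"
      using insert(1,2) G by (simp add: dehom_form[OF is_form_hom_component] Var4_nonzero power_add)
    then show ?case
      using I_add[OF I_mult2[OF I_hom[OF F, of d]] I_mult2[OF G(1)]] by blast
  qed
  from this[of "mdegree ` Poly_Mapping.keys F"]
  show ?thesis using hom_component_expand[of F] by (simp flip: rhom_sum[OF rhom_dehom])
qed

text \<open>Dehomogenising a congruence between \<open>F\<close> and an element of \<open>I\<close>
  gives \<open>F / X_i ^ d = G' / X_i ^ n\<close> with \<open>G'\<close> in \<open>I\<close>; after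
  clearing denominators, primality removes the power of \<open>X_i\<close>.\<close>

lemma J_form:
  assumes z: "Var4 i \<notin> I" and F: "is_form d F"
  shows "F \<in> J i \<longleftrightarrow> F \<in> I"
proof
  assume "F \<in> J i"
  then obtain G H where G: "G \<in> I" "F - G = (Var4 i - 1) * H" by (auto simp: J_def dvd_def)
  have "dehom i (Var4 i) = 1"
    by (subst dehom_form[OF is_form_Var4]) (simp add: Var4_nonzero eq_fract One_fract_def)
  then have "dehom i (F - G) = 0"
    unfolding G(2) by (simp add: rhom_mult[OF rhom_dehom] rhom_diff[OF rhom_dehom] rhom_1[OF rhom_dehom])
  then have "dehom i F = dehom i G" by (simp add: rhom_diff[OF rhom_dehom])
  with dehom_I[OF G(1)] dehom_form[OF F]
  obtain G' n where "G' \<in> I" "Fract F (Var4 i ^ d) = Fract G' (Var4 i ^ n)" by metis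
  then have "F * Var4 i ^ n \<in> I" using I_mult2 by (simp add: eq_fract Var4_nonzero)
  then show "F \<in> I" using I_prime I_power z by blast
qed (rule J_I)

text \<open>The factors are replaced by homogenisations, whose product is a form, so that
  \<open>J_form\<close> transfers the question to the prime ideal \<open>I\<close>.\<close>

lemma J_prime:
  assumes z: "Var4 i \<notin> I" and FG: "F * G \<in> J i"
  shows "F \<in> J i \<or> G \<in> J i"
proof -
  obtain M F' N G' where F': "is_form M F'" "(Var4 i - 1) dvd F' - F" and G': "is_form N G'" "(Var4 i - 1) dvd G' - G"
    using homogenize[where i = i and F = F] homogenize[where i = i and F = G] by blast
  have "F' * G' - F * G = (F' - F) * G' + F * (G' - G)" by (simp add: algebra_simps)
  then have "F' * G' - F * G \<in> J i" using F' G' by (intro J_dvd) simp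
  then have "F' * G' \<in> J i" using FG J_cong by blast
  then have "F' * G' \<in> I" using J_form[OF z is_form_mult[OF F'(1) G'(1) refl]] by simp
  then show ?thesis using I_prime J_I J_cong[OF J_dvd[OF F'(2)]] J_cong[OF J_dvd[OF G'(2)]] by blast
qed

lemma J_nvec:
  assumes P: "P \<in> geom_points I" "coords P $ i \<noteq> 0" and F: "F \<in> J i"
  shows "peval to_ac (nvec P i) F = 0"
proof -
  obtain G H where G: "G \<in> I" "F - G = (Var4 i - 1) * H" using F by (auto simp: J_def dvd_def)
  then have F: "F = G + (Var4 i - 1) * H" by (metis diff_add_cancel add.commute)
  note k = rhom_peval[OF rhom_to_ac, of "nvec P i"]
  show ?thesis using nvec_I[OF P G(1)] nvec_self[OF P(2)] unfolding F
    by (simp add: rhom_simps[OF k] peval_Var4[OF rhom_to_ac])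
qed

text \<open>The gradient of an element of \<open>I\<close> is the sum of the gradients of its
  homogeneous components, so forms already span the two-dimensional space of gradients. Forms are
  wanted because their derivatives rescale with the representative of the point and obey Euler's
  identity.\<close>

lemma independent_gradients:
  assumes P: "P \<in> geom_points I"
  obtains F1 F2 d1 d2 where "F1 \<in> I" "F2 \<in> I" "is_form d1 F1" "is_form d2 F2"
    "\<And>x y. x *s gradient4 F1 (coords P) + y *s gradient4 F2 (coords P) = 0 \<Longrightarrow> x = 0 \<and> y = 0"
proof -
  let ?g = "\<lambda>F. gradient4 F (coords P)"
  define S where "S = {?g F | F. F \<in> I}"
  define T where "T = {?g F | F. F \<in> I \<and> (\<exists>d. is_form d F)}"
  have "?g F \<in> vec.span T" if F: "F \<in> I" for F
  proof -
    have "?g (hom_component d F) \<in> T" for d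
      using I_hom[OF F] is_form_hom_component unfolding T_def by blast
    then have "(\<Sum>d\<in>mdegree ` Poly_Mapping.keys F. ?g (hom_component d F)) \<in> vec.span T"
      by (intro vec.span_sum vec.span_base)
    then show ?thesis using hom_component_expand[of F] by (simp flip: gradient4_sum)
  qed
  then have sub: "S \<subseteq> vec.span T" unfolding S_def by blast
  have "vec.dim S \<le> vec.dim T" using vec.dim_subset[OF sub] by (simp only: vec.dim_span)
  moreover have "T \<subseteq> S" unfolding S_def T_def by blast
  then have "vec.dim T \<le> vec.dim S" by (rule vec.dim_subset)
  moreover have "vec.dim S = 2" using smooth_I P by (simp add: nonsingular_curve_def S_def)
  ultimately have dimT: "vec.dim T = 2" by simp
  obtain B where B: "B \<subseteq> T" "vec.independent B" "card B = vec.dim T" by (rule vec.basis_exists[of T])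
  then obtain b1 b2 where b: "B = {b1, b2}" "b1 \<noteq> b2" using dimT card_2_iff[of B] by auto
  have "b1 \<in> T" "b2 \<in> T" using b(1) B(1) by simp_all
  then obtain F1 F2 d1 d2 where F: "F1 \<in> I" "F2 \<in> I" "is_form d1 F1" "is_form d2 F2" "b1 = ?g F1" "b2 = ?g F2"
    unfolding T_def by blast
  have ind: "b1 \<notin> vec.span {b2}" "b2 \<notin> vec.span {b1}"
    using B(2) b by (auto simp: vec.dependent_def insert_Diff_if)
  have "x = 0 \<and> y = 0" if e: "x *s b1 + y *s b2 = 0" for x y
  proof -
    have *: "x = 0" if "x *s b + y *s c = 0" "b \<notin> vec.span {c}" for x y b c
    proof (rule ccontr)
      assume x: "x \<noteq> 0"
      have "x *s b = - (y *s c)" using that(1) by (simp add: eq_neg_iff_add_eq_0)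
      then have "b = (inverse x * - y) *s c" using x
        by (metis vec.scale_minus_left vec.scale_scale vec.scale_one left_inverse)
      moreover have "(inverse x * - y) *s c \<in> vec.span {c}" by (rule vec.span_scale[OF vec.span_base]) simp
      ultimately show False using that(2) by metis
    qed
    show ?thesis using *[OF e ind(1)] *[of y b2 x b1] e ind(2) by (simp add: add.commute)
  qed
  then show thesis using that F by blast
qed

text \<open>Two elements of \<open>I\<close> with independent gradients eliminate, by Cramer's rule, two of the three generators
  of the maximal ideal.\<close>

lemma max_ideal_principal:
  assumes P: "P \<in> geom_points I" and i: "coords P $ i \<noteq> 0"
  obtains t where "peval to_ac (nvec P i) t = 0"
    "\<And>F. peval to_ac (nvec P i) F = 0 \<Longrightarrow> \<exists>H G. peval to_ac (nvec P i) H \<noteq> 0 \<and> H * F - G * t \<in> J i"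
proof -
  let ?w = "nvec P i" let ?k = "peval to_ac ?w"
  note k = rhom_peval[OF rhom_to_ac, of ?w]
  let ?D = "\<lambda>j F. ?k (pderiv4 j F)"
  obtain g :: "nat \<Rightarrow> 'a poly4" where g: "\<And>b. b < 3 \<Longrightarrow> ?k (g b) = 0"
    and gen: "\<And>F. ?k F = 0 \<Longrightarrow> \<exists>f0 f. F = f0 * (Var4 i - 1) + (\<Sum>b<3. f b * g b)"
    by (rule kernel_generators_poly4[of "nvec P i" i, OF nvec_self[OF i]]) blast
  obtain F1 F2 d1 d2 where F: "F1 \<in> I" "F2 \<in> I" "is_form d1 F1" "is_form d2 F2"
    and ind: "\<And>x y. x *s gradient4 F1 (coords P) + y *s gradient4 F2 (coords P) = 0 \<Longrightarrow> x = 0 \<and> y = 0"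
    by (rule independent_gradients[OF P]) blast
  have kF: "?k F1 = 0" "?k F2 = 0" using F nvec_I[OF P i] by auto
  \<comment> \<open>Partial derivatives of a form of degree \<open>d\<close> are forms of degree
    \<open>d - 1\<close>, so normalising the point scales the gradient by a nonzero factor; a form
    of degree 0 has zero gradient.\<close>
  have grad: "\<exists>c. c \<noteq> 0 \<and> (\<forall>j. gradient4 F (coords P) $ j = c * ?D j F)" if F: "is_form d F" for d F
  proof (cases d)
    case 0
    then show ?thesis using F by (intro exI[of _ 1]) (simp add: gradient4_def pderiv4_form_0 rhom_0[OF k] rhom_0[OF rhom_eval4])
  next
    case (Suc e)
    then show ?thesis using F i
      by (intro exI[of _ "(coords P $ i) ^ e"]) (simp add: gradient4_def eval4_coords_form[OF is_form_pderiv4])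
  qed
  obtain c1 where c1: "c1 \<noteq> 0" "\<And>j. gradient4 F1 (coords P) $ j = c1 * ?D j F1" using grad[OF F(3)] by blast
  obtain c2 where c2: "c2 \<noteq> 0" "\<And>j. gradient4 F2 (coords P) $ j = c2 * ?D j F2" using grad[OF F(4)] by blast
  have ind': "x = 0 \<and> y = 0" if "\<And>j. x * ?D j F1 + y * ?D j F2 = 0" for x y
    using ind[of "x / c1" "y / c2"] that c1 c2 by (simp add: vec_eq_iff)
  obtain h0 h where h: "F1 = h0 * (Var4 i - 1) + (\<Sum>b<3. h b * g b)" using gen[OF kF(1)] by blast
  obtain l0 l where l: "F2 = l0 * (Var4 i - 1) + (\<Sum>b<3. l b * g b)" using gen[OF kF(2)] by blast
  have Dsum: "?D j (\<Sum>b<3. f b * g b) = (\<Sum>b<3. ?k (f b) * ?D j (g b))" for j f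
    using g by (auto simp: pderiv4_sum pderiv4_mult rhom_simps[OF k] intro!: sum.cong)
  have Dz: "?D j (f0 * (Var4 i - 1)) = (if j = i then ?k f0 else 0)" for j f0
  proof -
    have "pderiv4 j (Var4 i - 1 :: 'a poly4) = (if j = i then 1 else 0)"
    proof -
      have "Const4 (- 1) = (- 1 :: 'a poly4)" using Const4_uminus[of "1 :: 'a"] by simp
      then have "pderiv4 j (- 1 :: 'a poly4) = 0" using pderiv4_Const4[of j "- 1 :: 'a"] by simp
      then show ?thesis using pderiv4_add[of j "Var4 i" "- 1 :: 'a poly4"] by (simp add: pderiv4_Var4)
    qed
    then show ?thesis
      by (simp add: pderiv4_mult rhom_simps[OF k] peval_Var4[OF rhom_to_ac] nvec_self[OF i])
  qed
  have eul: "(\<Sum>j\<in>UNIV. ?w j * ?D j G) = 0" if "?k G = 0" "is_form d G" for d G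
    using arg_cong[OF euler[OF that(2)], of ?k] that(1)
    by (simp add: rhom_simps[OF k] peval_Var4[OF rhom_to_ac])
  \<comment> \<open>A relation \<open>x, y\<close> between the coefficient rows leaves only the
    \<open>i\<close>-th coordinate of the combined gradient. Euler's identity and
    \<open>nvec P i i = 1\<close> kill that coordinate too, against the independence of the
    gradients.\<close>
  have "\<exists>b<3. \<exists>c<3. ?k (h b) * ?k (l c) - ?k (h c) * ?k (l b) \<noteq> 0"
  proof (rule exists_nonzero_minor)
    fix x y assume xy: "\<And>b. b < 3 \<Longrightarrow> x * ?k (h b) + y * ?k (l b) = 0"
    have D: "x * ?D j F1 + y * ?D j F2 = (if j = i then x * ?k h0 + y * ?k l0 else 0)" for j
    proof -
      have "x * ?D j F1 + y * ?D j F2 = (if j = i then x * ?k h0 + y * ?k l0 else 0)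
          + (\<Sum>b<3. (x * ?k (h b) + y * ?k (l b)) * ?D j (g b))"
        unfolding h l pderiv4_add rhom_add[OF k] Dsum Dz
        by (simp add: algebra_simps sum.distrib sum_distrib_left)
      then show ?thesis by (simp add: xy)
    qed
    have "0 = x * (\<Sum>j\<in>UNIV. ?w j * ?D j F1) + y * (\<Sum>j\<in>UNIV. ?w j * ?D j F2)"
      using eul[OF kF(1) F(3)] eul[OF kF(2) F(4)] by simp
    also have "\<dots> = (\<Sum>j\<in>UNIV. ?w j * (x * ?D j F1 + y * ?D j F2))"
      by (simp add: sum_distrib_left sum.distrib algebra_simps)
    also have "\<dots> = (\<Sum>j\<in>UNIV. if j = i then x * ?k h0 + y * ?k l0 else 0)"
      using nvec_self[OF i] by (intro sum.cong) (auto simp: D)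
    finally have "x * ?k h0 + y * ?k l0 = 0" by simp
    then show "x = 0 \<and> y = 0" using D by (intro ind') simp
  qed
  then obtain b c where bc: "b < 3" "c < 3" "?k (h b * l c - h c * l b) \<noteq> 0" by (auto simp: rhom_simps[OF k])
  then have "b \<noteq> c" by (auto simp: rhom_simps[OF k])
  then have "card ({..<3} - {b, c}) = 1" using bc by (subst card_Diff_subset) auto
  then obtain e where "{..<3} - {b, c} = {e}" by (rule card_1_singletonE)
  then have e: "{..<3} = {b, c, e}" "e \<noteq> b" "e \<noteq> c" using bc by auto
  have s3: "(\<Sum>b<3. f b * g b) = f b * g b + f c * g c + f e * g e" for f :: "nat \<Rightarrow> 'a poly4"
    using e \<open>b \<noteq> c\<close> by simp
  define r1 where "r1 = F1 - h0 * (Var4 i - 1)"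
  define r2 where "r2 = F2 - l0 * (Var4 i - 1)"
  have r1J: "r1 \<in> J i" "r2 \<in> J i" unfolding r1_def r2_def by (intro J_diff J_I F J_dvd dvd_triv_right)+
  have r1: "r1 = h b * g b + h c * g c + h e * g e" unfolding r1_def using h s3 by simp
  have r2: "r2 = l b * g b + l c * g c + l e * g e" unfolding r2_def using l s3 by simp
  show thesis
  proof (rule that[of "g e"])
    show "?k (g e) = 0" using g e by blast
    fix G assume "?k G = 0"
    then obtain f0 f where f: "G = f0 * (Var4 i - 1) + (\<Sum>b<3. f b * g b)" using gen by blast
    let ?H = "h b * l c - h c * l b"
    \<comment> \<open>\<open>l c * r1 - h c * r2\<close> and \<open>h b * r2 - l b * r1\<close> are
      \<open>?H * g b\<close> and \<open>?H * g c\<close> up to multiples of \<open>g e\<close>;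
      those multiples are collected here.\<close>
    let ?G = "?H * f e - f b * (l c * h e - h c * l e) - f c * (h b * l e - l b * h e)"
    have "?H * G - ?G * g e = f b * (l c * r1 - h c * r2) + f c * (h b * r2 - l b * r1) + ?H * f0 * (Var4 i - 1)"
      unfolding f s3 r1 r2 by (simp add: algebra_simps)
    moreover have "\<dots> \<in> J i"
      by (intro J_add J_mult J_diff r1J J_dvd dvd_triv_right)
    ultimately show "\<exists>H G'. ?k H \<noteq> 0 \<and> H * G - G' * g e \<in> J i" using bc(3) by metis
  qed
qed

end

section \<open>The Hilbert function\<close>

definition indep_mod :: "'a::field poly4 set \<Rightarrow> ('b \<Rightarrow> 'a poly4) \<Rightarrow> 'b set \<Rightarrow> bool" where
  "indep_mod I f A \<longleftrightarrow> (\<forall>c. (\<Sum>x\<in>A. Const4 (c x) * f x) \<in> I \<longrightarrow> (\<forall>x\<in>A. c x = 0))"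

lemma indep_modD: "indep_mod I f A \<Longrightarrow> (\<Sum>x\<in>A. Const4 (c x) * f x) \<in> I \<Longrightarrow> x \<in> A \<Longrightarrow> c x = 0"
  by (auto simp: indep_mod_def)

definition forms :: "nat \<Rightarrow> 'a::field poly4 set" where
  "forms n = {F. is_form n F}"

lemma finite_exponents: "finite {m :: 4 \<Rightarrow>\<^sub>0 nat. mdegree m = n}"
proof -
  have "finite (UNIV \<rightarrow>\<^sub>E {..n} :: (4 \<Rightarrow> nat) set)" by (rule finite_PiE) simp_all
  moreover have "Poly_Mapping.lookup ` {m :: 4 \<Rightarrow>\<^sub>0 nat. mdegree m = n} \<subseteq> (UNIV \<rightarrow>\<^sub>E {..n})"
  proof (rule image_subsetI, rule PiE_I)
    fix m :: "4 \<Rightarrow>\<^sub>0 nat" and i assume "m \<in> {m. mdegree m = n}"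
    then have m: "(\<Sum>i\<in>UNIV. Poly_Mapping.lookup m i) = n" by (simp only: mem_Collect_eq mdegree_def)
    have "Poly_Mapping.lookup m i \<le> (\<Sum>i\<in>UNIV. Poly_Mapping.lookup m i)" by (rule member_le_sum) simp_all
    then show "Poly_Mapping.lookup m i \<in> {..n}" unfolding m by (simp only: atMost_iff)
  qed simp
  ultimately have "finite (Poly_Mapping.lookup ` {m :: 4 \<Rightarrow>\<^sub>0 nat. mdegree m = n})"
    by (rule finite_subset[rotated])
  then show ?thesis by (rule finite_imageD) (simp add: inj_on_def lookup_inject)
qed

lemma forms_span:
  "forms n \<subseteq> poly4_vs.span ((\<lambda>m. Poly_Mapping.single m (1::'a::field)) ` {m. mdegree m = n})"
proof
  fix F :: "'a poly4" assume F: "F \<in> forms n"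
  have "(\<Sum>m\<in>Poly_Mapping.keys F. Poly_Mapping.single m (Poly_Mapping.lookup F m))
      \<in> poly4_vs.span ((\<lambda>m. Poly_Mapping.single m 1) ` {m. mdegree m = n})"
  proof (rule poly4_vs.span_sum)
    fix m assume "m \<in> Poly_Mapping.keys F"
    then have "mdegree m = n" using F by (auto simp: forms_def is_form_def)
    moreover have "Poly_Mapping.single m (Poly_Mapping.lookup F m)
        = scale4 (Poly_Mapping.lookup F m) (Poly_Mapping.single m 1)"
      by (simp add: scale4_def Const4_def mult_single)
    ultimately show "Poly_Mapping.single m (Poly_Mapping.lookup F m)
        \<in> poly4_vs.span ((\<lambda>m. Poly_Mapping.single m 1) ` {m. mdegree m = n})"
      by (auto intro!: poly4_vs.span_scale[OF poly4_vs.span_base])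
  qed
  then show "F \<in> poly4_vs.span ((\<lambda>m. Poly_Mapping.single m 1) ` {m. mdegree m = n})"
    using poly4_expand[of F] by simp
qed

lemma indep_forms_finite:
  "poly4_vs.independent (B :: 'a::field poly4 set) \<Longrightarrow> B \<subseteq> forms n \<Longrightarrow> finite B"
  using poly4_vs.independent_span_bound[of "(\<lambda>m. Poly_Mapping.single m (1::'a)) ` {m. mdegree m = n}" B]
    forms_span[of n] finite_exponents[of n] by blast

lemma scale_sum_eq_0:
  assumes "poly4_vs.independent B" "finite B" "(\<Sum>x\<in>B. scale4 (u x) x) = (0 :: 'a::field poly4)" "x \<in> B"
  shows "u x = 0"
  using assms poly4_vs.dependent_finite[OF assms(2)] by blast

context smooth_curve
begin

definition I_forms :: "nat \<Rightarrow> 'a poly4 set" where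
  "I_forms n = {F \<in> I. is_form n F}"

lemma subspace_I_forms: "poly4_vs.subspace (I_forms n)"
  by (rule poly4_vs.subspaceI)
    (auto simp: I_forms_def I_0 I_add is_form_add scale4_def I_mult is_form_Const4_mult)

lemma basis_I_forms:
  obtains B where "B \<subseteq> I_forms n" "poly4_vs.independent B" "finite B" "poly4_vs.span B = I_forms n"
    "card B = poly4_vs.dim (I_forms n)"
proof -
  obtain B where B: "B \<subseteq> I_forms n" "poly4_vs.independent B" "I_forms n \<subseteq> poly4_vs.span B"
    "card B = poly4_vs.dim (I_forms n)" by (rule poly4_vs.basis_exists)
  have "finite B" using B(1) by (intro indep_forms_finite[OF B(2), of n]) (auto simp: I_forms_def forms_def)
  moreover have "poly4_vs.span B = I_forms n"
    using B(1,3) poly4_vs.span_minimal[OF B(1) subspace_I_forms] by blast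
  ultimately show thesis using B that by blast
qed

lemma hilbert_eq: "hilbert_function I n = poly4_vs.dim (forms n :: 'a poly4 set) - poly4_vs.dim (I_forms n)"
  by (simp add: hilbert_function_def forms_def I_forms_def)

text \<open>Together with a basis of the degree \<open>n\<close> part of \<open>I\<close>, the
  family is linearly independent among all forms of degree \<open>n\<close>.\<close>

lemma card_le_hilbert_function:
  assumes "finite A" "\<And>x. x \<in> A \<Longrightarrow> is_form n (f x)" and ind: "indep_mod I f A"
  shows "card A \<le> hilbert_function I n"
proof -
  obtain B where B: "B \<subseteq> I_forms n" "poly4_vs.independent B" "finite B" "card B = poly4_vs.dim (I_forms n)"
    by (rule basis_I_forms)
  have inj: "inj_on f A"
  proof (rule inj_onI, rule ccontr)
    fix x y assume xy: "x \<in> A" "y \<in> A" "f x = f y" "x \<noteq> y"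
    define c where "c v = (if v = x then 1 else if v = y then - 1 else 0 :: 'a)" for v
    have "(\<Sum>v\<in>A. Const4 (c v) * f v) = (\<Sum>v\<in>{x, y}. Const4 (c v) * f v)"
      using xy assms(1) by (intro sum.mono_neutral_right) (auto simp: c_def)
    also have "\<dots> = 0" using xy by (simp add: c_def Const4_uminus)
    finally show False using indep_modD[OF ind, of c x] I_0 xy by (simp add: c_def)
  qed
  have disj: "f ` A \<inter> B = {}"
  proof (rule ccontr)
    assume "f ` A \<inter> B \<noteq> {}"
    then obtain x where x: "x \<in> A" "f x \<in> I" using B(1) by (auto simp: I_forms_def)
    have "(\<Sum>v\<in>A. Const4 (if v = x then 1 else 0) * f v) = (\<Sum>v\<in>A. if v = x then f x else 0)"
      by (intro sum.cong) auto
    then show False using indep_modD[OF ind, of "\<lambda>v. if v = x then 1 else 0" x] x assms(1) by simp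
  qed
  have fin: "finite (f ` A \<union> B)" using assms(1) B(3) by simp
  have "poly4_vs.independent (f ` A \<union> B)"
  proof
    assume "poly4_vs.dependent (f ` A \<union> B)"
    then obtain u where u: "\<exists>v\<in>f ` A \<union> B. u v \<noteq> 0" "(\<Sum>v\<in>f ` A \<union> B. scale4 (u v) v) = 0"
      using poly4_vs.dependent_finite[OF fin] by blast
    have s: "(\<Sum>x\<in>A. Const4 (u (f x)) * f x) + (\<Sum>v\<in>B. scale4 (u v) v) = 0"
      using u(2) disj assms(1) B(3) inj by (simp add: sum.union_disjoint sum.reindex scale4_def)
    have "(\<Sum>v\<in>B. scale4 (u v) v) \<in> I"
      using B(1) by (intro I_sum) (auto simp: scale4_def I_forms_def I_mult)
    then have "(\<Sum>x\<in>A. Const4 (u (f x)) * f x) \<in> I"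
      unfolding eq_neg_iff_add_eq_0[THEN iffD2, OF s] by (rule I_uminus)
    then have uA: "u (f x) = 0" if "x \<in> A" for x using indep_modD[OF ind, of "\<lambda>x. u (f x)"] that by blast
    then have "(\<Sum>v\<in>B. scale4 (u v) v) = 0" using s by simp
    then have "u v = 0" if "v \<in> B" for v using scale_sum_eq_0[OF B(2,3)] that by blast
    then show False using uA u(1) by blast
  qed
  moreover have "f ` A \<union> B \<subseteq> forms n" using assms(2) B(1) by (auto simp: forms_def I_forms_def)
  moreover obtain T :: "'a poly4 set" where T: "T \<subseteq> forms n" "poly4_vs.independent T" "forms n \<subseteq> poly4_vs.span T"
    "card T = poly4_vs.dim (forms n :: 'a poly4 set)" by (rule poly4_vs.basis_exists[of "forms n"])
  ultimately have "card (f ` A \<union> B) \<le> card T"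
    using poly4_vs.independent_span_bound[OF indep_forms_finite[OF T(2,1)], of "f ` A \<union> B"] by blast
  moreover have "card (f ` A \<union> B) = card A + card B"
    using disj assms(1) B(3) inj by (simp add: card_Un_disjoint card_image)
  ultimately show ?thesis using T(4) B(4) by (simp add: hilbert_eq)
qed

text \<open>A basis of the degree \<open>n\<close> part of \<open>I\<close> is extended to one of
  all forms of degree \<open>n\<close>; the added elements are the family.\<close>

lemma hilbert_function_family:
  obtains A where "finite A" "card A = hilbert_function I n" "\<And>F. F \<in> A \<Longrightarrow> is_form n F" "indep_mod I (\<lambda>F. F) A"
proof -
  obtain B where B: "B \<subseteq> I_forms n" "poly4_vs.independent B" "finite B" "poly4_vs.span B = I_forms n"
    "card B = poly4_vs.dim (I_forms n)" by (rule basis_I_forms)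
  have "B \<subseteq> forms n" using B(1) by (auto simp: I_forms_def forms_def)
  then obtain T where T: "B \<subseteq> T" "T \<subseteq> forms n" "poly4_vs.independent T" "forms n \<subseteq> poly4_vs.span T"
    using poly4_vs.maximal_independent_subset_extend[OF _ B(2)] by blast
  have fT: "finite T" by (rule indep_forms_finite[OF T(3,2)])
  have "card T = poly4_vs.dim (forms n :: 'a poly4 set)"
    using poly4_vs.dim_unique[OF T(2,4,3) refl] by simp
  then have c: "card (T - B) = hilbert_function I n"
    using B(3,5) T(1) by (simp add: card_Diff_subset hilbert_eq)
  have "indep_mod I (\<lambda>F. F) (T - B)"
    unfolding indep_mod_def
  proof (intro allI impI ballI)
    fix c x assume e: "(\<Sum>x\<in>T - B. Const4 (c x) * x) \<in> I" and x: "x \<in> T - B"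
    have "is_form n (\<Sum>x\<in>T - B. Const4 (c x) * x)"
      using T(2) by (intro is_form_sum is_form_Const4_mult) (auto simp: forms_def)
    then have "(\<Sum>x\<in>T - B. Const4 (c x) * x) \<in> poly4_vs.span B" using e by (simp add: B(4) I_forms_def)
    then obtain d where d: "(\<Sum>x\<in>T - B. Const4 (c x) * x) = (\<Sum>x\<in>B. scale4 (d x) x)"
      using poly4_vs.span_finite[OF B(3)] by auto
    define u where "u x = (if x \<in> B then - d x else c x)" for x
    have "(\<Sum>x\<in>T. scale4 (u x) x) = (\<Sum>x\<in>T - B. scale4 (u x) x) + (\<Sum>x\<in>B. scale4 (u x) x)"
      using fT T(1) by (rule sum.subset_diff[rotated])
    also have "(\<Sum>x\<in>T - B. scale4 (u x) x) = (\<Sum>x\<in>T - B. Const4 (c x) * x)"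
      by (intro sum.cong) (auto simp: u_def scale4_def)
    also have "(\<Sum>x\<in>B. scale4 (u x) x) = - (\<Sum>x\<in>B. scale4 (d x) x)"
      unfolding sum_negf[symmetric] by (intro sum.cong) (auto simp: u_def scale4_def Const4_uminus)
    finally have "(\<Sum>x\<in>T. scale4 (u x) x) = 0" using d by simp
    then have "u x = 0" using scale_sum_eq_0[OF T(3) fT] x by blast
    then show "c x = 0" using x by (simp add: u_def)
  qed
  then show thesis using that[of "T - B"] fT c T(2) by (auto simp: forms_def)
qed

text \<open>Degree 1 and genus 1 leave only the linear term of the Hilbert polynomial. Its
  coefficient is a difference of consecutive values, hence an integer, and it is positive because
  the values are not negative.\<close>

lemma hilbert_function_linear:
  obtains d n0 where "d > 0" "\<And>n. n \<ge> n0 \<Longrightarrow> hilbert_function I n = d * n"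
proof -
  obtain p where p: "is_hilbert_polynomial I p" "Polynomial.degree p = 1" "1 - poly p 0 = of_nat 1"
    using genus_I by (auto simp: is_curve_of_genus_def)
  obtain a c where ac: "p = [:a, c:]"
  proof (rule that[of "coeff p 0" "coeff p 1"], rule poly_eqI)
    show "coeff p n = coeff [:coeff p 0, coeff p 1:] n" for n
      using coeff_eq_0[of p n] p(2) by (auto simp: coeff_pCons split: nat.split)
  qed
  then have a: "a = 0" "c \<noteq> 0" using p(2,3) by auto
  obtain n0 where n0: "\<And>n. n \<ge> n0 \<Longrightarrow> of_nat (hilbert_function I n) = of_nat n * c"
    using p(1) ac a by (auto simp: is_hilbert_polynomial_def eventually_sequentially)
  have cpos: "c > 0" using n0[of "Suc n0"] a(2)
    by (metis le_SucI of_nat_0_le_iff of_nat_0_less_iff order_refl zero_le_mult_iff zero_less_Suc not_less_iff_gr_or_eq not_le)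
  define z where "z = int (hilbert_function I (Suc n0)) - int (hilbert_function I n0)"
  have "of_int z = c" using n0[of "Suc n0"] n0[of n0] by (simp add: z_def algebra_simps)
  then have z: "c = of_nat (nat z)" using cpos by (metis of_int_0_less_iff of_nat_nat order_less_imp_le)
  show thesis
  proof (rule that[of "nat z" n0])
    show "nat z > 0" using cpos z by simp
    fix n assume "n0 \<le> n"
    then have "(of_nat (hilbert_function I n) :: rat) = of_nat (nat z * n)" using n0[of n] z by simp
    then show "hilbert_function I n = nat z * n" by (simp only: of_nat_eq_iff)
  qed
qed

end

section \<open>The order of vanishing at a point\<close>

locale pointed_curve = smooth_curve +
  fixes p0 :: "'a pspace3"
  assumes p0: "p0 \<in> rational_points I"
begin

definition "O_pt = to_ac_point p0"

lemma O_geom: "O_pt \<in> geom_points I"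
  using p0 by (simp add: O_pt_def rational_points_def)

lemma coords_to_ac_point:
  fixes Q :: "'a pspace3"
  obtains c where "c \<noteq> 0" "\<And>j. coords (to_ac_point Q) $ j = c * to_ac (coords Q $ j)"
proof -
  have "(\<chi> i. to_ac (coords Q $ i)) \<noteq> 0" using coords_nonzero[of Q] by (simp add: vec_eq_iff)
  from coords_proj_point[OF this] show thesis using that by (auto simp: to_ac_point_def)
qed

lemma coords_to_ac_point_eq_0: "coords (to_ac_point Q) $ j = 0 \<longleftrightarrow> coords (Q :: 'a pspace3) $ j = 0"
proof -
  obtain c where "c \<noteq> 0" "coords (to_ac_point Q) $ j = c * to_ac (coords Q $ j)"
    using coords_to_ac_point[of Q] by metis
  then show ?thesis by simp
qed

lemma nvec_to_ac_point: "nvec (to_ac_point Q) i = (\<lambda>j. to_ac (nvec (Q :: 'a pspace3) i j))"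
proof -
  obtain c where "c \<noteq> 0" "\<And>j. coords (to_ac_point Q) $ j = c * to_ac (coords Q $ j)"
    using coords_to_ac_point[of Q] by metis
  then show ?thesis by (simp add: nvec_def)
qed

lemma rhom_id: "rhom (\<lambda>x. x)"
  by (simp add: rhom_def)

lemma peval_nvec_to_ac_point:
  "peval to_ac (nvec (to_ac_point Q) i) F = to_ac (peval (\<lambda>x. x) (nvec (Q :: 'a pspace3) i) F)"
  unfolding nvec_to_ac_point by (subst peval_comp[OF rhom_id rhom_to_ac]) simp

lemma rational_form:
  fixes Q :: "'a pspace3"
  assumes "Q \<in> rational_points I" "F \<in> I" "is_form d F"
  shows "peval (\<lambda>x. x) (\<lambda>j. coords Q $ j) F = 0"
proof -
  obtain c where c: "c \<noteq> 0" "\<And>j. coords (to_ac_point Q) $ j = c * to_ac (coords Q $ j)"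
    by (rule coords_to_ac_point[of Q]) blast
  have "0 = eval4 F (coords (to_ac_point Q))"
    using assms(1,2) by (auto simp: rational_points_def geom_points_def vanishes_at_def)
  also have "\<dots> = c ^ d * peval to_ac (\<lambda>j. to_ac (coords Q $ j)) F"
    unfolding eval4_eq c(2) by (rule peval_scale_form[OF assms(3)])
  also have "\<dots> = c ^ d * to_ac (peval (\<lambda>x. x) (\<lambda>j. coords Q $ j) F)"
    by (subst peval_comp[OF rhom_id rhom_to_ac]) simp
  finally show ?thesis using c(1) by simp
qed

text \<open>If the maximal ideal at \<open>P\<close> were zero, then the minimal polynomials of the coordinates of \<open>P\<close>
  would give elements of \<open>I\<close>, which vanish at the rational point \<open>p0\<close>; so \<open>P\<close> would be
  rational and all Hilbert functions at most one.\<close>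

lemma max_ideal_nonzero:
  assumes P: "P \<in> geom_points I" and i: "coords P $ i \<noteq> 0"
  shows "\<exists>F. peval to_ac (nvec P i) F = 0 \<and> F \<notin> J i"
proof (rule ccontr)
  assume "\<not> ?thesis"
  then have KJ: "F \<in> J i" if "peval to_ac (nvec P i) F = 0" for F using that by blast
  let ?w = "nvec P i" let ?k = "peval to_ac ?w"
  note k = rhom_peval[OF rhom_to_ac, of ?w]
  note z = Var4_notin_I[OF P i]
  define y where "y j = coords p0 $ j" for j
  \<comment> \<open>The form \<open>f\<close> is the minimal polynomial of the \<open>j\<close>-th
    affine coordinate, homogenised with \<open>X_i\<close>. It vanishes at \<open>P\<close>, so it
    lies in \<open>I\<close> and must vanish at the rational point \<open>y\<close> as well.\<close>
  have mp: "\<exists>p. lead_coeff p = 1 \<and> hx to_ac (?w j) p = 0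
      \<and> (\<forall>q. lead_coeff q = 1 \<longrightarrow> hx to_ac (?w j) q = 0 \<longrightarrow> Polynomial.degree p \<le> Polynomial.degree q)
      \<and> (\<Sum>m\<le>Polynomial.degree p. coeff p m * y j ^ m * y i ^ (Polynomial.degree p - m)) = 0" for j
  proof -
    obtain p :: "'a poly" where p: "lead_coeff p = 1" "hx to_ac (?w j) p = 0"
      "\<And>q. lead_coeff q = 1 \<Longrightarrow> hx to_ac (?w j) q = 0 \<Longrightarrow> Polynomial.degree p \<le> Polynomial.degree q"
      by (rule alg_closure_monic[of "?w j"]) blast
    let ?n = "Polynomial.degree p"
    define f :: "'a poly4" where "f = (\<Sum>m\<le>?n. Const4 (coeff p m) * (Var4 j ^ m * Var4 i ^ (?n - m)))"
    have ff: "is_form ?n f" unfolding f_def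
      by (intro is_form_sum is_form_Const4_mult is_form_mult[OF is_form_Var4_power is_form_Var4_power]) simp
    have "p = (\<Sum>m\<le>?n. monom (coeff p m) m)" by (simp add: poly_as_sum_of_monoms)
    then have "hx to_ac (?w j) p = hx to_ac (?w j) (\<Sum>m\<le>?n. monom (coeff p m) m)" by simp
    also have "\<dots> = (\<Sum>m\<le>?n. to_ac (coeff p m) * ?w j ^ m)"
      unfolding rhom_sum[OF rhom_hx[OF rhom_to_ac]] by (intro sum.cong refl hx_monom rhom_to_ac)
    finally have "hx to_ac (?w j) p = (\<Sum>m\<le>?n. to_ac (coeff p m) * ?w j ^ m)" .
    then have "?k f = 0"
      using p(2) by (simp add: f_def rhom_simps[OF k] peval_Const4[OF rhom_to_ac] peval_Var4[OF rhom_to_ac] nvec_self[OF i])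
    then have "f \<in> I" using KJ J_form[OF z ff] by blast
    from rational_form[OF p0 this ff] have "(\<Sum>m\<le>?n. coeff p m * y j ^ m * y i ^ (?n - m)) = 0"
      by (simp add: f_def rhom_simps[OF rhom_peval[OF rhom_id]] peval_Const4[OF rhom_id] peval_Var4[OF rhom_id] y_def mult.assoc)
    then show ?thesis using p by blast
  qed
  \<comment> \<open>With \<open>y i = 0\<close> only the leading term of each homogenised minimal
    polynomial survives, so every coordinate of \<open>p0\<close> would vanish.\<close>
  have yi: "y i \<noteq> 0"
  proof
    assume yi: "y i = 0"
    have "y j = 0" for j
    proof -
      obtain p where p: "lead_coeff p = (1::'a)" "(\<Sum>m\<le>Polynomial.degree p. coeff p m * y j ^ m * y i ^ (Polynomial.degree p - m)) = 0"
        using mp by blast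
      have "(\<Sum>m\<le>Polynomial.degree p. coeff p m * y j ^ m * y i ^ (Polynomial.degree p - m))
          = (\<Sum>m\<le>Polynomial.degree p. if m = Polynomial.degree p then y j ^ m else 0)"
        using yi p(1) by (intro sum.cong) (auto simp: power_0_left)
      then show ?thesis using p(2) by simp
    qed
    then show False using coords_nonzero[of p0] by (simp add: vec_eq_iff y_def)
  qed
  \<comment> \<open>The minimal polynomial has the root \<open>y j / y i\<close> in the ground
    field. The cofactor has smaller degree and cannot vanish at \<open>?w j\<close>, so the linear
    factor does.\<close>
  have w: "?w j = to_ac (y j / y i)" for j
  proof -
    obtain p where p: "lead_coeff p = (1::'a)" "hx to_ac (?w j) p = 0"
      "\<And>q. lead_coeff q = 1 \<Longrightarrow> hx to_ac (?w j) q = 0 \<Longrightarrow> Polynomial.degree p \<le> Polynomial.degree q"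
      "(\<Sum>m\<le>Polynomial.degree p. coeff p m * y j ^ m * y i ^ (Polynomial.degree p - m)) = 0"
      using mp[of j] by blast
    let ?n = "Polynomial.degree p"
    have "poly p (y j / y i) * y i ^ ?n = (\<Sum>m\<le>?n. coeff p m * y j ^ m * y i ^ (?n - m))"
      unfolding poly_altdef sum_distrib_right using yi
      by (intro sum.cong refl) (simp add: power_divide power_diff)
    then have "poly p (y j / y i) = 0" using p(4) yi by simp
    then obtain q where q: "p = [:- (y j / y i), 1:] * q" by (auto simp: poly_eq_0_iff_dvd dvd_def)
    have "lead_coeff p = lead_coeff [:- (y j / y i), 1:] * lead_coeff q" unfolding q by (rule lead_coeff_mult)
    also have "\<dots> = lead_coeff q" by simp
    finally have lq: "lead_coeff q = 1" using p(1) by simp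
    then have "Polynomial.degree p = Suc (Polynomial.degree q)"
      unfolding q by (subst degree_mult_eq) auto
    then have "hx to_ac (?w j) q \<noteq> 0" using p(3)[OF lq] by auto
    moreover have "(?w j - to_ac (y j / y i)) * hx to_ac (?w j) q = 0"
    proof -
      have "hx to_ac (?w j) p = hx to_ac (?w j) [:- (y j / y i), 1:] * hx to_ac (?w j) q"
        unfolding q by (rule rhom_mult[OF rhom_hx[OF rhom_to_ac]])
      then show ?thesis using p(2) by (simp add: hx_pCons[OF rhom_to_ac] hx_0)
    qed
    ultimately show ?thesis by simp
  qed
  have kr: "\<exists>a. ?k F = to_ac a" for F
  proof -
    have "?w = (\<lambda>j. to_ac (y j / y i))" using w by (rule ext)
    from arg_cong[OF this, of "\<lambda>v. peval to_ac v F"] show ?thesis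
      using peval_comp[OF rhom_id rhom_to_ac, of "\<lambda>j. y j / y i" F] by metis
  qed
  \<comment> \<open>All values at \<open>P\<close> now lie in the ground field, so some nontrivial
    combination of two forms of equal degree vanishes at \<open>P\<close> and lies in
    \<open>I\<close>; but the Hilbert function is at least 2 in degree
    \<open>n0 + 2\<close>.\<close>
  obtain d n0 where d: "d > 0" "\<And>n. n \<ge> n0 \<Longrightarrow> hilbert_function I n = d * n" by (rule hilbert_function_linear) blast
  obtain A where A: "finite A" "card A = hilbert_function I (n0 + 2)" "\<And>F. F \<in> A \<Longrightarrow> is_form (n0 + 2) F" "indep_mod I (\<lambda>F. F) A"
    by (rule hilbert_function_family) blast
  have "1 * (n0 + 2) \<le> d * (n0 + 2)" using d(1) by (intro mult_le_mono1) simp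
  then have "2 \<le> card A" using A(2) d(2)[of "n0 + 2"] by simp
  then obtain F G where FG: "F \<in> A" "G \<in> A" "F \<noteq> G"
    by (metis A(1) card_le_Suc0_iff_eq not_numeral_le_zero numeral_2_eq_2 Suc_le_eq not_less)
  obtain a b where ab: "?k F = to_ac a" "?k G = to_ac b" using kr by blast
  have lin: "x = 0 \<and> y = 0" if "Const4 x * F + Const4 y * G \<in> I" for x y
  proof -
    define c where "c v = (if v = F then x else if v = G then y else 0)" for v
    have "(\<Sum>v\<in>A. Const4 (c v) * v) = (\<Sum>v\<in>{F, G}. Const4 (c v) * v)"
      using FG A(1) by (intro sum.mono_neutral_right) (auto simp: c_def)
    then have "(\<Sum>v\<in>A. Const4 (c v) * v) \<in> I" using that FG(3) by (simp add: c_def)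
    then show ?thesis using indep_modD[OF A(4), of c F] indep_modD[OF A(4), of c G] FG by (simp add: c_def)
  qed
  have inI: "Const4 x * F + Const4 y * G \<in> I" if "?k (Const4 x * F + Const4 y * G) = 0" for x y
    using KJ[OF that] J_form[OF z, of "n0 + 2"] A(3) FG by (simp add: is_form_add is_form_Const4_mult)
  have "?k (Const4 b * F + Const4 (- a) * G) = 0"
    using ab by (simp add: rhom_simps[OF k] peval_Const4[OF rhom_to_ac])
  then have "a = 0" using lin inI by fastforce
  then have "?k (Const4 1 * F + Const4 0 * G) = 0" using ab by simp
  then show False using lin inI by fastforce
qed

end

context smooth_curve
begin

lemma J_Var4_power: "Var4 i ^ n - 1 \<in> J i"
proof (induction n)
  case 0
  show ?case by (simp add: J_I I_0)
next
  case (Suc n)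
  have "Var4 i ^ Suc n - 1 = Var4 i * (Var4 i ^ n - 1) + (Var4 i - 1 :: 'a poly4)" by (simp add: algebra_simps)
  also have "\<dots> \<in> J i" by (rule J_add[OF J_mult[OF Suc, of "Var4 i"] J_dvd[OF dvd_refl]])
  finally show ?case .
qed

lemma J_sum: "(\<And>x. x \<in> A \<Longrightarrow> f x \<in> J i) \<Longrightarrow> sum f A \<in> J i"
  by (induction A rule: infinite_finite_induct) (simp_all add: J_I I_0 J_add)

section \<open>Local parameters and orders of vanishing\<close>

definition pt_val :: "'a alg_closure pspace3 \<Rightarrow> 4 \<Rightarrow> 'a poly4 \<Rightarrow> 'a alg_closure" where
  "pt_val P i = peval to_ac (nvec P i)"

lemma rhom_pt_val: "rhom (pt_val P i)"
  unfolding pt_val_def by (rule rhom_peval[OF rhom_to_ac])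

lemmas pt_val_simps = rhom_simps[OF rhom_pt_val]

lemma pt_val_Const4: "pt_val P i (Const4 c) = to_ac c"
  by (simp add: pt_val_def peval_Const4[OF rhom_to_ac])

lemma pt_val_Var4: "pt_val P i (Var4 j) = nvec P i j"
  by (simp add: pt_val_def peval_Var4[OF rhom_to_ac])

text \<open>A uniformizer in the chart \<open>X_i = 1\<close>. Divisibility in the local ring is
  expressed by a multiplier \<open>H\<close> that does not vanish at \<open>P\<close>, so that no
  localisation has to be formed.\<close>

definition local_param :: "'a alg_closure pspace3 \<Rightarrow> 4 \<Rightarrow> 'a poly4 \<Rightarrow> bool" where
  "local_param P i t \<longleftrightarrow> P \<in> geom_points I \<and> coords P $ i \<noteq> 0 \<and> (\<exists>D. is_form D t) \<and> pt_val P i t = 0 \<and> t \<notin> J i \<and>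
    (\<forall>F. pt_val P i F = 0 \<longrightarrow> (\<exists>H G. pt_val P i H \<noteq> 0 \<and> H * F - G * t \<in> J i))"

lemma J_pt_val: "P \<in> geom_points I \<Longrightarrow> coords P $ i \<noteq> 0 \<Longrightarrow> F \<in> J i \<Longrightarrow> pt_val P i F = 0"
  unfolding pt_val_def by (rule J_nvec)

text \<open>If \<open>F\<close> vanishes to order \<open>N\<close>, then the multiples of \<open>F\<close> and the first \<open>N\<close> powers of \<open>t\<close> are independent
  modulo \<open>I\<close>, while the Hilbert function grows by only \<open>d * e\<close> from degree \<open>n - e\<close> to \<open>n\<close>.\<close>

lemma bounded_order_form:
  assumes t: "local_param P i t" and F: "is_form e F" "F \<notin> I"
  shows "\<exists>N. \<forall>H G. pt_val P i H \<noteq> 0 \<longrightarrow> H * F - G * t ^ N \<notin> J i"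
proof -
  obtain D where P: "P \<in> geom_points I" and i: "coords P $ i \<noteq> 0" and D: "is_form D t"
    and t0: "pt_val P i t = 0" and tJ: "t \<notin> J i" using t by (auto simp: local_param_def)
  note z = Var4_notin_I[OF P i]
  obtain d n0 where d: "d > 0" "\<And>n. n \<ge> n0 \<Longrightarrow> hilbert_function I n = d * n" by (rule hilbert_function_linear) blast
  \<comment> \<open>One more than the growth \<open>d * e\<close> of the Hilbert function between
    the degrees \<open>n - e\<close> and \<open>n\<close>.\<close>
  define N where "N = d * e + 1"
  show ?thesis
  proof (intro exI[of _ N] allI impI notI)
    fix H G assume H: "pt_val P i H \<noteq> 0" and HG: "H * F - G * t ^ N \<in> J i"
    \<comment> \<open>\<open>n\<close> leaves room for \<open>t ^ k\<close> with
      \<open>k < N\<close>, padded by powers of \<open>X_i\<close>, and \<open>n - e\<close> is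
      still in the range where the Hilbert function is linear.\<close>
    define n where "n = N * D + n0 + e"
    obtain A where A: "finite A" "card A = hilbert_function I (N * D + n0)" "\<And>F. F \<in> A \<Longrightarrow> is_form (N * D + n0) F"
      "indep_mod I (\<lambda>F. F) A"
      by (rule hilbert_function_family) blast
    define f where "f = case_sum (\<lambda>B. B * F) (\<lambda>k. t ^ k * Var4 i ^ (n - k * D))"
    have "is_form n (f x)" if "x \<in> A <+> {..<N}" for x
    proof (cases x)
      case (Inl B)
      then show ?thesis using A(3) F that by (auto simp: f_def n_def intro!: is_form_mult)
    next
      case (Inr k)
      then have "k < N" using that by auto
      then have "k * D \<le> N * D" by (intro mult_le_mono1) simp
      then have "k * D \<le> n" unfolding n_def by linarith
      then show ?thesis unfolding Inr f_def sum.case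
        by (intro is_form_mult[OF is_form_power[OF D refl] is_form_Var4_power]) (simp add: mult.commute)
    qed
    moreover have "indep_mod I f (A <+> {..<N})"
      unfolding indep_mod_def
    proof (intro allI impI ballI)
      fix c x assume "(\<Sum>x\<in>A <+> {..<N}. Const4 (c x) * f x) \<in> I" and x: "x \<in> A <+> {..<N}"
      then have s: "(\<Sum>B\<in>A. Const4 (c (Inl B)) * (B * F)) + (\<Sum>k<N. Const4 (c (Inr k)) * (t ^ k * Var4 i ^ (n - k * D))) \<in> I"
        using A(1) by (simp add: sum.Plus f_def)
      define B' where "B' = (\<Sum>B\<in>A. Const4 (c (Inl B)) * B)"
      have B': "(\<Sum>B\<in>A. Const4 (c (Inl B)) * (B * F)) = B' * F"
        by (simp add: B'_def sum_distrib_right mult.assoc)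
      have "(\<Sum>k<N. Const4 (c (Inr k)) * t ^ k * (Var4 i ^ (n - k * D) - 1)) \<in> J i"
        by (intro J_sum J_mult J_Var4_power)
      then have "B' * F + (\<Sum>k<N. Const4 (c (Inr k)) * (t ^ k * Var4 i ^ (n - k * D)))
          - (\<Sum>k<N. Const4 (c (Inr k)) * t ^ k * (Var4 i ^ (n - k * D) - 1)) \<in> J i"
        using J_I[OF s] B' by (intro J_diff) simp_all
      then have S: "B' * F + (\<Sum>k<N. Const4 (c (Inr k)) * t ^ k) \<in> J i"
        by (simp add: algebra_simps sum_subtractf)
      \<comment> \<open>The coefficients vanish one after the other. Multiplication by
        \<open>H\<close> turns \<open>B' * F\<close> into a multiple of \<open>t ^ N\<close>, the
        factor \<open>t ^ k\<close> is cancelled in the prime ideal \<open>J i\<close>, and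
        evaluation at \<open>P\<close> isolates the coefficient of \<open>t ^ k\<close>.\<close>
      have cR: "c (Inr k) = 0" if "k < N" for k
        using that
      proof (induction k rule: less_induct)
        case (less k)
        define R where "R = (\<Sum>l\<in>{Suc k..<N}. Const4 (c (Inr l)) * t ^ (l - Suc k))"
        have "(\<Sum>l<N. Const4 (c (Inr l)) * t ^ l) = (\<Sum>l\<in>{k..<N}. Const4 (c (Inr l)) * t ^ l)"
          using less by (intro sum.mono_neutral_right) auto
        also have "\<dots> = Const4 (c (Inr k)) * t ^ k + (\<Sum>l\<in>{Suc k..<N}. Const4 (c (Inr l)) * t ^ l)"
          using less.prems by (rule sum.atLeast_Suc_lessThan)
        also have "(\<Sum>l\<in>{Suc k..<N}. Const4 (c (Inr l)) * t ^ l) = t ^ Suc k * R"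
          unfolding R_def sum_distrib_left
        proof (rule sum.cong[OF refl])
          fix l assume l: "l \<in> {Suc k..<N}"
          have "t ^ l = t ^ Suc k * t ^ (l - Suc k)" using l by (subst power_add[symmetric]) simp
          then show "Const4 (c (Inr l)) * t ^ l = t ^ Suc k * (Const4 (c (Inr l)) * t ^ (l - Suc k))"
            by (simp add: algebra_simps)
        qed
        finally have sumk: "(\<Sum>l<N. Const4 (c (Inr l)) * t ^ l) = t ^ k * (Const4 (c (Inr k)) + t * R)"
          by (simp add: algebra_simps)
        have tN: "t ^ N = t ^ k * (t * t ^ (N - Suc k))"
          using less.prems by (simp flip: power_add power_Suc)
        have "H * (B' * F + t ^ k * (Const4 (c (Inr k)) + t * R)) - B' * (H * F - G * t ^ N) \<in> J i"
          using S unfolding sumk by (intro J_diff J_mult HG)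
        moreover have "H * (B' * F + t ^ k * (Const4 (c (Inr k)) + t * R)) - B' * (H * F - G * t ^ N)
            = t ^ k * (B' * G * (t * t ^ (N - Suc k)) + H * (Const4 (c (Inr k)) + t * R))"
          unfolding tN by (simp add: algebra_simps)
        ultimately have "t ^ k * (B' * G * (t * t ^ (N - Suc k)) + H * (Const4 (c (Inr k)) + t * R)) \<in> J i" by simp
        moreover have "t ^ k \<notin> J i" for k
          using tJ J_form[OF z, of 0 1] I_1 J_prime[OF z] by (induction k) auto
        ultimately have "B' * G * (t * t ^ (N - Suc k)) + H * (Const4 (c (Inr k)) + t * R) \<in> J i"
          using J_prime[OF z] by blast
        from J_pt_val[OF P i this] have "pt_val P i H * to_ac (c (Inr k)) = 0"
          by (simp add: pt_val_simps t0 pt_val_Const4)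
        then show ?case using H by simp
      qed
      then have "B' * F \<in> I" using s B' by simp
      then have "B' \<in> I" using F(2) I_prime by blast
      then have "c (Inl B) = 0" if "B \<in> A" for B
        using indep_modD[OF A(4), of "\<lambda>B. c (Inl B)"] that by (simp add: B'_def)
      then show "c x = 0" using cR x by auto
    qed
    ultimately have "card (A <+> {..<N}) \<le> hilbert_function I n"
      using A(1) by (intro card_le_hilbert_function) auto
    then have "hilbert_function I (N * D + n0) + N \<le> hilbert_function I n"
      using A(1,2) by (simp add: card_Plus)
    then show False using d(2)[of n] d(2)[of "N * D + n0"] by (simp add: n_def N_def algebra_simps)
  qed
qed

lemma bounded_order:
  assumes t: "local_param P i t" and F: "F \<notin> J i"
  shows "\<exists>N. \<forall>H G. pt_val P i H \<noteq> 0 \<longrightarrow> H * F - G * t ^ N \<notin> J i"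
proof -
  obtain e F' where F': "is_form e F'" "(Var4 i - 1) dvd F' - F" using homogenize by blast
  then have FJ: "F' - F \<in> J i" by (intro J_dvd)
  then have "F' \<notin> I" using F J_I J_cong by blast
  from bounded_order_form[OF t F'(1) this] obtain N where
    N: "\<And>H G. pt_val P i H \<noteq> 0 \<Longrightarrow> H * F' - G * t ^ N \<notin> J i" by blast
  have "H * F - G * t ^ N \<notin> J i" if "pt_val P i H \<noteq> 0" for H G
  proof
    assume "H * F - G * t ^ N \<in> J i"
    from J_add[OF this J_mult[OF FJ, of H]] have "H * F' - G * t ^ N \<in> J i" by (simp add: algebra_simps)
    then show False using N[OF that] by blast
  qed
  then show ?thesis by blast
qed

text \<open>\<open>bounded_order\<close> yields an \<open>n\<close> such that \<open>t ^ n\<close>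
  divides \<open>F\<close> locally but \<open>t ^ Suc n\<close> does not. The cofactor cannot vanish
  at \<open>P\<close>, since it would then contain another factor \<open>t\<close>.\<close>

lemma order_factorization:
  assumes t: "local_param P i t" and F: "F \<notin> J i"
  shows "\<exists>n H U. pt_val P i H \<noteq> 0 \<and> pt_val P i U \<noteq> 0 \<and> H * F - U * t ^ n \<in> J i"
proof -
  define S where "S n \<longleftrightarrow> (\<exists>H G. pt_val P i H \<noteq> 0 \<and> H * F - G * t ^ n \<in> J i)" for n
  have "S 0" unfolding S_def by (intro exI[of _ 1] exI[of _ F]) (simp add: pt_val_simps J_I I_0)
  moreover obtain N where "\<not> S N" using bounded_order[OF t F] unfolding S_def by blast
  ultimately obtain n where n: "S n" "\<not> S (Suc n)" by (metis nat_induct)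
  then obtain H G where HG: "pt_val P i H \<noteq> 0" "H * F - G * t ^ n \<in> J i" unfolding S_def by blast
  have "pt_val P i G \<noteq> 0"
  proof
    assume "pt_val P i G = 0"
    then obtain H' G' where H': "pt_val P i H' \<noteq> 0" "H' * G - G' * t \<in> J i" using t by (auto simp: local_param_def)
    from J_add[OF J_mult[OF HG(2), of H'] J_mult[OF H'(2), of "t ^ n"]]
    have "H' * H * F - G' * t ^ Suc n \<in> J i" by (simp add: algebra_simps)
    moreover have "pt_val P i (H' * H) \<noteq> 0" using HG(1) H'(1) by (simp add: pt_val_simps)
    ultimately have "S (Suc n)" unfolding S_def by blast
    then show False using n(2) by blast
  qed
  then show ?thesis using HG by blast
qed

end

context pointed_curve
begin

text \<open>The generator from \<open>max_ideal_principal\<close> is homogenised, which changes it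
  only within \<open>J i\<close>. If it were in \<open>J i\<close>, the whole kernel of evaluation
  at \<open>P\<close> would be, against \<open>max_ideal_nonzero\<close>.\<close>

lemma ex_local_param:
  assumes P: "P \<in> geom_points I" and i: "coords P $ i \<noteq> 0"
  shows "\<exists>t. local_param P i t"
proof -
  obtain t where t: "pt_val P i t = 0"
    "\<And>F. pt_val P i F = 0 \<Longrightarrow> \<exists>H G. pt_val P i H \<noteq> 0 \<and> H * F - G * t \<in> J i"
    using max_ideal_principal[OF P i, folded pt_val_def] by blast
  obtain D t' where t': "is_form D t'" "(Var4 i - 1) dvd t' - t" using homogenize by blast
  then have tJ: "t' - t \<in> J i" by (intro J_dvd)
  have gen: "\<exists>H G. pt_val P i H \<noteq> 0 \<and> H * F - G * t' \<in> J i" if F0: "pt_val P i F = 0" for F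
  proof -
    obtain H G where HG: "pt_val P i H \<noteq> 0" "H * F - G * t \<in> J i" using t(2)[OF F0] by blast
    from J_diff[OF HG(2) J_mult[OF tJ, of G]] have "H * F - G * t' \<in> J i" by (simp add: algebra_simps)
    then show ?thesis using HG(1) by blast
  qed
  have "t' \<notin> J i"
  proof
    assume tJ': "t' \<in> J i"
    obtain F where F: "pt_val P i F = 0" "F \<notin> J i" using max_ideal_nonzero[OF P i] unfolding pt_val_def by blast
    obtain H G where HG: "pt_val P i H \<noteq> 0" "H * F - G * t' \<in> J i" using gen[OF F(1)] by blast
    from J_add[OF HG(2) J_mult[OF tJ', of G]] have "H * F \<in> J i" by simp
    then show False using J_prime[OF Var4_notin_I[OF P i]] F(2) J_pt_val[OF P i] HG(1) by blast
  qed
  moreover have "pt_val P i t' = 0" using t(1) J_pt_val[OF P i tJ] by (simp add: pt_val_simps)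
  ultimately show ?thesis using gen P i t'(1) unfolding local_param_def by blast
qed

section \<open>Power series expansion at the origin\<close>

definition "i0 = (SOME i. coords p0 $ i \<noteq> 0)"

lemma i0: "coords p0 $ i0 \<noteq> 0"
  unfolding i0_def by (rule someI_ex) (metis coords_nz_index)

lemma O_i0: "coords O_pt $ i0 \<noteq> 0"
  using i0 by (simp add: O_pt_def coords_to_ac_point_eq_0)

definition "val = peval (\<lambda>x. x) (nvec p0 i0)"

lemma rhom_val: "rhom val"
  unfolding val_def by (rule rhom_peval[OF rhom_id])

lemmas val_simps = rhom_simps[OF rhom_val]

lemma pt_val_O: "pt_val O_pt i0 F = to_ac (val F)"
  by (simp add: pt_val_def val_def O_pt_def peval_nvec_to_ac_point)

lemma val_Const4: "val (Const4 c) = c"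
  by (simp add: val_def peval_Const4[OF rhom_id])

definition "t0 = (SOME t. local_param O_pt i0 t)"

lemma t0: "local_param O_pt i0 t0"
  unfolding t0_def by (rule someI_ex) (rule ex_local_param[OF O_geom O_i0])

lemma val_t0: "val t0 = 0"
  using t0 by (simp add: local_param_def pt_val_O)

lemma J0_prime: "F * G \<in> J i0 \<Longrightarrow> F \<in> J i0 \<or> G \<in> J i0"
  by (rule J_prime[OF Var4_notin_I[OF O_geom O_i0]])

lemma t0_power: "t0 ^ n \<notin> J i0"
proof (induction n)
  case 0
  then show ?case using J_form[OF Var4_notin_I[OF O_geom O_i0], of 0 1] I_1 by simp
next
  case (Suc n)
  then show ?case using t0 J0_prime[of t0 "t0 ^ n"] by (auto simp: local_param_def)
qed

lemma J0_val: "F \<in> J i0 \<Longrightarrow> val F = 0"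
  using J_pt_val[OF O_geom O_i0, of F] by (simp add: pt_val_O)

text \<open>The polynomials whose restriction to the chart \<open>X\<^bsub>i0\<^esub> = 1\<close> vanishes to order at least \<open>n\<close> at the origin.\<close>

definition Q :: "nat \<Rightarrow> 'a poly4 set" where
  "Q n = {F. \<exists>H G. val H \<noteq> 0 \<and> H * F - G * t0 ^ n \<in> J i0}"

lemma Q_J: "F \<in> J i0 \<Longrightarrow> F \<in> Q n"
  unfolding Q_def mem_Collect_eq by (rule exI[of _ 1], rule exI[of _ 0]) (simp add: val_simps)

lemma Q_0: "F \<in> Q 0"
  unfolding Q_def mem_Collect_eq by (rule exI[of _ 1], rule exI[of _ F]) (simp add: val_simps J_I I_0)

lemma Q_t0: "n \<le> m \<Longrightarrow> G * t0 ^ m \<in> Q n"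
  unfolding Q_def mem_Collect_eq
  by (rule exI[of _ 1], rule exI[of _ "G * t0 ^ (m - n)"])
    (simp add: val_simps mult.assoc J_I I_0 flip: power_add)

lemma Q_mult: "F \<in> Q n \<Longrightarrow> G * F \<in> Q n"
proof -
  assume "F \<in> Q n"
  then obtain H K where H: "val H \<noteq> 0" "H * F - K * t0 ^ n \<in> J i0" by (auto simp: Q_def)
  from J_mult[OF H(2), of G] have "H * (G * F) - (G * K) * t0 ^ n \<in> J i0" by (simp add: algebra_simps)
  then show ?thesis using H(1) unfolding Q_def by blast
qed

lemma Q_add: "F \<in> Q n \<Longrightarrow> G \<in> Q n \<Longrightarrow> F + G \<in> Q n"
proof -
  assume "F \<in> Q n" "G \<in> Q n"
  then obtain H K H' K' where H: "val H \<noteq> 0" "H * F - K * t0 ^ n \<in> J i0" "val H' \<noteq> 0" "H' * G - K' * t0 ^ n \<in> J i0"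
    by (auto simp: Q_def)
  from J_add[OF J_mult[OF H(2), of H'] J_mult[OF H(4), of H]]
  have "(H * H') * (F + G) - (H' * K + H * K') * t0 ^ n \<in> J i0" by (simp add: algebra_simps)
  moreover have "val (H * H') \<noteq> 0" using H by (simp add: val_simps)
  ultimately show ?thesis unfolding Q_def by blast
qed

lemma Q_diff: "F \<in> Q n \<Longrightarrow> G \<in> Q n \<Longrightarrow> F - G \<in> Q n"
  using Q_add[of F n "- 1 * G"] Q_mult[of G n "- 1"] by simp

lemma Q_sum: "(\<And>x. x \<in> A \<Longrightarrow> f x \<in> Q n) \<Longrightarrow> sum f A \<in> Q n"
  by (induction A rule: infinite_finite_induct) (simp_all add: Q_J J_I I_0 Q_add)

text \<open>The origin is rational, so the value \<open>val G / val H\<close> lies in the ground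
  field and can be subtracted; the remaining cofactor vanishes at the origin and gains a factor
  \<open>t0\<close>.\<close>

lemma Q_step: assumes "F \<in> Q n" shows "\<exists>c. F - Const4 c * t0 ^ n \<in> Q (Suc n)"
proof -
  obtain H G where H: "val H \<noteq> 0" "H * F - G * t0 ^ n \<in> J i0" using assms by (auto simp: Q_def)
  define c where "c = val G / val H"
  have "val (G - Const4 c * H) = 0" using H(1) by (simp add: val_simps val_Const4 c_def)
  then obtain H' G' where H': "val H' \<noteq> 0" "H' * (G - Const4 c * H) - G' * t0 \<in> J i0"
    using t0 by (auto simp: local_param_def pt_val_O)
  from J_add[OF J_mult[OF H(2), of H'] J_mult[OF H'(2), of "t0 ^ n"]]
  have "(H' * H) * (F - Const4 c * t0 ^ n) - G' * t0 ^ Suc n \<in> J i0" by (simp add: algebra_simps)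
  moreover have "val (H' * H) \<noteq> 0" using H H' by (simp add: val_simps)
  ultimately show ?thesis unfolding Q_def by blast
qed

lemma Q_unique: assumes "Const4 c * t0 ^ n \<in> Q (Suc n)" shows "c = 0"
proof -
  obtain H G where H: "val H \<noteq> 0" "H * (Const4 c * t0 ^ n) - G * t0 ^ Suc n \<in> J i0" using assms by (auto simp: Q_def)
  then have "t0 ^ n * (H * Const4 c - G * t0) \<in> J i0" by (simp add: algebra_simps)
  then have "H * Const4 c - G * t0 \<in> J i0" using J0_prime t0_power by blast
  from J0_val[OF this] show ?thesis using H(1) by (simp add: val_simps val_Const4 val_t0)
qed

definition trunc :: "nat \<Rightarrow> 'a fps \<Rightarrow> 'a poly4" where
  "trunc n a = (\<Sum>k<n. Const4 (fps_nth a k) * t0 ^ k)"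

definition expands :: "'a poly4 \<Rightarrow> 'a fps \<Rightarrow> bool" where
  "expands F a \<longleftrightarrow> (\<forall>n. F - trunc n a \<in> Q n)"

lemma ex_expansion: "\<exists>a. expands F a"
proof -
  define c where "c n F = (SOME c. F - Const4 c * t0 ^ n \<in> Q (Suc n))" for n F
  define g where "g = rec_nat F (\<lambda>n G. G - Const4 (c n G) * t0 ^ n)"
  have g0: "g 0 = F" and gS: "g (Suc n) = g n - Const4 (c n (g n)) * t0 ^ n" for n by (simp_all add: g_def)
  have gQ: "g n \<in> Q n" for n
  proof (induction n)
    case (Suc n)
    have "g n - Const4 (c n (g n)) * t0 ^ n \<in> Q (Suc n)" unfolding c_def by (rule someI_ex[OF Q_step[OF Suc]])
    then show ?case by (simp add: gS)
  qed (simp add: Q_0)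
  define a where "a = Abs_fps (\<lambda>n. c n (g n))"
  have "F - trunc n a = g n" for n
    by (induction n) (simp_all add: trunc_def g0 gS a_def algebra_simps)
  then have "expands F a" using gQ by (simp add: expands_def)
  then show ?thesis ..
qed

lemma expands_unique: assumes "expands F a" "expands F b" shows "a = b"
proof (rule fps_ext)
  fix n show "fps_nth a n = fps_nth b n"
  proof (induction n rule: less_induct)
    case (less n)
    have "trunc n a = trunc n b" using less by (simp add: trunc_def)
    moreover have "(F - trunc (Suc n) b) - (F - trunc (Suc n) a) \<in> Q (Suc n)"
      using assms unfolding expands_def by (intro Q_diff[of "F - trunc (Suc n) b"]) blast+
    ultimately have "Const4 (fps_nth a n - fps_nth b n) * t0 ^ n \<in> Q (Suc n)"
      by (simp add: trunc_def Const4_diff algebra_simps)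
    from Q_unique[OF this] show ?case by simp
  qed
qed

lemma expands_add: assumes "expands F a" "expands G b" shows "expands (F + G) (a + b)"
  unfolding expands_def
proof
  fix n
  have "(F + G) - trunc n (a + b) = (F - trunc n a) + (G - trunc n b)"
    by (simp add: trunc_def Const4_add sum.distrib algebra_simps)
  also have "\<dots> \<in> Q n" using assms unfolding expands_def by (intro Q_add) blast+
  finally show "(F + G) - trunc n (a + b) \<in> Q n" .
qed

text \<open>The difference consists of the products with \<open>i + j \<ge> n\<close>, each of which
  contains \<open>t0 ^ n\<close>.\<close>

lemma trunc_mult: "trunc n a * trunc n b - trunc n (a * b) \<in> Q n"
proof -
  define g where "g i j = Const4 (fps_nth a i) * t0 ^ i * (Const4 (fps_nth b j) * t0 ^ j)" for i j
  have "trunc n (a * b) = (\<Sum>k<n. \<Sum>i\<le>k. g i (k - i))"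
    unfolding trunc_def
  proof (rule sum.cong[OF refl])
    fix k
    have "Const4 (fps_nth (a * b) k) * t0 ^ k = (\<Sum>i\<le>k. Const4 (fps_nth a i * fps_nth b (k - i)) * t0 ^ k)"
      by (simp add: fps_mult_nth rhom_sum[OF rhom_Const4] sum_distrib_right atMost_atLeast0)
    also have "\<dots> = (\<Sum>i\<le>k. g i (k - i))"
    proof (rule sum.cong[OF refl])
      fix i assume "i \<in> {..k}"
      then have "t0 ^ k = t0 ^ i * t0 ^ (k - i)" by (simp flip: power_add)
      then show "Const4 (fps_nth a i * fps_nth b (k - i)) * t0 ^ k = g i (k - i)"
        by (simp add: g_def Const4_mult algebra_simps)
    qed
    finally show "Const4 (fps_nth (a * b) k) * t0 ^ k = (\<Sum>i\<le>k. g i (k - i))" .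
  qed
  also have "\<dots> = (\<Sum>(i, j)\<in>{(i, j). i + j < n}. g i j)" by (rule sum.triangle_reindex[symmetric])
  finally have 1: "trunc n (a * b) = (\<Sum>(i, j)\<in>{(i, j). i + j < n}. g i j)" .
  have 2: "trunc n a * trunc n b = (\<Sum>(i, j)\<in>{..<n} \<times> {..<n}. g i j)"
    by (simp add: trunc_def sum_product sum.cartesian_product g_def)
  have sub: "{(i, j). i + j < n} \<subseteq> {..<n} \<times> {..<n}" by auto
  have "trunc n a * trunc n b - trunc n (a * b) = (\<Sum>(i, j)\<in>{..<n} \<times> {..<n} - {(i, j). i + j < n}. g i j)"
    unfolding 1 2 using sub by (subst sum_diff) auto
  also have "\<dots> \<in> Q n"
  proof (rule Q_sum)
    fix x assume "x \<in> {..<n} \<times> {..<n} - {(i, j). i + j < n}"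
    then obtain i j where x: "x = (i, j)" and ij: "\<not> i + j < n" by auto
    have "g i j = (Const4 (fps_nth a i) * Const4 (fps_nth b j)) * t0 ^ (i + j)"
      by (simp add: g_def power_add algebra_simps)
    then show "(case x of (i, j) \<Rightarrow> g i j) \<in> Q n" using Q_t0[of n "i + j"] ij x by simp
  qed
  finally show ?thesis .
qed

lemma expands_mult: assumes "expands F a" "expands G b" shows "expands (F * G) (a * b)"
  unfolding expands_def
proof
  fix n
  have "F * G - trunc n (a * b) = G * (F - trunc n a) + trunc n a * (G - trunc n b) + (trunc n a * trunc n b - trunc n (a * b))"
    by (simp add: algebra_simps)
  also have "\<dots> \<in> Q n" using assms unfolding expands_def by (intro Q_add Q_mult trunc_mult) blast+
  finally show "F * G - trunc n (a * b) \<in> Q n" .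
qed

lemma trunc_const: "n > 0 \<Longrightarrow> trunc n (fps_const c) = Const4 c"
  by (simp add: trunc_def lessThan_Suc_eq_insert_0 sum.delta if_distrib[of Const4] if_distrib[of "\<lambda>x. x * _"] cong: if_cong)

lemma expands_const: "expands (Const4 c) (fps_const c)"
  unfolding expands_def
proof
  fix n show "Const4 c - trunc n (fps_const c) \<in> Q n"
    by (cases n) (simp_all add: Q_0 trunc_const Q_J J_I I_0)
qed

definition ev :: "'a poly4 \<Rightarrow> 'a fps" where
  "ev F = (THE a. expands F a)"

lemma expands_ev: "expands F (ev F)"
  unfolding ev_def using ex_expansion expands_unique by (metis the_equality)

lemma ev_eqI: "expands F a \<Longrightarrow> ev F = a"
  using expands_ev expands_unique by blast

lemma rhom_ev: "rhom ev"
  unfolding rhom_def using ev_eqI[OF expands_add[OF expands_ev expands_ev]]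
    ev_eqI[OF expands_mult[OF expands_ev expands_ev]] ev_eqI[OF expands_const[of 1]] by simp

lemmas ev_simps = rhom_simps[OF rhom_ev]

lemma ev_Const4: "ev (Const4 c) = fps_const c"
  by (rule ev_eqI[OF expands_const])

lemma ev_nth_0: "fps_nth (ev F) 0 = val F"
proof -
  have "F - trunc (Suc 0) (ev F) \<in> Q (Suc 0)" using expands_ev by (simp add: expands_def)
  then obtain H G where H: "val H \<noteq> 0" "H * (F - Const4 (fps_nth (ev F) 0)) - G * t0 \<in> J i0"
    by (auto simp: Q_def trunc_def)
  from J0_val[OF H(2)] show ?thesis using H(1) by (simp add: val_simps val_Const4 val_t0)
qed

lemma ev_t0: "ev t0 = fps_X"
proof (rule ev_eqI, unfold expands_def, rule)
  fix n
  consider "n = 0" | "n = 1" | m where "n = Suc (Suc m)" by (cases n; cases "n - 1") auto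
  then show "t0 - trunc n fps_X \<in> Q n"
  proof cases
    case 2
    then show ?thesis using Q_t0[of 1 1 1] by (simp add: trunc_def)
  next
    case (3 m)
    have "trunc n fps_X = (\<Sum>k<n. if k = 1 then t0 else 0)"
      unfolding trunc_def by (intro sum.cong) auto
    then show ?thesis using 3 by (simp add: Q_J J_I I_0)
  qed (simp add: Q_0)
qed

text \<open>A zero expansion means vanishing to every order, while
  \<open>order_factorization\<close> gives each polynomial outside \<open>J i0\<close> a finite
  order.\<close>

lemma ev_eq_0: "ev F = 0 \<longleftrightarrow> F \<in> J i0"
proof
  assume "F \<in> J i0"
  then have "expands F 0" by (simp add: expands_def trunc_def Q_J)
  then show "ev F = 0" by (rule ev_eqI)
next
  assume "ev F = 0"
  then have F0: "F \<in> Q n" for n using expands_ev[of F] by (simp add: expands_def trunc_def)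
  show "F \<in> J i0"
  proof (rule ccontr)
    assume "F \<notin> J i0"
    then obtain n H U where H: "val H \<noteq> 0" "val U \<noteq> 0" "H * F - U * t0 ^ n \<in> J i0"
      using order_factorization[OF t0, of F] unfolding pt_val_O by auto
    obtain H' G' where H': "val H' \<noteq> 0" "H' * F - G' * t0 ^ Suc n \<in> J i0" using F0[of "Suc n"] unfolding Q_def by blast
    from J_diff[OF J_mult[OF H'(2), of H] J_mult[OF H(3), of H']]
    have "t0 ^ n * (H' * U - H * G' * t0) \<in> J i0" by (simp add: algebra_simps)
    then have "H' * U - H * G' * t0 \<in> J i0" using J0_prime t0_power by blast
    from J0_val[OF this] show False using H(2) H'(1) by (simp add: val_simps val_t0)
  qed
qed

lemma ev_form_eq_0: "is_form d F \<Longrightarrow> ev F = 0 \<longleftrightarrow> F \<in> I"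
  unfolding ev_eq_0 by (rule J_form[OF Var4_notin_I[OF O_geom O_i0]])

lemma ev_I: "F \<in> I \<Longrightarrow> ev F = 0"
  unfolding ev_eq_0 by (rule J_I)

lemma ev_Var4_i0: "ev (Var4 i0) = 1"
  using ev_eq_0[of "Var4 i0 - 1"] J_dvd[OF dvd_refl] by (simp add: ev_simps)

end

context pointed_curve
begin

section \<open>The function field inside the field of Laurent series\<close>

definition fe :: "'a poly4 \<Rightarrow> 'a fls" where
  "fe F = fps_to_fls (ev F)"

lemma rhom_fe: "rhom fe"
  by (simp add: rhom_def fe_def ev_simps fls_times_fps_to_fls)

lemmas fe_simps = rhom_simps[OF rhom_fe]

lemma fe_Const4: "fe (Const4 c) = fls_const c"
  by (simp add: fe_def ev_Const4)

lemma fe_form_eq_0: "is_form d F \<Longrightarrow> fe F = 0 \<longleftrightarrow> F \<in> I"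
  by (simp add: fe_def ev_form_eq_0)

lemma fe_I: "F \<in> I \<Longrightarrow> fe F = 0"
  by (simp add: fe_def ev_I)

lemma fe_i0: "fe (Var4 i0) = 1"
  by (simp add: fe_def ev_Var4_i0)

lemma rhom_fls_const: "rhom (fls_const :: 'a \<Rightarrow> 'a fls)"
  by (simp add: rhom_def fls_eq_iff)

lemma fe_eq_peval: "fe F = peval fls_const (\<lambda>j. fe (Var4 j)) F"
  by (rule rhom_eq_peval[OF rhom_fe rhom_fls_const fe_Const4])

text \<open>On forms of degree \<open>d\<close> this is division by the \<open>d\<close>-th power of \<open>X\<^sub>i\<close>, inside the function field.\<close>

definition eps :: "4 \<Rightarrow> 'a poly4 \<Rightarrow> 'a fls" where
  "eps i = peval fls_const (\<lambda>j. inverse (fe (Var4 i)) * fe (Var4 j))"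

lemma rhom_eps: "rhom (eps i)"
  unfolding eps_def by (rule rhom_peval[OF rhom_fls_const])

lemmas eps_simps = rhom_simps[OF rhom_eps]

lemma eps_form: "is_form d F \<Longrightarrow> eps i F = fe F / fe (Var4 i) ^ d"
  unfolding eps_def peval_scale_form fe_eq_peval[symmetric] by (simp add: divide_inverse power_inverse mult.commute)

lemma eps_i0: "eps i0 = fe"
  by (rule ext) (simp add: eps_def fe_i0 fe_eq_peval[symmetric])

lemma fe_Var4: "Var4 i \<notin> I \<Longrightarrow> fe (Var4 i) \<noteq> 0"
  using fe_form_eq_0[OF is_form_Var4] by blast

lemma eps_dvd: "Var4 i \<notin> I \<Longrightarrow> (Var4 i - 1) dvd F \<Longrightarrow> eps i F = 0"
proof -
  assume "Var4 i \<notin> I"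
  then have "eps i (Var4 i) = 1" using fe_Var4 by (simp add: eps_form[OF is_form_Var4])
  moreover assume "(Var4 i - 1) dvd F"
  ultimately show ?thesis by (auto simp: dvd_def eps_simps)
qed

lemma eps_eq_0:
  assumes z: "Var4 i \<notin> I"
  shows "eps i F = 0 \<longleftrightarrow> F \<in> J i"
proof -
  obtain d F' where F': "is_form d F'" "(Var4 i - 1) dvd F' - F" using homogenize by blast
  have "eps i F = eps i F'" using eps_dvd[OF z F'(2)] by (simp add: eps_simps)
  then have "eps i F = 0 \<longleftrightarrow> F' \<in> I" using F'(1) fe_Var4[OF z] by (simp add: eps_form fe_form_eq_0)
  also have "\<dots> \<longleftrightarrow> F \<in> J i" using J_form[OF z F'(1)] J_cong[OF J_dvd[OF F'(2)]] by blast
  finally show ?thesis .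
qed

lemma homogenize2:
  obtains d F' G' where "is_form d F'" "is_form d G'" "F' - F \<in> J i" "G' - G \<in> J i"
proof -
  obtain M F' N G' where F': "is_form M F'" "(Var4 i - 1) dvd F' - F" and G': "is_form N G'" "(Var4 i - 1) dvd G' - G"
    using homogenize[where i = i and F = F] homogenize[where i = i and F = G] by blast
  show thesis
  proof (rule that[of "M + N" "Var4 i ^ N * F'" "Var4 i ^ M * G'"])
    show "is_form (M + N) (Var4 i ^ N * F')" "is_form (M + N) (Var4 i ^ M * G')"
      using F'(1) G'(1) by (auto intro: is_form_mult[OF is_form_Var4_power])
    have "Var4 i ^ n * K' - K \<in> J i" if "(Var4 i - 1) dvd K' - K" for n K K'
    proof -
      have "Var4 i ^ n * K' - K = K' * (Var4 i ^ n - 1) + (K' - K)" by (simp add: algebra_simps)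
      also have "\<dots> \<in> J i" by (intro J_add J_mult J_Var4_power J_dvd that)
      finally show ?thesis .
    qed
    then show "Var4 i ^ N * F' - F \<in> J i" "Var4 i ^ M * G' - G \<in> J i" using F' G' by blast+
  qed
qed

text \<open>No homogeneity is needed here, because \<open>fe\<close> sends \<open>X\<^bsub>i0\<^esub>\<close> to \<open>1\<close>.\<close>

definition KK :: "'a fls set" where
  "KK = {fe F / fe G | F G. fe G \<noteq> 0}"

lemma KK_form: "is_form d F \<Longrightarrow> is_form d G \<Longrightarrow> G \<notin> I \<Longrightarrow> fe F / fe G \<in> KK"
  using fe_form_eq_0 unfolding KK_def by blast

lemma KK_formsE:
  assumes "x \<in> KK"
  obtains d F G where "is_form d F" "is_form d G" "G \<notin> I" "x = fe F / fe G"
proof -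
  obtain F G where x: "x = fe F / fe G" "fe G \<noteq> 0" using assms by (auto simp: KK_def)
  obtain d F' G' where F': "is_form d F'" "is_form d G'" "F' - F \<in> J i0" "G' - G \<in> J i0" by (rule homogenize2)
  have "fe (F' - F) = 0" "fe (G' - G) = 0"
    using F'(3,4) unfolding eps_eq_0[OF Var4_notin_I[OF O_geom O_i0], symmetric] eps_i0 .
  then have "fe F' = fe F" "fe G' = fe G" by (simp_all add: fe_simps)
  then show thesis using that[OF F'(1,2)] x fe_form_eq_0[OF F'(2)] by auto
qed

lemma KK_const: "fls_const c \<in> KK"
  unfolding KK_def mem_Collect_eq by (rule exI[of _ "Const4 c"], rule exI[of _ 1]) (simp add: fe_Const4 fe_simps)

lemma KK_mult: assumes "x \<in> KK" "y \<in> KK" shows "x * y \<in> KK"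
proof -
  obtain F G F' G' where "x = fe F / fe G" "fe G \<noteq> 0" "y = fe F' / fe G'" "fe G' \<noteq> 0" using assms by (auto simp: KK_def)
  then have "x * y = fe (F * F') / fe (G * G')" "fe (G * G') \<noteq> 0" by (simp_all add: fe_simps)
  then show ?thesis unfolding KK_def by blast
qed

lemma KK_add: assumes "x \<in> KK" "y \<in> KK" shows "x + y \<in> KK"
proof -
  obtain F G F' G' where "x = fe F / fe G" "fe G \<noteq> 0" "y = fe F' / fe G'" "fe G' \<noteq> 0" using assms by (auto simp: KK_def)
  then have "x + y = fe (F * G' + F' * G) / fe (G * G')" "fe (G * G') \<noteq> 0" by (simp_all add: fe_simps add_frac_eq)
  then show ?thesis unfolding KK_def by blast
qed

lemma KK_inverse: assumes "x \<in> KK" shows "inverse x \<in> KK"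
proof (cases "x = 0")
  case True
  then show ?thesis using assms by simp
next
  case False
  obtain F G where "x = fe F / fe G" "fe G \<noteq> 0" using assms by (auto simp: KK_def)
  then have "inverse x = fe G / fe F" "fe F \<noteq> 0" using False by auto
  then show ?thesis unfolding KK_def by blast
qed

lemma KK_diff: "x \<in> KK \<Longrightarrow> y \<in> KK \<Longrightarrow> x - y \<in> KK"
  using KK_add[of x "fls_const (- 1) * y"] KK_mult[OF KK_const[of "- 1"], of y] by simp

lemma KK_divide: "x \<in> KK \<Longrightarrow> y \<in> KK \<Longrightarrow> x / y \<in> KK"
  by (simp add: divide_inverse KK_mult KK_inverse)

lemma KK_power: "x \<in> KK \<Longrightarrow> x ^ n \<in> KK"
  using KK_const[of 1] by (induction n) (simp_all add: KK_mult)

section \<open>Local rings, residues and orders\<close>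

definition ch :: "'a alg_closure pspace3 \<Rightarrow> 4" where
  "ch P = (SOME i. coords P $ i \<noteq> 0)"

lemma ch: "coords P $ ch P \<noteq> 0"
  unfolding ch_def by (rule someI_ex) (metis coords_nz_index)

definition pev :: "'a alg_closure pspace3 \<Rightarrow> 'a poly4 \<Rightarrow> 'a alg_closure" where
  "pev P = pt_val P (ch P)"

lemma rhom_pev: "rhom (pev P)"
  unfolding pev_def by (rule rhom_pt_val)

lemmas pev_simps = rhom_simps[OF rhom_pev]

lemma pev_Const4: "pev P (Const4 c) = to_ac c"
  by (simp add: pev_def pt_val_Const4)

lemma vanishes_pev: "is_form d F \<Longrightarrow> vanishes_at F P \<longleftrightarrow> pev P F = 0"
  using vanishes_at_iff[OF _ ch] by (simp add: pev_def pt_val_def)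

definition ep :: "'a alg_closure pspace3 \<Rightarrow> 'a poly4 \<Rightarrow> 'a fls" where
  "ep P = eps (ch P)"

lemma rhom_ep: "rhom (ep P)"
  unfolding ep_def by (rule rhom_eps)

lemmas ep_simps = rhom_simps[OF rhom_ep]

lemma ep_Const4: "ep P (Const4 c) = fls_const c"
  by (simp add: ep_def eps_def peval_Const4[OF rhom_fls_const])

lemma ep_eq_0: "P \<in> geom_points I \<Longrightarrow> ep P F = 0 \<longleftrightarrow> F \<in> J (ch P)"
  unfolding ep_def by (rule eps_eq_0[OF Var4_notin_I[OF _ ch]])

lemma ep_pev: "P \<in> geom_points I \<Longrightarrow> ep P F = 0 \<Longrightarrow> pev P F = 0"
  unfolding pev_def by (rule J_pt_val[OF _ ch]) (simp_all add: ep_eq_0)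

lemma ep_nz: "P \<in> geom_points I \<Longrightarrow> pev P F \<noteq> 0 \<Longrightarrow> ep P F \<noteq> 0"
  using ep_pev by blast

lemma ep_form_ratio:
  "P \<in> geom_points I \<Longrightarrow> is_form d F \<Longrightarrow> is_form d G \<Longrightarrow> ep P F / ep P G = fe F / fe G"
  unfolding ep_def using fe_Var4[OF Var4_notin_I[OF _ ch]] by (simp add: eps_form)

text \<open>The local ring at \<open>P\<close>, placed inside the Laurent series at the origin, so
  that functions at different points are elements of one field.\<close>

definition LR :: "'a alg_closure pspace3 \<Rightarrow> 'a fls set" where
  "LR P = {ep P F / ep P G | F G. pev P G \<noteq> 0}"

definition res :: "'a alg_closure pspace3 \<Rightarrow> 'a fls \<Rightarrow> 'a alg_closure" where
  "res P x = (THE v. \<exists>F G. pev P G \<noteq> 0 \<and> x = ep P F / ep P G \<and> v = pev P F / pev P G)"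

lemma res_eq:
  assumes P: "P \<in> geom_points I" and G: "pev P G \<noteq> 0"
  shows "res P (ep P F / ep P G) = pev P F / pev P G"
  unfolding res_def
proof (rule the_equality)
  fix v assume "\<exists>F' G'. pev P G' \<noteq> 0 \<and> ep P F / ep P G = ep P F' / ep P G' \<and> v = pev P F' / pev P G'"
  then obtain F' G' where F': "pev P G' \<noteq> 0" "ep P F / ep P G = ep P F' / ep P G'" "v = pev P F' / pev P G'" by blast
  have "ep P F * ep P G' = ep P F' * ep P G"
    using F'(2) ep_nz[OF P G] ep_nz[OF P F'(1)] by (simp add: frac_eq_eq)
  then have "ep P (F * G' - F' * G) = 0" by (simp add: ep_simps)
  from ep_pev[OF P this] show "v = pev P F / pev P G" using F' G by (simp add: pev_simps frac_eq_eq)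
qed (use G in blast)

lemma LR_E:
  assumes "P \<in> geom_points I" "x \<in> LR P"
  obtains F G where "pev P G \<noteq> 0" "ep P G \<noteq> 0" "x = ep P F / ep P G" "res P x = pev P F / pev P G"
  using assms res_eq ep_nz unfolding LR_def by blast

lemma LR_I: "pev P G \<noteq> 0 \<Longrightarrow> x = ep P F / ep P G \<Longrightarrow> x \<in> LR P"
  unfolding LR_def by blast

lemma LR_forms:
  assumes P: "P \<in> geom_points I" and x: "x \<in> LR P"
  obtains d F G where "is_form d F" "is_form d G" "pev P G \<noteq> 0" "x = fe F / fe G" "res P x = pev P F / pev P G"
proof -
  obtain F G where FG: "pev P G \<noteq> 0" "x = ep P F / ep P G" "res P x = pev P F / pev P G" using LR_E[OF P x] by metis
  obtain d F' G' where F': "is_form d F'" "is_form d G'" "F' - F \<in> J (ch P)" "G' - G \<in> J (ch P)" by (rule homogenize2)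
  have "ep P (F' - F) = 0" "ep P (G' - G) = 0" using F' ep_eq_0[OF P] by auto
  moreover from this have "pev P (F' - F) = 0" "pev P (G' - G) = 0" using ep_pev[OF P] by auto
  ultimately have "ep P F' = ep P F" "ep P G' = ep P G" "pev P F' = pev P F" "pev P G' = pev P G"
    by (simp_all add: ep_simps pev_simps)
  then show thesis using that[OF F'(1,2)] FG ep_form_ratio[OF P F'(1,2)] by metis
qed

lemma LR_form_I:
  assumes P: "P \<in> geom_points I" and "is_form d F" "is_form d G" "pev P G \<noteq> 0"
  shows "fe F / fe G \<in> LR P" "res P (fe F / fe G) = pev P F / pev P G"
  using LR_I[of P G "fe F / fe G" F] res_eq[OF P assms(4), of F] ep_form_ratio[OF assms(1-3)] assms(4) by auto

lemma pev_notin_I: "P \<in> geom_points I \<Longrightarrow> is_form d G \<Longrightarrow> pev P G \<noteq> 0 \<Longrightarrow> G \<notin> I"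
  using vanishes_pev[of d G P] by (auto simp: geom_points_def)

lemma LR_KK: "P \<in> geom_points I \<Longrightarrow> x \<in> LR P \<Longrightarrow> x \<in> KK"
  by (metis LR_forms KK_form pev_notin_I)

lemma LR_const: "fls_const c \<in> LR P" "P \<in> geom_points I \<Longrightarrow> res P (fls_const c) = to_ac c"
proof -
  have e: "fls_const c = ep P (Const4 c) / ep P 1" by (simp add: ep_Const4 ep_simps)
  show "fls_const c \<in> LR P" by (rule LR_I[OF _ e]) (simp add: pev_simps)
  show "P \<in> geom_points I \<Longrightarrow> res P (fls_const c) = to_ac c"
    unfolding e by (subst res_eq) (simp_all add: pev_simps pev_Const4)
qed

lemma LR_mult:
  assumes P: "P \<in> geom_points I" and "x \<in> LR P" "y \<in> LR P"
  shows "x * y \<in> LR P" "res P (x * y) = res P x * res P y"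
proof -
  obtain F G where x: "pev P G \<noteq> 0" "ep P G \<noteq> 0" "x = ep P F / ep P G" "res P x = pev P F / pev P G" using LR_E[OF P assms(2)] by blast
  obtain F' G' where y: "pev P G' \<noteq> 0" "ep P G' \<noteq> 0" "y = ep P F' / ep P G'" "res P y = pev P F' / pev P G'" using LR_E[OF P assms(3)] by blast
  have e: "x * y = ep P (F * F') / ep P (G * G')" using x y by (simp add: ep_simps)
  have "pev P (G * G') \<noteq> 0" using x y by (simp add: pev_simps)
  then show "x * y \<in> LR P" "res P (x * y) = res P x * res P y"
    using LR_I[OF _ e] res_eq[OF P, of "G * G'" "F * F'"] e x y by (auto simp: pev_simps)
qed

lemma LR_add:
  assumes P: "P \<in> geom_points I" and "x \<in> LR P" "y \<in> LR P"
  shows "x + y \<in> LR P" "res P (x + y) = res P x + res P y"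
proof -
  obtain F G where x: "pev P G \<noteq> 0" "ep P G \<noteq> 0" "x = ep P F / ep P G" "res P x = pev P F / pev P G" using LR_E[OF P assms(2)] by blast
  obtain F' G' where y: "pev P G' \<noteq> 0" "ep P G' \<noteq> 0" "y = ep P F' / ep P G'" "res P y = pev P F' / pev P G'" using LR_E[OF P assms(3)] by blast
  have e: "x + y = ep P (F * G' + F' * G) / ep P (G * G')" using x y by (simp add: ep_simps add_frac_eq)
  have "pev P (G * G') \<noteq> 0" using x y by (simp add: pev_simps)
  then show "x + y \<in> LR P" "res P (x + y) = res P x + res P y"
    using LR_I[OF _ e] res_eq[OF P, of "G * G'" "F * G' + F' * G"] e x y by (auto simp: pev_simps add_frac_eq)
qed

lemma LR_diff:
  assumes P: "P \<in> geom_points I" and "x \<in> LR P" "y \<in> LR P"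
  shows "x - y \<in> LR P" "res P (x - y) = res P x - res P y"
proof -
  note m = LR_mult[OF P LR_const(1)[of "- 1"] assms(3)]
  have e: "x - y = x + fls_const (- 1) * y" by simp
  show "x - y \<in> LR P" unfolding e by (rule LR_add(1)[OF P assms(2) m(1)])
  show "res P (x - y) = res P x - res P y"
    unfolding e LR_add(2)[OF P assms(2) m(1)] m(2) by (simp only: LR_const(2)[OF P]) simp
qed

lemma LR_power:
  assumes P: "P \<in> geom_points I" and "x \<in> LR P"
  shows "x ^ n \<in> LR P \<and> res P (x ^ n) = res P x ^ n"
proof (induction n)
  case 0
  show ?case using LR_const(1)[of 1 P] LR_const(2)[of P 1] P by simp
next
  case (Suc n)
  then show ?case using LR_mult[OF P assms(2), of "x ^ n"] by simp
qed

lemma LR_inverse: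
  assumes P: "P \<in> geom_points I" and "x \<in> LR P" "res P x \<noteq> 0"
  shows "inverse x \<in> LR P" "res P (inverse x) = inverse (res P x)"
proof -
  obtain F G where x: "pev P G \<noteq> 0" "ep P G \<noteq> 0" "x = ep P F / ep P G" "res P x = pev P F / pev P G" using LR_E[OF P assms(2)] by blast
  have e: "inverse x = ep P G / ep P F" and F: "pev P F \<noteq> 0" using x assms(3) by auto
  show "inverse x \<in> LR P" by (rule LR_I[OF F e])
  show "res P (inverse x) = inverse (res P x)" unfolding e res_eq[OF P F] using x by simp
qed

lemma res_0: "P \<in> geom_points I \<Longrightarrow> res P 0 = 0"
  using LR_const(2)[of P 0] by simp

definition units :: "'a alg_closure pspace3 \<Rightarrow> 'a fls set" where
  "units P = {x \<in> LR P. res P x \<noteq> 0}"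

lemma units_mult: "P \<in> geom_points I \<Longrightarrow> x \<in> units P \<Longrightarrow> y \<in> units P \<Longrightarrow> x * y \<in> units P"
  by (simp add: units_def LR_mult)

lemma units_inverse: "P \<in> geom_points I \<Longrightarrow> x \<in> units P \<Longrightarrow> inverse x \<in> units P"
  by (simp add: units_def LR_inverse)

lemma units_1: "P \<in> geom_points I \<Longrightarrow> 1 \<in> units P"
  using LR_const(1)[of 1 P] LR_const(2)[of P 1] by (simp add: units_def)

lemma units_nz: "P \<in> geom_points I \<Longrightarrow> x \<in> units P \<Longrightarrow> x \<noteq> 0"
  using res_0 by (auto simp: units_def)

lemma units_powi: assumes P: "P \<in> geom_points I" and x: "x \<in> units P" shows "x powi n \<in> units P"
proof -
  have "y ^ k \<in> units P" if "y \<in> units P" for y k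
    using that by (induction k) (simp_all add: units_1[OF P] units_mult[OF P])
  then show ?thesis using units_inverse[OF P x] x by (simp add: power_int_def)
qed

definition gen :: "'a alg_closure pspace3 \<Rightarrow> 'a fls \<Rightarrow> bool" where
  "gen P t \<longleftrightarrow> t \<in> LR P \<and> res P t = 0 \<and> (\<forall>x\<in>LR P. res P x = 0 \<longrightarrow> (\<exists>y\<in>LR P. x = y * t))"

text \<open>Modelled clause by clause on \<open>ord_at\<close>, with equality of Laurent series in
  place of \<open>sect_eq\<close>.\<close>

definition ordK :: "'a alg_closure pspace3 \<Rightarrow> 'a fls \<Rightarrow> int" where
  "ordK P x = (THE n. \<exists>t u. gen P t \<and> u \<in> units P \<and> x = u * t powi n)"

text \<open>The local ring is a discrete valuation ring: a local parameter generates its maximal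
  ideal, and \<open>order_factorization\<close> for numerator and denominator writes every nonzero
  function as a unit times a power of it.\<close>

lemma ex_gen:
  assumes P: "P \<in> geom_points I"
  obtains t where "gen P t" "t \<noteq> 0" "\<And>x. x \<in> KK \<Longrightarrow> x \<noteq> 0 \<Longrightarrow> \<exists>u\<in>units P. \<exists>n. x = u * t powi n"
proof -
  obtain t where lp: "local_param P (ch P) t" using ex_local_param[OF P ch] by blast
  let ?t = "ep P t"
  have t0: "?t \<noteq> 0" using lp by (simp add: local_param_def ep_eq_0[OF P])
  have "?t = ep P t / ep P 1" by (simp add: ep_simps)
  then have tL: "?t \<in> LR P" "res P ?t = 0"
    using LR_I[of P 1 ?t t] res_eq[OF P, of 1 t] lp by (simp_all add: pev_simps local_param_def flip: pev_def)
  have g: "gen P ?t"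
    unfolding gen_def
  proof (intro conjI ballI impI tL)
    fix x assume x: "x \<in> LR P" "res P x = 0"
    obtain F G where FG: "pev P G \<noteq> 0" "ep P G \<noteq> 0" "x = ep P F / ep P G" "res P x = pev P F / pev P G" using LR_E[OF P x(1)] by blast
    then have "pev P F = 0" using x(2) by simp
    then obtain H K where H: "pev P H \<noteq> 0" "H * F - K * t \<in> J (ch P)" using lp unfolding local_param_def pev_def by blast
    then have "ep P H * ep P F = ep P K * ?t" using ep_eq_0[OF P, of "H * F - K * t"] by (simp add: ep_simps)
    moreover have "x * (ep P H * ep P G) = ep P H * (x * ep P G)" by (simp add: algebra_simps)
    moreover have "x * ep P G = ep P F" using FG(2,3) by simp
    ultimately have "x * (ep P H * ep P G) = ep P K * ?t" by simp
    then have "x = (ep P K / ep P (H * G)) * ?t" using FG(2) ep_nz[OF P H(1)] by (simp add: ep_simps eq_divide_eq)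
    moreover have "ep P K / ep P (H * G) \<in> LR P" using H FG by (intro LR_I[OF _ refl]) (simp add: pev_simps)
    ultimately show "\<exists>y\<in>LR P. x = y * ?t" by blast
  qed
  have fac: "\<exists>u\<in>units P. \<exists>n. ep P F = u * ?t powi n" if F: "ep P F \<noteq> 0" for F
  proof -
    obtain n H U where H: "pev P H \<noteq> 0" "pev P U \<noteq> 0" "H * F - U * t ^ n \<in> J (ch P)"
      using order_factorization[OF lp] F unfolding ep_eq_0[OF P] pev_def by blast
    then have "ep P H * ep P F = ep P U * ?t ^ n" using ep_eq_0[OF P, of "H * F - U * t ^ n"] by (simp add: ep_simps)
    then have "ep P F = (ep P U / ep P H) * ?t powi int n" using ep_nz[OF P H(1)] by (simp add: field_simps)
    moreover have "ep P U / ep P H \<in> units P" using H res_eq[OF P H(1)] LR_I[OF H(1) refl] by (simp add: units_def)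
    ultimately show ?thesis by blast
  qed
  show thesis
  proof (rule that[OF g t0])
    fix x assume x: "x \<in> KK" "x \<noteq> 0"
    obtain d F G where FG: "is_form d F" "is_form d G" "G \<notin> I" "x = fe F / fe G" using KK_formsE[OF x(1)] by blast
    have "ep P F / ep P G = x" using ep_form_ratio[OF P FG(1,2)] FG(4) by simp
    moreover from this have "ep P F \<noteq> 0" "ep P G \<noteq> 0" using x(2) by auto
    then obtain u n v m where "u \<in> units P" "ep P F = u * ?t powi n" "v \<in> units P" "ep P G = v * ?t powi m" using fac by metis
    ultimately have "x = (u * inverse v) * ?t powi (n - m)" "u * inverse v \<in> units P"
      using t0 units_mult[OF P _ units_inverse[OF P]] units_nz[OF P] by (auto simp: power_int_diff field_simps)
    then show "\<exists>u\<in>units P. \<exists>n. x = u * ?t powi n" by blast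
  qed
qed

lemma gen_unit_multiple:
  assumes P: "P \<in> geom_points I" and t: "gen P t" "t \<noteq> 0" and s: "gen P s"
  shows "\<exists>v\<in>units P. s = v * t"
proof -
  obtain y z where yz: "y \<in> LR P" "s = y * t" "z \<in> LR P" "t = z * s" using t(1) s unfolding gen_def by metis
  then have "z * y = 1" using t(2) by (metis mult.assoc mult_cancel_right1 mult.commute)
  then have "res P z * res P y = 1" using LR_mult(2)[OF P yz(3,1)] LR_const(2)[of P 1] P by simp
  then have "y \<in> units P" using yz(1) by (auto simp: units_def)
  then show ?thesis using yz(2) by blast
qed

lemma unit_powi_unique:
  assumes P: "P \<in> geom_points I" and t: "gen P t" "t \<noteq> 0" and u: "u \<in> units P" "v \<in> units P"
    and e: "u * t powi n = v * t powi m"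
  shows "n = m"
proof -
  have *: "\<not> n < m" if u: "u \<in> units P" "v \<in> units P" and e: "u * t powi n = v * t powi m" for u v n m
  proof
    assume nm: "n < m"
    have "u = v * t powi (m - n)" using e t(2) by (simp add: power_int_diff field_simps)
    also have "t powi (m - n) = t ^ nat (m - n)" using nm by (simp add: power_int_nonneg_exp)
    finally have "res P u = res P v * res P t ^ nat (m - n)"
      using LR_mult(2)[OF P, of v "t ^ nat (m - n)"] LR_power[OF P, of t] u t(1) by (simp add: units_def gen_def)
    then show False using t(1) u nm by (simp add: units_def gen_def power_0_left)
  qed
  show ?thesis using *[OF u e] *[OF u(2,1) e[symmetric]] by simp
qed

text \<open>Uniformizers differ by units, so every decomposition can be rewritten with the fixed
  \<open>t1\<close>, where the exponent is unique.\<close>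

lemma ordK_eqI:
  assumes P: "P \<in> geom_points I" and t: "gen P t" and u: "u \<in> units P" "x = u * t powi n" and x: "x \<noteq> 0"
  shows "ordK P x = n"
proof -
  obtain t1 where t1: "gen P t1" "t1 \<noteq> 0" using ex_gen[OF P] by blast
  have norm: "\<exists>v'\<in>units P. v * s powi m = v' * t1 powi m" if s: "gen P s" and v: "v \<in> units P" for s v m
  proof -
    obtain w where w: "w \<in> units P" "s = w * t1" using gen_unit_multiple[OF P t1 s] by blast
    then have "v * s powi m = (v * w powi m) * t1 powi m" by (simp add: power_int_mult_distrib)
    then show ?thesis using units_mult[OF P v units_powi[OF P w(1)]] by blast
  qed
  show ?thesis
    unfolding ordK_def
  proof (rule the_equality)
    show "\<exists>t u. gen P t \<and> u \<in> units P \<and> x = u * t powi n" using t u by blast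
    fix m assume "\<exists>s v. gen P s \<and> v \<in> units P \<and> x = v * s powi m"
    then obtain s v where s: "gen P s" "v \<in> units P" "x = v * s powi m" by blast
    obtain v' where "v' \<in> units P" "x = v' * t1 powi m" using norm[OF s(1,2)] s(3) by metis
    moreover obtain u' where "u' \<in> units P" "x = u' * t1 powi n" using norm[OF t u(1)] u(2) by metis
    ultimately show "m = n" using unit_powi_unique[OF P t1] by metis
  qed
qed

lemma ordK_decomp:
  assumes P: "P \<in> geom_points I" and x: "x \<in> KK" "x \<noteq> 0" and t: "gen P t" "t \<noteq> 0"
  obtains u where "u \<in> units P" "x = u * t powi (ordK P x)"
proof -
  obtain s where s: "gen P s" "s \<noteq> 0" "\<exists>u\<in>units P. \<exists>n. x = u * s powi n" using ex_gen[OF P] x by metis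
  then obtain u n where un: "u \<in> units P" "x = u * s powi n" by blast
  obtain v where v: "v \<in> units P" "s = v * t" using gen_unit_multiple[OF P t s(1)] by blast
  then have "x = (u * v powi n) * t powi n" using un by (simp add: power_int_mult_distrib)
  moreover have "u * v powi n \<in> units P" using units_mult[OF P un(1) units_powi[OF P v(1)]] .
  ultimately show thesis using that ordK_eqI[OF P t(1)] x(2) by metis
qed

lemma ordK_mult:
  assumes P: "P \<in> geom_points I" and x: "x \<in> KK" "x \<noteq> 0" and y: "y \<in> KK" "y \<noteq> 0"
  shows "ordK P (x * y) = ordK P x + ordK P y"
proof -
  obtain t where t: "gen P t" "t \<noteq> 0" using ex_gen[OF P] by blast
  obtain u where u: "u \<in> units P" "x = u * t powi (ordK P x)" by (rule ordK_decomp[OF P x t])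
  obtain v where v: "v \<in> units P" "y = v * t powi (ordK P y)" by (rule ordK_decomp[OF P y t])
  have "x * y = (u * v) * t powi (ordK P x + ordK P y)"
    using t(2) by (subst u(2), subst v(2)) (simp add: power_int_add algebra_simps)
  then show ?thesis by (rule ordK_eqI[OF P t(1) units_mult[OF P u(1) v(1)]]) (use x y in simp)
qed

lemma ordK_units: assumes P: "P \<in> geom_points I" and u: "u \<in> units P" shows "ordK P u = 0"
proof -
  obtain t where t: "gen P t" "t \<noteq> 0" using ex_gen[OF P] by blast
  show ?thesis using ordK_eqI[OF P t(1) u, of u 0] units_nz[OF P u] by simp
qed

lemma ordK_gen: assumes P: "P \<in> geom_points I" and t: "gen P t" "t \<noteq> 0" shows "ordK P t = 1"
  using ordK_eqI[OF P t(1) units_1[OF P], of t 1] t(2) by simp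

lemma ordK_inverse:
  assumes P: "P \<in> geom_points I" and x: "x \<in> KK" "x \<noteq> 0"
  shows "ordK P (inverse x) = - ordK P x"
  using ordK_mult[OF P x KK_inverse[OF x(1)]] ordK_units[OF P units_1[OF P]] x(2) by simp

lemma ordK_divide:
  assumes P: "P \<in> geom_points I" and x: "x \<in> KK" "x \<noteq> 0" and y: "y \<in> KK" "y \<noteq> 0"
  shows "ordK P (x / y) = ordK P x - ordK P y"
  using ordK_mult[OF P x KK_inverse[OF y(1)]] ordK_inverse[OF P y] y(2) by (simp add: divide_inverse)

lemma ordK_power:
  assumes P: "P \<in> geom_points I" and x: "x \<in> KK" "x \<noteq> 0"
  shows "ordK P (x ^ n) = int n * ordK P x"
  by (induction n) (simp_all add: ordK_units[OF P units_1[OF P]] ordK_mult[OF P x KK_power[OF x(1)]] x(2) algebra_simps)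

lemma ordK_nonneg_iff:
  assumes P: "P \<in> geom_points I" and x: "x \<in> KK" "x \<noteq> 0"
  shows "ordK P x \<ge> 0 \<longleftrightarrow> x \<in> LR P" "ordK P x \<ge> 1 \<longleftrightarrow> x \<in> LR P \<and> res P x = 0"
proof -
  have nn: "y \<in> LR P \<and> (ordK P y \<ge> 1 \<longrightarrow> res P y = 0)" if y: "y \<in> KK" "y \<noteq> 0" "ordK P y \<ge> 0" for y
  proof -
    obtain t where t: "gen P t" "t \<noteq> 0" using ex_gen[OF P] by blast
    obtain u where u: "u \<in> units P" "y = u * t powi (ordK P y)" by (rule ordK_decomp[OF P y(1,2) t])
    have "y = u * t ^ nat (ordK P y)" using u(2) y(3) by (simp add: power_int_nonneg_exp)
    then show ?thesis
      using LR_mult[OF P, of u "t ^ nat (ordK P y)"] LR_power[OF P, of t] u(1) t(1) by (simp add: units_def gen_def power_0_left)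
  qed
  have lr: "ordK P x \<ge> 0" if L: "x \<in> LR P"
  proof (rule ccontr)
    assume "\<not> ordK P x \<ge> 0"
    then have "ordK P (inverse x) \<ge> 1" using ordK_inverse[OF P x] by simp
    then have i: "inverse x \<in> LR P" "res P (inverse x) = 0" using nn[OF KK_inverse[OF x(1)]] x(2) by auto
    then have "res P (inverse x * x) = 0" using LR_mult(2)[OF P i(1) L] by simp
    then show False using x(2) LR_const(2)[OF P, of 1] by simp
  qed
  show "ordK P x \<ge> 0 \<longleftrightarrow> x \<in> LR P" using nn[OF x] lr by blast
  show "ordK P x \<ge> 1 \<longleftrightarrow> x \<in> LR P \<and> res P x = 0"
  proof
    assume "x \<in> LR P \<and> res P x = 0"
    moreover from this have "ordK P x \<noteq> 0"
    proof (intro notI)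
      assume L: "x \<in> LR P \<and> res P x = 0" and o: "ordK P x = 0"
      obtain t where t: "gen P t" "t \<noteq> 0" using ex_gen[OF P] by blast
      obtain u where "u \<in> units P" "x = u * t powi (ordK P x)" by (rule ordK_decomp[OF P x t])
      then show False using o L by (simp add: units_def)
    qed
    ultimately show "ordK P x \<ge> 1" using lr by force
  qed (use nn[OF x] in auto)
qed

text \<open>Whether a form vanishes at the origin does not depend on the chart. In a quotient of
  forms representing \<open>x\<close> the denominator therefore expands with nonzero constant term,
  and the constant term of the numerator decides about the residue.\<close>

lemma LR_O: "x \<in> LR O_pt \<Longrightarrow> fls_subdegree x \<ge> 0 \<and> (x \<noteq> 0 \<longrightarrow> (res O_pt x \<noteq> 0 \<longleftrightarrow> fls_subdegree x = 0))"
proof -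
  assume "x \<in> LR O_pt"
  then obtain d F G where FG: "is_form d F" "is_form d G" "pev O_pt G \<noteq> 0" "x = fe F / fe G" "res O_pt x = pev O_pt F / pev O_pt G"
    using LR_forms[OF O_geom] by metis
  have nz: "pev O_pt H \<noteq> 0 \<longleftrightarrow> fps_nth (ev H) 0 \<noteq> 0" if "is_form e H" for e H
    using vanishes_pev[OF that] vanishes_at_iff[OF that O_i0] pt_val_O[of H] by (simp add: pt_val_def ev_nth_0)
  have sub: "fls_subdegree (fe H) \<ge> 0" "fps_nth (ev H) 0 \<noteq> 0 \<Longrightarrow> fls_subdegree (fe H) = 0" for H
    by (simp_all add: fe_def fls_subdegree_fls_to_fps)
  have sub0: "fe H \<noteq> 0 \<Longrightarrow> fls_subdegree (fe H) = 0 \<Longrightarrow> fps_nth (ev H) 0 \<noteq> 0" for H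
    using nth_subdegree_nonzero[of "ev H"] by (simp add: fe_def fls_subdegree_fls_to_fps)
  have G: "fls_subdegree (fe G) = 0" "fe G \<noteq> 0"
    using nz[OF FG(2)] FG(3) sub(2) by (auto simp: fe_def)
  show ?thesis
  proof (cases "fe F = 0")
    case False
    then have "fls_subdegree x = fls_subdegree (fe F)" using G FG(4) by (simp add: fls_divide_subdegree)
    then show ?thesis using sub[of F] sub0[of F] False nz[OF FG(1)] FG(3,5) by auto
  qed (use FG in simp)
qed

text \<open>The quotient \<open>s\<close> of \<open>t0\<close> by a power of \<open>Var4 i0\<close>
  is regular, vanishes at the origin and expands to \<open>fls_X\<close>. It is a regular multiple
  of any uniformizer, which therefore has subdegree exactly 1.\<close>

lemma ordK_O: assumes x: "x \<in> KK" "x \<noteq> 0" shows "ordK O_pt x = fls_subdegree x"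
proof -
  obtain t where t: "gen O_pt t" "t \<noteq> 0" using ex_gen[OF O_geom] by blast
  have tL: "t \<in> LR O_pt" "res O_pt t = 0" using t(1) by (auto simp: gen_def)
  then have ge: "fls_subdegree t \<ge> 1" using LR_O[OF tL(1)] t(2) by auto
  obtain D where D: "is_form D t0" using t0 by (auto simp: local_param_def)
  define s where "s = fe t0 / fe (Var4 i0 ^ D)"
  have s: "s = fls_X" by (simp add: s_def fe_simps fe_i0) (simp add: fe_def ev_t0)
  have zO: "pev O_pt (Var4 i0 ^ D) \<noteq> 0"
    using vanishes_pev[OF is_form_Var4_power[of D i0], of O_pt] vanishes_at_iff[OF is_form_Var4_power[of D i0] O_i0]
    by (simp add: rhom_power[OF rhom_peval[OF rhom_to_ac]] peval_Var4[OF rhom_to_ac] nvec_self[OF O_i0])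
  have sL: "s \<in> LR O_pt" unfolding s_def by (rule LR_form_I(1)[OF O_geom D is_form_Var4_power zO])
  moreover have "res O_pt s = 0" using LR_O[OF sL] s by auto
  ultimately obtain y where y: "y \<in> LR O_pt" "s = y * t" using t(1) by (auto simp: gen_def)
  then have "y \<noteq> 0" using s by auto
  then have "fls_subdegree y + fls_subdegree t = 1" using y s t(2) by (metis fls_subdegree_mult fls_X_subdegree)
  then have t1: "fls_subdegree t = 1" using ge LR_O[OF y(1)] by linarith
  obtain u where u: "u \<in> units O_pt" "x = u * t powi (ordK O_pt x)" by (rule ordK_decomp[OF O_geom x t])
  then have "u \<noteq> 0" using units_nz[OF O_geom] by blast
  moreover have "fls_subdegree u = 0" using u(1) LR_O[of u] \<open>u \<noteq> 0\<close> by (simp add: units_def)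
  ultimately have "fls_subdegree (u * t powi (ordK O_pt x)) = ordK O_pt x" using t(2) t1 by simp
  then show ?thesis using u(2) by simp
qed

end

context pointed_curve
begin

section \<open>Rational sections as Laurent series\<close>

text \<open>The expansion of a fraction at the origin. A fraction has many representations, some
  with a denominator killed by \<open>fe\<close>; the value is read off from one with
  \<open>fe G \<noteq> 0\<close>.\<close>

definition nu :: "'a poly4 fract \<Rightarrow> 'a fls" where
  "nu s = (THE x. \<exists>F G. s = Fract F G \<and> fe G \<noteq> 0 \<and> x = fe F / fe G)"

lemma fe_nz: "fe G \<noteq> 0 \<Longrightarrow> G \<noteq> 0"
  using fe_simps(1) by metis

lemma nu_Fract:
  assumes "fe G \<noteq> 0"
  shows "nu (Fract F G) = fe F / fe G"
  unfolding nu_def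
proof (rule the_equality)
  fix x assume "\<exists>F' G'. Fract F G = Fract F' G' \<and> fe G' \<noteq> 0 \<and> x = fe F' / fe G'"
  then obtain F' G' where F': "Fract F G = Fract F' G'" "fe G' \<noteq> 0" "x = fe F' / fe G'" by blast
  then have "F * G' = F' * G" using fe_nz assms by (simp add: eq_fract)
  then have "fe F * fe G' = fe F' * fe G" by (metis fe_simps(4))
  then show "x = fe F / fe G" using F' assms by (simp add: frac_eq_eq)
qed (use assms in blast)

lemma rat_E:
  assumes "s \<in> rat_sections I n"
  obtains F G d e where "s = Fract F G" "is_form e F" "is_form d G" "G \<notin> I" "int e = int d + n" "fe G \<noteq> 0" "nu s = fe F / fe G"
proof -
  obtain F G d e where "s = Fract F G" "is_form e F" "is_form d G" "G \<notin> I" "int e = int d + n"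
    using assms by (auto simp: rat_sections_def)
  then show thesis using that fe_form_eq_0[of d G] nu_Fract by metis
qed

lemma rat_I: "is_form e F \<Longrightarrow> is_form d G \<Longrightarrow> G \<notin> I \<Longrightarrow> int e = int d + n \<Longrightarrow> Fract F G \<in> rat_sections I n"
  unfolding rat_sections_def by blast

lemma rat_mult:
  assumes "s \<in> rat_sections I n" "t \<in> rat_sections I m"
  shows "s * t \<in> rat_sections I (n + m)" "nu (s * t) = nu s * nu t"
proof -
  obtain F G d e where s: "s = Fract F G" "is_form e F" "is_form d G" "G \<notin> I" "int e = int d + n" "fe G \<noteq> 0" "nu s = fe F / fe G"
    by (rule rat_E[OF assms(1)])
  obtain F' G' d' e' where t: "t = Fract F' G'" "is_form e' F'" "is_form d' G'" "G' \<notin> I" "int e' = int d' + m" "fe G' \<noteq> 0" "nu t = fe F' / fe G'"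
    by (rule rat_E[OF assms(2)])
  have st: "s * t = Fract (F * F') (G * G')" using s(1) t(1) by simp
  show "s * t \<in> rat_sections I (n + m)" unfolding st
    by (rule rat_I[OF is_form_mult[OF s(2) t(2) refl] is_form_mult[OF s(3) t(3) refl]])
      (use s t I_prime in auto)
  show "nu (s * t) = nu s * nu t" unfolding st using s(6,7) t(6,7) by (simp add: nu_Fract fe_simps)
qed

lemma rat_inverse:
  assumes "s \<in> rat_sections I 0" "nu s \<noteq> 0"
  shows "inverse s \<in> rat_sections I 0" "nu (inverse s) = inverse (nu s)"
proof -
  obtain F G d e where s: "s = Fract F G" "is_form e F" "is_form d G" "G \<notin> I" "int e = int d + 0" "fe G \<noteq> 0" "nu s = fe F / fe G"
    by (rule rat_E[OF assms(1)])
  then have F: "fe F \<noteq> 0" "F \<notin> I" using assms(2) fe_I by auto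
  have i: "inverse s = Fract G F" using s(1) by simp
  show "inverse s \<in> rat_sections I 0" unfolding i using s F by (intro rat_I) auto
  show "nu (inverse s) = inverse (nu s)" unfolding i using s F by (simp add: nu_Fract)
qed

lemma rat_1: "1 \<in> rat_sections I 0" "nu 1 = 1"
  using rat_I[of 0 1 0 1 0] I_1 nu_Fract[of 1 1] by (simp_all add: One_fract_def fe_simps)

lemma rat_power: "s \<in> rat_sections I 0 \<Longrightarrow> s ^ k \<in> rat_sections I 0 \<and> nu (s ^ k) = nu s ^ k"
  using rat_1 rat_mult[of s 0 _ 0] by (induction k) auto

lemma rat_powi:
  assumes "s \<in> rat_sections I 0" "nu s \<noteq> 0"
  shows "s powi k \<in> rat_sections I 0 \<and> nu (s powi k) = nu s powi k"
  using rat_power[OF assms(1)] rat_power[OF rat_inverse(1)[OF assms]] rat_inverse[OF assms]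
  by (simp add: power_int_def)

text \<open>Equal twists make the numerator of \<open>s - t\<close> a form, and a form is killed by
  \<open>fe\<close> exactly when it lies in \<open>I\<close>.\<close>

lemma sect_eq_iff:
  assumes "s \<in> rat_sections I n" "t \<in> rat_sections I n"
  shows "sect_eq I s t \<longleftrightarrow> nu s = nu t"
proof -
  obtain F G d e where s: "s = Fract F G" "is_form e F" "is_form d G" "G \<notin> I" "int e = int d + n" "fe G \<noteq> 0" "nu s = fe F / fe G"
    by (rule rat_E[OF assms(1)])
  obtain F' G' d' e' where t: "t = Fract F' G'" "is_form e' F'" "is_form d' G'" "G' \<notin> I" "int e' = int d' + n" "fe G' \<noteq> 0" "nu t = fe F' / fe G'"
    by (rule rat_E[OF assms(2)])
  have nz: "G \<noteq> 0" "G' \<noteq> 0" using s t fe_nz by auto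
  have st: "s - t = Fract (F * G' - F' * G) (G * G')" using s(1) t(1) nz by simp
  have eq: "nu s = nu t \<longleftrightarrow> fe (F * G' - F' * G) = 0"
    using s(6,7) t(6,7) by (simp add: fe_simps frac_eq_eq)
  show ?thesis
  proof
    assume "sect_eq I s t"
    then obtain A B where AB: "A \<in> I" "B \<notin> I" "s - t = Fract A B" by (auto simp: sect_eq_def)
    moreover have "B \<noteq> 0" using AB(2) I_0 by blast
    ultimately have "(F * G' - F' * G) * B = A * (G * G')" using st nz by (simp add: eq_fract)
    then have "(F * G' - F' * G) * B \<in> I" using I_mult2[OF AB(1)] by metis
    then show "nu s = nu t" unfolding eq using I_prime AB(2) fe_I by blast
  next
    assume "nu s = nu t"
    moreover have deg: "e + d' = e' + d" using s(5) t(5) by linarith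
    have "is_form (e + d') (F * G' - F' * G)"
      by (rule is_form_diff[OF is_form_mult[OF s(2) t(3) refl] is_form_mult[OF t(2) s(3) deg]])
    ultimately have "F * G' - F' * G \<in> I" unfolding eq using fe_form_eq_0 by blast
    moreover have "G * G' \<notin> I" using s t I_prime by blast
    ultimately show "sect_eq I s t" using st unfolding sect_eq_def by blast
  qed
qed

lemma rat_0: "0 \<in> rat_sections I n" "nu 0 = 0"
proof -
  have f: "is_form d (0 :: 'a poly4)" for d by simp
  have nI: "Var4 i0 ^ k \<notin> I" for k using I_power Var4_notin_I[OF O_geom O_i0] by blast
  have z: "(0 :: 'a poly4 fract) = Fract 0 (Var4 i0 ^ nat (- n))" by (simp add: Zero_fract_def eq_fract Var4_nonzero)
  show "0 \<in> rat_sections I n" by (subst z, rule rat_I[OF f is_form_Var4_power nI, of "nat n"]) simp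
  show "nu 0 = 0" using nu_Fract[of 1 0] by (simp add: Zero_fract_def fe_simps)
qed

lemma nu_KK: "s \<in> rat_sections I 0 \<Longrightarrow> nu s \<in> KK"
  by (erule rat_E) (auto intro: KK_form)

lemma KK_nu: assumes "x \<in> KK" obtains s where "s \<in> rat_sections I 0" "nu s = x"
proof -
  obtain d F G where FG: "is_form d F" "is_form d G" "G \<notin> I" "x = fe F / fe G" by (rule KK_formsE[OF assms])
  then show thesis using that[of "Fract F G"] rat_I[of d F d G 0] nu_Fract[of G F] fe_form_eq_0 by auto
qed

lemma stalk_I:
  assumes "P \<in> geom_points I" "s \<in> rat_sections I n" "is_form e F" "is_form d G" "int e = int d + n" "pev P G \<noteq> 0" "nu s = fe F / fe G"
  shows "s \<in> stalk I n P"
proof -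
  have "G \<notin> I" using pev_notin_I assms by blast
  then have "Fract F G \<in> rat_sections I n" "fe G \<noteq> 0" using assms rat_I fe_form_eq_0 by auto
  then have "sect_eq I s (Fract F G)" using assms(2,7) by (simp add: sect_eq_iff nu_Fract)
  then show ?thesis using assms vanishes_pev unfolding stalk_def by blast
qed

lemma stalk_E:
  assumes "P \<in> geom_points I" "s \<in> stalk I n P"
  obtains F G d e where "s \<in> rat_sections I n" "is_form e F" "is_form d G" "int e = int d + n" "pev P G \<noteq> 0" "nu s = fe F / fe G"
proof -
  obtain F G d e where s: "s \<in> rat_sections I n" "is_form e F" "is_form d G" "int e = int d + n" "\<not> vanishes_at G P" "sect_eq I s (Fract F G)"
    using assms(2) by (auto simp: stalk_def)
  then have p: "pev P G \<noteq> 0" using vanishes_pev by blast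
  then have "G \<notin> I" using pev_notin_I assms(1) s(3) by blast
  then have "Fract F G \<in> rat_sections I n" "fe G \<noteq> 0" using s rat_I fe_form_eq_0 by auto
  then have "nu s = fe F / fe G" using s(1,6) by (simp add: sect_eq_iff nu_Fract)
  then show thesis using that s p by blast
qed

lemma stalk_0: assumes P: "P \<in> geom_points I"
  shows "s \<in> stalk I 0 P \<longleftrightarrow> s \<in> rat_sections I 0 \<and> nu s \<in> LR P"
proof
  assume "s \<in> stalk I 0 P"
  from stalk_E[OF P this] show "s \<in> rat_sections I 0 \<and> nu s \<in> LR P"
    by (metis LR_form_I(1)[OF P] add.right_neutral of_nat_eq_iff)
next
  assume s: "s \<in> rat_sections I 0 \<and> nu s \<in> LR P"
  then obtain d F G where FG: "is_form d F" "is_form d G" "pev P G \<noteq> 0" "nu s = fe F / fe G" using LR_forms[OF P] by metis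
  then show "s \<in> stalk I 0 P" using s stalk_I[OF P _ FG(1,2) _ FG(3,4)] by simp
qed

lemma max_ideal_iff: assumes P: "P \<in> geom_points I"
  shows "s \<in> max_ideal I P \<longleftrightarrow> s \<in> rat_sections I 0 \<and> nu s \<in> LR P \<and> res P (nu s) = 0"
proof
  assume "s \<in> max_ideal I P"
  then obtain F G d where s: "s \<in> rat_sections I 0" "is_form d F" "is_form d G" "\<not> vanishes_at G P" "vanishes_at F P" "sect_eq I s (Fract F G)"
    by (auto simp: max_ideal_def)
  then have p: "pev P G \<noteq> 0" "pev P F = 0" using vanishes_pev by blast+
  then have "G \<notin> I" using pev_notin_I P s(3) by blast
  then have "Fract F G \<in> rat_sections I 0" "fe G \<noteq> 0" using s rat_I[of d F d G 0] fe_form_eq_0 by auto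
  then have "nu s = fe F / fe G" using s(1,6) by (simp add: sect_eq_iff nu_Fract)
  then show "s \<in> rat_sections I 0 \<and> nu s \<in> LR P \<and> res P (nu s) = 0"
    using LR_form_I[OF P s(2,3) p(1)] s(1) p(2) by simp
next
  assume s: "s \<in> rat_sections I 0 \<and> nu s \<in> LR P \<and> res P (nu s) = 0"
  then obtain d F G where FG: "is_form d F" "is_form d G" "pev P G \<noteq> 0" "nu s = fe F / fe G" "res P (nu s) = pev P F / pev P G"
    using LR_forms[OF P] by metis
  then have "G \<notin> I" using pev_notin_I P by blast
  then have "Fract F G \<in> rat_sections I 0" "fe G \<noteq> 0" using FG rat_I[of d F d G 0] fe_form_eq_0 by auto
  then have "sect_eq I s (Fract F G)" using sect_eq_iff[of s 0 "Fract F G"] s FG(4) by (simp add: nu_Fract)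
  moreover have "pev P F = 0" using FG s by auto
  ultimately show "s \<in> max_ideal I P" using s FG vanishes_pev unfolding max_ideal_def by blast
qed

lemma uniformizer_iff: assumes P: "P \<in> geom_points I"
  shows "uniformizer I P t \<longleftrightarrow> t \<in> rat_sections I 0 \<and> gen P (nu t)"
proof
  assume t: "uniformizer I P t"
  then have tr: "t \<in> rat_sections I 0" "nu t \<in> LR P" "res P (nu t) = 0" by (auto simp: uniformizer_def max_ideal_iff[OF P])
  have "\<exists>y\<in>LR P. x = y * nu t" if x: "x \<in> LR P" "res P x = 0" for x
  proof -
    obtain s where s: "s \<in> rat_sections I 0" "nu s = x" using KK_nu[OF LR_KK[OF P x(1)]] by blast
    then have "s \<in> max_ideal I P" using x by (simp add: max_ideal_iff[OF P])
    then obtain g where g: "g \<in> stalk I 0 P" "sect_eq I s (g * t)" using t by (auto simp: uniformizer_def)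
    then have gr: "g \<in> rat_sections I 0" "nu g \<in> LR P" by (auto simp: stalk_0[OF P])
    have "nu s = nu g * nu t" using g(2) sect_eq_iff[OF s(1), of "g * t"] rat_mult[OF gr(1) tr(1)] by simp
    then show ?thesis using gr(2) s(2) by blast
  qed
  then show "t \<in> rat_sections I 0 \<and> gen P (nu t)" using tr by (auto simp: gen_def)
next
  assume t: "t \<in> rat_sections I 0 \<and> gen P (nu t)"
  have "\<exists>g\<in>stalk I 0 P. sect_eq I s (g * t)" if s: "s \<in> max_ideal I P" for s
  proof -
    have sr: "s \<in> rat_sections I 0" "nu s \<in> LR P" "res P (nu s) = 0" using s by (auto simp: max_ideal_iff[OF P])
    then obtain y where y: "y \<in> LR P" "nu s = y * nu t" using t by (auto simp: gen_def)
    obtain g where g: "g \<in> rat_sections I 0" "nu g = y" using KK_nu[OF LR_KK[OF P y(1)]] by blast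
    have "sect_eq I s (g * t)" using sect_eq_iff[OF sr(1), of "g * t"] rat_mult[OF g(1), of t 0] t y g by simp
    then show ?thesis using g y by (auto simp: stalk_0[OF P])
  qed
  then show "uniformizer I P t" using t by (auto simp: uniformizer_def max_ideal_iff[OF P] gen_def)
qed

lemma gen_nz: assumes P: "P \<in> geom_points I" and t: "gen P t" shows "t \<noteq> 0"
proof
  assume t0: "t = 0"
  obtain t1 where "gen P t1" "t1 \<noteq> 0" using ex_gen[OF P] by blast
  then show False using t t0 by (auto simp: gen_def)
qed

text \<open>Under \<open>nu\<close> the conditions on \<open>n\<close> in the two definite
  descriptions become equivalent.\<close>

lemma ord_at_eq:
  assumes P: "P \<in> geom_points I" and f: "f \<in> rat_sections I 0"
  shows "ord_at I P f = ordK P (nu f)"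
proof -
  have "(\<exists>t u. uniformizer I P t \<and> u \<in> stalk I 0 P - max_ideal I P \<and> sect_eq I f (u * t powi n))
     \<longleftrightarrow> (\<exists>t u. gen P t \<and> u \<in> units P \<and> nu f = u * t powi n)" for n
  proof
    assume "\<exists>t u. uniformizer I P t \<and> u \<in> stalk I 0 P - max_ideal I P \<and> sect_eq I f (u * t powi n)"
    then obtain t u where t: "t \<in> rat_sections I 0" "gen P (nu t)"
      and u: "u \<in> rat_sections I 0" "nu u \<in> units P" and e: "sect_eq I f (u * t powi n)"
      by (auto simp: uniformizer_iff[OF P] stalk_0[OF P] max_ideal_iff[OF P] units_def)
    have tp: "t powi n \<in> rat_sections I 0" "nu (t powi n) = nu t powi n" using rat_powi[OF t(1) gen_nz[OF P t(2)]] by auto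
    have "nu f = nu u * nu t powi n" using e sect_eq_iff[OF f, of "u * t powi n"] rat_mult[OF u(1) tp(1)] tp(2) by simp
    then show "\<exists>t u. gen P t \<and> u \<in> units P \<and> nu f = u * t powi n" using t u by blast
  next
    assume "\<exists>t u. gen P t \<and> u \<in> units P \<and> nu f = u * t powi n"
    then obtain t' u' where t': "gen P t'" "u' \<in> units P" "nu f = u' * t' powi n" by blast
    obtain t where t: "t \<in> rat_sections I 0" "nu t = t'" using KK_nu[OF LR_KK[OF P, of t']] t'(1) by (auto simp: gen_def)
    obtain u where u: "u \<in> rat_sections I 0" "nu u = u'" using KK_nu[OF LR_KK[OF P, of u']] t'(2) by (auto simp: units_def)
    have tp: "t powi n \<in> rat_sections I 0" "nu (t powi n) = t' powi n" using rat_powi[OF t(1)] gen_nz[OF P t'(1)] t by auto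
    have "sect_eq I f (u * t powi n)" using sect_eq_iff[OF f, of "u * t powi n"] rat_mult[OF u(1) tp(1)] tp(2) u(2) t'(3) by simp
    then show "\<exists>t u. uniformizer I P t \<and> u \<in> stalk I 0 P - max_ideal I P \<and> sect_eq I f (u * t powi n)"
      using t t' u by (auto simp: uniformizer_iff[OF P] stalk_0[OF P] max_ideal_iff[OF P] units_def)
  qed
  then show ?thesis unfolding ord_at_def ordK_def by simp
qed

text \<open>The functions that are regular away from the origin.\<close>

definition RR :: "'a fls set" where
  "RR = {x \<in> KK. \<forall>P\<in>geom_points I. P \<noteq> O_pt \<longrightarrow> x \<in> LR P}"

lemma RR_KK: "x \<in> RR \<Longrightarrow> x \<in> KK"
  by (simp add: RR_def)

lemma RR_LR: "x \<in> RR \<Longrightarrow> P \<in> geom_points I \<Longrightarrow> P \<noteq> O_pt \<Longrightarrow> x \<in> LR P"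
  by (simp add: RR_def)

lemma RR_const: "fls_const c \<in> RR"
  by (simp add: RR_def KK_const LR_const)

lemma RR_add: "x \<in> RR \<Longrightarrow> y \<in> RR \<Longrightarrow> x + y \<in> RR"
  by (simp add: RR_def KK_add LR_add)

lemma RR_mult: "x \<in> RR \<Longrightarrow> y \<in> RR \<Longrightarrow> x * y \<in> RR"
  by (simp add: RR_def KK_mult LR_mult)

lemma RR_diff: "x \<in> RR \<Longrightarrow> y \<in> RR \<Longrightarrow> x - y \<in> RR"
  by (simp add: RR_def KK_diff LR_diff)

lemma RR_power: "x \<in> RR \<Longrightarrow> x ^ n \<in> RR"
  using RR_const[of 1] by (induction n) (simp_all add: RR_mult)

end

section \<open>The hyperplane section at the origin\<close>

locale embedded_curve = pointed_curve +
  assumes normal: "projectively_normal I"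
    and sheaf_iso: "sheaf_isomorphic I (twisting_sheaf I 1) (divisor_sheaf I (\<lambda>P. 4 * point_divisor p0 P))"
begin

lemma point_divisor_O: "point_divisor p0 P = (if P = O_pt then 1 else 0)"
  by (simp add: point_divisor_def O_pt_def)

lemma linear_rat: "is_form 1 F \<Longrightarrow> Fract F 1 \<in> rat_sections I 1" "nu (Fract F 1) = fe F"
  using rat_I[of 1 F 0 1 1] I_1 nu_Fract[of 1 F] by (simp_all add: fe_simps)

lemma linear_twisting:
  assumes "is_form 1 F" "U \<subseteq> geom_points I"
  shows "Fract F 1 \<in> twisting_sheaf I 1 U"
proof -
  have "Fract F 1 \<in> stalk I 1 P" if P: "P \<in> geom_points I" for P
    by (rule stalk_I[OF P linear_rat(1)[OF assms(1)] assms(1) is_form_1])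
      (simp_all add: pev_simps fe_simps linear_rat(2))
  then show ?thesis using assms(2) linear_rat(1)[OF assms(1)] unfolding twisting_sheaf_def by blast
qed

lemma divisor_sheaf_iff:
  assumes "U \<subseteq> geom_points I"
  shows "f \<in> divisor_sheaf I (\<lambda>P. 4 * point_divisor p0 P) U \<longleftrightarrow>
    f \<in> rat_sections I 0 \<and> (nu f = 0 \<or> (\<forall>P\<in>U. ordK P (nu f) \<ge> (if P = O_pt then - 4 else 0)))"
proof (cases "f \<in> rat_sections I 0")
  case True
  have "sect_eq I f 0 \<longleftrightarrow> nu f = 0" using sect_eq_iff[OF True rat_0(1)] rat_0(2) by simp
  then show ?thesis using True ord_at_eq[OF _ True] assms
    by (auto simp: divisor_sheaf_def point_divisor_O subset_iff)
qed (simp add: divisor_sheaf_def)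

text \<open>On global linear forms the sheaf isomorphism multiplies by one fixed rational function.
  Surjectivity provides a linear form \<open>L\<close> that is sent to the constant 1, so this
  function is \<open>1 / L\<close>.\<close>

lemma linear_form_at_origin:
  "\<exists>L. is_form 1 L \<and> fe L \<noteq> 0 \<and> (\<forall>P\<in>geom_points I. P \<noteq> O_pt \<longrightarrow> pev P L \<noteq> 0) \<and> fls_subdegree (fe L) \<le> 4 \<and>
    (\<forall>x\<in>RR. (x \<noteq> 0 \<longrightarrow> fls_subdegree x \<ge> - 4) \<longrightarrow> (\<exists>F. is_form 1 F \<and> x = fe F / fe L))"
proof -
  let ?M = "twisting_sheaf I 1" and ?N = "divisor_sheaf I (\<lambda>P. 4 * point_divisor p0 P)"
  define W where "W = geom_points I"
  obtain \<phi> where \<phi>0: "\<forall>U. zariski_open I U \<and> U \<noteq> {} \<longrightarrow>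
         \<phi> U ` ?M U \<subseteq> ?N U \<and>
         (\<forall>s\<in>?M U. \<forall>t\<in>?M U. sect_eq I (\<phi> U s) (\<phi> U t) \<longleftrightarrow> sect_eq I s t) \<and>
         (\<forall>f\<in>?N U. \<exists>s\<in>?M U. sect_eq I (\<phi> U s) f) \<and>
         (\<forall>s\<in>?M U. \<forall>t\<in>?M U. sect_eq I (\<phi> U (s + t)) (\<phi> U s + \<phi> U t)) \<and>
         (\<forall>h\<in>twisting_sheaf I 0 U. \<forall>s\<in>?M U. sect_eq I (\<phi> U (h * s)) (h * \<phi> U s)) \<and>
         (\<forall>V. zariski_open I V \<and> V \<noteq> {} \<and> V \<subseteq> U \<longrightarrow>
            (\<forall>s\<in>?M U. sect_eq I (\<phi> V s) (\<phi> U s)))"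
    using sheaf_iso[unfolded sheaf_isomorphic_def] by (rule exE)
  note \<phi> = \<phi>0[THEN spec, THEN mp, OF conjI]
  note \<phi>N = \<phi>[THEN conjunct1]
    and \<phi>inj = \<phi>[THEN conjunct2, THEN conjunct1, THEN bspec, THEN bspec]
    and \<phi>sur = \<phi>[THEN conjunct2, THEN conjunct2, THEN conjunct1, THEN bspec]
    and \<phi>lin = \<phi>[THEN conjunct2, THEN conjunct2, THEN conjunct2, THEN conjunct2, THEN conjunct1, THEN bspec, THEN bspec]
    and \<phi>restr = \<phi>[THEN conjunct2, THEN conjunct2, THEN conjunct2, THEN conjunct2, THEN conjunct2, THEN spec, THEN mp, THEN bspec]
  have Wop: "zariski_open I W"
    unfolding zariski_open_def W_def
    by (rule exI[of _ "{1}"]) (auto simp: vanishes_at_def rhom_1[OF rhom_eval4] intro!: exI[of _ 0])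
  have Wne: "W \<noteq> {}" using O_geom by (auto simp: W_def)
  let ?s = "\<lambda>F. Fract F (1 :: 'a poly4)"
  define n where "n F = nu (\<phi> W (?s F))" for F
  have sM: "?s F \<in> ?M U" if "is_form 1 F" "U \<subseteq> W" for F U
    using linear_twisting that by (simp add: W_def)
  have NU: "f \<in> ?N U \<longleftrightarrow> f \<in> rat_sections I 0 \<and> (nu f = 0 \<or> (\<forall>P\<in>U. ordK P (nu f) \<ge> (if P = O_pt then - 4 else 0)))"
    if "U \<subseteq> W" for U f using divisor_sheaf_iff that by (simp add: W_def)
  have \<phi>r: "\<phi> U s \<in> rat_sections I 0" if "zariski_open I U" "U \<noteq> {}" "s \<in> ?M U" for U s
    using \<phi>N[OF that(1,2)] that(3) unfolding divisor_sheaf_def by blast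
  \<comment> \<open>On the open set where \<open>F\<close> does not vanish, \<open>G / F\<close> is
    a regular function and linearity over it applies; compatibility with restriction carries the
    relation back to the global sections.\<close>
  have A: "n G * fe F = fe G * n F" if F: "is_form 1 F" and G: "is_form 1 G" and P: "P \<in> W" "pev P F \<noteq> 0" for F G P
  proof -
    define U where "U = {Q \<in> W. \<not> vanishes_at F Q}"
    have Uop: "zariski_open I U" unfolding zariski_open_def U_def W_def using F by (intro exI[of _ "{F}"]) auto
    have Une: "U \<noteq> {}" using P vanishes_pev[OF F] by (auto simp: U_def)
    have UW: "U \<subseteq> W" by (auto simp: U_def)
    have FI: "F \<notin> I" "fe F \<noteq> 0" "F \<noteq> 0" using pev_notin_I[of P 1 F] P F fe_form_eq_0 fe_nz by (auto simp: W_def)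
    have hr: "Fract G F \<in> rat_sections I 0" using rat_I[OF G F FI(1)] by simp
    have "Fract G F \<in> stalk I 0 Q" if "Q \<in> U" for Q
      by (rule stalk_I[OF _ hr G F]) (use that nu_Fract[OF FI(2)] vanishes_pev[OF F] in \<open>simp_all add: U_def W_def\<close>)
    then have hT: "Fract G F \<in> twisting_sheaf I 0 U" using hr by (simp add: twisting_sheaf_def)
    have prod: "Fract G F * ?s F = ?s G" using FI(3) by (simp add: eq_fract)
    have "sect_eq I (\<phi> U (?s G)) (Fract G F * \<phi> U (?s F))" using \<phi>lin[OF Uop Une hT sM[OF F UW]] unfolding prod .
    moreover have r: "\<phi> U (?s G) \<in> rat_sections I 0" "\<phi> U (?s F) \<in> rat_sections I 0"
      "\<phi> W (?s G) \<in> rat_sections I 0" "\<phi> W (?s F) \<in> rat_sections I 0"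
      using \<phi>r[OF Uop Une sM[OF G UW]] \<phi>r[OF Uop Une sM[OF F UW]] \<phi>r[OF Wop Wne sM[OF G order_refl]]
        \<phi>r[OF Wop Wne sM[OF F order_refl]] by blast+
    ultimately have "nu (\<phi> U (?s G)) = (fe G / fe F) * nu (\<phi> U (?s F))"
      using sect_eq_iff[OF r(1), of "Fract G F * \<phi> U (?s F)"] rat_mult[OF hr r(2)] nu_Fract[OF FI(2)] by simp
    moreover have "nu (\<phi> U (?s H)) = n H" if "is_form 1 H" for H
    proof -
      have "sect_eq I (\<phi> U (?s H)) (\<phi> W (?s H))" using \<phi>restr[OF Wop Wne _ sM[OF that order_refl]] Uop Une UW by simp
      moreover have "\<phi> U (?s H) \<in> rat_sections I 0" "\<phi> W (?s H) \<in> rat_sections I 0"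
        using \<phi>r[OF Uop Une sM[OF that UW]] \<phi>r[OF Wop Wne sM[OF that order_refl]] by blast+
      ultimately show ?thesis unfolding n_def using sect_eq_iff[of "\<phi> U (?s H)" 0 "\<phi> W (?s H)"] by blast
    qed
    ultimately show ?thesis using F G FI(2) by simp
  qed
  \<comment> \<open>A preimage of \<open>x\<close> is a global section of the twisting sheaf, which
    projective normality represents by a linear form.\<close>
  have sur: "\<exists>F. is_form 1 F \<and> n F = x" if x: "x \<in> RR" "x \<noteq> 0 \<longrightarrow> fls_subdegree x \<ge> - 4" for x
  proof -
    obtain f where f: "f \<in> rat_sections I 0" "nu f = x" using KK_nu[OF RR_KK[OF x(1)]] by blast
    have "f \<in> ?N W" unfolding NU[OF order_refl] using f x ordK_O[OF RR_KK[OF x(1)]] ordK_nonneg_iff(1)[OF _ RR_KK[OF x(1)]] RR_LR[OF x(1)]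
      by (auto simp: W_def)
    then obtain s where s: "s \<in> ?M W" "sect_eq I (\<phi> W s) f" using \<phi>sur[OF Wop Wne] by blast
    obtain F where F: "is_form 1 F" "sect_eq I s (?s F)"
      using normal s(1) unfolding projectively_normal_def W_def by (metis of_nat_1)
    have "sect_eq I (\<phi> W s) (\<phi> W (?s F))" by (rule \<phi>inj[OF Wop Wne s(1) sM[OF F(1) order_refl], THEN iffD2, OF F(2)])
    then have "nu (\<phi> W s) = n F"
      unfolding n_def by (rule sect_eq_iff[OF \<phi>r[OF Wop Wne s(1)] \<phi>r[OF Wop Wne sM[OF F(1) order_refl]], THEN iffD1])
    moreover have "nu (\<phi> W s) = x" using sect_eq_iff[OF \<phi>r[OF Wop Wne s(1)] f(1), THEN iffD1, OF s(2)] f(2) by (rule trans)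
    ultimately have "n F = x" by (rule subst)
    with F(1) show ?thesis by (intro exI[of _ F] conjI)
  qed
  obtain L where L: "is_form 1 L" "n L = 1" using sur[of 1] RR_const[of 1] by auto
  have zO: "pev O_pt (Var4 i0) \<noteq> 0"
    using vanishes_pev[OF is_form_Var4[of i0], of O_pt] vanishes_at_iff[OF is_form_Var4[of i0] O_i0]
    by (simp add: peval_Var4[OF rhom_to_ac] nvec_self[OF O_i0])
  have z1: "is_form 1 (Var4 i0 :: 'a poly4)" using is_form_Var4 by simp
  have "1 = fe L * n (Var4 i0)" using A[OF z1 L(1) _ zO] O_geom L(2) by (simp add: fe_i0 W_def)
  then have L0: "fe L \<noteq> 0" and nz: "n (Var4 i0) = 1 / fe L" by (auto simp: eq_divide_eq mult.commute)
  have nF: "n F = fe F / fe L" if "is_form 1 F" for F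
    using A[OF z1 that _ zO] O_geom nz by (simp add: fe_i0 W_def)
  have bound: "ordK P (n F) \<ge> (if P = O_pt then - 4 else 0)" if "is_form 1 F" "P \<in> W" "n F \<noteq> 0" for F P
  proof -
    have "\<phi> W (?s F) \<in> ?N W" using \<phi>N[OF Wop Wne] sM[OF that(1) order_refl] by blast
    then show ?thesis using that(2,3) unfolding NU[OF order_refl] n_def by blast
  qed
  have nKK: "n F \<in> KK" if "is_form 1 F" for F
    using nu_KK[OF \<phi>r[OF Wop Wne sM[OF that order_refl]]] by (simp add: n_def)
  \<comment> \<open>At a zero \<open>P\<close> of \<open>L\<close> other than the origin, the
    quotient by \<open>L\<close> of a coordinate not vanishing at \<open>P\<close> would be in the
    image of the isomorphism and yet have a pole at \<open>P\<close>.\<close>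
  have "pev P L \<noteq> 0" if P: "P \<in> geom_points I" "P \<noteq> O_pt" for P
  proof
    assume LP: "pev P L = 0"
    have F: "is_form 1 (Var4 (ch P) :: 'a poly4)" using is_form_Var4 by simp
    have FP: "pev P (Var4 (ch P)) \<noteq> 0" by (simp add: pev_def pt_val_Var4 nvec_self[OF ch])
    let ?x = "fe L / fe (Var4 (ch P))"
    have x: "?x \<in> LR P" "res P ?x = 0" using LR_form_I[OF P(1) L(1) F FP] LP by simp_all
    have F0: "fe (Var4 (ch P)) \<noteq> 0" using fe_form_eq_0[OF F] pev_notin_I[OF P(1) F FP] by simp
    have "ordK P ?x \<ge> 1" using ordK_nonneg_iff(2)[OF P(1) LR_KK[OF P(1) x(1)]] x L0 F0 by simp
    moreover have "inverse ?x = n (Var4 (ch P))" using nF[OF F] by simp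
    then have "ordK P (n (Var4 (ch P))) = - ordK P ?x"
      using ordK_inverse[OF P(1) LR_KK[OF P(1) x(1)]] L0 F0 by simp
    moreover have "n (Var4 (ch P)) \<noteq> 0" using nF[OF F] L0 F0 by simp
    ultimately show False using bound[OF F, of P] P by (simp add: W_def)
  qed
  moreover have "fls_subdegree (fe L) \<le> 4"
  proof -
    have "ordK O_pt (n (Var4 i0)) \<ge> - 4" using bound[OF z1, of O_pt] O_geom L0 nz by (simp add: W_def)
    moreover have "n (Var4 i0) \<in> KK" "n (Var4 i0) \<noteq> 0" using nKK[OF z1] nz L0 by simp_all
    then have "ordK O_pt (n (Var4 i0)) = fls_subdegree (1 / fe L)" using ordK_O nz by simp
    ultimately show ?thesis using L0 by (simp add: fls_divide_subdegree)
  qed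
  moreover have "\<exists>F. is_form 1 F \<and> x = fe F / fe L" if x: "x \<in> RR" "x \<noteq> 0 \<longrightarrow> fls_subdegree x \<ge> - 4" for x
  proof -
    obtain F where F: "is_form 1 F" "n F = x" using sur[OF x] by (elim exE conjE)
    have "x = fe F / fe L" using nF[OF F(1)] F(2) by (rule subst[rotated])
    with F(1) show ?thesis by (intro exI[of _ F] conjI)
  qed
  ultimately show ?thesis using L(1) L0 by (intro exI[where x = L]) simp
qed

definition L0 :: "'a poly4" where
  "L0 = (SOME L. is_form 1 L \<and> fe L \<noteq> 0 \<and> (\<forall>P\<in>geom_points I. P \<noteq> O_pt \<longrightarrow> pev P L \<noteq> 0) \<and> fls_subdegree (fe L) \<le> 4 \<and>
    (\<forall>x\<in>RR. (x \<noteq> 0 \<longrightarrow> fls_subdegree x \<ge> - 4) \<longrightarrow> (\<exists>F. is_form 1 F \<and> x = fe F / fe L)))"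

definition "l0 = fe L0"

lemma L0: "is_form 1 L0" "l0 \<noteq> 0" "P \<in> geom_points I \<Longrightarrow> P \<noteq> O_pt \<Longrightarrow> pev P L0 \<noteq> 0" "fls_subdegree l0 \<le> 4"
  "x \<in> RR \<Longrightarrow> (x \<noteq> 0 \<Longrightarrow> fls_subdegree x \<ge> - 4) \<Longrightarrow> \<exists>F. is_form 1 F \<and> x = fe F / l0"
  using someI_ex[OF linear_form_at_origin, folded L0_def] unfolding l0_def by blast+

definition "m0 = nat (fls_subdegree l0)"

lemma fe_subdegree: "fls_subdegree (fe F) \<ge> 0"
  by (simp add: fe_def fls_subdegree_fls_to_fps)

lemma m0: "fls_subdegree l0 = int m0" "m0 \<le> 4"
  using fe_subdegree[of L0] L0(4) by (simp_all add: m0_def l0_def)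

lemma form_RR: assumes F: "is_form n F" shows "fe F / l0 ^ n \<in> RR" "fe F \<noteq> 0 \<Longrightarrow> fls_subdegree (fe F / l0 ^ n) \<ge> - int (m0 * n)"
proof -
  have Ln: "is_form n (L0 ^ n)" by (rule is_form_power[OF L0(1)]) simp
  have e: "fe F / l0 ^ n = fe F / fe (L0 ^ n)" by (simp add: l0_def fe_simps)
  have "L0 ^ n \<notin> I" using fe_form_eq_0[OF Ln] L0(2) by (simp add: l0_def fe_simps)
  then show "fe F / l0 ^ n \<in> RR" unfolding e RR_def
    using KK_form[OF F Ln] LR_form_I(1)[OF _ F Ln] L0(3) by (auto simp: pev_simps)
  show "fls_subdegree (fe F / l0 ^ n) \<ge> - int (m0 * n)" if "fe F \<noteq> 0"
    using that L0(2) fe_subdegree[of F] by (simp add: fls_divide_subdegree fls_subdegree_pow m0(1) mult.commute)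
qed

text \<open>The product \<open>x * l0 ^ n\<close> is a regular section of the \<open>n\<close>-th
  twist: away from the origin because \<open>x\<close> is regular there, at the origin by the bound
  on the pole. Projective normality makes it a form.\<close>

lemma RR_form:
  assumes x: "x \<in> RR" and deg: "x \<noteq> 0 \<Longrightarrow> fls_subdegree x \<ge> - int (m0 * n)"
  obtains F where "is_form n F" "x = fe F / l0 ^ n"
proof -
  obtain d A C where AC: "is_form d A" "is_form d C" "C \<notin> I" "x = fe A / fe C" by (rule KK_formsE[OF RR_KK[OF x]])
  have C: "fe C \<noteq> 0" using AC fe_form_eq_0 by blast
  have Ln: "is_form n (L0 ^ n)" by (rule is_form_power[OF L0(1)]) simp
  define s where "s = Fract (A * L0 ^ n) C"
  have sr: "s \<in> rat_sections I (int n)" unfolding s_def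
    by (rule rat_I[OF is_form_mult[OF AC(1) Ln refl] AC(2,3)]) simp
  have nus: "nu s = x * l0 ^ n" unfolding s_def using nu_Fract[OF C] AC(4) by (simp add: fe_simps l0_def)
  have "s \<in> stalk I (int n) P" if P: "P \<in> geom_points I" for P
  proof (cases "P = O_pt")
    case False
    obtain e F G where FG: "is_form e F" "is_form e G" "pev P G \<noteq> 0" "x = fe F / fe G"
      using LR_forms[OF P RR_LR[OF x P False]] by metis
    show ?thesis
      by (rule stalk_I[OF P sr is_form_mult[OF FG(1) Ln refl] FG(2) _ FG(3)])
        (simp_all add: nus FG(4) fe_simps l0_def)
  next
    case True
    let ?y = "x * l0 ^ n"
    have "l0 \<in> KK" unfolding KK_def mem_Collect_eq
      by (rule exI[of _ L0], rule exI[of _ 1]) (simp add: l0_def fe_simps)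
    then have y: "?y \<in> KK" using RR_KK[OF x] by (intro KK_mult KK_power)
    have "?y \<in> LR O_pt"
    proof (cases "x = 0")
      case True
      then show ?thesis using LR_const(1)[of 0] by simp
    next
      case False
      then have "fls_subdegree ?y \<ge> 0" using deg L0(2) by (simp add: fls_subdegree_pow m0(1) mult.commute)
      then show ?thesis using ordK_nonneg_iff(1)[OF O_geom y] ordK_O[OF y] False L0(2) by simp
    qed
    then obtain e F G where FG: "is_form e F" "is_form e G" "pev O_pt G \<noteq> 0" "?y = fe F / fe G"
      using LR_forms[OF O_geom] by metis
    \<comment> \<open>Since \<open>fe (Var4 i0) = 1\<close>, the factor \<open>Var4 i0 ^ n\<close>
      raises the degree of the numerator without changing the expansion.\<close>
    show ?thesis unfolding True
      by (rule stalk_I[OF O_geom sr is_form_mult[OF FG(1) is_form_Var4_power[of n i0] refl] FG(2) _ FG(3)])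
        (simp_all add: nus FG(4) fe_simps fe_i0)
  qed
  then have "s \<in> twisting_sheaf I (int n) (geom_points I)" using sr by (simp add: twisting_sheaf_def)
  then obtain F where F: "is_form n F" "sect_eq I s (Fract F 1)" using normal unfolding projectively_normal_def by blast
  have "Fract F 1 \<in> rat_sections I (int n)" by (rule rat_I[OF F(1) is_form_1 I_1]) simp
  then have "nu s = fe F" using F(2) sr nu_Fract[of 1 F] by (simp add: sect_eq_iff fe_simps)
  then have "x = fe F / l0 ^ n" using nus L0(2) by (simp add: eq_divide_eq)
  then show thesis by (rule that[OF F(1)])
qed

end

section \<open>Counting pole orders\<close>

notation fls_nth (infixl "$$" 75)

text \<open>Gaussian elimination: an equation with a nonzero pivot \<open>M \<sigma> a0\<close>
  removes the unknown \<open>a0\<close> from the others.\<close>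

lemma nontrivial_solution:
  fixes M :: "'s \<Rightarrow> 'b \<Rightarrow> 'a::field"
  assumes "finite S" "finite A" "card S < card A"
  shows "\<exists>c. (\<exists>a\<in>A. c a \<noteq> 0) \<and> (\<forall>\<sigma>\<in>S. (\<Sum>a\<in>A. c a * M \<sigma> a) = 0)"
  using assms
proof (induction S arbitrary: A M rule: finite_induct)
  case empty
  then obtain a where "a \<in> A" by fastforce
  then show ?case by (intro exI[of _ "\<lambda>_. 1"]) auto
next
  case (insert \<sigma> S)
  show ?case
  proof (cases "\<forall>a\<in>A. M \<sigma> a = 0")
    case True
    have "card S < card A" using insert.prems(2) insert.hyps by simp
    then obtain c where "\<exists>a\<in>A. c a \<noteq> 0" "\<forall>\<sigma>\<in>S. (\<Sum>a\<in>A. c a * M \<sigma> a) = 0"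
      using insert.IH[OF insert.prems(1), of M] by blast
    then show ?thesis using True by (intro exI[of _ c]) auto
  next
    case False
    then obtain a0 where a0: "a0 \<in> A" "M \<sigma> a0 \<noteq> 0" by blast
    define M' where "M' \<tau> a = M \<tau> a - M \<tau> a0 * (M \<sigma> a / M \<sigma> a0)" for \<tau> a
    have "card S < card (A - {a0})" using insert.prems insert.hyps a0 by simp
    then obtain c where c: "\<exists>a\<in>A - {a0}. c a \<noteq> 0" "\<forall>\<tau>\<in>S. (\<Sum>a\<in>A - {a0}. c a * M' \<tau> a) = 0"
      using insert.IH[of "A - {a0}" M'] insert.prems(1) by blast
    define s where "s = (\<Sum>a\<in>A - {a0}. c a * (M \<sigma> a / M \<sigma> a0))"
    define d where "d a = (if a = a0 then - s else c a)" for a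
    have sum: "(\<Sum>a\<in>A. d a * M \<tau> a) = (\<Sum>a\<in>A - {a0}. c a * M \<tau> a) - s * M \<tau> a0" for \<tau>
    proof -
      have "(\<Sum>a\<in>A. d a * M \<tau> a) = d a0 * M \<tau> a0 + (\<Sum>a\<in>A - {a0}. d a * M \<tau> a)"
        using insert.prems(1) a0(1) by (rule sum.remove)
      also have "(\<Sum>a\<in>A - {a0}. d a * M \<tau> a) = (\<Sum>a\<in>A - {a0}. c a * M \<tau> a)"
        by (intro sum.cong) (auto simp: d_def)
      finally show ?thesis by (simp add: d_def)
    qed
    have "(\<Sum>a\<in>A. d a * M \<tau> a) = 0" if "\<tau> \<in> insert \<sigma> S" for \<tau>
    proof (cases "\<tau> = \<sigma>")
      case True
      have "s * M \<sigma> a0 = (\<Sum>a\<in>A - {a0}. c a * M \<sigma> a)"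
        unfolding s_def sum_distrib_right using a0(2) by (intro sum.cong) auto
      then show ?thesis using sum True by simp
    next
      case False
      have "(\<Sum>a\<in>A - {a0}. c a * M \<tau> a) - s * M \<tau> a0 = (\<Sum>a\<in>A - {a0}. c a * M' \<tau> a)"
        unfolding s_def M'_def sum_distrib_right sum_subtractf[symmetric] by (intro sum.cong) (auto simp: algebra_simps)
      then show ?thesis using sum c(2) False that by simp
    qed
    moreover have "\<exists>a\<in>A. d a \<noteq> 0" using c(1) by (auto simp: d_def)
    ultimately show ?thesis by blast
  qed
qed

text \<open>Among the terms with nonzero coefficient, the one of least subdegree has a leading term
  that nothing can cancel.\<close>

lemma distinct_subdegree_independent:
  fixes f :: "'b \<Rightarrow> 'a::field fls"
  assumes A: "finite A" and inj: "inj_on (\<lambda>a. fls_subdegree (f a)) A" and nz: "\<And>a. a \<in> A \<Longrightarrow> f a \<noteq> 0"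
    and s: "(\<Sum>a\<in>A. fls_const (c a) * f a) = 0" and a: "a \<in> A"
  shows "c a = 0"
proof (rule ccontr)
  assume ca: "c a \<noteq> 0"
  define B where "B = {a \<in> A. c a \<noteq> 0}"
  have B: "finite B" "B \<noteq> {}" using A a ca by (auto simp: B_def)
  then obtain b where b: "b \<in> B" "\<And>x. x \<in> B \<Longrightarrow> fls_subdegree (f b) \<le> fls_subdegree (f x)"
    using arg_min_if_finite[OF B, of "\<lambda>x. fls_subdegree (f x)"] arg_min_least[OF B, of _ "\<lambda>x. fls_subdegree (f x)"] by metis
  let ?n = "fls_subdegree (f b)"
  have nth: "(fls_const x * g) $$ n = x * g $$ n" for x and g :: "'a fls" and n by simp
  have "0 = (\<Sum>x\<in>A. fls_const (c x) * f x) $$ ?n" using s by simp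
  also have "\<dots> = (\<Sum>x\<in>A. c x * f x $$ ?n)" by (simp add: fls_nth_sum nth)
  also have "\<dots> = (\<Sum>x\<in>A. if x = b then c b * f b $$ ?n else 0)"
  proof (rule sum.cong[OF refl])
    fix x assume x: "x \<in> A"
    have "f x $$ ?n = 0" if "x \<noteq> b" "c x \<noteq> 0"
    proof -
      have "fls_subdegree (f x) \<noteq> ?n" using inj x b(1) that(1) by (auto simp: inj_on_def B_def)
      moreover have "?n \<le> fls_subdegree (f x)" using b(2)[of x] x that(2) by (simp add: B_def)
      ultimately show ?thesis by simp
    qed
    then show "c x * f x $$ ?n = (if x = b then c b * f b $$ ?n else 0)" by auto
  qed
  also have "\<dots> = c b * f b $$ ?n" using A b(1) by (simp add: B_def)
  finally show False using nth_fls_subdegree_nonzero[of "f b"] nz[of b] b(1) by (auto simp: B_def)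
qed

text \<open>Beyond the gaps, the count up to \<open>m * n\<close> is \<open>m * n + 1\<close> minus
  the number of gaps. Comparison with \<open>d * n\<close> for two consecutive \<open>n\<close>
  gives \<open>m = d\<close> and a single gap; and 1 is a gap as soon as there is any.\<close>

lemma numerical_semigroup_one_gap:
  fixes S :: "nat set"
  assumes S0: "0 \<in> S" and add: "\<And>a b. a \<in> S \<Longrightarrow> b \<in> S \<Longrightarrow> a + b \<in> S" and p: "p \<in> S" "Suc p \<in> S"
    and m: "m > 0" and card: "\<And>n. n \<ge> n0 \<Longrightarrow> card (S \<inter> {..m * n}) = d * n"
  shows "S = - {1}"
proof -
  have mult: "k * a \<in> S" if "a \<in> S" for k a
    using that S0 add by (induction k) auto
  \<comment> \<open>For positive \<open>p\<close> and \<open>n\<close> at least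
    \<open>p * p\<close>, the decomposition
    \<open>n = (n div p - n mod p) * p + n mod p * Suc p\<close> has nonnegative coefficients, so
    all gaps lie below \<open>K\<close>.\<close>
  define K where "K = p * p"
  have big: "n \<in> S" if "n \<ge> K" for n
  proof (cases "p = 0")
    case True
    then show ?thesis using mult[OF p(2), of n] by simp
  next
    case False
    then have "n mod p < p" by simp
    moreover have "n div p \<ge> p" using that False unfolding K_def by (metis div_le_mono nonzero_mult_div_cancel_right)
    ultimately have "(n div p - n mod p) * p + n mod p * Suc p = n div p * p + n mod p"
      by (simp add: diff_mult_distrib algebra_simps)
    then have "n = (n div p - n mod p) * p + n mod p * Suc p" by simp
    then show ?thesis using add[OF mult[OF p(1)] mult[OF p(2)]] by metis
  qed
  define G where "G = {..<K} - S"
  have count: "m * n + 1 = d * n + card G" if "n \<ge> n0" "n \<ge> K" for n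
  proof -
    have "K \<le> m * n" using that(2) m by (metis mult_le_mono1 le_trans Suc_leI One_nat_def mult_1)
    then have e: "{..m * n} = (S \<inter> {..m * n}) \<union> G" using big by (auto simp: G_def not_le)
    have "card {..m * n} = card (S \<inter> {..m * n}) + card G"
      by (subst e, rule card_Un_disjoint) (auto simp: G_def)
    then show ?thesis using card[OF that(1)] by simp
  qed
  have "card G = 1"
  proof -
    let ?n = "n0 + K"
    have "m * ?n + 1 = d * ?n + card G" "m * Suc ?n + 1 = d * Suc ?n + card G" by (rule count; simp)+
    then have "m = d" by simp
    then show ?thesis using count[of ?n] by simp
  qed
  then obtain g where g: "G = {g}" by (rule card_1_singletonE)
  have "1 \<notin> S"
  proof
    assume "1 \<in> S"
    then have "g \<in> S" using mult[of 1 g] by simp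
    then show False using g by (auto simp: G_def)
  qed
  then have "1 \<in> G" using big by (auto simp: G_def not_le[symmetric])
  then have "G = {1}" using g by auto
  then show ?thesis using big by (auto simp: G_def not_less[symmetric])
qed

context embedded_curve
begin

definition poles :: "nat set" where
  "poles = {k. \<exists>x\<in>RR. x \<noteq> 0 \<and> fls_subdegree x = - int k}"

text \<open>The case \<open>n = 0\<close> of \<open>RR_form\<close>: a function without poles is a
  form of degree 0.\<close>

lemma RR_const_iff:
  assumes x: "x \<in> RR" and deg: "x \<noteq> 0 \<Longrightarrow> fls_subdegree x \<ge> 0"
  obtains c where "x = fls_const c"
proof -
  obtain F where F: "is_form 0 F" "x = fe F / l0 ^ 0" using RR_form[OF x, of 0] deg by auto
  have "F = Const4 (Poly_Mapping.lookup F 0)"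
  proof (rule poly_mapping_eqI)
    fix m show "Poly_Mapping.lookup F m = Poly_Mapping.lookup (Const4 (Poly_Mapping.lookup F 0)) m"
    proof (cases "m = 0")
      case False
      then have "mdegree m \<noteq> 0" by (auto simp: mdegree_def poly_mapping_eq_iff fun_eq_iff)
      moreover have "mdegree m = 0" if "m \<in> Poly_Mapping.keys F" using F(1) that by (simp add: is_form_def)
      ultimately have "m \<notin> Poly_Mapping.keys F" by metis
      then show ?thesis using False by (simp add: in_keys_iff Const4_def lookup_single when_def)
    qed (simp add: Const4_def)
  qed
  then show thesis using that[of "Poly_Mapping.lookup F 0"] F(2) fe_Const4[of "Poly_Mapping.lookup F 0"] by simp
qed

lemma RR_poles:
  assumes "x \<in> RR" "x \<noteq> 0"
  shows "fls_subdegree x \<le> 0" "nat (- fls_subdegree x) \<in> poles"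
proof -
  show *: "fls_subdegree x \<le> 0"
  proof (rule ccontr)
    assume "\<not> ?thesis"
    then show False using RR_const_iff[OF assms(1)] fls_const_subdegree by (metis linorder_le_cases order_refl not_le)
  qed
  show "nat (- fls_subdegree x) \<in> poles" using assms * by (auto simp: poles_def)
qed

text \<open>Forms realising different pole orders are independent modulo \<open>I\<close>.
  Conversely, if there were more independent forms than pole orders, some nontrivial combination
  would have zero Laurent coefficients at all attained orders, although its own leading order is one
  of them.\<close>

lemma card_poles: "card (poles \<inter> {..m0 * n}) = hilbert_function I n"
proof (rule antisym)
  let ?S = "poles \<inter> {..m0 * n}"
  have "\<exists>F. is_form n F \<and> fe F \<noteq> 0 \<and> fls_subdegree (fe F / l0 ^ n) = - int k" if k: "k \<in> ?S" for k
  proof -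
    obtain x where x: "x \<in> RR" "x \<noteq> 0" "fls_subdegree x = - int k" using k unfolding poles_def by blast
    have "int k \<le> int (m0 * n)" using k by (simp only: of_nat_le_iff) simp
    then obtain F where "is_form n F" "x = fe F / l0 ^ n" using RR_form[OF x(1), of n] x(3) by auto
    then show ?thesis using x by auto
  qed
  then obtain f where f: "\<And>k. k \<in> ?S \<Longrightarrow> is_form n (f k) \<and> fe (f k) \<noteq> 0 \<and> fls_subdegree (fe (f k) / l0 ^ n) = - int k"
    by metis
  show "card ?S \<le> hilbert_function I n"
  proof (rule card_le_hilbert_function)
    show "indep_mod I f ?S"
      unfolding indep_mod_def
    proof (intro allI impI ballI)
      fix c k assume "(\<Sum>k\<in>?S. Const4 (c k) * f k) \<in> I" and k: "k \<in> ?S"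
      then have s: "(\<Sum>k\<in>?S. fls_const (c k) * fe (f k)) = 0"
        using fe_I by (force simp: fe_simps fe_Const4)
      have "fls_subdegree (fe (f k)) = fls_subdegree (l0 ^ n) - int k" if "k \<in> ?S" for k
        using f[OF that] L0(2) by (auto simp: fls_divide_subdegree)
      then have "inj_on (\<lambda>k. fls_subdegree (fe (f k))) ?S" by (auto simp: inj_on_def)
      then show "c k = 0" using distinct_subdegree_independent[OF _ _ _ s k] f by blast
    qed
  qed (use f in auto)
  obtain A where A: "finite A" "card A = hilbert_function I n" "\<And>F. F \<in> A \<Longrightarrow> is_form n F" "indep_mod I (\<lambda>F. F) A"
    by (rule hilbert_function_family) blast
  show "hilbert_function I n \<le> card ?S"
  proof (rule ccontr)
    assume "\<not> ?thesis"
    then have "card ?S < card A" using A(2) by simp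
    from nontrivial_solution[OF _ A(1) this, of "\<lambda>k a. (fe a / l0 ^ n) $$ (- int k)"]
    obtain c where c: "\<exists>a\<in>A. c a \<noteq> 0" "\<And>k. k \<in> ?S \<Longrightarrow> (\<Sum>a\<in>A. c a * (fe a / l0 ^ n) $$ (- int k)) = 0" by auto
    define F where "F = (\<Sum>a\<in>A. Const4 (c a) * a)"
    have F: "is_form n F" unfolding F_def using A(3) by (intro is_form_sum is_form_Const4_mult)
    let ?x = "fe F / l0 ^ n"
    have x: "?x = (\<Sum>a\<in>A. fls_const (c a) * (fe a / l0 ^ n))"
      by (simp add: F_def fe_simps fe_Const4 sum_divide_distrib)
    have "F \<notin> I" using indep_modD[OF A(4), of c] c(1) by (auto simp: F_def)
    then have nz: "fe F \<noteq> 0" using fe_form_eq_0[OF F] by simp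
    then have x0: "?x \<noteq> 0" using L0(2) by simp
    note p = RR_poles[OF form_RR(1)[OF F] x0]
    have "nat (- fls_subdegree ?x) \<le> m0 * n" unfolding nat_le_iff using form_RR(2)[OF F nz] by linarith
    then have "nat (- fls_subdegree ?x) \<in> ?S" using p(2) by simp
    from c(2)[OF this] have "(\<Sum>a\<in>A. c a * (fe a / l0 ^ n) $$ fls_subdegree ?x) = 0" using p(1) by simp
    moreover have "?x $$ fls_subdegree ?x = (\<Sum>a\<in>A. c a * (fe a / l0 ^ n) $$ fls_subdegree ?x)"
    proof -
      have nth: "(fls_const u * g) $$ j = u * g $$ j" for u and g :: "'a fls" and j by simp
      show ?thesis by (subst (1) x) (simp only: fls_nth_sum nth)
    qed
    ultimately show False using nth_fls_subdegree_nonzero[OF x0] by simp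
  qed
qed

lemma poles_add: "a \<in> poles \<Longrightarrow> b \<in> poles \<Longrightarrow> a + b \<in> poles"
proof -
  assume "a \<in> poles" "b \<in> poles"
  then obtain x y where "x \<in> RR" "x \<noteq> 0" "fls_subdegree x = - int a" "y \<in> RR" "y \<noteq> 0" "fls_subdegree y = - int b"
    by (auto simp: poles_def)
  then have "x * y \<in> RR" "x * y \<noteq> 0" "fls_subdegree (x * y) = - int (a + b)" by (simp_all add: RR_mult)
  then show ?thesis unfolding poles_def by blast
qed

lemma poles_eq: "poles = - {1}"
proof -
  obtain d n0 where d: "d > 0" "\<And>n. n \<ge> n0 \<Longrightarrow> hilbert_function I n = d * n" by (rule hilbert_function_linear) blast
  \<comment> \<open>Otherwise only the pole order 0 is counted and the Hilbert function is bounded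
    by 1, while it is at least 2 in degree \<open>n0 + 2\<close>.\<close>
  have m0: "m0 > 0"
  proof (rule ccontr)
    assume "\<not> m0 > 0"
    then have "card (poles \<inter> {..0}) = hilbert_function I (n0 + 2)" using card_poles[of "n0 + 2"] by simp
    moreover have "card (poles \<inter> {..0}) \<le> card {0::nat}" by (rule card_mono) auto
    moreover have "1 * (n0 + 2) \<le> d * (n0 + 2)" using d(1) by (intro mult_le_mono1) simp
    ultimately show False using d(2)[of "n0 + 2"] by simp
  qed
  have p0: "0 \<in> poles" unfolding poles_def using RR_const[of 1] by (auto intro!: bexI[of _ 1])
  obtain D where D: "is_form D t0" using t0 by (auto simp: local_param_def)
  \<comment> \<open>\<open>t0 * Var4 i0\<close> and \<open>Var4 i0 ^ N\<close> have the same degree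
    \<open>N\<close> and expand with subdegrees 1 and 0; divided by \<open>L0 ^ N\<close> they give
    two consecutive pole orders.\<close>
  define N where "N = D + 1"
  have f: "is_form N (t0 * Var4 i0)" "is_form N (Var4 i0 ^ N :: 'a poly4)"
    by (rule is_form_mult[OF D is_form_Var4], simp add: N_def) (rule is_form_Var4_power)
  have fet: "fe (t0 * Var4 i0) = fls_X" "fe (Var4 i0 ^ N) = 1" by (simp_all add: fe_simps fe_i0) (simp add: fe_def ev_t0)
  have "fls_subdegree (fe (t0 * Var4 i0) / l0 ^ N) = 1 - int (m0 * N)" "fls_subdegree (fe (Var4 i0 ^ N) / l0 ^ N) = - int (m0 * N)"
    unfolding fet using L0(2) embedded_curve.m0(1)[OF embedded_curve_axioms]
    by (simp_all add: fls_divide_subdegree fls_subdegree_pow algebra_simps del: power_Suc)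
  then have "nat (int (m0 * N) - 1) \<in> poles" "nat (int (m0 * N)) \<in> poles"
    using RR_poles(2)[OF form_RR(1)[OF f(1)]] RR_poles(2)[OF form_RR(1)[OF f(2)]] fet L0(2) by auto
  moreover have "nat (int M - 1) = M - 1" "nat (int M) = M" for M by simp_all
  moreover have "Suc (m0 * N - 1) = m0 * N" using m0 by (simp add: N_def)
  ultimately have "m0 * N - 1 \<in> poles" "Suc (m0 * N - 1) \<in> poles" by metis+
  then show ?thesis
    using numerical_semigroup_one_gap[OF p0 poles_add _ _ m0, of "m0 * N - 1" n0 d] card_poles d(2) by simp
qed

definition pole_le :: "'a fls \<Rightarrow> nat \<Rightarrow> bool" where
  "pole_le x k \<longleftrightarrow> (\<forall>j < - int k. x $$ j = 0)"

lemma pole_le_iff: "pole_le x k \<longleftrightarrow> x = 0 \<or> fls_subdegree x \<ge> - int k"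
  unfolding pole_le_def using fls_subdegree_geI[of x "- int k"] by auto

lemma pole_le_reduce:
  assumes "x \<in> RR" "pole_le x (Suc k)" "y \<in> RR" "y \<noteq> 0" "fls_subdegree y = - int (Suc k)"
  obtains c where "x - fls_const c * y \<in> RR" "pole_le (x - fls_const c * y) k"
proof -
  define c where "c = x $$ (- int (Suc k)) / y $$ (- int (Suc k))"
  have yn: "y $$ (- int (Suc k)) \<noteq> 0" using nth_fls_subdegree_nonzero[OF assms(4)] assms(5) by simp
  have "(x - fls_const c * y) $$ j = 0" if "j < - int k" for j
  proof (cases "j = - int (Suc k)")
    case True
    then show ?thesis using yn by (simp add: c_def)
  next
    case False
    then show ?thesis using that assms(2,5) by (simp add: pole_le_def)
  qed
  then show thesis using that[of c] assms RR_diff RR_mult RR_const by (simp add: pole_le_def)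
qed

text \<open>The pole order 1 is the gap, so at most a simple pole means no pole.\<close>

lemma pole_le_1:
  assumes "x \<in> RR" "pole_le x 1"
  obtains c where "x = fls_const c"
proof (rule RR_const_iff[OF assms(1)])
  assume x: "x \<noteq> 0"
  then have "fls_subdegree x \<ge> - 1" using assms(2) by (simp add: pole_le_iff)
  moreover have "nat (- fls_subdegree x) \<noteq> 1" using RR_poles(2)[OF assms(1) x] poles_eq by auto
  ultimately show "fls_subdegree x \<ge> 0" by auto
qed (rule that)

text \<open>The pole orders 4, 3 and 2 are removed in turn by \<open>x ^ 2\<close>, \<open>y\<close>
  and \<open>x\<close>; what remains has at most a simple pole.\<close>

lemma pole_le_4:
  assumes x: "x \<in> RR" "fls_subdegree x = - 2" and y: "y \<in> RR" "fls_subdegree y = - 3" and u: "u \<in> RR" "pole_le u 4"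
  obtains c0 c1 c2 c3 where "u = fls_const c0 + fls_const c1 * x + fls_const c2 * y + fls_const c3 * x ^ 2"
proof -
  have nz: "x \<noteq> 0" "y \<noteq> 0" using x y by auto
  have x2: "x ^ 2 \<in> RR" "x ^ 2 \<noteq> 0" "fls_subdegree (x ^ 2) = - int (Suc 3)"
    using RR_power[OF x(1)] nz x(2) by (simp_all add: fls_subdegree_pow)
  have u4: "pole_le u (Suc 3)" using u(2) by simp
  obtain c3 where 3: "u - fls_const c3 * x ^ 2 \<in> RR" "pole_le (u - fls_const c3 * x ^ 2) 3"
    by (rule pole_le_reduce[OF u(1) u4 x2])
  then have "pole_le (u - fls_const c3 * x ^ 2) (Suc 2)" by simp
  then obtain c2 where 2: "u - fls_const c3 * x ^ 2 - fls_const c2 * y \<in> RR" "pole_le (u - fls_const c3 * x ^ 2 - fls_const c2 * y) 2"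
    using pole_le_reduce[OF 3(1) _ y(1) nz(2)] y(2) by auto
  then have "pole_le (u - fls_const c3 * x ^ 2 - fls_const c2 * y) (Suc 1)" by (simp add: numeral_2_eq_2)
  then obtain c1 where 1: "u - fls_const c3 * x ^ 2 - fls_const c2 * y - fls_const c1 * x \<in> RR"
     "pole_le (u - fls_const c3 * x ^ 2 - fls_const c2 * y - fls_const c1 * x) 1"
    using pole_le_reduce[OF 2(1) _ x(1) nz(1)] x(2) by auto
  obtain c0 where "u - fls_const c3 * x ^ 2 - fls_const c2 * y - fls_const c1 * x = fls_const c0"
    by (rule pole_le_1[OF 1])
  then have "u = fls_const c0 + fls_const c1 * x + fls_const c2 * y + fls_const c3 * x ^ 2" by (simp add: algebra_simps)
  then show thesis by (rule that)
qed

text \<open>Once leading coefficients agree, the square of a function with pole order 3 minus the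
  cube of one with pole order 2 has pole order at most 5. It is then a combination of
  \<open>x * z\<close>, \<open>x ^ 2\<close>, \<open>z\<close>, \<open>x\<close> and 1, and division
  by 2 completes the square.\<close>

lemma weierstrass:
  assumes two: "(2::'a) \<noteq> 0"
  obtains x y a b c where "x \<in> RR" "y \<in> RR" "fls_subdegree x = - 2" "fls_subdegree y = - 3"
    "y ^ 2 = x ^ 3 + fls_const a * x ^ 2 + fls_const b * x + fls_const c"
proof -
  have "2 \<in> poles" "3 \<in> poles" by (auto simp: poles_eq)
  then obtain x0 y0 where xy0: "x0 \<in> RR" "y0 \<in> RR" "x0 \<noteq> 0" "y0 \<noteq> 0" "fls_subdegree x0 = - 2" "fls_subdegree y0 = - 3"
    by (auto simp: poles_def)
  \<comment> \<open>Scaling both functions by \<open>k\<close> equalises the leading coefficients of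
    the square and the cube, as these are multiplied by \<open>k ^ 2\<close> and
    \<open>k ^ 3\<close>.\<close>
  define k where "k = (y0 $$ (- 3)) ^ 2 / (x0 $$ (- 2)) ^ 3"
  have lead: "x0 $$ (- 2) \<noteq> 0" "y0 $$ (- 3) \<noteq> 0"
    using nth_fls_subdegree_nonzero[of x0] nth_fls_subdegree_nonzero[of y0] xy0 by auto
  then have k0: "k \<noteq> 0" by (simp add: k_def)
  define x where "x = fls_const k * x0"
  define z where "z = fls_const k * y0"
  have x: "x \<in> RR" "x \<noteq> 0" "fls_subdegree x = - 2" and z: "z \<in> RR" "z \<noteq> 0" "fls_subdegree z = - 3"
    using xy0 k0 by (simp_all add: x_def z_def RR_mult RR_const)
  define w where "w = z ^ 2 - x ^ 3"
  have w: "w \<in> RR" using x z by (simp add: w_def RR_diff RR_power)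
  have lc: "(f ^ n) $$ (int n * fls_subdegree f) = (f $$ fls_subdegree f) ^ n" for f :: "'a fls" and n
    using fls_pow_base[of f n] by simp
  have sub: "fls_subdegree (z ^ 2) = - 6" "fls_subdegree (x ^ 3) = - 6" using x z by (simp_all add: fls_subdegree_pow)
  have eq6: "(z ^ 2) $$ (- 6) = (x ^ 3) $$ (- 6)"
  proof -
    have "(z ^ 2) $$ (- 6) = (k * y0 $$ (- 3)) ^ 2" using lc[of z 2] z(3) by (simp add: z_def)
    also have "(y0 $$ (- 3)) ^ 2 = k * (x0 $$ (- 2)) ^ 3" using lead by (simp add: k_def)
    then have "(k * y0 $$ (- 3)) ^ 2 = (k * x0 $$ (- 2)) ^ 3"
      by (simp add: power_mult_distrib) (simp add: power2_eq_square power3_eq_cube)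
    also have "\<dots> = (x ^ 3) $$ (- 6)" using lc[of x 3] x(3) by (simp add: x_def)
    finally show ?thesis .
  qed
  have "pole_le w 5"
    unfolding pole_le_def
  proof (intro allI impI)
    fix j :: int assume "j < - int 5"
    then consider "j = - 6" | "j < - 6" by fastforce
    then show "w $$ j = 0" using eq6 sub by cases (simp_all add: w_def)
  qed
  then have "pole_le w (Suc 4)" by simp
  moreover have "x * z \<in> RR" "x * z \<noteq> 0" "fls_subdegree (x * z) = - int (Suc 4)" using x z by (simp_all add: RR_mult)
  ultimately obtain \<alpha> where \<alpha>: "w - fls_const \<alpha> * (x * z) \<in> RR" "pole_le (w - fls_const \<alpha> * (x * z)) 4"
    by (rule pole_le_reduce[OF w])
  obtain \<epsilon> \<delta> \<gamma> \<beta> where e: "w - fls_const \<alpha> * (x * z) = fls_const \<epsilon> + fls_const \<delta> * x + fls_const \<gamma> * z + fls_const \<beta> * x ^ 2"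
    by (rule pole_le_4[OF x(1,3) z(1,3) \<alpha>])
  define h where "h = inverse (2 :: 'a)"
  \<comment> \<open>Half the total coefficient \<open>\<alpha> x + \<gamma>\<close> of
    \<open>z\<close>: passing to \<open>z - q\<close> removes the terms linear in
    \<open>z\<close>.\<close>
  define q where "q = fls_const (h * \<alpha>) * x + fls_const (h * \<gamma>)"
  have hh: "2 * fls_const h = 1" using two by (simp add: h_def flip: fls_const_numeral)
  have q2: "2 * q = fls_const \<alpha> * x + fls_const \<gamma>"
  proof -
    have "2 * q = (2 * fls_const h) * (fls_const \<alpha> * x + fls_const \<gamma>)"
      unfolding q_def by (simp add: algebra_simps flip: fls_const_mult_const)
    then show ?thesis using hh by simp
  qed
  define y where "y = z - q"
  have qR: "q \<in> RR" using x by (simp add: q_def RR_add RR_mult RR_const)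
  have qn: "q $$ j = 0" if "j \<le> - 3" for j using that x(3) by (simp add: q_def)
  have "fls_subdegree y = - 3"
  proof (rule fls_subdegree_eqI)
    show "y $$ (- 3) \<noteq> 0" using nth_fls_subdegree_nonzero[OF z(2)] z(3) qn[of "- 3"] by (simp add: y_def)
    show "y $$ j = 0" if "j < - 3" for j using that qn[of j] z(3) by (simp add: y_def)
  qed
  moreover have "y ^ 2 = x ^ 3 + fls_const (\<beta> + (h * \<alpha>) ^ 2) * x ^ 2
      + fls_const (\<delta> + 2 * (h * \<alpha>) * (h * \<gamma>)) * x + fls_const (\<epsilon> + (h * \<gamma>) ^ 2)"
  proof -
    have "z ^ 2 = x ^ 3 + fls_const \<alpha> * (x * z) + fls_const \<epsilon> + fls_const \<delta> * x + fls_const \<gamma> * z + fls_const \<beta> * x ^ 2"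
      using e by (simp add: w_def algebra_simps)
    moreover have "y ^ 2 = z ^ 2 - (2 * q) * z + q ^ 2" by (simp add: y_def power2_eq_square algebra_simps)
    ultimately have "y ^ 2 = x ^ 3 + fls_const \<epsilon> + fls_const \<delta> * x + fls_const \<beta> * x ^ 2 + q ^ 2"
      unfolding q2 by (simp add: algebra_simps)
    moreover have "q ^ 2 = fls_const ((h * \<alpha>) ^ 2) * x ^ 2 + fls_const (2 * (h * \<alpha>) * (h * \<gamma>)) * x + fls_const ((h * \<gamma>) ^ 2)"
    proof -
      have c2: "fls_const (2 * u * v) = 2 * fls_const u * fls_const v" for u v :: 'a by (simp flip: fls_const_mult_const)
      show ?thesis unfolding q_def c2 fls_const_power by (simp add: power2_eq_square algebra_simps)
    qed
    ultimately show ?thesis by (simp add: algebra_simps add: fls_plus_const[symmetric])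
  qed
  moreover have "y \<in> RR" using z qR by (simp add: y_def RR_diff)
  ultimately show thesis using that x by blast
qed

end

section \<open>The Weierstrass model in projective space\<close>

lemma four_eq_zero: "(4::4) = 0"
  by simp

lemma sum_UNIV4: "sum f (UNIV::4 set) = f 0 + f 1 + f 2 + (f 3 :: 'b::comm_monoid_add)"
  using sum_4[of f] unfolding four_eq_zero by (simp only: ac_simps)

lemma prod_UNIV4: "prod f (UNIV::4 set) = f 0 * f 1 * f 2 * (f 3 :: 'b::comm_monoid_mult)"
proof -
  have U: "(UNIV :: 4 set) = {0, 1, 2, 3}" using exhaust_4 unfolding four_eq_zero by blast
  show ?thesis unfolding U by (simp add: mult.assoc)
qed

lemma all_index4: "(\<forall>i::4. R i) \<longleftrightarrow> R 0 \<and> R 1 \<and> R 2 \<and> R 3"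
  using forall_4[of R] unfolding four_eq_zero by blast

definition vec4 :: "'b \<Rightarrow> 'b \<Rightarrow> 'b \<Rightarrow> 'b \<Rightarrow> 4 \<Rightarrow> 'b" where
  "vec4 u v w z = (\<lambda>i. if i = 0 then u else if i = 1 then v else if i = 2 then w else z)"

lemma vec4_nth [simp]: "vec4 u v w z 0 = u" "vec4 u v w z 1 = v" "vec4 u v w z 2 = w" "vec4 u v w z 3 = z"
  by (simp_all add: vec4_def)

lemma linear_form_expand:
  assumes "is_form 1 (F :: 'a::comm_ring_1 poly4)"
  shows "F = (\<Sum>j\<in>UNIV. Const4 (Poly_Mapping.lookup F (Poly_Mapping.single j 1)) * Var4 j)"
proof -
  have "Poly_Mapping.lookup F m = Poly_Mapping.lookup (\<Sum>j\<in>UNIV. Poly_Mapping.single (Poly_Mapping.single j 1) (Poly_Mapping.lookup F (Poly_Mapping.single j 1))) m" for m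
  proof (cases "\<exists>j. m = Poly_Mapping.single j 1")
    case True
    then obtain j where m: "m = Poly_Mapping.single j 1" by blast
    have "Poly_Mapping.single i (1::nat) = Poly_Mapping.single j 1 \<longleftrightarrow> i = j" for i :: 4
      by (metis lookup_single_eq lookup_single_not_eq one_neq_zero)
    then show ?thesis unfolding m by (simp add: lookup_sum lookup_single when_def)
  next
    case False
    have "m \<notin> Poly_Mapping.keys F"
    proof
      assume "m \<in> Poly_Mapping.keys F"
      then have "(\<Sum>i\<in>UNIV. Poly_Mapping.lookup m i) = 1" using assms by (simp add: is_form_def mdegree_def)
      then obtain j where j: "Poly_Mapping.lookup m j = 1" "\<And>i. j \<noteq> i \<Longrightarrow> Poly_Mapping.lookup m i = 0"
        unfolding sum_eq_1_iff[OF finite_class.finite_UNIV] by blast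
      have "m = Poly_Mapping.single j 1"
        by (rule poly_mapping_eqI) (use j in \<open>auto simp: lookup_single when_def\<close>)
      then show False using False by blast
    qed
    moreover have "Poly_Mapping.single j 1 \<noteq> m" for j using False by blast
    ultimately show ?thesis by (simp add: lookup_sum lookup_single in_keys_iff)
  qed
  then have "F = (\<Sum>j\<in>UNIV. Poly_Mapping.single (Poly_Mapping.single j 1) (Poly_Mapping.lookup F (Poly_Mapping.single j 1)))"
    by (rule poly_mapping_eqI)
  then show ?thesis by (simp only: Const4_def Var4_def mult_single add_0_left mult_1_right)
qed

lemma poly4_form_induct [consumes 1, case_names one var add const]:
  fixes F :: "'a::comm_ring_1 poly4"
  assumes F: "is_form n F"
    and one: "R 0 1" and var: "\<And>n F i. R n F \<Longrightarrow> R (Suc n) (Var4 i * F)"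
    and add: "\<And>n F G. R n F \<Longrightarrow> R n G \<Longrightarrow> R n (F + G)"
    and const: "\<And>n F c. R n F \<Longrightarrow> R n (Const4 c * F)"
  shows "R n F"
proof -
  have pow: "R (k + l) (Var4 i ^ k * G)" if "R l G" for k l i G
  proof (induction k)
    case (Suc k)
    then show ?case using var[of "k + l" "Var4 i ^ k * G" i] by (simp add: mult.assoc)
  qed (use that in simp)
  have mon: "R (mdegree m) (Poly_Mapping.single m c)" for m c
  proof -
    let ?l = "Poly_Mapping.lookup m"
    have "R (?l 0 + (?l 1 + (?l 2 + (?l 3 + 0)))) (Var4 0 ^ ?l 0 * (Var4 1 ^ ?l 1 * (Var4 2 ^ ?l 2 * (Var4 3 ^ ?l 3 * 1))))"
      by (intro pow one)
    then have "R (mdegree m) (\<Prod>i\<in>UNIV. Var4 i ^ ?l i)"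
      by (simp add: mdegree_def sum_UNIV4 prod_UNIV4 mult.assoc add.assoc)
    then show ?thesis unfolding single_poly4 by (rule const)
  qed
  have 0: "R n 0" using const[OF mon[of "Poly_Mapping.single 0 n" 1], of 0] by (simp add: mdegree_single)
  have "R n (\<Sum>m\<in>A. Poly_Mapping.single m (Poly_Mapping.lookup F m))" if "finite A" "A \<subseteq> Poly_Mapping.keys F" for A
    using that
  proof (induction A rule: finite_induct)
    case (insert m A)
    then have "mdegree m = n" using F by (auto simp: is_form_def)
    then show ?case using insert add mon[of m] by simp
  qed (simp add: 0)
  then show ?thesis using poly4_expand[of F] by (metis finite_keys order_refl)
qed

lemma is_form_lin_subst: "is_form n F \<Longrightarrow> is_form n (lin_subst M (F :: 'a::comm_ring_1 poly4))"
proof (induction rule: poly4_form_induct)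
  case one
  then show ?case by (simp add: rhom_1[OF rhom_lin_subst])
next
  case (var n F i)
  have "lin_subst M (Var4 i) = (\<Sum>j\<in>UNIV. Const4 (M $ i $ j) * Var4 j)"
    by (simp add: lin_subst_eq peval_Var4[OF rhom_Const4])
  then have "is_form (Suc 0) (lin_subst M (Var4 i))" by (simp only:) (intro is_form_sum is_form_Const4_mult is_form_Var4)
  then show ?case using var by (simp add: rhom_mult[OF rhom_lin_subst] is_form_mult)
next
  case (const n F c)
  have "lin_subst M (Const4 c) = Const4 c" by (simp add: lin_subst_eq peval_Const4[OF rhom_Const4])
  then show ?case using const by (simp add: rhom_mult[OF rhom_lin_subst] is_form_Const4_mult)
qed (simp add: rhom_add[OF rhom_lin_subst] is_form_add)

lemma peval_lin_subst:
  assumes h: "rhom h"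
  shows "peval h v (lin_subst M F) = peval h (\<lambda>i. \<Sum>j\<in>UNIV. h (M $ i $ j) * v j) F"
  unfolding lin_subst_eq
  by (subst peval_comp[OF rhom_Const4 rhom_peval[OF h]])
    (simp add: rhom_simps[OF rhom_peval[OF h]] peval_Const4[OF h] peval_Var4[OF h])

lemma lin_subst_lin_subst: "lin_subst A (lin_subst B F) = lin_subst (B ** A) (F :: 'a::comm_ring_1 poly4)"
proof -
  have "(\<Sum>j\<in>UNIV. Const4 (B $ i $ j) * (\<Sum>k\<in>UNIV. Const4 (A $ j $ k) * Var4 k))
      = (\<Sum>k\<in>UNIV. Const4 ((B ** A) $ i $ k) * Var4 k)" for i
  proof -
    have "(\<Sum>j\<in>UNIV. Const4 (B $ i $ j) * (\<Sum>k\<in>UNIV. Const4 (A $ j $ k) * Var4 k))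
        = (\<Sum>k\<in>UNIV. \<Sum>j\<in>UNIV. Const4 (B $ i $ j) * (Const4 (A $ j $ k) * Var4 k))"
      unfolding sum_distrib_left by (rule sum.swap)
    also have "\<dots> = (\<Sum>k\<in>UNIV. Const4 ((B ** A) $ i $ k) * Var4 k)"
      by (simp add: matrix_matrix_mult_def rhom_simps[OF rhom_Const4] sum_distrib_right mult.assoc)
    finally show ?thesis .
  qed
  then show ?thesis
    unfolding lin_subst_eq[of A] by (subst peval_lin_subst[OF rhom_Const4]) (simp add: lin_subst_eq)
qed

lemma lin_subst_mat_1: "lin_subst (mat 1) F = (F :: 'a::comm_ring_1 poly4)"
proof -
  have "(\<Sum>j\<in>UNIV. Const4 (mat 1 $ i $ j) * Var4 j) = (Var4 i :: 'a poly4)" for i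
  proof -
    have "(\<Sum>j\<in>UNIV. Const4 (mat 1 $ i $ j) * Var4 j) = (\<Sum>j\<in>UNIV. if i = j then Var4 j else (0 :: 'a poly4))"
      by (intro sum.cong) (auto simp: mat_def)
    then show ?thesis by simp
  qed
  then show ?thesis unfolding lin_subst_eq by (simp add: peval_Const4_Var4)
qed

locale weierstrass_curve = embedded_curve +
  fixes x y :: "'a fls" and a b c :: 'a
  assumes two: "(2::'a) \<noteq> 0"
    and xy_RR: "x \<in> RR" "y \<in> RR" and xy_deg: "fls_subdegree x = - 2" "fls_subdegree y = - 3"
    and weq: "y ^ 2 = x ^ 3 + fls_const a * x ^ 2 + fls_const b * x + fls_const c"
begin

lemma xy_nz: "x \<noteq> 0" "y \<noteq> 0"
  using xy_deg by auto

section \<open>The linear change of coordinates\<close>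

definition vv :: "4 \<Rightarrow> 'a fls" where
  "vv = vec4 1 x y (x ^ 2)"

lemma vv_nz: "vv k \<noteq> 0"
  using xy_nz by (simp add: vv_def vec4_def)

lemma vv_RR: "vv k \<in> RR"
  using xy_RR RR_const[of 1] by (auto simp: vv_def vec4_def RR_power)

lemma vv_deg: "fls_subdegree (vv k) \<ge> - 4"
  using xy_deg by (simp add: vv_def vec4_def fls_subdegree_pow)

lemma vv_deg_inj: "inj (\<lambda>k. fls_subdegree (vv k))"
proof -
  have "fls_subdegree (vv i) = fls_subdegree (vv j) \<longrightarrow> i = j" for i j
  proof -
    have "\<forall>i j. fls_subdegree (vv i) = fls_subdegree (vv j) \<longrightarrow> i = j"
      unfolding all_index4 using xy_deg by (simp add: vv_def fls_subdegree_pow)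
    then show ?thesis by blast
  qed
  then show ?thesis by (auto simp: inj_def)
qed

lemma vv_independent: "(\<Sum>k\<in>UNIV. fls_const (u k) * vv k) = 0 \<Longrightarrow> u k = 0"
  by (rule distinct_subdegree_independent[of UNIV vv]) (use vv_deg_inj vv_nz in auto)

definition Zf :: "4 \<Rightarrow> 'a poly4" where
  "Zf k = (SOME F. is_form 1 F \<and> vv k = fe F / l0)"

lemma Zf: "is_form 1 (Zf k)" "fe (Zf k) = l0 * vv k"
proof -
  have "\<exists>F. is_form 1 F \<and> vv k = fe F / l0" using vv_deg by (intro L0(5)[OF vv_RR]) simp
  from someI_ex[OF this] show "is_form 1 (Zf k)" "fe (Zf k) = l0 * vv k"
    using L0(2) unfolding Zf_def[symmetric] by auto
qed

definition NN :: "'a ^ 4 ^ 4" where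
  "NN = (\<chi> k j. Poly_Mapping.lookup (Zf k) (Poly_Mapping.single j 1))"

lemma Zf_NN: "Zf k = (\<Sum>j\<in>UNIV. Const4 (NN $ k $ j) * Var4 j)"
  using linear_form_expand[OF Zf(1)] by (simp add: NN_def)

lemma fe_NN: "(\<Sum>j\<in>UNIV. fls_const (NN $ k $ j) * fe (Var4 j)) = l0 * vv k"
  using Zf(2)[of k] unfolding Zf_NN by (simp add: fe_simps fe_Const4)

text \<open>The quotient of a coordinate by \<open>L0\<close> is regular away from the origin with a
  pole of order at most 4 there, and \<open>1, x, y, x ^ 2\<close> span all such functions.\<close>

lemma ex_CC: "\<exists>u. fe (Var4 j) = l0 * (\<Sum>k\<in>UNIV. fls_const (u k) * vv k)"
proof -
  have j: "is_form 1 (Var4 j :: 'a poly4)" using is_form_Var4 by simp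
  have r: "fe (Var4 j) / l0 \<in> RR" using form_RR(1)[OF j] by simp
  have "pole_le (fe (Var4 j) / l0) 4"
    using form_RR(2)[OF j] m0(2) by (cases "fe (Var4 j) = 0") (auto simp: pole_le_iff intro: order_trans[rotated])
  then obtain c0 c1 c2 c3 where "fe (Var4 j) / l0 = fls_const c0 + fls_const c1 * x + fls_const c2 * y + fls_const c3 * x ^ 2"
    by (rule pole_le_4[OF xy_RR(1) xy_deg(1) xy_RR(2) xy_deg(2) r])
  then have "fe (Var4 j) = l0 * (\<Sum>k\<in>UNIV. fls_const (vec4 c0 c1 c2 c3 k) * vv k)"
    using L0(2) by (simp add: sum_UNIV4 vv_def divide_eq_eq mult.commute)
  then show ?thesis by blast
qed

definition CC :: "'a ^ 4 ^ 4" where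
  "CC = (\<chi> j k. (SOME u. fe (Var4 j) = l0 * (\<Sum>k\<in>UNIV. fls_const (u k) * vv k)) k)"

lemma fe_CC: "fe (Var4 j) = l0 * (\<Sum>k\<in>UNIV. fls_const (CC $ j $ k) * vv k)"
  using someI_ex[OF ex_CC[of j]] by (simp add: CC_def)

text \<open>The matrices express the coordinates over \<open>L0\<close> and the functions
  \<open>1, x, y, x ^ 2\<close> through each other. The latter have distinct pole orders and are
  independent, so coefficients can be compared.\<close>

lemma NN_CC: "NN ** CC = mat 1"
proof -
  have "(NN ** CC) $ k $ l - mat 1 $ k $ l = 0" for k l
  proof (rule vv_independent[where u = "\<lambda>l. (NN ** CC) $ k $ l - mat 1 $ k $ l"])
    have fc: "fls_const (u - v) = fls_const u - fls_const v" for u v :: 'a by (rule rhom_diff[OF rhom_fls_const])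
    have "l0 * vv k = (\<Sum>j\<in>UNIV. fls_const (NN $ k $ j) * (l0 * (\<Sum>l\<in>UNIV. fls_const (CC $ j $ l) * vv l)))"
      using fe_NN[of k] by (simp only: fe_CC)
    also have "\<dots> = l0 * (\<Sum>j\<in>UNIV. \<Sum>l\<in>UNIV. fls_const (NN $ k $ j) * (fls_const (CC $ j $ l) * vv l))"
      by (simp add: sum_distrib_left algebra_simps)
    also have "\<dots> = l0 * (\<Sum>l\<in>UNIV. fls_const ((NN ** CC) $ k $ l) * vv l)"
    proof -
      have e: "fls_const ((NN ** CC) $ k $ l) = (\<Sum>j\<in>UNIV. fls_const (NN $ k $ j) * fls_const (CC $ j $ l))" for l
        unfolding matrix_matrix_mult_def by (simp add: rhom_sum[OF rhom_fls_const])
      show ?thesis unfolding e sum_distrib_right mult.assoc by (subst sum.swap) (rule refl)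
    qed
    finally have "vv k = (\<Sum>l\<in>UNIV. fls_const ((NN ** CC) $ k $ l) * vv l)" using L0(2) by simp
    moreover have "(\<Sum>l\<in>UNIV. fls_const (mat 1 $ k $ l) * vv l) = (\<Sum>l\<in>UNIV. if k = l then vv l else 0)"
      by (intro sum.cong) (auto simp: mat_def)
    ultimately show "(\<Sum>l\<in>UNIV. fls_const ((NN ** CC) $ k $ l - mat 1 $ k $ l) * vv l) = 0"
      by (simp add: fc left_diff_distrib sum_subtractf)
  qed
  then show ?thesis by (simp add: vec_eq_iff)
qed

lemma CC_NN: "CC ** NN = mat 1"
  using NN_CC by (simp add: matrix_left_right_inverse)

text \<open>Evaluation at the generic point of the curve in the new coordinates; on forms its kernel
  is the transformed ideal (\<open>lin_subst_NN_I\<close>).\<close>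

definition psi :: "'a poly4 \<Rightarrow> 'a fls" where
  "psi = peval fls_const vv"

lemma rhom_psi: "rhom psi"
  unfolding psi_def by (rule rhom_peval[OF rhom_fls_const])

lemmas psi_simps = rhom_simps[OF rhom_psi]

lemma psi_Var4: "psi (Var4 k) = vv k"
  by (simp add: psi_def peval_Var4[OF rhom_fls_const])

lemma psi_Const4: "psi (Const4 u) = fls_const u"
  by (simp add: psi_def peval_Const4[OF rhom_fls_const])

lemma fe_lin_subst_NN: "is_form n F \<Longrightarrow> fe (lin_subst NN F) = l0 ^ n * psi F"
  unfolding psi_def by (subst fe_eq_peval) (simp add: peval_lin_subst[OF rhom_fls_const] fe_NN peval_scale_form)

lemma lin_subst_NN_I: assumes F: "is_form n F" shows "lin_subst NN F \<in> I \<longleftrightarrow> psi F = 0"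
  using fe_form_eq_0[OF is_form_lin_subst[OF F], of NN] fe_lin_subst_NN[OF F] L0(2) by simp

lemma lin_subst_inverse: "lin_subst NN (lin_subst CC F) = F" "lin_subst CC (lin_subst NN F) = F"
  by (simp_all add: lin_subst_lin_subst NN_CC CC_NN lin_subst_mat_1)

lemma fe_psi: "is_form n F \<Longrightarrow> fe F = l0 ^ n * psi (lin_subst CC F)"
  using fe_lin_subst_NN[OF is_form_lin_subst, of n F CC] by (simp add: lin_subst_inverse)

section \<open>The curve as the intersection of two quadrics\<close>

definition Q1 :: "'a poly4" where
  "Q1 = Var4 1 ^ 2 - Var4 0 * Var4 3"

text \<open>The Weierstrass equation, made quadratic by writing \<open>x ^ 3\<close> as
  \<open>x\<close> times the coordinate \<open>x ^ 2\<close>.\<close>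

definition Q2 :: "'a poly4" where
  "Q2 = Var4 2 ^ 2 - (Var4 1 * Var4 3 + Const4 a * (Var4 0 * Var4 3) + Const4 b * (Var4 0 * Var4 1) + Const4 c * Var4 0 ^ 2)"

definition K :: "'a poly4 set" where
  "K = {A * Q1 + B * Q2 | A B. True}"

lemma K_I: "F = A * Q1 + B * Q2 \<Longrightarrow> F \<in> K"
  unfolding K_def by blast

lemma K_0: "0 \<in> K"
  by (rule K_I[of _ 0 0]) simp

lemma K_add: "F \<in> K \<Longrightarrow> G \<in> K \<Longrightarrow> F + G \<in> K"
proof -
  assume "F \<in> K" "G \<in> K"
  then obtain A B A' B' where "F = A * Q1 + B * Q2" "G = A' * Q1 + B' * Q2" unfolding K_def by blast
  then show ?thesis by (intro K_I[of _ "A + A'" "B + B'"]) (simp add: algebra_simps)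
qed

lemma K_mult: "F \<in> K \<Longrightarrow> G * F \<in> K"
proof -
  assume "F \<in> K"
  then obtain A B where "F = A * Q1 + B * Q2" unfolding K_def by blast
  then show ?thesis by (intro K_I[of _ "G * A" "G * B"]) (simp add: algebra_simps)
qed

lemma K_Q: "Q1 \<in> K" "Q2 \<in> K"
  by (rule K_I[of _ 1 0], simp) (rule K_I[of _ 0 1], simp)

lemma psi_K: "F \<in> K \<Longrightarrow> psi F = 0"
proof -
  have "psi Q1 = 0" by (simp add: Q1_def psi_simps psi_Var4 vv_def)
  moreover have "psi Q2 = 0"
  proof -
    have "x ^ 3 = x * x ^ 2" by (simp add: power3_eq_cube power2_eq_square)
    then show ?thesis by (simp add: Q2_def psi_simps psi_Var4 psi_Const4 vv_def weq)
  qed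
  moreover assume "F \<in> K"
  ultimately show ?thesis unfolding K_def by (auto simp: psi_simps)
qed

text \<open>Modulo \<open>Q1\<close> and \<open>Q2\<close> every form of degree \<open>n\<close> is a combination of the monomials with exponents in
  \<open>Tn n\<close>; at \<open>(1 : x : y : x\<^sup>2)\<close> these have the pole orders \<open>4 * j + 2 * p + 3 * q\<close>, which are distinct.\<close>

definition Tn :: "nat \<Rightarrow> (nat \<times> nat \<times> nat \<times> nat) set" where
  "Tn n = {(i, j, p, q). p \<le> 1 \<and> q \<le> 1 \<and> i + j + p + q = n}"

definition mon :: "nat \<times> nat \<times> nat \<times> nat \<Rightarrow> 'a poly4" where
  "mon = (\<lambda>(i, j, p, q). Var4 0 ^ i * Var4 3 ^ j * Var4 1 ^ p * Var4 2 ^ q)"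

lemma finite_Tn: "finite (Tn n)"
  by (rule finite_subset[of _ "{..n} \<times> {..n} \<times> {..n} \<times> {..n}"]) (auto simp: Tn_def)

definition NS :: "nat \<Rightarrow> 'a poly4 set" where
  "NS n = {F. \<exists>u. F - (\<Sum>t\<in>Tn n. Const4 (u t) * mon t) \<in> K}"

lemma NS_mon: "t \<in> Tn n \<Longrightarrow> mon t \<in> NS n"
proof -
  assume t: "t \<in> Tn n"
  have "(\<Sum>s\<in>Tn n. Const4 (if s = t then 1 else 0) * mon s) = (\<Sum>s\<in>Tn n. if s = t then mon t else 0)"
    by (intro sum.cong) auto
  then have "mon t - (\<Sum>s\<in>Tn n. Const4 (if s = t then 1 else 0) * mon s) = 0" using t finite_Tn by simp
  then show ?thesis unfolding NS_def mem_Collect_eq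
    by (intro exI[of _ "\<lambda>s. if s = t then 1 else 0"]) (simp only: K_0)
qed

lemma NS_K: "F \<in> K \<Longrightarrow> F \<in> NS n"
  unfolding NS_def mem_Collect_eq by (rule exI[of _ "\<lambda>_. 0"]) simp

lemma NS_add: "F \<in> NS n \<Longrightarrow> G \<in> NS n \<Longrightarrow> F + G \<in> NS n"
proof -
  assume "F \<in> NS n" "G \<in> NS n"
  then obtain u v where "F - (\<Sum>t\<in>Tn n. Const4 (u t) * mon t) \<in> K" "G - (\<Sum>t\<in>Tn n. Const4 (v t) * mon t) \<in> K"
    unfolding NS_def by blast
  from K_add[OF this] have "F + G - (\<Sum>t\<in>Tn n. Const4 (u t + v t) * mon t) \<in> K"
    by (simp add: Const4_add sum.distrib algebra_simps)
  then show ?thesis unfolding NS_def mem_Collect_eq by (rule exI[of _ "\<lambda>t. u t + v t"])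
qed

lemma NS_const: "F \<in> NS n \<Longrightarrow> Const4 k * F \<in> NS n"
proof -
  assume "F \<in> NS n"
  then obtain u where "F - (\<Sum>t\<in>Tn n. Const4 (u t) * mon t) \<in> K" unfolding NS_def by blast
  from K_mult[OF this, of "Const4 k"] have "Const4 k * F - (\<Sum>t\<in>Tn n. Const4 (k * u t) * mon t) \<in> K"
    by (simp add: Const4_mult sum_distrib_left right_diff_distrib mult.assoc)
  then show ?thesis unfolding NS_def mem_Collect_eq by (rule exI[of _ "\<lambda>t. k * u t"])
qed

lemma NS_sum: "(\<And>t. t \<in> A \<Longrightarrow> f t \<in> NS n) \<Longrightarrow> sum f A \<in> NS n"
  by (induction A rule: infinite_finite_induct) (simp_all add: NS_K K_0 NS_add)

lemma NS_cong: "F - G \<in> K \<Longrightarrow> G \<in> NS n \<Longrightarrow> F \<in> NS n"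
  using NS_add[OF NS_K[of "F - G" n], of G] by simp

lemma NS_Var4_mon: assumes "t \<in> Tn n" shows "Var4 k * mon t \<in> NS (Suc n)"
proof -
  obtain i j p q where t: "t = (i, j, p, q)" by (cases t)
  have pq: "p \<le> 1" "q \<le> 1" "i + j + p + q = n" using assms by (auto simp: t Tn_def)
  have mem: "mon (i', j', p', q') \<in> NS (Suc n)" if "p' \<le> 1" "q' \<le> 1" "i' + j' + p' + q' = Suc n" for i' j' p' q'
    using that by (intro NS_mon) (simp add: Tn_def)
  consider "k = 0" | "k = 1" | "k = 2" | "k = 3" using exhaust_4[of k] unfolding four_eq_zero by blast
  then show ?thesis
  proof cases
    case 1
    have "Var4 k * mon t = mon (Suc i, j, p, q)" by (simp add: 1 t mon_def algebra_simps)
    then show ?thesis using mem pq by simp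
  next
    case 4
    have "Var4 k * mon t = mon (i, Suc j, p, q)" by (simp add: 4 t mon_def algebra_simps)
    then show ?thesis using mem pq by simp
  next
    case 2
    consider "p = 0" | "p = 1" using pq by linarith
    then show ?thesis
    proof cases
      case 1
      have "Var4 k * mon t = mon (i, j, 1, q)" by (simp add: 2 1 t mon_def algebra_simps)
      then show ?thesis using mem pq 1 by simp
    next
      case p: 2
      have "Var4 k * mon t - mon (Suc i, Suc j, 0, q) = (Var4 0 ^ i * Var4 3 ^ j * Var4 2 ^ q) * Q1"
        by (simp add: 2 p t mon_def Q1_def algebra_simps power2_eq_square)
      then have "Var4 k * mon t - mon (Suc i, Suc j, 0, q) \<in> K" using K_mult[OF K_Q(1)] by simp
      then show ?thesis by (rule NS_cong) (use mem pq p in simp)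
    qed
  next
    case 3
    consider "q = 0" | "q = 1" using pq by linarith
    then show ?thesis
    proof cases
      case 1
      have "Var4 k * mon t = mon (i, j, p, 1)" by (simp add: 3 1 t mon_def algebra_simps)
      then show ?thesis using mem pq 1 by simp
    next
      case q: 2
      consider "p = 0" | "p = 1" using pq by linarith
      then show ?thesis
      proof cases
        case p: 1
        let ?G = "mon (i, Suc j, 1, 0) + Const4 a * mon (Suc i, Suc j, 0, 0) + Const4 b * mon (Suc i, j, 1, 0) + Const4 c * mon (Suc (Suc i), j, 0, 0)"
        have "Var4 k * mon t - ?G = (Var4 0 ^ i * Var4 3 ^ j) * Q2"
          by (simp add: 3 p q t mon_def Q2_def algebra_simps power2_eq_square)
        then have "Var4 k * mon t - ?G \<in> K" using K_mult[OF K_Q(2)] by simp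
        then show ?thesis by (rule NS_cong) (intro NS_add NS_const mem; use pq p q in simp)
      next
        case p: 2
        let ?G = "mon (Suc i, Suc (Suc j), 0, 0) + Const4 a * mon (Suc i, Suc j, 1, 0) + Const4 b * mon (Suc (Suc i), Suc j, 0, 0) + Const4 c * mon (Suc (Suc i), j, 1, 0)"
        \<comment> \<open>Eliminating \<open>Var4 2 ^ 2\<close> by \<open>Q2\<close> leaves two
          terms containing \<open>Var4 1 ^ 2\<close>, which the multiple of \<open>Q1\<close>
          rewrites.\<close>
        have "Var4 k * mon t - ?G = (Var4 0 ^ i * Var4 3 ^ j * Var4 1) * Q2 + (Var4 0 ^ i * Var4 3 ^ j * (Var4 3 + Const4 b * Var4 0)) * Q1"
          by (simp add: 3 p q t mon_def Q1_def Q2_def algebra_simps power2_eq_square)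
        then have "Var4 k * mon t - ?G \<in> K" using K_add[OF K_mult[OF K_Q(2)] K_mult[OF K_Q(1)]] by simp
        then show ?thesis by (rule NS_cong) (intro NS_add NS_const mem; use pq p q in simp)
      qed
    qed
  qed
qed

lemma NS_Var4: assumes "F \<in> NS n" shows "Var4 k * F \<in> NS (Suc n)"
proof -
  obtain u where u: "F - (\<Sum>t\<in>Tn n. Const4 (u t) * mon t) \<in> K" using assms unfolding NS_def by blast
  have "Var4 k * F - (\<Sum>t\<in>Tn n. Const4 (u t) * (Var4 k * mon t)) \<in> K"
    using K_mult[OF u, of "Var4 k"] by (simp add: sum_distrib_left algebra_simps)
  then show ?thesis by (rule NS_cong) (intro NS_sum NS_const NS_Var4_mon)
qed

lemma form_NS: "is_form n F \<Longrightarrow> F \<in> NS n"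
proof (induction rule: poly4_form_induct)
  case one
  have "mon (0, 0, 0, 0) \<in> NS 0" by (rule NS_mon) (simp add: Tn_def)
  then show ?case by (simp add: mon_def)
qed (simp_all add: NS_Var4 NS_add NS_const)

lemma psi_mon_deg: "fls_subdegree (psi (mon (i, j, p, q))) = - int (4 * j + 2 * p + 3 * q)" "psi (mon t) \<noteq> 0"
  using xy_nz xy_deg
  by (simp_all add: mon_def psi_simps psi_Var4 vv_def fls_subdegree_pow split: prod.split)

text \<open>The values 0, 2, 3, 5 of \<open>2 * p + 3 * q\<close> are distinct modulo 4, so the pole
  order determines \<open>p\<close>, \<open>q\<close> and \<open>j\<close>, and the degree then
  determines \<open>i\<close>.\<close>

lemma psi_mon_inj: "inj_on (\<lambda>t. fls_subdegree (psi (mon t))) (Tn n)"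
proof (rule inj_onI)
  fix s t assume s: "s \<in> Tn n" and t: "t \<in> Tn n" and e: "fls_subdegree (psi (mon s)) = fls_subdegree (psi (mon t))"
  obtain i j p q i' j' p' q' where st: "s = (i, j, p, q)" "t = (i', j', p', q')" by (cases s, cases t)
  have "int (4 * j + 2 * p + 3 * q) = int (4 * j' + 2 * p' + 3 * q')" using e unfolding st psi_mon_deg(1) by linarith
  then have "4 * j + 2 * p + 3 * q = 4 * j' + 2 * p' + 3 * q'" by (simp only: of_nat_eq_iff)
  moreover have "p = 0 \<or> p = 1" "q = 0 \<or> q = 1" "p' = 0 \<or> p' = 1" "q' = 0 \<or> q' = 1"
    and n: "i + j + p + q = n" "i' + j' + p' + q' = n"
    using s t by (auto simp: st Tn_def)
  ultimately have "j = j' \<and> p = p' \<and> q = q'" by (elim disjE; simp; presburger)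
  then have "i = i' \<and> j = j' \<and> p = p' \<and> q = q'" using n by simp
  then show "s = t" by (simp add: st)
qed

text \<open>After reduction modulo \<open>K\<close> only monomials with distinct pole orders are
  left, and these cannot cancel.\<close>

lemma psi_eq_0_iff: "is_form n F \<Longrightarrow> psi F = 0 \<longleftrightarrow> F \<in> K"
proof
  assume F: "is_form n F" and 0: "psi F = 0"
  obtain u where u: "F - (\<Sum>t\<in>Tn n. Const4 (u t) * mon t) \<in> K" using form_NS[OF F] unfolding NS_def by blast
  have "(\<Sum>t\<in>Tn n. fls_const (u t) * psi (mon t)) = 0" using psi_K[OF u] 0 by (simp add: psi_simps psi_Const4)
  then have "u t = 0" if "t \<in> Tn n" for t
    using distinct_subdegree_independent[OF finite_Tn psi_mon_inj psi_mon_deg(2)] that by blast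
  then show "F \<in> K" using u by simp
qed (rule psi_K)

lemma I_iff_K: "is_form n F \<Longrightarrow> F \<in> I \<longleftrightarrow> lin_subst CC F \<in> K"
  using lin_subst_NN_I[OF is_form_lin_subst, of n F CC] psi_eq_0_iff[OF is_form_lin_subst, of n F CC]
  by (simp add: lin_subst_inverse)

end

section \<open>Affine points and divisors of functions\<close>

context weierstrass_curve
begin

definition cub :: "'a \<Rightarrow> 'a" where
  "cub u = u ^ 3 + a * u ^ 2 + b * u + c"

text \<open>\<open>Zf 3\<close> is \<open>L0\<close> times \<open>x ^ 2\<close> in the expansion at
  the origin and has no pole there, so \<open>L0\<close> must absorb a pole of order 4.\<close>

lemma m0_pos: "m0 \<ge> 4"
proof -
  have "fls_subdegree (fe (Zf 3)) = int m0 - 4"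
    using Zf(2)[of 3] L0(2) xy_nz xy_deg by (simp add: vv_def fls_subdegree_pow m0(1))
  then show ?thesis using fe_subdegree[of "Zf 3"] by simp
qed

lemma psi_RR: "psi F \<in> RR"
  by (induction F rule: poly4_induct) (simp_all add: psi_simps psi_Var4 psi_Const4 RR_const vv_RR RR_add RR_mult)

lemma res_psi:
  assumes P: "P \<in> geom_points I" "P \<noteq> O_pt"
  shows "res P (psi F) = peval to_ac (\<lambda>k. res P (vv k)) F"
proof (induction F rule: poly4_induct)
  case (const u)
  show ?case by (simp add: psi_Const4 LR_const(2)[OF P(1)] peval_Const4[OF rhom_to_ac])
next
  case (var i)
  show ?case by (simp add: psi_Var4 peval_Var4[OF rhom_to_ac])
next
  case (add F G)
  then show ?case
    using LR_add(2)[OF P(1) RR_LR[OF psi_RR P] RR_LR[OF psi_RR P], of F G]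
    by (simp add: psi_simps rhom_add[OF rhom_peval[OF rhom_to_ac]])
next
  case (mult F G)
  then show ?case
    using LR_mult(2)[OF P(1) RR_LR[OF psi_RR P] RR_LR[OF psi_RR P], of F G]
    by (simp add: psi_simps rhom_mult[OF rhom_peval[OF rhom_to_ac]])
qed

lemma xy_LR: "P \<in> geom_points I \<Longrightarrow> P \<noteq> O_pt \<Longrightarrow> x \<in> LR P" "P \<in> geom_points I \<Longrightarrow> P \<noteq> O_pt \<Longrightarrow> y \<in> LR P"
  using RR_LR xy_RR by blast+

lemma res_vv:
  assumes P: "P \<in> geom_points I" "P \<noteq> O_pt"
  shows "res P (vv k) = vec4 1 (res P x) (res P y) (res P x ^ 2) k"
  using LR_power[OF P(1) xy_LR(1)[OF P], of 2] LR_const(2)[OF P(1), of 1] by (auto simp: vv_def vec4_def)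

lemma psi_form_ratio:
  assumes P: "P \<in> geom_points I" "P \<noteq> O_pt" and F: "is_form d F"
  shows "res P (psi (lin_subst CC F)) = pev P F / pev P L0 ^ d"
proof -
  have Ln: "is_form d (L0 ^ d)" by (rule is_form_power[OF L0(1)]) simp
  have "psi (lin_subst CC F) = fe F / fe (L0 ^ d)" using fe_psi[OF F] L0(2) by (simp add: fe_simps l0_def)
  then show ?thesis using LR_form_I(2)[OF P(1) F Ln] L0(3)[OF P] by (simp add: pev_simps)
qed

text \<open>The values of \<open>x\<close> and \<open>y\<close> determine those of every coordinate
  divided by \<open>L0\<close>, hence the homogeneous coordinates up to a common factor.\<close>

lemma affine_point_eqI:
  assumes P: "P \<in> geom_points I" "P \<noteq> O_pt" and S: "S \<in> geom_points I" "S \<noteq> O_pt"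
    and e: "res P x = res S x" "res P y = res S y"
  shows "P = S"
proof -
  have "(\<lambda>k. res P (vv k)) = (\<lambda>k. res S (vv k))" by (rule ext) (simp only: res_vv[OF P] res_vv[OF S] e)
  then have "res P (psi F) = res S (psi F)" for F by (simp only: res_psi[OF P] res_psi[OF S])
  then have r: "pev P (Var4 j) / pev P L0 = pev S (Var4 j) / pev S L0" for j
    using psi_form_ratio[OF P is_form_Var4[of j]] psi_form_ratio[OF S is_form_Var4[of j]] by simp
  define k where "k = (coords P $ ch P) * (pev P L0 / pev S L0) / (coords S $ ch S)"
  have "coords P $ j = k * coords S $ j" for j
  proof -
    have "coords P $ j = coords P $ ch P * pev P (Var4 j)" using ch[of P] by (simp add: pev_def pt_val_Var4 nvec_def)
    also have "pev P (Var4 j) = pev P L0 * (pev S (Var4 j) / pev S L0)" using r[of j] L0(3)[OF P] by (simp add: divide_eq_eq mult.commute)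
    also have "pev S (Var4 j) = coords S $ j / coords S $ ch S" by (simp add: pev_def pt_val_Var4 nvec_def)
    finally show ?thesis by (simp add: k_def mult_ac)
  qed
  then have "coords P = k *s coords S" by (simp add: vec_eq_iff)
  moreover have "k \<noteq> 0" using ch[of P] ch[of S] L0(3)[OF P] L0(3)[OF S] by (simp add: k_def)
  ultimately have "proj_point (coords P) = proj_point (coords S)" using proj_point_eqI[OF coords_nonzero] by metis
  then show ?thesis by (simp only: proj_point_coords)
qed

lemma rational_pev: "\<exists>u. pev (to_ac_point T) F = to_ac (u :: 'a)"
  unfolding pev_def pt_val_def peval_nvec_to_ac_point by blast

lemma res_cubic:
  assumes P: "P \<in> geom_points I" "P \<noteq> O_pt" and e: "res P x = to_ac p" "res P y = to_ac q"
  shows "q ^ 2 = cub p"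
proof -
  note xl = xy_LR(1)[OF P] and yl = xy_LR(2)[OF P]
  have "res P (y ^ 2) = to_ac (q ^ 2)" using LR_power[OF P(1) yl, of 2] e by simp
  moreover have "res P (x ^ 3 + fls_const a * x ^ 2 + fls_const b * x + fls_const c) = to_ac (cub p)"
    using LR_power[OF P(1) xl] xl e by (simp add: LR_add[OF P(1)] LR_mult[OF P(1)] LR_const LR_const(2)[OF P(1)] cub_def)
  ultimately show ?thesis using weq by (metis to_ac_eq_iff)
qed

lemma rational_affine:
  assumes T: "T \<in> rational_points I" "to_ac_point T \<noteq> O_pt"
  obtains p q where "res (to_ac_point T) x = to_ac p" "res (to_ac_point T) y = to_ac q" "q ^ 2 = cub p"
proof -
  let ?P = "to_ac_point T"
  have P: "?P \<in> geom_points I" using T(1) by (simp add: rational_points_def)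
  have "\<exists>u. res ?P (vv k) = to_ac u" for k
  proof -
    have "vv k = fe (Zf k) / fe L0" using Zf(2)[of k] L0(2) by (simp add: l0_def)
    then have "res ?P (vv k) = pev ?P (Zf k) / pev ?P L0" using LR_form_I(2)[OF P Zf(1) L0(1) L0(3)[OF P T(2)]] by simp
    then show ?thesis using rational_pev[of T "Zf k"] rational_pev[of T L0] by (metis to_ac_divide)
  qed
  from this[of 1] this[of 2] obtain p q where "res ?P x = to_ac p" "res ?P y = to_ac q" by (auto simp: vv_def)
  then show thesis using that res_cubic[OF P T(2)] by blast
qed

text \<open>The vector \<open>(1, p, q, p ^ 2)\<close> annihilates \<open>Q1\<close> and
  \<open>Q2\<close>; the matrix \<open>CC\<close> carries it back to the original coordinates, where
  it therefore annihilates \<open>I\<close>.\<close>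

lemma ex_point:
  assumes pq: "q ^ 2 = cub p"
  obtains R where "R \<in> rational_points I" "to_ac_point R \<in> geom_points I" "to_ac_point R \<noteq> O_pt"
    "res (to_ac_point R) x = to_ac p" "res (to_ac_point R) y = to_ac q"
proof -
  define V where "V = vec4 1 p q (p ^ 2)"
  define u where "u j = (\<Sum>k\<in>UNIV. CC $ j $ k * V k)" for j
  have Nu: "(\<Sum>j\<in>UNIV. NN $ k $ j * u j) = V k" for k
  proof -
    have "(\<Sum>j\<in>UNIV. NN $ k $ j * u j) = (\<Sum>l\<in>UNIV. (NN ** CC) $ k $ l * V l)"
      unfolding u_def matrix_matrix_mult_def sum_distrib_left by (subst sum.swap) (simp add: sum_distrib_right mult.assoc)
    also have "\<dots> = (\<Sum>l\<in>UNIV. if k = l then V l else 0)" unfolding NN_CC by (intro sum.cong) (auto simp: mat_def)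
    finally show ?thesis by simp
  qed
  define w :: "'a ^ 4" where "w = (\<chi> j. u j)"
  have w0: "w \<noteq> 0"
  proof
    assume "w = 0"
    then have "u j = 0" for j by (simp add: w_def vec_eq_iff)
    then show False using Nu[of 0] by (simp add: V_def)
  qed
  define R where "R = proj_point w"
  obtain d where d: "d \<noteq> 0" "coords R = d *s w" using coords_proj_point[OF w0] unfolding R_def by blast
  obtain e where e: "e \<noteq> 0" "\<And>j. coords (to_ac_point R) $ j = e * to_ac (coords R $ j)"
    using coords_to_ac_point[of R] by metis
  define g where "g = e * to_ac d"
  have g: "g \<noteq> 0" using d e by (simp add: g_def)
  let ?P = "to_ac_point R"
  have cP: "(\<lambda>j. coords ?P $ j) = (\<lambda>j. g * to_ac (u j))" using d e by (simp add: g_def w_def mult.assoc)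
  have ev: "eval4 F (coords ?P) = g ^ n * to_ac (peval (\<lambda>x. x) u F)" if "is_form n F" for n F
  proof -
    have "eval4 F (coords ?P) = g ^ n * peval to_ac (\<lambda>j. to_ac (u j)) F"
      unfolding eval4_eq cP by (rule peval_scale_form[OF that])
    then show ?thesis by (subst peval_comp[OF rhom_id rhom_to_ac])
  qed
  have Vu: "peval (\<lambda>x. x) V (lin_subst CC F) = peval (\<lambda>x. x) u F" for F
    unfolding peval_lin_subst[OF rhom_id] u_def[abs_def] ..
  note v = rhom_simps[OF rhom_peval[OF rhom_id]]
  have VK: "peval (\<lambda>x. x) V F = 0" if "F \<in> K" for F
  proof -
    have "peval (\<lambda>x. x) V Q1 = 0" by (simp add: Q1_def v peval_Var4[OF rhom_id] V_def)
    moreover have "peval (\<lambda>x. x) V Q2 = 0"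
    proof -
      have "p ^ 3 = p * p ^ 2" by (simp add: power3_eq_cube power2_eq_square)
      then show ?thesis using pq by (simp add: Q2_def v peval_Var4[OF rhom_id] peval_Const4[OF rhom_id] V_def cub_def)
    qed
    ultimately show ?thesis using that unfolding K_def by (auto simp: v)
  qed
  have uI: "eval4 F (coords ?P) = 0" if "F \<in> I" "is_form n F" for n F
    using ev[OF that(2)] VK Vu[of F] I_iff_K[OF that(2)] that(1) by simp
  have geom: "?P \<in> geom_points I"
    unfolding geom_points_def mem_Collect_eq vanishes_at_def
  proof
    fix F assume F: "F \<in> I"
    have "eval4 (\<Sum>d\<in>mdegree ` Poly_Mapping.keys F. hom_component d F) (coords ?P) = 0"
      unfolding rhom_sum[OF rhom_eval4] using uI[OF I_hom[OF F] is_form_hom_component] by simp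
    then show "eval4 F (coords ?P) = 0" using hom_component_expand[of F] by simp
  qed
  have Zev: "eval4 (Zf k) (coords ?P) = g * to_ac (V k)" for k
  proof -
    have "peval (\<lambda>x. x) u (Zf k) = V k"
      unfolding Zf_NN by (simp add: v peval_Var4[OF rhom_id] peval_Const4[OF rhom_id] Nu)
    then show ?thesis using ev[OF Zf(1)] by simp
  qed
  have pe: "eval4 F (coords ?P) = coords ?P $ ch ?P * pev ?P F" if "is_form 1 F" for F
    using eval4_coords_form[OF that ch] by (simp add: pev_def pt_val_def)
  have Z0: "pev ?P (Zf 0) \<noteq> 0" using pe[OF Zf(1), of 0] Zev[of 0] g by (auto simp: V_def)
  have res: "res ?P (vv k) = to_ac (V k)" for k
  proof -
    have "vv k = fe (Zf k) / fe (Zf 0)" using Zf(2) L0(2) by (simp add: vv_def)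
    then have "res ?P (vv k) = pev ?P (Zf k) / pev ?P (Zf 0)" using LR_form_I(2)[OF geom Zf(1) Zf(1) Z0] by simp
    also have "\<dots> = (coords ?P $ ch ?P * pev ?P (Zf k)) / (coords ?P $ ch ?P * pev ?P (Zf 0))" using ch by simp
    also have "\<dots> = to_ac (V k)" unfolding pe[OF Zf(1), symmetric] Zev using g by (simp add: V_def)
    finally show ?thesis .
  qed
  \<comment> \<open>\<open>Zf 0\<close> expands to \<open>l0\<close>, which vanishes at the origin,
    but it does not vanish at \<open>?P\<close>.\<close>
  have "?P \<noteq> O_pt"
  proof
    assume PO: "?P = O_pt"
    have "fls_subdegree (fe (Zf 0)) > 0" using Zf(2)[of 0] m0(1) m0_pos by (simp add: vv_def)
    then have "fps_nth (ev (Zf 0)) 0 = 0"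
      using fls_eq0_below_subdegree[of 0 "fe (Zf 0)"] by (simp add: fe_def)
    then have "vanishes_at (Zf 0) O_pt"
      using vanishes_at_iff[OF Zf(1) O_i0] pt_val_O[of "Zf 0"] by (simp add: pt_val_def ev_nth_0)
    then show False using Z0 vanishes_pev[OF Zf(1)] PO by simp
  qed
  moreover have "R \<in> rational_points I" using geom by (simp add: rational_points_def)
  ultimately show thesis using that geom res[of 1] res[of 2] by (simp add: vv_def V_def)
qed

text \<open>A polynomial in \<open>x\<close> and \<open>y\<close> differs from its value at
  \<open>(p, q)\<close> by an element of the ideal of \<open>x - p\<close> and \<open>y - q\<close>;
  for the coordinate \<open>x ^ 2\<close> the cofactor is \<open>x + p\<close>.\<close>

lemma psi_decomp:
  "\<exists>A\<in>RR. \<exists>B\<in>RR. psi F = fls_const (peval (\<lambda>x. x) (vec4 1 p q (p ^ 2)) F) + (x - fls_const p) * A + (y - fls_const q) * B"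
  (is "\<exists>A\<in>RR. \<exists>B\<in>RR. psi F = fls_const (?v F) + ?x * A + ?y * B")
proof (induction F rule: poly4_induct)
  case (const u)
  show ?case
    by (rule bexI[of _ 0], rule bexI[of _ 0]) (use RR_const[of 0] in \<open>simp_all add: psi_Const4 peval_Const4[OF rhom_id]\<close>)
next
  case (var i)
  have r: "0 \<in> RR" "1 \<in> RR" "x + fls_const p \<in> RR" using RR_const[of 0] RR_const[of 1] RR_add[OF xy_RR(1) RR_const] by auto
  have "\<forall>i. \<exists>A\<in>RR. \<exists>B\<in>RR. vv i = fls_const (vec4 1 p q (p ^ 2) i) + ?x * A + ?y * B"
    unfolding all_index4
  proof (intro conjI)
    show "\<exists>A\<in>RR. \<exists>B\<in>RR. vv 0 = fls_const (vec4 1 p q (p ^ 2) 0) + ?x * A + ?y * B"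
      by (rule bexI[OF _ r(1)], rule bexI[OF _ r(1)]) (simp add: vv_def)
    show "\<exists>A\<in>RR. \<exists>B\<in>RR. vv 1 = fls_const (vec4 1 p q (p ^ 2) 1) + ?x * A + ?y * B"
      by (rule bexI[OF _ r(2)], rule bexI[OF _ r(1)]) (simp add: vv_def)
    show "\<exists>A\<in>RR. \<exists>B\<in>RR. vv 2 = fls_const (vec4 1 p q (p ^ 2) 2) + ?x * A + ?y * B"
      by (rule bexI[OF _ r(1)], rule bexI[OF _ r(2)]) (simp add: vv_def)
    show "\<exists>A\<in>RR. \<exists>B\<in>RR. vv 3 = fls_const (vec4 1 p q (p ^ 2) 3) + ?x * A + ?y * B"
      by (rule bexI[OF _ r(3)], rule bexI[OF _ r(1)]) (simp add: vv_def fls_const_power power2_eq_square algebra_simps)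
  qed
  then show ?case unfolding psi_Var4 peval_Var4[OF rhom_id] by blast
next
  case (add F G)
  then obtain A B A' B' where AB: "A \<in> RR" "B \<in> RR" "A' \<in> RR" "B' \<in> RR"
    "psi F = fls_const (?v F) + ?x * A + ?y * B" "psi G = fls_const (?v G) + ?x * A' + ?y * B'" by blast
  have "fls_const (?v (F + G)) = fls_const (?v F) + fls_const (?v G)"
    by (simp add: rhom_add[OF rhom_peval[OF rhom_id]] rhom_add[OF rhom_fls_const])
  then have "psi (F + G) = fls_const (?v (F + G)) + ?x * (A + A') + ?y * (B + B')"
    unfolding psi_simps AB(5,6) by (simp add: algebra_simps)
  then show ?case using RR_add AB(1-4) by blast
next
  case (mult F G)
  then obtain A B A' B' where AB: "A \<in> RR" "B \<in> RR" "A' \<in> RR" "B' \<in> RR"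
    "psi F = fls_const (?v F) + ?x * A + ?y * B" "psi G = fls_const (?v G) + ?x * A' + ?y * B'" by blast
  have c: "fls_const (?v (F * G)) = fls_const (?v F) * fls_const (?v G)"
    by (simp add: rhom_mult[OF rhom_peval[OF rhom_id]])
  have "psi (F * G) = (fls_const (?v F) + ?x * A + ?y * B) * psi G" unfolding psi_simps AB(5) ..
  also have "\<dots> = fls_const (?v F) * psi G + ?x * (A * psi G) + ?y * (B * psi G)" by (simp only: distrib_right mult.assoc)
  also have "fls_const (?v F) * psi G = fls_const (?v F) * fls_const (?v G) + ?x * (fls_const (?v F) * A') + ?y * (fls_const (?v F) * B')"
    unfolding AB(6) by (simp only: distrib_left mult.left_commute)
  finally have "psi (F * G) = fls_const (?v (F * G)) + ?x * (A * psi G + fls_const (?v F) * A') + ?y * (B * psi G + fls_const (?v F) * B')"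
    unfolding c by (simp only: distrib_left add_ac)
  moreover have "A * psi G + fls_const (?v F) * A' \<in> RR" "B * psi G + fls_const (?v F) * B' \<in> RR"
    using AB(1-4) psi_RR RR_const RR_add RR_mult by blast+
  ultimately show ?case by blast
qed

text \<open>In a representation of \<open>z\<close> by forms the denominator is a unit at
  \<open>P\<close>, and the numerator has no constant part in its decomposition from
  \<open>psi_decomp\<close>.\<close>

lemma max_ideal_affine:
  assumes P: "P \<in> geom_points I" "P \<noteq> O_pt" and e: "res P x = to_ac p" "res P y = to_ac q"
    and z: "z \<in> LR P" "res P z = 0"
  obtains A B where "A \<in> LR P" "B \<in> LR P" "z = (x - fls_const p) * A + (y - fls_const q) * B"
proof -
  obtain d F G where FG: "is_form d F" "is_form d G" "pev P G \<noteq> 0" "z = fe F / fe G" "res P z = pev P F / pev P G"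
    using LR_forms[OF P(1) z(1)] by metis
  let ?F = "psi (lin_subst CC F)" and ?G = "psi (lin_subst CC G)"
  have zz: "z = ?F / ?G" using FG(4) fe_psi[OF FG(1)] fe_psi[OF FG(2)] L0(2) by simp
  have G: "res P ?G \<noteq> 0" using psi_form_ratio[OF P FG(2)] FG(3) L0(3)[OF P] by simp
  have "res P ?F = 0" using psi_form_ratio[OF P FG(1)] FG(3,5) z(2) by simp
  moreover have "(\<lambda>k. res P (vv k)) = (\<lambda>k. to_ac (vec4 1 p q (p ^ 2) k))"
    by (rule ext) (simp add: res_vv[OF P] e vec4_def)
  then have "res P ?F = to_ac (peval (\<lambda>x. x) (vec4 1 p q (p ^ 2)) (lin_subst CC F))"
    unfolding res_psi[OF P] by (simp only: peval_comp[OF rhom_id rhom_to_ac])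
  ultimately have v0: "peval (\<lambda>x. x) (vec4 1 p q (p ^ 2)) (lin_subst CC F) = 0" by simp
  obtain A B where AB: "A \<in> RR" "B \<in> RR" "?F = (x - fls_const p) * A + (y - fls_const q) * B"
    using psi_decomp[of "lin_subst CC F" p q] unfolding v0 by auto
  have i: "inverse ?G \<in> LR P" by (rule LR_inverse(1)[OF P(1) RR_LR[OF psi_RR P] G])
  have "z = (x - fls_const p) * (A * inverse ?G) + (y - fls_const q) * (B * inverse ?G)"
    unfolding zz AB(3) by (simp add: divide_inverse distrib_right mult.assoc)
  then show thesis using that LR_mult(1)[OF P(1) RR_LR[OF AB(1) P] i] LR_mult(1)[OF P(1) RR_LR[OF AB(2) P] i] by blast
qed

text \<open>Since \<open>x - p\<close> and \<open>y - q\<close> generate the maximal ideal, a common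
  divisor of both that vanishes at \<open>P\<close> generates it alone.\<close>

lemma gen_affine:
  assumes P: "P \<in> geom_points I" "P \<noteq> O_pt" and e: "res P x = to_ac p" "res P y = to_ac q"
    and s: "s \<in> LR P" "res P s = 0" and A: "A \<in> LR P" "x - fls_const p = s * A" and B: "B \<in> LR P" "y - fls_const q = s * B"
  shows "gen P s"
  unfolding gen_def
proof (intro conjI ballI impI s)
  fix z assume z: "z \<in> LR P" "res P z = 0"
  obtain A' B' where AB: "A' \<in> LR P" "B' \<in> LR P" "z = (x - fls_const p) * A' + (y - fls_const q) * B'"
    by (rule max_ideal_affine[OF P e z])
  then have "z = (A * A' + B * B') * s" unfolding A(2) B(2) by (simp add: algebra_simps)
  moreover have "A * A' + B * B' \<in> LR P" using LR_add(1)[OF P(1) LR_mult(1)[OF P(1) A(1) AB(1)] LR_mult(1)[OF P(1) B(1) AB(2)]] .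
  ultimately show "\<exists>w\<in>LR P. z = w * s" by blast
qed

text \<open>The difference quotient of the cubic between \<open>x\<close> and \<open>p\<close>; at a
  point with \<open>x = p\<close> its value is the derivative of the cubic at
  \<open>p\<close>.\<close>

definition hh :: "'a \<Rightarrow> 'a fls" where
  "hh p = x ^ 2 + fls_const p * x + fls_const (p ^ 2) + fls_const a * (x + fls_const p) + fls_const b"

lemma hh: "y ^ 2 - fls_const (cub p) = (x - fls_const p) * hh p"
proof -
  have "fls_const (cub p) = fls_const p ^ 3 + fls_const a * fls_const p ^ 2 + fls_const b * fls_const p + fls_const c"
    by (simp add: cub_def fls_plus_const flip: fls_const_power)
  then show ?thesis unfolding weq hh_def fls_const_power
    by (simp only:) (simp add: power2_eq_square power3_eq_cube algebra_simps del: fls_const_mult_const)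
qed

lemma hh_RR: "hh p \<in> RR"
  unfolding hh_def using xy_RR by (intro RR_add RR_mult RR_const RR_power)

section \<open>The divisor of \<open>x - p\<close>\<close>

lemma res_sub_x: "P \<in> geom_points I \<Longrightarrow> P \<noteq> O_pt \<Longrightarrow> res P (x - fls_const p) = res P x - to_ac p"
  using LR_diff(2)[OF _ xy_LR(1) LR_const(1)] LR_const(2) by simp

lemma sub_x_RR: "x - fls_const p \<in> RR"
  by (intro RR_diff xy_RR RR_const)

lemma sub_x_deg: "fls_subdegree (x - fls_const p) = - 2" "x - fls_const p \<noteq> 0"
proof -
  have n: "fls_nth (x - fls_const p) (- 2) \<noteq> 0" using nth_fls_subdegree_nonzero[OF xy_nz(1)] xy_deg(1) by simp
  show "fls_subdegree (x - fls_const p) = - 2"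
    by (rule fls_subdegree_eqI[OF n]) (use xy_deg in simp)
  show "x - fls_const p \<noteq> 0" using n by (metis fls_zero_nth)
qed

text \<open>The value \<open>2 * q\<close> of \<open>y + q\<close> at \<open>P\<close> is nonzero,
  so the factorisation \<open>(y - q) * (y + q) = (x - p) * hh p\<close> makes \<open>y - q\<close>
  a multiple of \<open>x - p\<close>, which is then a uniformizer.\<close>

lemma ord_sub_x_simple:
  assumes P: "P \<in> geom_points I" "P \<noteq> O_pt" and e: "res P x = to_ac p" "res P y = to_ac q" and q: "q \<noteq> 0"
  shows "ordK P (x - fls_const p) = 1"
proof -
  have cq: "q ^ 2 = cub p" by (rule res_cubic[OF P e])
  have yq: "y + fls_const q \<in> LR P" by (rule LR_add(1)[OF P(1) xy_LR(2)[OF P] LR_const(1)])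
  have "res P (y + fls_const q) = to_ac q + to_ac q"
    unfolding LR_add(2)[OF P(1) xy_LR(2)[OF P] LR_const(1)] LR_const(2)[OF P(1)] e ..
  also have "\<dots> = to_ac (2 * q)" by (simp only: mult_2 to_ac_add)
  finally have nz: "res P (y + fls_const q) \<noteq> 0" using q two by (simp only: to_ac_eq_0_iff) simp
  then have y0: "y + fls_const q \<noteq> 0" using res_0[OF P(1)] by auto
  have "(y - fls_const q) * (y + fls_const q) = y ^ 2 - fls_const (q ^ 2)"
    by (simp add: algebra_simps power2_eq_square)
  then have "(y - fls_const q) * (y + fls_const q) = (x - fls_const p) * hh p" unfolding cq hh .
  then have "y - fls_const q = (x - fls_const p) * (hh p * inverse (y + fls_const q))"
    using y0 by (simp add: divide_inverse[symmetric] eq_divide_eq)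
  moreover have "hh p * inverse (y + fls_const q) \<in> LR P"
    by (rule LR_mult(1)[OF P(1) RR_LR[OF hh_RR P] LR_inverse(1)[OF P(1) yq nz]])
  moreover have "1 \<in> LR P" using LR_const(1)[of 1] by simp
  ultimately have "gen P (x - fls_const p)"
    using gen_affine[OF P e RR_LR[OF sub_x_RR P], of p 1 "hh p * inverse (y + fls_const q)"] res_sub_x[OF P] e by simp
  then show ?thesis using ordK_gen[OF P(1)] sub_x_deg(2) by blast
qed

text \<open>A double root \<open>p\<close> of the cubic would make \<open>y / (x - p)\<close> a function with a single simple pole at the origin.\<close>

lemma no_double_root:
  assumes p: "cub p = 0"
  shows "3 * p ^ 2 + 2 * a * p + b \<noteq> 0"
proof
  assume d: "3 * p ^ 2 + 2 * a * p + b = 0"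
  define w where "w = y / (x - fls_const p)"
  have "fls_const (3 * p ^ 2 + 2 * a * p + b) = 3 * fls_const p ^ 2 + 2 * fls_const a * fls_const p + fls_const b"
    by (simp add: fls_plus_const flip: fls_const_power fls_const_numeral)
  then have d': "3 * fls_const p ^ 2 + 2 * fls_const a * fls_const p + fls_const b = 0" using d by simp
  have "hh p = (x - fls_const p) * (x + 2 * fls_const p + fls_const a) + (3 * fls_const p ^ 2 + 2 * fls_const a * fls_const p + fls_const b)"
    unfolding hh_def fls_const_power by (simp add: power2_eq_square algebra_simps del: fls_const_mult_const)
  then have "y ^ 2 = (x - fls_const p) ^ 2 * (x + 2 * fls_const p + fls_const a)"
    using hh[of p] p d' by (simp add: power2_eq_square mult.assoc)
  then have w2: "w ^ 2 = x + 2 * fls_const p + fls_const a" using sub_x_deg(2) by (simp add: w_def power_divide)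
  have w2R: "w ^ 2 \<in> RR"
  proof -
    have "2 * fls_const p = fls_const (2 * p)" by (simp flip: fls_const_numeral)
    then show ?thesis unfolding w2 using xy_RR RR_const by (simp add: RR_add)
  qed
  have wK: "w \<in> KK" "w \<noteq> 0" using RR_KK[OF xy_RR(2)] RR_KK[OF sub_x_RR] xy_nz sub_x_deg(2) by (simp_all add: w_def KK_divide)
  \<comment> \<open>The order of \<open>w ^ 2\<close> is twice that of \<open>w\<close>, so
    regularity of the square gives regularity of \<open>w\<close>.\<close>
  have "w \<in> LR P" if P: "P \<in> geom_points I" "P \<noteq> O_pt" for P
  proof -
    have "ordK P (w ^ 2) \<ge> 0" using ordK_nonneg_iff(1)[OF P(1) RR_KK[OF w2R]] RR_LR[OF w2R P] wK(2) by simp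
    then have "ordK P w \<ge> 0" using ordK_power[OF P(1) wK, of 2] by simp
    then show ?thesis using ordK_nonneg_iff(1)[OF P(1) wK] by simp
  qed
  then have "w \<in> RR" using wK by (simp add: RR_def)
  moreover have "fls_subdegree w = - 1" unfolding w_def using fls_divide_subdegree[OF xy_nz(2) sub_x_deg(2)] sub_x_deg(1) xy_deg by simp
  ultimately have "1 \<in> poles" using RR_poles(2)[of w] wK(2) by simp
  then show False by (simp add: poles_eq)
qed

text \<open>The derivative of the cubic at \<open>p\<close> is nonzero, so \<open>hh p\<close> is a
  unit at \<open>P\<close> and \<open>x - p\<close> is a unit times \<open>y ^ 2\<close>; hence
  \<open>y\<close> is a uniformizer.\<close>

lemma ord_sub_x_double:
  assumes P: "P \<in> geom_points I" "P \<noteq> O_pt" and e: "res P x = to_ac p" "res P y = to_ac 0"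
  shows "ordK P (x - fls_const p) = 2"
proof -
  have cq: "cub p = 0" using res_cubic[OF P e] by simp
  have hL: "hh p \<in> LR P" by (rule RR_LR[OF hh_RR P])
  have "res P (hh p) = to_ac (3 * p ^ 2 + 2 * a * p + b)"
    using LR_power[OF P(1) xy_LR(1)[OF P]] xy_LR(1)[OF P] e unfolding hh_def
    by (simp add: LR_add[OF P(1)] LR_mult[OF P(1)] LR_const LR_const(2)[OF P(1)])
      (simp add: power2_eq_square algebra_simps)
  then have nz: "res P (hh p) \<noteq> 0" using no_double_root[OF cq] by (simp only: to_ac_eq_0_iff not_False_eq_True)
  then have h0: "hh p \<noteq> 0" using res_0[OF P(1)] by auto
  have y2: "y ^ 2 = (x - fls_const p) * hh p" using hh[of p] cq by simp
  then have "x - fls_const p = y * (y * inverse (hh p))" using h0 by (simp add: power2_eq_square field_simps)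
  moreover have "y * inverse (hh p) \<in> LR P" by (rule LR_mult(1)[OF P(1) xy_LR(2)[OF P] LR_inverse(1)[OF P(1) hL nz]])
  moreover have "1 \<in> LR P" using LR_const(1)[of 1] by simp
  ultimately have "gen P y"
    using gen_affine[OF P e xy_LR(2)[OF P], of "y * inverse (hh p)" 1] e by simp
  then have "ordK P y = 1" using ordK_gen[OF P(1)] xy_nz by blast
  then have "ordK P (y ^ 2) = 2" using ordK_power[OF P(1) RR_KK[OF xy_RR(2)] xy_nz(2), of 2] by simp
  moreover have "ordK P (hh p) = 0" using ordK_units[OF P(1)] hL nz by (simp add: units_def)
  ultimately show ?thesis
    using ordK_mult[OF P(1) RR_KK[OF sub_x_RR] sub_x_deg(2) RR_KK[OF hh_RR] h0, of p] y2 by simp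
qed

definition ind :: "'b \<Rightarrow> 'b \<Rightarrow> int" where
  "ind S P = (if P = S then 1 else 0)"

definition affine :: "'a alg_closure pspace3 \<Rightarrow> 'a \<Rightarrow> 'a \<Rightarrow> bool" where
  "affine P p q \<longleftrightarrow> P \<in> geom_points I \<and> P \<noteq> O_pt \<and> res P x = to_ac p \<and> res P y = to_ac q"

lemma affine_eq: "affine P p q \<Longrightarrow> S \<in> geom_points I \<Longrightarrow> S \<noteq> O_pt \<Longrightarrow> S = P \<longleftrightarrow> res S x = to_ac p \<and> res S y = to_ac q"
  using affine_point_eqI[of S P] by (auto simp: affine_def)

text \<open>Over \<open>x = p\<close> the coordinate \<open>y\<close> can only be \<open>q\<close>
  or \<open>- q\<close>. For \<open>q = 0\<close> the two points coincide, and the sum of the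
  indicators is the double zero.\<close>

lemma divisor_sub_x:
  assumes R: "affine R p q" and R': "affine R' p (- q)" and P: "P \<in> geom_points I" "P \<noteq> O_pt"
  shows "ordK P (x - fls_const p) = ind R P + ind R' P"
proof (cases "res P x = to_ac p")
  case False
  then have "res P (x - fls_const p) \<noteq> 0" using res_sub_x[OF P] by simp
  then have "x - fls_const p \<in> units P" using RR_LR[OF sub_x_RR P] by (simp add: units_def)
  moreover have "P \<noteq> R" "P \<noteq> R'" using False R R' by (auto simp: affine_def)
  ultimately show ?thesis using ordK_units[OF P(1)] by (simp add: ind_def)
next
  case True
  have cq: "q ^ 2 = cub p" using R res_cubic by (auto simp: affine_def)
  have "res P (y ^ 2) = to_ac (cub p)"
    unfolding weq using LR_power[OF P(1) xy_LR(1)[OF P]] xy_LR(1)[OF P] True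
    by (simp add: LR_add[OF P(1)] LR_mult[OF P(1)] LR_const LR_const(2)[OF P(1)] cub_def)
  then have "res P y ^ 2 = to_ac q ^ 2" using LR_power[OF P(1) xy_LR(2)[OF P], of 2] cq by (simp flip: to_ac_power)
  then have Y: "res P y = to_ac q \<or> res P y = to_ac (- q)" by (simp add: power2_eq_iff)
  show ?thesis
  proof (cases "q = 0")
    case True
    then show ?thesis using ord_sub_x_double[OF P \<open>res P x = to_ac p\<close>] Y affine_eq[OF R P] affine_eq[OF R' P] \<open>res P x = to_ac p\<close>
      by (simp add: ind_def)
  next
    case False
    have "to_ac q \<noteq> to_ac (- q)" unfolding to_ac_eq_iff using False two by (simp add: eq_neg_iff_add_eq_0 flip: mult_2)
    then have "ind R P + ind R' P = 1"
      unfolding ind_def affine_eq[OF R P] affine_eq[OF R' P] using Y \<open>res P x = to_ac p\<close> by auto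
    then show ?thesis using ord_sub_x_simple[OF P \<open>res P x = to_ac p\<close>] Y False by (metis neg_equal_0_iff_equal)
  qed
qed

end

section \<open>Two-torsion\<close>

context weierstrass_curve
begin

lemma affine_opposite:
  assumes "affine P p q"
  obtains P' where "affine P' p (- q)"
proof -
  have "(- q) ^ 2 = cub p" using assms res_cubic by (auto simp: affine_def)
  then show thesis using ex_point[of "- q" p] that unfolding affine_def by metis
qed

text \<open>The tangent line \<open>l\<close> at \<open>T\<close> meets the curve again at \<open>-R\<close>; with the opposite line \<open>l'\<close> we have
  \<open>l * l' = (x - p)\<^sup>2 * (x - r)\<close>, which determines the divisor of \<open>l\<close> because \<open>l\<close> and \<open>l'\<close> have a
  common zero only if \<open>R = -R\<close>.\<close>

lemma double_point:
  assumes T: "affine T p q" and q: "q \<noteq> 0"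
  obtains R g where "R \<in> rational_points I" "to_ac_point R \<noteq> O_pt" "g \<in> KK" "g \<noteq> 0"
    "\<And>P. P \<in> geom_points I \<Longrightarrow> ordK P g = 2 * ind T P - ind (to_ac_point R) P - ind O_pt P"
proof -
  have cq: "q ^ 2 = cub p" using T res_cubic by (auto simp: affine_def)
  \<comment> \<open>The slope of the tangent at \<open>(p, q)\<close>. Below, \<open>r\<close> is
    the third root of the cubic minus the squared line, and \<open>s\<close> is the negative of the
    height of the line at \<open>r\<close>.\<close>
  define \<mu> where "\<mu> = (3 * p ^ 2 + 2 * a * p + b) / (2 * q)"
  have \<mu>: "2 * q * \<mu> = 3 * p ^ 2 + 2 * a * p + b" using q two by (simp add: \<mu>_def)
  define r where "r = \<mu> ^ 2 - 2 * p - a"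
  define s where "s = - (q + \<mu> * (r - p))"
  have idn: "u ^ 3 + a * u ^ 2 + b * u + c - (q + \<mu> * (u - p)) ^ 2 = (u - p) ^ 2 * (u - r)" for u
  proof -
    have "u ^ 3 + a * u ^ 2 + b * u + c - (q + \<mu> * (u - p)) ^ 2
      = (cub p - q ^ 2) + (u - p) * (3 * p ^ 2 + 2 * a * p + b - 2 * q * \<mu>) + (u - p) ^ 2 * (u - r)"
      by (simp add: cub_def r_def power2_eq_square power3_eq_cube algebra_simps)
    then show ?thesis using cq \<mu> by simp
  qed
  have "s ^ 2 = cub r" using idn[of r] unfolding s_def power2_minus by (simp add: cub_def)
  then obtain R where R: "R \<in> rational_points I" "affine (to_ac_point R) r s"
    using ex_point[of s r] unfolding affine_def by metis
  let ?R = "to_ac_point R"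
  obtain T' where T': "affine T' p (- q)" by (rule affine_opposite[OF T])
  obtain R' where R': "affine R' r (- s)" by (rule affine_opposite[OF R(2)])
  define m where "m = fls_const q + fls_const \<mu> * (x - fls_const p)"
  define l where "l = y - m"
  define l' where "l' = y + m"
  have mR: "m \<in> RR" unfolding m_def by (intro RR_add RR_mult RR_const sub_x_RR)
  have lR: "l \<in> RR" "l' \<in> RR" unfolding l_def l'_def using xy_RR mR by (auto intro: RR_add RR_diff)
  have prod: "l * l' = (x - fls_const p) ^ 2 * (x - fls_const r)"
  proof -
    have fc: "fls_const (u + v) = fls_const u + fls_const v" "fls_const (u - v) = fls_const u - fls_const v"
      "fls_const (u * v) = fls_const u * fls_const v" "fls_const (2 * u) = 2 * fls_const u" "fls_const (3 * u) = 3 * fls_const u" for u v :: 'a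
      by (simp_all add: rhom_add[OF rhom_fls_const] rhom_diff[OF rhom_fls_const] flip: fls_const_numeral)
    define P' L' A' B' C' Q' where D: "P' = fls_const p" "L' = fls_const \<mu>" "A' = fls_const a" "B' = fls_const b" "C' = fls_const c" "Q' = fls_const q"
    have e1: "Q' ^ 2 = P' ^ 3 + A' * P' ^ 2 + B' * P' + C'"
      unfolding D fls_const_power[symmetric] cq cub_def by (simp add: fc(1,3) fls_const_power del: fls_const_mult_const)
    have e2: "2 * Q' * L' = 3 * P' ^ 2 + 2 * A' * P' + B'"
    proof -
      have "fls_const (2 * (q * \<mu>)) = fls_const (3 * p ^ 2 + 2 * (a * p) + b)" using \<mu> by (simp add: mult.assoc)
      then show ?thesis unfolding D by (simp only: fc fls_const_power fls_const_numeral mult.assoc)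
    qed
    have r': "fls_const r = L' ^ 2 - 2 * P' - A'"
      unfolding r_def D by (simp only: fc fls_const_power fls_const_numeral)
    have "l * l' = y ^ 2 - m ^ 2" by (simp add: l_def l'_def power2_eq_square algebra_simps)
    also have "\<dots> = x ^ 3 + A' * x ^ 2 + B' * x + C' - (Q' + L' * (x - P')) ^ 2" unfolding weq m_def D ..
    also have "\<dots> = (P' ^ 3 + A' * P' ^ 2 + B' * P' + C' - Q' ^ 2) + (x - P') * (3 * P' ^ 2 + 2 * A' * P' + B' - 2 * Q' * L')
        + (x - P') ^ 2 * (x - (L' ^ 2 - 2 * P' - A'))"
      by (simp add: power2_eq_square power3_eq_cube algebra_simps)
    finally show ?thesis unfolding r'[symmetric] using e1 e2 by (simp add: D)
  qed
  have nz: "l \<noteq> 0" "l' \<noteq> 0" using prod sub_x_deg(2) by auto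
  note lK = RR_KK[OF lR(1)] RR_KK[OF lR(2)]
  note xp = RR_KK[OF sub_x_RR] sub_x_deg(2)
  have res_m: "res P m = to_ac q + to_ac \<mu> * (res P x - to_ac p)" if P: "P \<in> geom_points I" "P \<noteq> O_pt" for P
    unfolding m_def LR_add(2)[OF P(1) LR_const(1) LR_mult(1)[OF P(1) LR_const(1) RR_LR[OF sub_x_RR P]]]
      LR_mult(2)[OF P(1) LR_const(1) RR_LR[OF sub_x_RR P]] res_sub_x[OF P] LR_const(2)[OF P(1)] ..
  have res_l: "res P l = res P y - (to_ac q + to_ac \<mu> * (res P x - to_ac p))"
    "res P l' = res P y + (to_ac q + to_ac \<mu> * (res P x - to_ac p))" if P: "P \<in> geom_points I" "P \<noteq> O_pt" for P
    unfolding l_def l'_def LR_diff(2)[OF P(1) xy_LR(2)[OF P] RR_LR[OF mR P]] LR_add(2)[OF P(1) xy_LR(2)[OF P] RR_LR[OF mR P]]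
      res_m[OF P] by (rule refl)+
  have ms: "to_ac q + to_ac \<mu> * (to_ac r - to_ac p) = - to_ac s"
    by (simp add: s_def)
  have resv: "res T l = 0" "res R' l = 0" "res T' l' = 0" "res ?R l' = 0"
  proof -
    show "res T l = 0" "res T' l' = 0" using res_l[of T] res_l[of T'] T T' by (simp_all add: affine_def)
    have "res R' l = to_ac (- s) - (to_ac q + to_ac \<mu> * (to_ac r - to_ac p))" using res_l(1)[of R'] R' by (simp add: affine_def)
    then show "res R' l = 0" unfolding ms by simp
    have "res ?R l' = to_ac s + (to_ac q + to_ac \<mu> * (to_ac r - to_ac p))" using res_l(2)[of ?R] R(2) by (simp add: affine_def)
    then show "res ?R l' = 0" unfolding ms by simp
  qed
  have ordl: "ordK P l = 2 * ind T P + ind R' P" if P: "P \<in> geom_points I" "P \<noteq> O_pt" for P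
  proof -
    have "ordK P (l * l') = ordK P l + ordK P l'" by (rule ordK_mult[OF P(1) lK(1) nz(1) lK(2) nz(2)])
    moreover have "ordK P (l * l') = 2 * ordK P (x - fls_const p) + ordK P (x - fls_const r)"
      unfolding prod using ordK_mult[OF P(1) KK_power[OF xp(1)] _ xp(1) xp(2)] ordK_power[OF P(1) xp(1,2)] sub_x_deg(2) by simp
    ultimately have tot: "ordK P l + ordK P l' = 2 * (ind T P + ind T' P) + (ind ?R P + ind R' P)"
      using divisor_sub_x[OF T T' P] divisor_sub_x[OF R(2) R' P] by simp
    have zero: "ordK P z = 0" if "z \<in> RR" "res P z \<noteq> 0" for z
      using ordK_units[OF P(1)] RR_LR[OF that(1) P] that(2) by (simp add: units_def)
    have one: "ordK P z \<ge> 1" if "z \<in> RR" "res P z = 0" "z \<noteq> 0" for z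
      using ordK_nonneg_iff(2)[OF P(1) RR_KK[OF that(1)] that(3)] RR_LR[OF that(1) P] that(2) by simp
    consider "res P l \<noteq> 0" | "res P l' \<noteq> 0" | "res P l = 0" "res P l' = 0" by blast
    then show ?thesis
    proof cases
      case 1
      then have "P \<noteq> T" "P \<noteq> R'" using resv by auto
      then show ?thesis using zero[OF lR(1) 1] by (simp add: ind_def)
    next
      case 2
      then have "P \<noteq> T'" "P \<noteq> ?R" using resv by auto
      then show ?thesis using zero[OF lR(2) 2] tot by (simp add: ind_def)
    next
      \<comment> \<open>Here \<open>y\<close> and the line both vanish, which excludes
        \<open>T\<close> and \<open>T'\<close> because \<open>q\<close> is nonzero. The two orders
        are positive with sum \<open>ind ?R P + ind R' P\<close>, at most 2, so both are 1.\<close>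
      case 3
      let ?m = "to_ac q + to_ac \<mu> * (res P x - to_ac p)"
      have ym: "res P y - ?m = 0" "res P y + ?m = 0" using 3 unfolding res_l[OF P] by auto
      have "2 * res P y = (res P y - ?m) + (res P y + ?m)" by simp
      then have "2 * res P y = 0" unfolding ym by simp
      moreover have "(2 :: 'a alg_closure) \<noteq> 0" using two by (metis to_ac_eq_0_iff to_ac_numeral)
      ultimately have y0: "res P y = 0" by simp
      then have m0: "?m = 0" using ym by simp
      have xnp: "res P x \<noteq> to_ac p"
      proof
        assume "res P x = to_ac p"
        then show False using m0 q by simp
      qed
      have "P \<noteq> T" "P \<noteq> T'" using xnp T T' by (auto simp: affine_def)
      then have i0: "ind T P = 0" "ind T' P = 0" by (simp_all add: ind_def)
      have "ordK P l \<ge> 1" "ordK P l' \<ge> 1" using one lR nz 3 by blast+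
      moreover have "ind ?R P \<le> 1" "ind R' P \<le> 1" by (simp_all add: ind_def)
      moreover have "ordK P l + ordK P l' = ind ?R P + ind R' P" using tot i0 by simp
      ultimately have "ordK P l \<le> ind R' P" "ind R' P \<le> ordK P l" by linarith+
      then show ?thesis using i0 by simp
    qed
  qed
  \<comment> \<open>The divisors of \<open>l\<close> and \<open>x - r\<close> are 2(T) + (R') - 3(O)
    and (R) + (R') - 2(O); their difference is 2(T) - (R) - (O).\<close>
  define g where "g = l / (x - fls_const r)"
  have g: "g \<in> KK" "g \<noteq> 0" using lK xp nz by (simp_all add: g_def KK_divide)
  have "ordK P g = 2 * ind T P - ind ?R P - ind O_pt P" if P: "P \<in> geom_points I" for P
  proof (cases "P = O_pt")
    case False
    have "ordK P g = ordK P l - ordK P (x - fls_const r)" unfolding g_def by (rule ordK_divide[OF P lK(1) nz(1) xp])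
    then show ?thesis using ordl[OF P False] divisor_sub_x[OF R(2) R' P False] False by (simp add: ind_def[of O_pt])
  next
    case True
    have my: "fls_nth m j = 0" if "j < - 2" for j
      using that xy_deg(1) by (simp add: m_def)
    have "fls_subdegree l = - 3"
    proof (rule fls_subdegree_eqI)
      show "fls_nth l (- 3) \<noteq> 0" using nth_fls_subdegree_nonzero[OF xy_nz(2)] xy_deg(2) my[of "- 3"] by (simp add: l_def)
      show "fls_nth l j = 0" if "j < - 3" for j using that xy_deg(2) my[of j] by (simp add: l_def)
    qed
    then have "fls_subdegree g = - 1" unfolding g_def using fls_divide_subdegree[OF nz(1) sub_x_deg(2)] sub_x_deg(1) by simp
    moreover have "P \<noteq> T" "P \<noteq> ?R" using True T R(2) by (auto simp: affine_def)
    ultimately show ?thesis using ordK_O[OF g] True by (simp add: ind_def)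
  qed
  then show thesis using that R g unfolding affine_def by blast
qed

text \<open>The factor \<open>x - r\<close> cancels the pole of \<open>h\<close> at \<open>R\<close>
  and adds a zero at the opposite point \<open>R'\<close>. The product has pole order at most 2 at
  the origin, so it is a combination of \<open>x\<close> and 1; vanishing at \<open>R'\<close> makes
  it a multiple of \<open>x - r\<close>, and \<open>h\<close> is constant.\<close>

lemma equivalent_points_eq:
  assumes R: "R \<in> rational_points I" "to_ac_point R \<noteq> O_pt" and h: "h \<in> KK" "h \<noteq> 0"
    and div: "\<And>P. P \<in> geom_points I \<Longrightarrow> ordK P h = ind S P - ind (to_ac_point R) P"
  shows "S = to_ac_point R"
proof -
  let ?R = "to_ac_point R"
  have Rg: "?R \<in> geom_points I" using R by (simp add: rational_points_def)
  obtain r s where "affine ?R r s" using rational_affine[OF R] Rg R(2) unfolding affine_def by metis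
  note Ra = this
  obtain R' where R': "affine R' r (- s)" by (rule affine_opposite[OF Ra])
  define w where "w = h * (x - fls_const r)"
  note xr = RR_KK[OF sub_x_RR[of r]] sub_x_deg(2)[of r]
  have w: "w \<in> KK" "w \<noteq> 0" using h xr by (simp_all add: w_def KK_mult)
  have ow: "ordK P w = ordK P h + ordK P (x - fls_const r)" if "P \<in> geom_points I" for P
    unfolding w_def by (rule ordK_mult[OF that h xr])
  have ow': "ordK P w = ind S P + ind R' P" if P: "P \<in> geom_points I" "P \<noteq> O_pt" for P
    using ow[OF P(1)] div[OF P(1)] divisor_sub_x[OF Ra R' P] by simp
  have ind_nn: "ind U P \<ge> 0" for U P :: "'a alg_closure pspace3" by (simp add: ind_def)
  have "w \<in> LR P" if P: "P \<in> geom_points I" "P \<noteq> O_pt" for P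
    using ordK_nonneg_iff(1)[OF P(1) w] ow'[OF P] ind_nn[of S P] ind_nn[of R' P] by simp
  then have wR: "w \<in> RR" using w by (simp add: RR_def)
  have "fls_subdegree h \<ge> 0" using div[OF O_geom] ordK_O[OF h] ind_nn[of S O_pt] R(2) by (simp add: ind_def[of ?R])
  then have "fls_subdegree w \<ge> - 2" using h xr sub_x_deg(1)[of r] by (simp add: w_def)
  then have "pole_le w (Suc 1)" by (simp add: pole_le_iff numeral_2_eq_2)
  then obtain k where k: "w - fls_const k * x \<in> RR" "pole_le (w - fls_const k * x) 1"
    using pole_le_reduce[OF wR _ xy_RR(1) xy_nz(1), of 1] xy_deg(1) by auto
  obtain d where "w - fls_const k * x = fls_const d" by (rule pole_le_1[OF k])
  then have wk: "w = fls_const k * x + fls_const d" by (simp add: algebra_simps)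
  have R'g: "R' \<in> geom_points I" "R' \<noteq> O_pt" "res R' x = to_ac r" using R' by (auto simp: affine_def)
  have "ordK R' w \<ge> 1" using ow'[OF R'g(1,2)] ind_nn[of S R'] by (simp add: ind_def[of R'])
  then have "res R' w = 0" using ordK_nonneg_iff(2)[OF R'g(1) w] by simp
  moreover have "res R' w = to_ac (k * r + d)"
    unfolding wk LR_add(2)[OF R'g(1) LR_mult(1)[OF R'g(1) LR_const(1) xy_LR(1)[OF R'g(1,2)]] LR_const(1)]
      LR_mult(2)[OF R'g(1) LR_const(1) xy_LR(1)[OF R'g(1,2)]] LR_const(2)[OF R'g(1)] R'g(3) by simp
  ultimately have "to_ac (k * r + d) = 0" by metis
  then have kd: "k * r + d = 0" by (simp only: to_ac_eq_0_iff)
  then have "d = - (k * r)" by (metis add.commute add_eq_0_iff)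
  then have "w = fls_const k * (x - fls_const r)" unfolding wk by (simp add: right_diff_distrib)
  then have hk: "h = fls_const k" using xr(2) by (simp add: w_def)
  then have "k \<noteq> 0" using h(2) by auto
  then have "h \<in> units ?R" using LR_const(1)[of k] LR_const(2)[OF Rg, of k] by (simp add: units_def hk)
  then have "ordK ?R h = 0" by (rule ordK_units[OF Rg])
  then show ?thesis using div[OF Rg] by (simp add: ind_def split: if_splits)
qed

section \<open>Addition of points through linear equivalence\<close>

lemma lin_equiv_iff:
  "lin_equiv I D D' \<longleftrightarrow> (\<exists>g\<in>KK. g \<noteq> 0 \<and> (\<forall>P\<in>geom_points I. D P - D' P = ordK P g))"
proof
  assume "lin_equiv I D D'"
  then obtain f where f: "f \<in> rat_sections I 0" "\<not> sect_eq I f 0" "\<forall>P\<in>geom_points I. D P - D' P = ord_at I P f"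
    by (auto simp: lin_equiv_def)
  then show "\<exists>g\<in>KK. g \<noteq> 0 \<and> (\<forall>P\<in>geom_points I. D P - D' P = ordK P g)"
    using sect_eq_iff[OF f(1) rat_0(1)] rat_0(2) nu_KK[OF f(1)] ord_at_eq[OF _ f(1)] by (intro bexI[of _ "nu f"]) auto
next
  assume "\<exists>g\<in>KK. g \<noteq> 0 \<and> (\<forall>P\<in>geom_points I. D P - D' P = ordK P g)"
  then obtain g where g: "g \<in> KK" "g \<noteq> 0" "\<forall>P\<in>geom_points I. D P - D' P = ordK P g" by blast
  obtain f where f: "f \<in> rat_sections I 0" "nu f = g" using KK_nu[OF g(1)] by blast
  then show "lin_equiv I D D'"
    unfolding lin_equiv_def using sect_eq_iff[OF f(1) rat_0(1)] rat_0(2) ord_at_eq[OF _ f(1)] g by (intro bexI[of _ f]) auto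
qed

lemma to_ac_point_inj:
  fixes S T :: "'a pspace3"
  assumes "to_ac_point S = to_ac_point T"
  shows "S = T"
proof -
  obtain i where i: "coords S $ i \<noteq> 0" by (rule coords_nz_index)
  then have i': "coords T $ i \<noteq> 0" using assms coords_to_ac_point_eq_0 by metis
  have "nvec S i = nvec T i"
  proof
    fix j show "nvec S i j = nvec T i j"
      using nvec_to_ac_point[of S i] nvec_to_ac_point[of T i] assms by (metis to_ac_eq_iff)
  qed
  then have "coords S $ j / coords S $ i = coords T $ j / coords T $ i" for j by (simp add: nvec_def fun_eq_iff)
  then have "coords S = (coords S $ i / coords T $ i) *s coords T" using i i' by (simp add: vec_eq_iff field_simps)
  moreover have "coords S $ i / coords T $ i \<noteq> 0" using i i' by simp
  ultimately have "proj_point (coords S) = proj_point (coords T)" using proj_point_eqI[OF coords_nonzero] by metis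
  then show ?thesis by (simp only: proj_point_coords)
qed

lemma point_divisor_ind: "point_divisor S = ind (to_ac_point S)"
  by (rule ext) (simp add: point_divisor_def ind_def)

text \<open>For uniqueness, the quotient of the functions belonging to two candidates has divisor
  \<open>(R2) - (R)\<close>, and \<open>equivalent_points_eq\<close> applies.\<close>

lemma ec_add_eqI:
  assumes R: "R \<in> rational_points I" "to_ac_point R \<noteq> O_pt"
    and g: "g \<in> KK" "g \<noteq> 0"
      "\<And>P. P \<in> geom_points I \<Longrightarrow> ordK P g = ind (to_ac_point S) P + ind (to_ac_point T) P - ind (to_ac_point R) P - ind O_pt P"
  shows "ec_add I p0 S T = R"
  unfolding ec_add_def
proof (rule the_equality)
  have "\<forall>P\<in>geom_points I. point_divisor S P + point_divisor T P - (point_divisor R P + point_divisor p0 P) = ordK P g"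
    using g(3) by (simp add: point_divisor_ind O_pt_def)
  then show "R \<in> rational_points I \<and> lin_equiv I (\<lambda>x. point_divisor S x + point_divisor T x) (\<lambda>x. point_divisor R x + point_divisor p0 x)"
    unfolding lin_equiv_iff using R(1) g(1,2) by blast
next
  fix R2 assume "R2 \<in> rational_points I \<and> lin_equiv I (\<lambda>x. point_divisor S x + point_divisor T x) (\<lambda>x. point_divisor R2 x + point_divisor p0 x)"
  then obtain g2 where g2: "g2 \<in> KK" "g2 \<noteq> 0"
    "\<And>P. P \<in> geom_points I \<Longrightarrow> point_divisor S P + point_divisor T P - (point_divisor R2 P + point_divisor p0 P) = ordK P g2"
    unfolding lin_equiv_iff by blast
  have "ordK P (g / g2) = ind (to_ac_point R2) P - ind (to_ac_point R) P" if P: "P \<in> geom_points I" for P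
    using ordK_divide[OF P g(1,2) g2(1,2)] g(3)[OF P] g2(3)[OF P] by (simp add: point_divisor_ind O_pt_def)
  then have "to_ac_point R2 = to_ac_point R"
    using equivalent_points_eq[OF R KK_divide[OF g(1) g2(1)]] g(2) g2(2) by simp
  then show "R2 = R" by (rule to_ac_point_inj)
qed

lemma O_pt_eq_iff: "to_ac_point T = O_pt \<longleftrightarrow> T = p0"
  unfolding O_pt_def using to_ac_point_inj by blast

text \<open>For nonzero \<open>q\<close> the tangent construction gives \<open>T + T = R\<close>
  with \<open>R\<close> different from the origin, so \<open>T\<close> would not have order
  2.\<close>

lemma torsion_y_zero:
  assumes T: "T \<in> carrier (ec_torsion I p0 2)" "T \<noteq> p0"
  obtains p where "affine (to_ac_point T) p 0"
proof -
  have Tr: "T \<in> rational_points I" and pow: "T [^]\<^bsub>ec_group I p0\<^esub> (2::nat) = p0"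
    using T(1) by (auto simp: ec_torsion_def ec_group_def)
  have TO: "to_ac_point T \<noteq> O_pt" using T(2) O_pt_eq_iff by blast
  have Tg: "to_ac_point T \<in> geom_points I" using Tr by (simp add: rational_points_def)
  obtain p q where pq: "affine (to_ac_point T) p q" using rational_affine[OF Tr TO] Tg TO unfolding affine_def by metis
  have "ordK P 1 = 0" if "P \<in> geom_points I" for P using ordK_units[OF that units_1[OF that]] .
  \<comment> \<open>The power in the monoid unfolds to \<open>(p0 + T) + T\<close>, so the sum with
    the identity has to be computed as well.\<close>
  then have 1: "ec_add I p0 p0 T = T"
    using KK_const[of 1] by (intro ec_add_eqI[OF Tr TO, of 1]) (simp_all add: O_pt_def)
  have 2: "ec_add I p0 (ec_add I p0 p0 T) T = p0"
    using pow by (simp add: ec_group_def nat_pow_def numeral_2_eq_2)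
  have "q = 0"
  proof (rule ccontr)
    assume "q \<noteq> 0"
    from double_point[OF pq this] obtain R g where R: "R \<in> rational_points I" "to_ac_point R \<noteq> O_pt" "g \<in> KK" "g \<noteq> 0"
      "\<And>P. P \<in> geom_points I \<Longrightarrow> ordK P g = 2 * ind (to_ac_point T) P - ind (to_ac_point R) P - ind O_pt P" by blast
    have "ec_add I p0 T T = R" by (rule ec_add_eqI[OF R(1-4)]) (simp add: R(5))
    then show False using 1 2 R(2) O_pt_eq_iff by metis
  qed
  then show thesis using that pq by blast
qed

text \<open>The isomorphism gives four torsion points, at least three of them other than
  \<open>p0\<close>. They all have \<open>y = 0\<close>, so distinct points have distinct
  \<open>x\<close>.\<close>

lemma cubic_splits:
  assumes "ec_torsion I p0 2 \<cong> integer_mod_group 2 \<times>\<times> integer_mod_group 2"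
  obtains e1 e2 e3 where "e1 \<noteq> e2" "e1 \<noteq> e3" "e2 \<noteq> e3" "cub e1 = 0" "cub e2 = 0" "cub e3 = 0"
proof -
  let ?C = "carrier (ec_torsion I p0 2)"
  obtain f where "f \<in> iso (ec_torsion I p0 2) (integer_mod_group 2 \<times>\<times> integer_mod_group 2)" using assms by (auto simp: is_iso_def)
  then have "bij_betw f ?C (carrier (integer_mod_group 2 \<times>\<times> integer_mod_group 2))" by (simp add: iso_def)
  then have "card ?C = card (carrier (integer_mod_group 2 \<times>\<times> integer_mod_group 2))" by (rule bij_betw_same_card)
  also have "\<dots> = 4" by (simp add: DirProd_def carrier_integer_mod_group)
  finally have c4: "card ?C = 4" .
  then have fin: "finite ?C" by (metis card.infinite zero_neq_numeral)
  have "card (?C - {p0}) \<ge> 3" using card_Diff1_le[of ?C p0] c4 card_Diff_singleton_if[of ?C p0] by (auto split: if_splits)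
  then obtain U where U: "U \<subseteq> ?C - {p0}" "card U = 3" by (metis obtain_subset_with_card_n)
  then obtain T1 T2 T3 where T: "U = {T1, T2, T3}" "T1 \<noteq> T2" "T2 \<noteq> T3" "T1 \<noteq> T3" using card_3_iff[of U] by blast
  then have m: "T1 \<in> ?C" "T1 \<noteq> p0" "T2 \<in> ?C" "T2 \<noteq> p0" "T3 \<in> ?C" "T3 \<noteq> p0" using U(1) by auto
  obtain e1 where e1: "affine (to_ac_point T1) e1 0" by (rule torsion_y_zero[OF m(1,2)])
  obtain e2 where e2: "affine (to_ac_point T2) e2 0" by (rule torsion_y_zero[OF m(3,4)])
  obtain e3 where e3: "affine (to_ac_point T3) e3 0" by (rule torsion_y_zero[OF m(5,6)])
  have cub0: "cub e = 0" if "affine P e 0" for P e using that res_cubic[of P e 0] by (auto simp: affine_def)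
  have dist: "e \<noteq> e'" if "affine (to_ac_point S) e 0" "affine (to_ac_point S') e' 0" "S \<noteq> S'" for S S' :: "'a pspace3" and e e'
    using that affine_point_eqI[of "to_ac_point S" "to_ac_point S'"] to_ac_point_inj[of S S'] by (auto simp: affine_def)
  show thesis
    using that[of e1 e2 e3] dist[OF e1 e2 T(2)] dist[OF e2 e3 T(3)] dist[OF e1 e3 T(4)] cub0[OF e1] cub0[OF e2] cub0[OF e3] by blast
qed

end

section \<open>The Jacobi model\<close>

definition jac1 :: "'a::field \<Rightarrow> 'a poly4" where
  "jac1 u = Const4 u * Var4 0 ^ 2 + Var4 1 ^ 2 - Var4 2 ^ 2"

definition jac2 :: "'a::field \<Rightarrow> 'a poly4" where
  "jac2 v = Const4 v * Var4 0 ^ 2 + Var4 2 ^ 2 - Var4 3 ^ 2"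

lemma ideal_poly4I:
  fixes S :: "'a::field poly4 set"
  assumes "0 \<in> S" "\<And>F G. F \<in> S \<Longrightarrow> G \<in> S \<Longrightarrow> F + G \<in> S" "\<And>F G. F \<in> S \<Longrightarrow> G * F \<in> S"
  shows "ideal S poly4_ring"
proof -
  have R: "ring (poly4_ring :: 'a poly4 ring)" by (rule ring_from_type_algebra)
  have inv: "\<ominus>\<^bsub>poly4_ring\<^esub> F = - F" for F :: "'a poly4"
    by (rule abelian_group.minus_equality[OF ring.is_abelian_group[OF R]]) (simp_all add: ring_of_type_algebra_def)
  show ?thesis
  proof (rule idealI[OF R])
    show "subgroup S (add_monoid poly4_ring)"
    proof
      fix F assume "F \<in> S"
      then have "- F \<in> S" using assms(3)[of F "- 1"] by simp
      then show "inv\<^bsub>add_monoid poly4_ring\<^esub> F \<in> S" using inv[of F] by (simp add: a_inv_def)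
    qed (use assms in \<open>simp_all add: ring_of_type_algebra_def\<close>)
  qed (use assms in \<open>simp_all add: ring_of_type_algebra_def mult.commute\<close>)
qed

text \<open>The parameters sum to zero, so the third generator is minus the sum of the first
  two.\<close>

lemma genideal_jacobi:
  fixes u v :: "'a::field"
  shows "F \<in> Idl\<^bsub>poly4_ring\<^esub> {jac1 u, jac2 v, Const4 (- u - v) * Var4 0 ^ 2 + Var4 3 ^ 2 - Var4 1 ^ 2}
    \<longleftrightarrow> (\<exists>A B. F = A * jac1 u + B * jac2 v)" (is "F \<in> Idl\<^bsub>?R\<^esub> ?S \<longleftrightarrow> _")
proof
  define D where "D = {A * jac1 u + B * jac2 v | A B. True}"
  have DI: "G \<in> D" if "G = A * jac1 u + B * jac2 v" for A B G using that unfolding D_def by blast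
  have "ideal D ?R"
  proof (rule ideal_poly4I)
    show "0 \<in> D" by (rule DI[of _ 0 0]) simp
    fix G H assume "G \<in> D"
    then obtain A B where G: "G = A * jac1 u + B * jac2 v" unfolding D_def by blast
    show "H * G \<in> D" by (rule DI[of _ "H * A" "H * B"]) (simp add: G algebra_simps)
    assume "H \<in> D"
    then obtain A' B' where H: "H = A' * jac1 u + B' * jac2 v" unfolding D_def by blast
    show "G + H \<in> D" by (rule DI[of _ "A + A'" "B + B'"]) (simp add: G H algebra_simps)
  qed
  moreover have "?S \<subseteq> D"
  proof -
    have "jac1 u \<in> D" by (rule DI[of _ 1 0]) simp
    moreover have "jac2 v \<in> D" by (rule DI[of _ 0 1]) simp
    moreover have "Const4 (- u - v) * Var4 0 ^ 2 + Var4 3 ^ 2 - Var4 1 ^ 2 \<in> D"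
      by (rule DI[of _ "- 1" "- 1"]) (simp add: jac1_def jac2_def Const4_diff Const4_uminus algebra_simps)
    ultimately show ?thesis by blast
  qed
  moreover assume "F \<in> Idl\<^bsub>?R\<^esub> ?S"
  ultimately have "F \<in> D" by (auto simp: genideal_def)
  then show "\<exists>A B. F = A * jac1 u + B * jac2 v" unfolding D_def by blast
next
  assume "\<exists>A B. F = A * jac1 u + B * jac2 v"
  then obtain A B where F: "F = A * jac1 u + B * jac2 v" by blast
  show "F \<in> Idl\<^bsub>?R\<^esub> ?S"
    unfolding genideal_def
  proof (rule InterI, clarify)
    fix D assume D: "ideal D ?R" "?S \<subseteq> D"
    have mult: "G * H \<in> D" if "H \<in> D" for G H
      using ideal.I_l_closed[OF D(1) that, of G] by (simp add: ring_of_type_algebra_def)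
    have add: "G + H \<in> D" if "G \<in> D" "H \<in> D" for G H
      using additive_subgroup.a_closed[OF ideal.axioms(1)[OF D(1)] that] by (simp add: ring_of_type_algebra_def)
    show "F \<in> D" unfolding F using D(2) by (intro add mult) simp_all
  qed
qed

lemma jacobi_model_iff:
  "F \<in> jacobi_model u v \<longleftrightarrow> (\<exists>n. \<forall>i. \<exists>A B. Var4 i ^ n * F = A * jac1 u + B * jac2 (v :: 'a::field))"
  unfolding jacobi_model_def saturation_def Let_def using genideal_jacobi[of _ u v]
  by (simp add: jac1_def jac2_def)

section \<open>Smoothness of the Jacobi model\<close>

lemma gradient4_mult: "gradient4 (F * G) v = eval4 F v *s gradient4 G v + eval4 G v *s gradient4 F v"
  by (simp add: gradient4_def vec_eq_iff pderiv4_mult rhom_add[OF rhom_eval4] rhom_mult[OF rhom_eval4] mult.commute)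

lemma gradient4_Const4: "gradient4 (Const4 u) v = 0"
  by (simp add: gradient4_def vec_eq_iff pderiv4_Const4 rhom_0[OF rhom_eval4])

lemma eval4_Const4: "eval4 (Const4 u) v = to_ac u"
  by (simp add: eval4_eq peval_Const4[OF rhom_to_ac])

lemma eval4_Var4: "eval4 (Var4 i) v = v $ i"
  by (simp add: eval4_eq peval_Var4[OF rhom_to_ac])

lemma gradient4_Var4_square: "gradient4 (Var4 i ^ 2) v $ j = (if j = i then 2 * v $ i else 0)"
  unfolding power2_eq_square gradient4_mult
  by (simp add: gradient4_def pderiv4_Var4 eval4_Var4 rhom_1[OF rhom_eval4] rhom_0[OF rhom_eval4])

lemma gradient4_diff: "gradient4 (F - G) v = gradient4 F v - gradient4 G v"
proof -
  have "gradient4 (F - G + G) v = gradient4 (F - G) v + gradient4 G v" by (rule gradient4_add)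
  then show ?thesis by simp
qed

text \<open>A relation between the gradients of the two quadrics forces so many coordinates to
  vanish that the equations, with \<open>u\<close>, \<open>v\<close> and \<open>u + v\<close>
  nonzero, kill the remaining ones.\<close>

lemma jacobi_nonsingular:
  fixes u v :: "'a::field"
  assumes two: "(2::'a) \<noteq> 0" and uv: "u \<noteq> 0" "v \<noteq> 0" "u + v \<noteq> 0"
  shows "nonsingular_curve (jacobi_model u v)"
  unfolding nonsingular_curve_def
proof
  fix P assume P: "P \<in> geom_points (jacobi_model u v)"
  define w where "w = coords P"
  have two': "(2::'a alg_closure) \<noteq> 0" using two by (metis to_ac_eq_0_iff to_ac_numeral)
  have jm: "jac1 u \<in> jacobi_model u v" "jac2 v \<in> jacobi_model u v"
    unfolding jacobi_model_iff
    by (rule exI[of _ 0], rule allI, rule exI[of _ 1], rule exI[of _ 0], simp)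
      (rule exI[of _ 0], rule allI, rule exI[of _ 0], rule exI[of _ 1], simp)
  then have ev: "eval4 (jac1 u) w = 0" "eval4 (jac2 v) w = 0" using P by (auto simp: geom_points_def vanishes_at_def w_def)
  note es = rhom_simps[OF rhom_eval4] eval4_Const4 eval4_Var4
  have e1: "to_ac u * w $ 0 ^ 2 + w $ 1 ^ 2 = w $ 2 ^ 2" and e2: "to_ac v * w $ 0 ^ 2 + w $ 2 ^ 2 = w $ 3 ^ 2"
    using ev by (simp_all add: jac1_def jac2_def es)
  let ?g1 = "gradient4 (jac1 u) w" and ?g2 = "gradient4 (jac2 v) w"
  have g1: "?g1 $ 0 = 2 * to_ac u * w $ 0" "?g1 $ 1 = 2 * w $ 1" "?g1 $ 2 = - 2 * w $ 2" "?g1 $ 3 = 0"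
    and g2: "?g2 $ 0 = 2 * to_ac v * w $ 0" "?g2 $ 1 = 0" "?g2 $ 2 = 2 * w $ 2" "?g2 $ 3 = - 2 * w $ 3"
    by (simp_all add: jac1_def jac2_def gradient4_diff gradient4_add gradient4_mult gradient4_Const4 eval4_Const4 gradient4_Var4_square)
  have w0: "\<not> (w $ 0 = 0 \<and> w $ 1 = 0 \<and> w $ 2 = 0 \<and> w $ 3 = 0)"
    using coords_nonzero[of P] unfolding w_def vec_eq_iff all_index4 by simp
  have ind: "s = 0 \<and> t = 0" if "s *s ?g1 + t *s ?g2 = 0" for s t
  proof -
    have "\<forall>i. s * ?g1 $ i + t * ?g2 $ i = 0" using that by (simp add: vec_eq_iff)
    then have "2 * ((s * to_ac u + t * to_ac v) * w $ 0) = 0" "2 * (s * w $ 1) = 0" "2 * ((t - s) * w $ 2) = 0" "2 * (t * w $ 3) = 0"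
      unfolding all_index4 g1 g2 by (simp_all add: algebra_simps)
    then have h: "s * to_ac u + t * to_ac v = 0 \<or> w $ 0 = 0" "s = 0 \<or> w $ 1 = 0" "t = s \<or> w $ 2 = 0" "t = 0 \<or> w $ 3 = 0"
      using two' by auto
    have uv': "to_ac u \<noteq> 0" "to_ac v \<noteq> 0" "to_ac u + to_ac v \<noteq> 0" using uv by (simp_all flip: to_ac_add)
    show ?thesis
    proof (rule ccontr)
      assume n: "\<not> (s = 0 \<and> t = 0)"
      consider "s = 0" "t \<noteq> 0" | "s \<noteq> 0" "t = 0" | "s \<noteq> 0" "t \<noteq> 0" using n by blast
      then show False
      proof cases
        case 1
        then have "w $ 3 = 0" "w $ 2 = 0" "w $ 0 = 0" using h uv' by auto
        then show False using e1 w0 by simp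
      next
        case 2
        then have "w $ 1 = 0" "w $ 2 = 0" "w $ 0 = 0" using h uv' by auto
        then show False using e2 w0 by simp
      next
        case 3
        then have z: "w $ 1 = 0" "w $ 3 = 0" using h by auto
        then have "(to_ac u + to_ac v) * w $ 0 ^ 2 = 0" using e1 e2 by (simp add: distrib_right add.commute)
        then have "w $ 0 = 0" using uv' by simp
        then show False using e1 z w0 by simp
      qed
    qed
  qed
  \<comment> \<open>An element of the saturation satisfies
    \<open>X_i ^ n * F = A * jac1 u + B * jac2 v\<close>. Since \<open>F\<close> and both quadrics
    vanish at the point, differentiation gives a multiple of the gradient of \<open>F\<close>, with
    nonzero factor \<open>w $ i ^ n\<close>.\<close>
  have span: "gradient4 F w \<in> vec.span {?g1, ?g2}" if F: "F \<in> jacobi_model u v" for F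
  proof -
    obtain i where i: "w $ i \<noteq> 0" unfolding w_def by (rule coords_nz_index)
    obtain n A B where AB: "Var4 i ^ n * F = A * jac1 u + B * jac2 v" using F unfolding jacobi_model_iff by blast
    have "eval4 F w = 0" using P F by (auto simp: geom_points_def vanishes_at_def w_def)
    then have l: "gradient4 (Var4 i ^ n * F) w = (w $ i ^ n) *s gradient4 F w"
      by (simp add: gradient4_mult es)
    have "gradient4 (A * jac1 u + B * jac2 v) w = eval4 A w *s ?g1 + eval4 B w *s ?g2"
      using ev by (simp add: gradient4_add gradient4_mult)
    also have "\<dots> \<in> vec.span {?g1, ?g2}" by (intro vec.span_add vec.span_scale vec.span_base) simp_all
    finally have "inverse (w $ i ^ n) *s ((w $ i ^ n) *s gradient4 F w) \<in> vec.span {?g1, ?g2}"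
      using l AB by (metis vec.span_scale)
    moreover have "inverse (w $ i ^ n) * w $ i ^ n = 1" using i by simp
    ultimately show ?thesis by (simp only: vec.scale_scale vec.scale_one)
  qed
  have ne: "?g1 \<noteq> ?g2" using ind[of 1 "- 1"] by auto
  have "vec.independent {?g1, ?g2}"
  proof
    assume "vec.dependent {?g1, ?g2}"
    then obtain f where f: "\<exists>x\<in>{?g1, ?g2}. f x \<noteq> 0" "(\<Sum>x\<in>{?g1, ?g2}. f x *s x) = 0"
      using vec.dependent_finite[of "{?g1, ?g2}"] by auto
    then have "f ?g1 *s ?g1 + f ?g2 *s ?g2 = 0" using ne by simp
    from ind[OF this] show False using f(1) by simp
  qed
  moreover have "card {?g1, ?g2} = 2" using ne by simp
  moreover have "{?g1, ?g2} \<subseteq> {gradient4 F w | F. F \<in> jacobi_model u v}" using jm by blast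
  moreover have "{gradient4 F w | F. F \<in> jacobi_model u v} \<subseteq> vec.span {?g1, ?g2}" using span by blast
  ultimately show "vec.dim {gradient4 F (coords P) | F. F \<in> jacobi_model u v} = 2"
    unfolding w_def[symmetric] by (intro vec.dim_unique[of "{?g1, ?g2}"])
qed

section \<open>The isomorphism with the Jacobi model\<close>

lemma hom_component_sum: "hom_component d (sum f A) = (\<Sum>x\<in>A. hom_component d (f x))"
  by (rule poly_mapping_eqI) (simp add: lookup_hom_component lookup_sum)

lemma hom_component_lin_subst:
  "hom_component d (lin_subst M F) = lin_subst M (hom_component d (F :: 'a::comm_ring_1 poly4))"
proof -
  let ?D = "mdegree ` Poly_Mapping.keys F"
  have "hom_component d (lin_subst M F) = hom_component d (lin_subst M (\<Sum>e\<in>?D. hom_component e F))"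
    using hom_component_expand[of F] by simp
  also have "\<dots> = (\<Sum>e\<in>?D. hom_component d (lin_subst M (hom_component e F)))"
    by (simp add: rhom_sum[OF rhom_lin_subst] hom_component_sum)
  also have "\<dots> = (\<Sum>e\<in>?D. lin_subst M (hom_component d (hom_component e F)))"
    by (intro sum.cong refl)
      (simp add: hom_component_form[OF is_form_lin_subst[OF is_form_hom_component]]
        hom_component_form[OF is_form_hom_component] rhom_0[OF rhom_lin_subst])
  also have "\<dots> = lin_subst M (hom_component d (\<Sum>e\<in>?D. hom_component e F))"
    by (simp add: rhom_sum[OF rhom_lin_subst] hom_component_sum)
  finally show ?thesis using hom_component_expand[of F] by simp
qed

context weierstrass_curve
begin

text \<open>Under the matrix \<open>TT\<close> the Jacobi quadrics become combinations of
  \<open>Q1\<close> and \<open>Q2\<close>. Distinct roots and characteristic different from 2 make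
  these combinations invertible, so both pairs generate the same ideal up to the change of
  coordinates.\<close>

lemma linearly_isomorphic_jacobi:
  assumes d: "e1 \<noteq> e2" "e1 \<noteq> e3" "e2 \<noteq> e3"
    and abc: "a = - (e1 + e2 + e3)" "b = e1 * e2 + e1 * e3 + e2 * e3" "c = - (e1 * e2 * e3)"
  shows "linearly_isomorphic I p0 (jacobi_model (e1 - e2) (e2 - e3)) jacobi_identity"
proof -
  \<comment> \<open>Coefficients of the new coordinates in \<open>1, x, y, x ^ 2\<close>: the first
    row is \<open>2 * y\<close>, the others expand
    \<open>(x - e_i)^2 - (e_i - e_j) * (e_i - e_k)\<close>.\<close>
  define TT :: "'a ^ 4 ^ 4" where "TT = (\<chi> i j. vec4 (vec4 0 0 2 0)
      (vec4 (e1 * (e2 + e3) - e2 * e3) (- 2 * e1) 0 1)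
      (vec4 (e2 * (e1 + e3) - e1 * e3) (- 2 * e2) 0 1)
      (vec4 (e3 * (e1 + e2) - e1 * e2) (- 2 * e3) 0 1) i j)"
  have "z = 0" if z: "TT *v z = 0" for z
  proof -
    have "\<forall>i. (TT *v z) $ i = 0" using z by simp
    then have h: "2 * z $ 2 = 0"
      "(e1 * (e2 + e3) - e2 * e3) * z $ 0 - 2 * e1 * z $ 1 + z $ 3 = 0"
      "(e2 * (e1 + e3) - e1 * e3) * z $ 0 - 2 * e2 * z $ 1 + z $ 3 = 0"
      "(e3 * (e1 + e2) - e1 * e2) * z $ 0 - 2 * e3 * z $ 1 + z $ 3 = 0"
      unfolding all_index4 by (simp_all add: matrix_vector_mult_def sum_UNIV4 TT_def)
    have "2 * (e1 - e2) * (z $ 1 - e3 * z $ 0)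
        = ((e2 * (e1 + e3) - e1 * e3) * z $ 0 - 2 * e2 * z $ 1 + z $ 3) - ((e1 * (e2 + e3) - e2 * e3) * z $ 0 - 2 * e1 * z $ 1 + z $ 3)"
      by (simp add: algebra_simps)
    then have z1: "z $ 1 = e3 * z $ 0" using d two unfolding h by simp
    have "2 * (e2 - e3) * (z $ 1 - e1 * z $ 0)
        = ((e3 * (e1 + e2) - e1 * e2) * z $ 0 - 2 * e3 * z $ 1 + z $ 3) - ((e2 * (e1 + e3) - e1 * e3) * z $ 0 - 2 * e2 * z $ 1 + z $ 3)"
      by (simp add: algebra_simps)
    then have "z $ 1 = e1 * z $ 0" using d two unfolding h by simp
    then have z0: "z $ 0 = 0" using z1 d by simp
    then have "z $ 1 = 0" "z $ 2 = 0" "z $ 3 = 0" using z1 h two by simp_all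
    then show "z = 0" using z0 unfolding vec_eq_iff all_index4 by simp
  qed
  then obtain TI where TI: "TI ** TT = mat 1" using matrix_left_invertible_ker by blast
  then have TI': "TT ** TI = mat 1" by (simp add: matrix_left_right_inverse)
  have undo_TT: "lin_subst TI (lin_subst TT F) = F" for F by (simp add: lin_subst_lin_subst TI' lin_subst_mat_1)
  define M where "M = TT ** NN"
  have M: "lin_subst M F = lin_subst NN (lin_subst TT F)" for F by (simp add: M_def lin_subst_lin_subst)
  have inv: "invertible M"
    unfolding invertible_def
  proof (intro exI[of _ "CC ** TI"] conjI)
    have "M ** (CC ** TI) = TT ** (NN ** CC) ** TI" unfolding M_def by (simp add: matrix_mul_assoc)
    then show r: "M ** (CC ** TI) = mat 1" by (simp add: NN_CC TI')
    then show "CC ** TI ** M = mat 1" by (simp add: matrix_left_right_inverse)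
  qed
  let ?j1 = "jac1 (e1 - e2)" and ?j2 = "jac2 (e2 - e3)"
  define XT :: "4 \<Rightarrow> 'a poly4" where "XT i = lin_subst TT (Var4 i)" for i
  have XT: "XT i = Const4 (TT $ i $ 0) * Var4 0 + Const4 (TT $ i $ 1) * Var4 1 + Const4 (TT $ i $ 2) * Var4 2 + Const4 (TT $ i $ 3) * Var4 3" for i
    by (simp add: XT_def lin_subst_eq peval_Var4[OF rhom_Const4] sum_UNIV4)
  note sT = rhom_simps[OF rhom_lin_subst[of TT]]
  have sTc: "lin_subst A (Const4 k) = Const4 k" for A :: "'a ^ 4 ^ 4" and k
    by (simp add: lin_subst_eq peval_Const4[OF rhom_Const4])
  define E1 E2 E3 where E: "E1 = Const4 e1" "E2 = Const4 e2" "E3 = Const4 e3"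
  note cs = rhom_simps[OF rhom_Const4]
  have XX: "XT 0 = 2 * Var4 2"
    "XT 1 = (E1 * (E2 + E3) - E2 * E3) * Var4 0 - 2 * E1 * Var4 1 + Var4 3"
    "XT 2 = (E2 * (E1 + E3) - E1 * E3) * Var4 0 - 2 * E2 * Var4 1 + Var4 3"
    "XT 3 = (E3 * (E1 + E2) - E1 * E2) * Var4 0 - 2 * E3 * Var4 1 + Var4 3"
    unfolding XT E by (simp_all add: TT_def cs)
  have Q2E: "Q2 = Var4 2 ^ 2 - (Var4 1 * Var4 3 - (E1 + E2 + E3) * (Var4 0 * Var4 3) + (E1 * E2 + E1 * E3 + E2 * E3) * (Var4 0 * Var4 1) - E1 * E2 * E3 * Var4 0 ^ 2)"
    unfolding Q2_def unfolding abc E by (simp add: cs algebra_simps)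
  have T1: "lin_subst TT ?j1 = Const4 (4 * (e1 - e2)) * (Q2 + Const4 (e1 + e2) * Q1)"
  proof -
    have "lin_subst TT ?j1 = (E1 - E2) * XT 0 ^ 2 + XT 1 ^ 2 - XT 2 ^ 2" by (simp add: jac1_def sT sTc XT_def E cs)
    also have "\<dots> = 4 * (E1 - E2) * (Q2 + (E1 + E2) * Q1)"
      unfolding XX Q2E Q1_def by (simp add: power2_eq_square algebra_simps)
    finally show ?thesis by (simp add: E cs)
  qed
  have T2: "lin_subst TT ?j2 = Const4 (4 * (e2 - e3)) * (Q2 + Const4 (e2 + e3) * Q1)"
  proof -
    have "lin_subst TT ?j2 = (E2 - E3) * XT 0 ^ 2 + XT 2 ^ 2 - XT 3 ^ 2" by (simp add: jac2_def sT sTc XT_def E cs)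
    also have "\<dots> = 4 * (E2 - E3) * (Q2 + (E2 + E3) * Q1)"
      unfolding XX Q2E Q1_def by (simp add: power2_eq_square algebra_simps)
    finally show ?thesis by (simp add: E cs)
  qed
  define k1 k2 k3 where k: "k1 = inverse (4 * (e1 - e2))" "k2 = inverse (4 * (e2 - e3))" "k3 = inverse (e1 - e3)"
  have four: "(4::'a) \<noteq> 0"
  proof -
    have "(4::'a) = 2 * 2" by simp
    then show ?thesis using two by (metis mult_eq_0_iff)
  qed
  have kk: "Const4 k1 * Const4 (4 * (e1 - e2)) = 1" "Const4 k2 * Const4 (4 * (e2 - e3)) = 1" "Const4 k3 * Const4 (e1 - e3) = 1"
  proof -
    have "k1 * (4 * (e1 - e2)) = 1" "k2 * (4 * (e2 - e3)) = 1" "k3 * (e1 - e3) = 1"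
      unfolding k using d four by (auto intro!: left_inverse)
    then show "Const4 k1 * Const4 (4 * (e1 - e2)) = 1" "Const4 k2 * Const4 (4 * (e2 - e3)) = 1" "Const4 k3 * Const4 (e1 - e3) = 1"
      by (metis Const4_mult Const4_1)+
  qed
  have j1Q: "Const4 k1 * lin_subst TT ?j1 = Q2 + Const4 (e1 + e2) * Q1"
    unfolding T1 mult.assoc[symmetric] kk(1) by simp
  have j2Q: "Const4 k2 * lin_subst TT ?j2 = Q2 + Const4 (e2 + e3) * Q1"
    unfolding T2 mult.assoc[symmetric] kk(2) by simp
  \<comment> \<open>Subtracting the normalised quadrics cancels \<open>Q2\<close> and leaves
    \<open>(e1 + e2) - (e2 + e3) = e1 - e3\<close> times \<open>Q1\<close>.\<close>
  have "Const4 k1 * lin_subst TT ?j1 - Const4 k2 * lin_subst TT ?j2 = Const4 (e1 - e3) * Q1"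
    unfolding j1Q j2Q by (simp add: cs algebra_simps)
  then have Q1j: "Q1 = Const4 k3 * (Const4 k1 * lin_subst TT ?j1 - Const4 k2 * lin_subst TT ?j2)"
    using kk(3) by (simp add: mult.assoc[symmetric])
  have Q2j: "Q2 = Const4 k1 * lin_subst TT ?j1 - Const4 (e1 + e2) * Q1" unfolding j1Q by simp
  note sI = rhom_simps[OF rhom_lin_subst[of TI]]
  define D where "D = {A * ?j1 + B * ?j2 | A B. True}"
  have Dadd: "F + G \<in> D" if FG: "F \<in> D" "G \<in> D" for F G
  proof -
    obtain A B A' B' where "F = A * ?j1 + B * ?j2" "G = A' * ?j1 + B' * ?j2" using FG unfolding D_def by blast
    then have "F + G = (A + A') * ?j1 + (B + B') * ?j2" by (simp add: algebra_simps)
    then show ?thesis unfolding D_def by blast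
  qed
  have Dmult: "G * F \<in> D" if FD: "F \<in> D" for F G
  proof -
    obtain A B where "F = A * ?j1 + B * ?j2" using FD unfolding D_def by blast
    then have "G * F = (G * A) * ?j1 + (G * B) * ?j2" by (simp add: algebra_simps)
    then show ?thesis unfolding D_def by blast
  qed
  have Dj: "?j1 \<in> D" "?j2 \<in> D"
  proof -
    have "?j1 = 1 * ?j1 + 0 * ?j2" "?j2 = 0 * ?j1 + 1 * ?j2" by simp_all
    then show "?j1 \<in> D" "?j2 \<in> D" unfolding D_def by blast+
  qed
  have Dneg: "F - G \<in> D" if "F \<in> D" "G \<in> D" for F G using Dadd[OF that(1) Dmult[OF that(2), of "- 1"]] by simp
  have Q1D: "lin_subst TI Q1 \<in> D"
    by (subst Q1j) (simp only: sI sTc undo_TT, intro Dmult Dneg Dj)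
  have Q2D: "lin_subst TI Q2 \<in> D"
    by (subst Q2j) (simp only: sI sTc undo_TT, intro Dmult Dneg Dj Q1D)
  have formD: "F \<in> D" if F: "is_form n F" "lin_subst M F \<in> I" for n F
  proof -
    have "psi (lin_subst TT F) = 0" using F(2) lin_subst_NN_I[OF is_form_lin_subst[OF F(1)]] by (simp add: M)
    then have "lin_subst TT F \<in> K" using psi_eq_0_iff[OF is_form_lin_subst[OF F(1)]] by blast
    then obtain A B where "lin_subst TT F = A * Q1 + B * Q2" unfolding K_def by blast
    then have "F = lin_subst TI A * lin_subst TI Q1 + lin_subst TI B * lin_subst TI Q2"
      by (metis undo_TT rhom_add[OF rhom_lin_subst] rhom_mult[OF rhom_lin_subst])
    then show ?thesis using Dadd[OF Dmult[OF Q1D] Dmult[OF Q2D]] by metis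
  qed
  have jI: "lin_subst M ?j1 \<in> I" "lin_subst M ?j2 \<in> I"
  proof -
    have f: "is_form 2 ?j1" "is_form 2 ?j2" unfolding jac1_def jac2_def
      by (intro is_form_add is_form_diff is_form_Const4_mult is_form_Var4_power)+
    have "lin_subst TT ?j1 \<in> K" "lin_subst TT ?j2 \<in> K"
      unfolding T1 T2 by (intro K_mult K_add K_Q)+
    then show "lin_subst M ?j1 \<in> I" "lin_subst M ?j2 \<in> I"
      unfolding M using lin_subst_NN_I[OF is_form_lin_subst[OF f(1)]] lin_subst_NN_I[OF is_form_lin_subst[OF f(2)]] psi_K by blast+
  qed
  have "jacobi_model (e1 - e2) (e2 - e3) = {F. lin_subst M F \<in> I}"
  proof (rule Set.equalityI; rule Set.subsetI)
    fix F assume "F \<in> jacobi_model (e1 - e2) (e2 - e3)"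
    then obtain n A B where AB: "Var4 0 ^ n * F = A * ?j1 + B * ?j2" unfolding jacobi_model_iff by blast
    note sM = rhom_simps[OF rhom_lin_subst[of M]]
    have "lin_subst M (Var4 0) ^ n * lin_subst M F = lin_subst M A * lin_subst M ?j1 + lin_subst M B * lin_subst M ?j2"
      using arg_cong[OF AB, of "lin_subst M"] by (simp only: sM)
    then have "lin_subst M (Var4 0) ^ n * lin_subst M F \<in> I" using I_add[OF I_mult[OF jI(1)] I_mult[OF jI(2)]] by metis
    \<comment> \<open>The coordinate \<open>X_0\<close> corresponds to \<open>2 * y\<close>, which
      is nonzero on the curve, so primality of \<open>I\<close> cancels the power of
      \<open>X_0\<close> coming from the saturation.\<close>
    moreover have "lin_subst M (Var4 0) \<notin> I"
    proof -
      have "psi (lin_subst TT (Var4 0)) = 2 * y"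
        using XX(1) by (simp add: XT_def psi_simps psi_Var4 vv_def)
      moreover have "2 * y \<noteq> 0"
      proof -
        have "(2 :: 'a fls) \<noteq> 0" using two by (metis fls_const_numeral fls_const_eq_0_iff)
        then show ?thesis using xy_nz(2) by simp
      qed
      ultimately show ?thesis unfolding M using lin_subst_NN_I[OF is_form_lin_subst[OF is_form_Var4]] by metis
    qed
    ultimately show "F \<in> {F. lin_subst M F \<in> I}" using I_prime I_power by blast
  next
    fix F assume "F \<in> {F. lin_subst M F \<in> I}"
    then have F: "lin_subst M F \<in> I" by simp
    \<comment> \<open>Membership in \<open>I\<close> passes to homogeneous components, which lie in
      the ideal of the two quadrics; so the exponent 0 suffices in the saturation.\<close>
    have "hom_component d F \<in> D" for d
      using formD[OF is_form_hom_component, of d F] I_hom[OF F, of d] by (simp add: hom_component_lin_subst)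
    moreover have "0 \<in> D" using Dmult[OF Dj(1), of 0] by simp
    ultimately have "sum (\<lambda>d. hom_component d F) A \<in> D" for A
      by (induction A rule: infinite_finite_induct) (simp_all add: Dadd)
    then have "F \<in> D" using hom_component_expand[of F] by metis
    then obtain A B where "F = A * ?j1 + B * ?j2" unfolding D_def by blast
    then show "F \<in> jacobi_model (e1 - e2) (e2 - e3)"
      unfolding jacobi_model_iff by (intro exI[of _ 0] allI exI[of _ A] exI[of _ B]) simp
  qed
  moreover have "proj_point (M *v coords p0) = jacobi_identity"
  proof -
    \<comment> \<open>\<open>L0\<close> vanishes to order exactly 4 at the origin, so of
      \<open>1, x, y, x ^ 2\<close> only \<open>x ^ 2\<close> keeps a nonzero value after
      multiplication by \<open>l0\<close>. The origin is \<open>(0 : 0 : 0 : 1)\<close> in the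
      Weierstrass coordinates, and the last column of \<open>TT\<close> is
      \<open>(0, 1, 1, 1)\<close>.\<close>
    have m4: "m0 = 4" using m0_pos m0(2) by simp
    have Nk: "(NN *v coords p0) $ k = coords p0 $ i0 * val (Zf k)" for k
      unfolding Zf_NN using i0
      by (simp add: val_simps val_Const4 matrix_vector_mult_def sum_distrib_left)
        (simp add: val_def peval_Var4[OF rhom_id] nvec_def)
    have vz: "val (Zf k) = fls_nth (l0 * vv k) 0" for k
    proof -
      have "fls_nth (fe (Zf k)) 0 = fps_nth (ev (Zf k)) 0" by (simp add: fe_def)
      then show ?thesis by (simp only: Zf(2) ev_nth_0)
    qed
    have deg: "fls_subdegree (l0 * vv k) = 4 + fls_subdegree (vv k)" for k
      using L0(2) vv_nz m0(1) m4 by simp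
    have v0: "val (Zf 0) = 0" "val (Zf 1) = 0" "val (Zf 2) = 0"
      unfolding vz using deg[of 0] deg[of 1] deg[of 2] by (simp_all add: fls_eq0_below_subdegree vv_def xy_deg)
    have v3: "val (Zf 3) \<noteq> 0"
    proof -
      have "fls_subdegree (l0 * vv 3) = 0" using deg[of 3] by (simp add: vv_def fls_subdegree_pow xy_deg)
      then show ?thesis unfolding vz using nth_fls_subdegree_nonzero[of "l0 * vv 3"] L0(2) vv_nz[of 3] by simp
    qed
    define \<zeta> where "\<zeta> = coords p0 $ i0 * val (Zf 3)"
    have \<zeta>: "\<zeta> \<noteq> 0" using i0 v3 by (simp add: \<zeta>_def)
    define w :: "'a ^ 4" where "w = (\<chi> i. if i = 0 then 0 else 1)"
    have "(M *v coords p0) = TT *v (NN *v coords p0)" by (simp add: M_def matrix_vector_mul_assoc)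
    also have "\<dots> = \<zeta> *s w"
      unfolding vec_eq_iff all_index4
    proof -
      have "(TT *v z) $ i = TT $ i $ 0 * z $ 0 + TT $ i $ 1 * z $ 1 + TT $ i $ 2 * z $ 2 + TT $ i $ 3 * z $ 3" for z i
        by (simp add: matrix_vector_mult_def sum_UNIV4)
      then show "(TT *v (NN *v coords p0)) $ 0 = (\<zeta> *s w) $ 0 \<and> (TT *v (NN *v coords p0)) $ 1 = (\<zeta> *s w) $ 1 \<and>
          (TT *v (NN *v coords p0)) $ 2 = (\<zeta> *s w) $ 2 \<and> (TT *v (NN *v coords p0)) $ 3 = (\<zeta> *s w) $ 3"
        by (simp only: Nk v0) (simp add: TT_def w_def \<zeta>_def)
    qed
    finally have "M *v coords p0 = \<zeta> *s w" .
    moreover have "w \<noteq> 0" by (simp add: w_def vec_eq_iff all_index4)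
    ultimately have "proj_point (M *v coords p0) = proj_point w" using proj_point_eqI[OF _ \<zeta>] by metis
    then show ?thesis by (simp add: jacobi_identity_def w_def)
  qed
  ultimately show ?thesis using inv unfolding linearly_isomorphic_def by blast
qed

text \<open>Vieta's formulas by divided differences: a first difference at two roots vanishes, the
  difference of two of these gives \<open>a\<close>, and substitution back gives \<open>b\<close>
  and \<open>c\<close>.\<close>

lemma cubic_coefficients:
  assumes d: "e1 \<noteq> e2" "e1 \<noteq> e3" "e2 \<noteq> e3" and z: "cub e1 = 0" "cub e2 = 0" "cub e3 = 0"
  shows "a = - (e1 + e2 + e3)" "b = e1 * e2 + e1 * e3 + e2 * e3" "c = - (e1 * e2 * e3)"
proof -
  have q: "u ^ 2 + u * v + v ^ 2 + a * (u + v) + b = 0" if "u \<noteq> v" "cub u = 0" "cub v = 0" for u v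
  proof -
    have "(u - v) * (u ^ 2 + u * v + v ^ 2 + a * (u + v) + b) = cub u - cub v"
      by (simp add: cub_def power2_eq_square power3_eq_cube algebra_simps)
    then show ?thesis using that by simp
  qed
  note q12 = q[OF d(1) z(1,2)] and q13 = q[OF d(2) z(1,3)]
  have "(e2 - e3) * (e1 + e2 + e3 + a) = (e1 ^ 2 + e1 * e2 + e2 ^ 2 + a * (e1 + e2) + b) - (e1 ^ 2 + e1 * e3 + e3 ^ 2 + a * (e1 + e3) + b)"
    by (simp add: power2_eq_square algebra_simps)
  then have "e1 + e2 + e3 + a = 0" using d(3) q12 q13 by simp
  then show a: "a = - (e1 + e2 + e3)" by (metis add.commute add_eq_0_iff)
  have "b = (e1 * e2 + e1 * e3 + e2 * e3) + (e1 ^ 2 + e1 * e2 + e2 ^ 2 + a * (e1 + e2) + b)"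
    unfolding a by (simp add: power2_eq_square algebra_simps)
  then show b: "b = e1 * e2 + e1 * e3 + e2 * e3" using q12 by simp
  have "c = - (e1 * e2 * e3) + cub e1"
    unfolding cub_def unfolding a b by (simp add: power2_eq_square power3_eq_cube algebra_simps)
  then show "c = - (e1 * e2 * e3)" using z(1) by simp
qed

end

theorem theorem11:
  fixes I :: "'a::field poly4 set" and p0 :: "'a pspace3"
  assumes "CHAR('a) \<noteq> 2"
    and "elliptic_curve I p0"
    and "projectively_normal I"
    and "sheaf_isomorphic I (twisting_sheaf I 1) (divisor_sheaf I (\<lambda>P. 4 * point_divisor p0 P))"
    and "ec_torsion I p0 2 \<cong> integer_mod_group 2 \<times>\<times> integer_mod_group 2"
  shows "\<exists>a b. nonsingular_curve (jacobi_model a b) \<and>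
           linearly_isomorphic I p0 (jacobi_model a b) jacobi_identity"
proof -
  have two: "(2::'a) \<noteq> 0"
  proof
    assume "(2::'a) = 0"
    then have "of_nat 2 = (0::'a)" by simp
    then have "CHAR('a) dvd 2" by (simp only: of_nat_eq_0_iff_char_dvd)
    then have "CHAR('a) = 1" using assms(1) by (metis prime_nat_iff two_is_prime_nat)
    then show False by simp
  qed
  interpret embedded_curve I p0
    using assms(2,3,4) by unfold_locales (auto simp: elliptic_curve_def)
  obtain x y a b c where w: "x \<in> RR" "y \<in> RR" "fls_subdegree x = - 2" "fls_subdegree y = - 3"
    "y ^ 2 = x ^ 3 + fls_const a * x ^ 2 + fls_const b * x + fls_const c"
    by (rule weierstrass[OF two])
  interpret weierstrass_curve I p0 x y a b c
    by unfold_locales (use two w in auto)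
  obtain e1 e2 e3 where e: "e1 \<noteq> e2" "e1 \<noteq> e3" "e2 \<noteq> e3" "cub e1 = 0" "cub e2 = 0" "cub e3 = 0"
    by (rule cubic_splits[OF assms(5)])
  have "linearly_isomorphic I p0 (jacobi_model (e1 - e2) (e2 - e3)) jacobi_identity"
    by (rule linearly_isomorphic_jacobi[OF e(1-3) cubic_coefficients[OF e]])
  \<comment> \<open>Distinct roots make \<open>e1 - e2\<close>, \<open>e2 - e3\<close> and their sum
    \<open>e1 - e3\<close> nonzero.\<close>
  moreover have "nonsingular_curve (jacobi_model (e1 - e2) (e2 - e3))"
    using e by (intro jacobi_nonsingular[OF two]) auto
  ultimately show ?thesis by blast
qed

end
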